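(* Let $\Bbbk$ be an algebraically closed field of characteristic $\ne2$, $m\ge1$ and $\mathbf u=(u_1,\dots,u_m)\in\Bbbk^m$. If the $\mathbf u$-admissible condition holds, then the cyclotomic Brauer category $\mathcal{CB}(\mathbf u)$ is an upper finite weakly triangular category.
   Context: CYCLOTOMIC BRAUER CATEGORY. Let $f(t)=\prod_{i=1}^m(t-u_i)$. The affine Brauer category $\mathcal{AB}$ is the strict $\Bbbk$-linear monoidal category generated by one object (objects: $a\in\mathbb N$, the $a$-th tensor power; identity $1_a$) and morphisms $\cup:0\to2$, $\cap:2\to0$, $s:2\to2$, $x:1\to1$, subject to $s^2=1_2$, $(s\otimes1_1)(1_1\otimes s)(s\otimes1_1)=(1_1\otimes s)(s\otimes1_1)(1_1\otimes s)$, $(1_1\otimes\cap)(\cup\otimes1_1)=1_1=(\cap\otimes1_1)(1_1\otimes\cup)$, $\cap s=\cap$, $s\cup=\cup$, $(\cap\otimes1_1)(1_1\otimes s)=(1_1\otimes\cap)(s\otimes1_1)$, $(x\otimes1_1)s-s(1_1\otimes x)=\cup\cap-1_2$, $\cap(x\otimes1_1)=-\cap(1_1\otimes x)$. For fixed scalars $\omega=(\omega_k)_{k\ge0}$, $\mathcal{CB}(\mathbf u)$ is the quotient of $\mathcal{AB}$ by the right tensor ideal generated by $f(x)$ and $\cap(x^k\otimes1_1)\cup-\omega_k$, $k\ge0$. Morphisms are drawn as diagrams ($x$ is a dot $\bullet$), composition being vertical stacking and tensor product horizontal juxtaposition. An $(a,b)$-Brauer diagram pairs $a$ points on a lower line and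 $b$ points on an upper line; strands joining two upper (lower) points are cups (caps), the others are vertical. A normally ordered dotted $(a,b)$-Brauer diagram has dots on its strands, at most $m-1$ on each strand, placed at the lower endpoint of vertical strands, at the left endpoint of caps and at the right endpoint of cups. Two are equivalent if they have the same underlying pairing and the same number of dots on corresponding strands. The set of equivalence classes is $\mathbb B_{a,b}$; it always spans $\mathrm{Hom}_{\mathcal{CB}(\mathbf u)}(a,b)$. The $\mathbf u$-admissible condition (on $\mathbf u,\omega$) is equivalent to $\mathrm{Hom}_{\mathcal{CB}(\mathbf u)}(a,b)$ having maximal dimension, i.e. to $\mathbb B_{a,b}$ being a basis of it, for all $a,b\in\mathbb N$. WEAKLY TRIANGULAR CATEGORIES. Let $\mathcal A$ be a small $\Bbbk$-linear category with object set $J$ and finite-dimensional Hom spaces, with an equivalence relation $\sim$ on $J$ all of whose classes are finite; put $I=J/\sim$. The associated algebra is $A=\bigoplus_{a,b\in J}1_aA1_b$, with $1_aA1_b=\mathrm{Hom}_{\mathcal A}(b,a)$ and product given by composition. For $\mathbf a\in I$ put $1_{\mathbf a}=\sum_{b\in\mathbf a}1_b$. For a subspace $B\subseteq A$ put $B_{a,b}=1_aB1_b$, $B_{\mathbf a,\mathbf b}=1_{\mathbf a}B1_{\mathbf b}$, $B_{\mathbf a}=B_{\mathbf a,\mathbf a}$. A weakly triangular decomposition of $A$ is a datum $(I,A^-,A^\circ,A^+)$ such that: (W1) $(I,\preceq)$ is a poset; (W2) $A^-,A^\circ,A^+$ are subspaces of $A$ with $A^\pm=\bigoplus_{b,c\in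 J}A^\pm_{b,c}$ and $A^\circ=\bigoplus_{\mathbf a\in I}\bigoplus_{b,c\in\mathbf a}A^\circ_{b,c}$; (W3) $A^-_{\mathbf a,\mathbf b}=0$ and $A^+_{\mathbf b,\mathbf a}=0$ unless $\mathbf a\preceq\mathbf b$; and $A^-_{\mathbf a}=A^+_{\mathbf a}=\bigoplus_{c\in\mathbf a}\Bbbk1_c$; (W4) multiplication gives a linear isomorphism $A^-\otimes_{\mathbb K}A^\circ\otimes_{\mathbb K}A^+\to A$, where $\mathbb K=\bigoplus_{b\in J}\Bbbk1_b$. It is upper finite if $\{\mathbf b\in I:\mathbf a\preceq\mathbf b\}$ is finite for every $\mathbf a\in I$. $\mathcal A$ is an upper finite weakly triangular category if, for some such $\sim$, $A$ has an upper finite weakly triangular decomposition. *)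

theory Defs
  imports
    "Jordan_Normal_Form.VS_Connect"
    "HOL-Algebra.AbelCoset"
    "HOL-Library.Poly_Mapping"
begin

section \<open>Linear categories\<close>

text \<open>
  Scalars are the elements of a type of class \<open>field\<close>, seen as the record \<open>class_ring\<close>.  Every
  Hom space is a vector space in the sense of \<open>vectorspace class_ring\<close>; the components \<open>mult\<close> and
  \<open>one\<close> that the record type \<open>module\<close> inherits from rings are irrelevant there.
  \<open>cmp a b c g f\<close> is the composite of \<open>f\<close> from \<open>a\<close> to \<open>b\<close> with \<open>g\<close> from \<open>b\<close> to \<open>c\<close>.
\<close>

record ('j, 'm, 'k) lincat =
  objs :: "'j set"
  hom_sp :: "'j \<Rightarrow> 'j \<Rightarrow> ('k, 'm) module"
  idm :: "'j \<Rightarrow> 'm"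
  cmp :: "'j \<Rightarrow> 'j \<Rightarrow> 'j \<Rightarrow> 'm \<Rightarrow> 'm \<Rightarrow> 'm"

abbreviation mor :: "('j, 'm, 'k, 'z) lincat_scheme \<Rightarrow> 'j \<Rightarrow> 'j \<Rightarrow> 'm set" where
  "mor C a b \<equiv> carrier (hom_sp C a b)"

locale linear_category =
  fixes C :: "('j, 'm, 'k::field, 'z) lincat_scheme"
  assumes hom_vectorspace:
      "\<lbrakk>a \<in> objs C; b \<in> objs C\<rbrakk> \<Longrightarrow> vectorspace class_ring (hom_sp C a b)"
    and id_closed: "a \<in> objs C \<Longrightarrow> idm C a \<in> mor C a a"
    and comp_closed:
      "\<lbrakk>a \<in> objs C; b \<in> objs C; c \<in> objs C; f \<in> mor C a b; g \<in> mor C b c\<rbrakk>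
        \<Longrightarrow> cmp C a b c g f \<in> mor C a c"
    and id_left:
      "\<lbrakk>a \<in> objs C; b \<in> objs C; f \<in> mor C a b\<rbrakk> \<Longrightarrow> cmp C a b b (idm C b) f = f"
    and id_right:
      "\<lbrakk>a \<in> objs C; b \<in> objs C; f \<in> mor C a b\<rbrakk> \<Longrightarrow> cmp C a a b f (idm C a) = f"
    and comp_assoc:
      "\<lbrakk>a \<in> objs C; b \<in> objs C; c \<in> objs C; d \<in> objs C;
        f \<in> mor C a b; g \<in> mor C b c; h \<in> mor C c d\<rbrakk>
        \<Longrightarrow> cmp C a c d h (cmp C a b c g f) = cmp C a b d (cmp C b c d h g) f"
    and comp_add_left:
      "\<lbrakk>a \<in> objs C; b \<in> objs C; c \<in> objs C; f \<in> mor C a b; g \<in> mor C b c; g' \<in> mor C b c\<rbrakk>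
        \<Longrightarrow> cmp C a b c (g \<oplus>\<^bsub>hom_sp C b c\<^esub> g') f
            = cmp C a b c g f \<oplus>\<^bsub>hom_sp C a c\<^esub> cmp C a b c g' f"
    and comp_add_right:
      "\<lbrakk>a \<in> objs C; b \<in> objs C; c \<in> objs C; f \<in> mor C a b; f' \<in> mor C a b; g \<in> mor C b c\<rbrakk>
        \<Longrightarrow> cmp C a b c g (f \<oplus>\<^bsub>hom_sp C a b\<^esub> f')
            = cmp C a b c g f \<oplus>\<^bsub>hom_sp C a c\<^esub> cmp C a b c g f'"
    and comp_smult_left:
      "\<lbrakk>a \<in> objs C; b \<in> objs C; c \<in> objs C; f \<in> mor C a b; g \<in> mor C b c\<rbrakk>
        \<Longrightarrow> cmp C a b c (r \<odot>\<^bsub>hom_sp C b c\<^esub> g) f = r \<odot>\<^bsub>hom_sp C a c\<^esub> cmp C a b c g f"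
    and comp_smult_right:
      "\<lbrakk>a \<in> objs C; b \<in> objs C; c \<in> objs C; f \<in> mor C a b; g \<in> mor C b c\<rbrakk>
        \<Longrightarrow> cmp C a b c g (r \<odot>\<^bsub>hom_sp C a b\<^esub> f) = r \<odot>\<^bsub>hom_sp C a c\<^esub> cmp C a b c g f"

definition finite_dim_homs :: "('j, 'm, 'k::field, 'z) lincat_scheme \<Rightarrow> bool" where
  "finite_dim_homs C \<longleftrightarrow>
     (\<forall>a\<in>objs C. \<forall>b\<in>objs C. vectorspace.fin_dim class_ring (hom_sp C a b))"

text \<open>Linear categories with a tensor product; \<open>tens a b c d f g\<close> is the tensor product of
  \<open>f\<close> from \<open>a\<close> to \<open>b\<close> with \<open>g\<close> from \<open>c\<close> to \<open>d\<close>.\<close>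

record ('j, 'm, 'k) monlincat = "('j, 'm, 'k) lincat" +
  tens_obj :: "'j \<Rightarrow> 'j \<Rightarrow> 'j"
  tens :: "'j \<Rightarrow> 'j \<Rightarrow> 'j \<Rightarrow> 'j \<Rightarrow> 'm \<Rightarrow> 'm \<Rightarrow> 'm"

definition right_tensor_ideal ::
  "('j, 'm, 'k::field, 'z) monlincat_scheme \<Rightarrow> ('j \<Rightarrow> 'j \<Rightarrow> 'm set) \<Rightarrow> bool" where
  "right_tensor_ideal C N \<longleftrightarrow>
     (\<forall>a\<in>objs C. \<forall>b\<in>objs C. subspace class_ring (N a b) (hom_sp C a b)) \<and>
     (\<forall>a\<in>objs C. \<forall>b\<in>objs C. \<forall>c\<in>objs C. \<forall>d\<in>objs C.
        \<forall>f\<in>mor C a b. \<forall>g\<in>N b c. \<forall>h\<in>mor C c d.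
          cmp C a c d h (cmp C a b c g f) \<in> N a d) \<and>
     (\<forall>a\<in>objs C. \<forall>b\<in>objs C. \<forall>c\<in>objs C. \<forall>d\<in>objs C. \<forall>g\<in>N a b. \<forall>h\<in>mor C c d.
          tens C a b c d g h \<in> N (tens_obj C a c) (tens_obj C b d))"

definition generated_right_ideal ::
  "('j, 'm, 'k::field, 'z) monlincat_scheme \<Rightarrow> ('j \<Rightarrow> 'j \<Rightarrow> 'm set) \<Rightarrow> 'j \<Rightarrow> 'j \<Rightarrow> 'm set" where
  "generated_right_ideal C S a b =
     {f \<in> mor C a b. \<forall>N. right_tensor_ideal C N \<longrightarrow>
        (\<forall>c\<in>objs C. \<forall>d\<in>objs C. S c d \<subseteq> N c d) \<longrightarrow> f \<in> N a b}"

definition quotient_space :: "('k, 'm) module \<Rightarrow> 'm set \<Rightarrow> ('k, 'm set) module" where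
  "quotient_space V W =
     \<lparr>carrier = a_rcosets\<^bsub>V\<^esub> W, mult = undefined, one = undefined,
      zero = W, add = set_add V,
      smult = (\<lambda>r X. \<Union>x\<in>X. W +>\<^bsub>V\<^esub> (r \<odot>\<^bsub>V\<^esub> x))\<rparr>"

definition quotient_category ::
  "('j, 'm, 'k, 'z) lincat_scheme \<Rightarrow> ('j \<Rightarrow> 'j \<Rightarrow> 'm set) \<Rightarrow> ('j, 'm set, 'k) lincat" where
  "quotient_category C N =
     \<lparr>objs = objs C,
      hom_sp = (\<lambda>a b. quotient_space (hom_sp C a b) (N a b)),
      idm = (\<lambda>a. N a a +>\<^bsub>hom_sp C a a\<^esub> idm C a),
      cmp = (\<lambda>a b c Y X. \<Union>y\<in>Y. \<Union>x\<in>X. N a c +>\<^bsub>hom_sp C a c\<^esub> cmp C a b c y x)\<rparr>"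

section \<open>The affine and cyclotomic Brauer categories\<close>

subsection \<open>Presentation of the affine Brauer category\<close>

text \<open>
  Formal expressions for morphisms of a linear strict monoidal category with objects the natural
  numbers.  \<open>Cmp g f\<close> is ``\<open>g\<close> after \<open>f\<close>'' (\<open>g\<close> on top of \<open>f\<close>), and \<open>Tns f g\<close> has \<open>f\<close> to the left
  of \<open>g\<close>.  The zero morphisms are typed, since some Hom spaces contain nothing else.
\<close>

datatype 'k brterm =
    Cup | Cap | Cross | Dot
  | One nat
  | Zer nat nat
  | Add "'k brterm" "'k brterm"
  | Scl 'k "'k brterm"
  | Cmp "'k brterm" "'k brterm"  (infixr \<open>\<^bold>\<circ>\<close> 70)
  | Tns "'k brterm" "'k brterm"  (infixr \<open>\<^bold>\<otimes>\<close> 75)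

abbreviation Sub :: "'k::field brterm \<Rightarrow> 'k brterm \<Rightarrow> 'k brterm"  (infixl \<open>\<^bold>-\<close> 60) where
  "f \<^bold>- g \<equiv> Add f (Scl (- 1) g)"

inductive arrow :: "'k brterm \<Rightarrow> nat \<Rightarrow> nat \<Rightarrow> bool" where
  "arrow Cup 0 2"
| "arrow Cap 2 0"
| "arrow Cross 2 2"
| "arrow Dot 1 1"
| "arrow (One a) a a"
| "arrow (Zer a b) a b"
| "\<lbrakk>arrow f a b; arrow g a b\<rbrakk> \<Longrightarrow> arrow (Add f g) a b"
| "arrow f a b \<Longrightarrow> arrow (Scl r f) a b"
| "\<lbrakk>arrow f a b; arrow g b c\<rbrakk> \<Longrightarrow> arrow (g \<^bold>\<circ> f) a c"
| "\<lbrakk>arrow f a b; arrow g c d\<rbrakk> \<Longrightarrow> arrow (f \<^bold>\<otimes> g) (a + c) (b + d)"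

text \<open>\<open>ab_eq a b f g\<close>: the expressions \<open>f\<close> and \<open>g\<close> denote the same morphism from \<open>a\<close> to \<open>b\<close> in the
  affine Brauer category.\<close>

inductive ab_eq :: "nat \<Rightarrow> nat \<Rightarrow> 'k::field brterm \<Rightarrow> 'k brterm \<Rightarrow> bool" where
  refl: "arrow f a b \<Longrightarrow> ab_eq a b f f"
| sym: "ab_eq a b f g \<Longrightarrow> ab_eq a b g f"
| trans: "\<lbrakk>ab_eq a b f g; ab_eq a b g h\<rbrakk> \<Longrightarrow> ab_eq a b f h"
| add_cong: "\<lbrakk>ab_eq a b f f'; ab_eq a b g g'\<rbrakk> \<Longrightarrow> ab_eq a b (Add f g) (Add f' g')"
| scl_cong: "ab_eq a b f f' \<Longrightarrow> ab_eq a b (Scl r f) (Scl r f')"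
| cmp_cong: "\<lbrakk>ab_eq a b f f'; ab_eq b c g g'\<rbrakk> \<Longrightarrow> ab_eq a c (g \<^bold>\<circ> f) (g' \<^bold>\<circ> f')"
| tns_cong: "\<lbrakk>ab_eq a b f f'; ab_eq c d g g'\<rbrakk> \<Longrightarrow> ab_eq (a + c) (b + d) (f \<^bold>\<otimes> g) (f' \<^bold>\<otimes> g')"
| add_assoc: "\<lbrakk>arrow f a b; arrow g a b; arrow h a b\<rbrakk>
    \<Longrightarrow> ab_eq a b (Add (Add f g) h) (Add f (Add g h))"
| add_comm: "\<lbrakk>arrow f a b; arrow g a b\<rbrakk> \<Longrightarrow> ab_eq a b (Add f g) (Add g f)"
| add_zero: "arrow f a b \<Longrightarrow> ab_eq a b (Add f (Zer a b)) f"
| scl_zero: "arrow f a b \<Longrightarrow> ab_eq a b (Scl 0 f) (Zer a b)"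
| scl_one: "arrow f a b \<Longrightarrow> ab_eq a b (Scl 1 f) f"
| scl_scl: "arrow f a b \<Longrightarrow> ab_eq a b (Scl r (Scl s f)) (Scl (r * s) f)"
| scl_add_left: "arrow f a b \<Longrightarrow> ab_eq a b (Scl (r + s) f) (Add (Scl r f) (Scl s f))"
| scl_add_right: "\<lbrakk>arrow f a b; arrow g a b\<rbrakk>
    \<Longrightarrow> ab_eq a b (Scl r (Add f g)) (Add (Scl r f) (Scl r g))"
| cmp_assoc: "\<lbrakk>arrow f a b; arrow g b c; arrow h c d\<rbrakk>
    \<Longrightarrow> ab_eq a d ((h \<^bold>\<circ> g) \<^bold>\<circ> f) (h \<^bold>\<circ> (g \<^bold>\<circ> f))"
| one_left: "arrow f a b \<Longrightarrow> ab_eq a b (One b \<^bold>\<circ> f) f"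
| one_right: "arrow f a b \<Longrightarrow> ab_eq a b (f \<^bold>\<circ> One a) f"
| cmp_add_left: "\<lbrakk>arrow f a b; arrow g b c; arrow g' b c\<rbrakk>
    \<Longrightarrow> ab_eq a c (Add g g' \<^bold>\<circ> f) (Add (g \<^bold>\<circ> f) (g' \<^bold>\<circ> f))"
| cmp_add_right: "\<lbrakk>arrow f a b; arrow f' a b; arrow g b c\<rbrakk>
    \<Longrightarrow> ab_eq a c (g \<^bold>\<circ> Add f f') (Add (g \<^bold>\<circ> f) (g \<^bold>\<circ> f'))"
| cmp_scl_left: "\<lbrakk>arrow f a b; arrow g b c\<rbrakk> \<Longrightarrow> ab_eq a c (Scl r g \<^bold>\<circ> f) (Scl r (g \<^bold>\<circ> f))"
| cmp_scl_right: "\<lbrakk>arrow f a b; arrow g b c\<rbrakk> \<Longrightarrow> ab_eq a c (g \<^bold>\<circ> Scl r f) (Scl r (g \<^bold>\<circ> f))"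
| tns_assoc: "\<lbrakk>arrow f a b; arrow g c d; arrow h e l\<rbrakk>
    \<Longrightarrow> ab_eq (a + c + e) (b + d + l) ((f \<^bold>\<otimes> g) \<^bold>\<otimes> h) (f \<^bold>\<otimes> (g \<^bold>\<otimes> h))"
| tns_unit_left: "arrow f a b \<Longrightarrow> ab_eq a b (One 0 \<^bold>\<otimes> f) f"
| tns_unit_right: "arrow f a b \<Longrightarrow> ab_eq a b (f \<^bold>\<otimes> One 0) f"
| tns_one: "ab_eq (a + b) (a + b) (One a \<^bold>\<otimes> One b) (One (a + b))"
| interchange: "\<lbrakk>arrow f a b; arrow g b c; arrow f' a' b'; arrow g' b' c'\<rbrakk>
    \<Longrightarrow> ab_eq (a + a') (c + c') ((g \<^bold>\<circ> f) \<^bold>\<otimes> (g' \<^bold>\<circ> f')) ((g \<^bold>\<otimes> g') \<^bold>\<circ> (f \<^bold>\<otimes> f'))"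
| tns_add_left: "\<lbrakk>arrow f a b; arrow f' a b; arrow g c d\<rbrakk>
    \<Longrightarrow> ab_eq (a + c) (b + d) (Add f f' \<^bold>\<otimes> g) (Add (f \<^bold>\<otimes> g) (f' \<^bold>\<otimes> g))"
| tns_add_right: "\<lbrakk>arrow f a b; arrow g c d; arrow g' c d\<rbrakk>
    \<Longrightarrow> ab_eq (a + c) (b + d) (f \<^bold>\<otimes> Add g g') (Add (f \<^bold>\<otimes> g) (f \<^bold>\<otimes> g'))"
| tns_scl_left: "\<lbrakk>arrow f a b; arrow g c d\<rbrakk>
    \<Longrightarrow> ab_eq (a + c) (b + d) (Scl r f \<^bold>\<otimes> g) (Scl r (f \<^bold>\<otimes> g))"
| tns_scl_right: "\<lbrakk>arrow f a b; arrow g c d\<rbrakk>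
    \<Longrightarrow> ab_eq (a + c) (b + d) (f \<^bold>\<otimes> Scl r g) (Scl r (f \<^bold>\<otimes> g))"
| cross_cross: "ab_eq 2 2 (Cross \<^bold>\<circ> Cross) (One 2)"
| braid: "ab_eq 3 3
    ((Cross \<^bold>\<otimes> One 1) \<^bold>\<circ> (One 1 \<^bold>\<otimes> Cross) \<^bold>\<circ> (Cross \<^bold>\<otimes> One 1))
    ((One 1 \<^bold>\<otimes> Cross) \<^bold>\<circ> (Cross \<^bold>\<otimes> One 1) \<^bold>\<circ> (One 1 \<^bold>\<otimes> Cross))"
| zigzag_left: "ab_eq 1 1 ((One 1 \<^bold>\<otimes> Cap) \<^bold>\<circ> (Cup \<^bold>\<otimes> One 1)) (One 1)"
| zigzag_right: "ab_eq 1 1 ((Cap \<^bold>\<otimes> One 1) \<^bold>\<circ> (One 1 \<^bold>\<otimes> Cup)) (One 1)"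
| cap_cross: "ab_eq 2 0 (Cap \<^bold>\<circ> Cross) Cap"
| cross_cup: "ab_eq 0 2 (Cross \<^bold>\<circ> Cup) Cup"
| cap_slide: "ab_eq 3 1 ((Cap \<^bold>\<otimes> One 1) \<^bold>\<circ> (One 1 \<^bold>\<otimes> Cross)) ((One 1 \<^bold>\<otimes> Cap) \<^bold>\<circ> (Cross \<^bold>\<otimes> One 1))"
| dot_cross: "ab_eq 2 2
    (((Dot \<^bold>\<otimes> One 1) \<^bold>\<circ> Cross) \<^bold>- (Cross \<^bold>\<circ> (One 1 \<^bold>\<otimes> Dot)))
    ((Cup \<^bold>\<circ> Cap) \<^bold>- One 2)"
| cap_dot: "ab_eq 2 0 (Cap \<^bold>\<circ> (Dot \<^bold>\<otimes> One 1)) (Scl (- 1) (Cap \<^bold>\<circ> (One 1 \<^bold>\<otimes> Dot)))"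

definition ab_class :: "nat \<Rightarrow> nat \<Rightarrow> 'k::field brterm \<Rightarrow> 'k brterm set" where
  "ab_class a b f = {g. ab_eq a b f g}"

definition AB :: "(nat, 'k::field brterm set, 'k) monlincat" where
  "AB = \<lparr>objs = UNIV,
     hom_sp = (\<lambda>a b. \<lparr>carrier = {f. arrow f a b} // {(f, g). ab_eq a b f g},
        mult = undefined, one = undefined,
        zero = ab_class a b (Zer a b),
        add = (\<lambda>X Y. \<Union>f\<in>X. \<Union>g\<in>Y. ab_class a b (Add f g)),
        smult = (\<lambda>r X. \<Union>f\<in>X. ab_class a b (Scl r f))\<rparr>),
     idm = (\<lambda>a. ab_class a a (One a)),
     cmp = (\<lambda>a b c Y X. \<Union>g\<in>Y. \<Union>f\<in>X. ab_class a c (g \<^bold>\<circ> f)),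
     tens_obj = (+),
     tens = (\<lambda>a b c d X Y. \<Union>f\<in>X. \<Union>g\<in>Y. ab_class (a + c) (b + d) (f \<^bold>\<otimes> g))\<rparr>"

subsection \<open>The cyclotomic quotient\<close>

primrec dot_power :: "nat \<Rightarrow> 'k brterm" where
  "dot_power 0 = One 1"
| "dot_power (Suc k) = Dot \<^bold>\<circ> dot_power k"

text \<open>The value at the dot of the product of the linear factors \<open>t - u\<^sub>i\<close>.\<close>

primrec cyclotomic_poly :: "'k::field list \<Rightarrow> 'k brterm" where
  "cyclotomic_poly [] = One 1"
| "cyclotomic_poly (v # us) = (Dot \<^bold>- Scl v (One 1)) \<^bold>\<circ> cyclotomic_poly us"

definition bubble :: "nat \<Rightarrow> 'k brterm" where
  "bubble k = Cap \<^bold>\<circ> (dot_power k \<^bold>\<otimes> One 1) \<^bold>\<circ> Cup"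

definition cyclotomic_relators ::
  "'k::field list \<Rightarrow> (nat \<Rightarrow> 'k) \<Rightarrow> nat \<Rightarrow> nat \<Rightarrow> 'k brterm set set" where
  "cyclotomic_relators us \<omega> a b =
     {X. a = 1 \<and> b = 1 \<and> X = ab_class 1 1 (cyclotomic_poly us)} \<union>
     {X. a = 0 \<and> b = 0 \<and> (\<exists>k. X = ab_class 0 0 (bubble k \<^bold>- Scl (\<omega> k) (One 0)))}"

definition cyclotomic_ideal ::
  "'k::field list \<Rightarrow> (nat \<Rightarrow> 'k) \<Rightarrow> nat \<Rightarrow> nat \<Rightarrow> 'k brterm set set" where
  "cyclotomic_ideal us \<omega> = generated_right_ideal AB (cyclotomic_relators us \<omega>)"

definition CB :: "'k::field list \<Rightarrow> (nat \<Rightarrow> 'k) \<Rightarrow> (nat, 'k brterm set set, 'k) lincat" where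
  "CB us \<omega> = quotient_category AB (cyclotomic_ideal us \<omega>)"

definition cb_mor ::
  "'k::field list \<Rightarrow> (nat \<Rightarrow> 'k) \<Rightarrow> nat \<Rightarrow> nat \<Rightarrow> 'k brterm \<Rightarrow> 'k brterm set set" where
  "cb_mor us \<omega> a b f = cyclotomic_ideal us \<omega> a b +>\<^bsub>hom_sp AB a b\<^esub> ab_class a b f"

subsection \<open>Normally ordered dotted Brauer diagrams\<close>

text \<open>Points on the lower and the upper line are numbered from \<open>0\<close>, from left to right; a strand
  is the set of its two endpoints.\<close>

datatype bpoint = Lower nat | Upper nat

type_synonym pairing = "bpoint set set"

fun shift_point :: "nat \<Rightarrow> nat \<Rightarrow> bpoint \<Rightarrow> bpoint" where
  "shift_point a b (Lower i) = Lower (a + i)"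
| "shift_point a b (Upper j) = Upper (b + j)"

text \<open>
  For stacking a pairing \<open>Q\<close> on top of a pairing \<open>P\<close>, put the lower points of \<open>P\<close> on line \<open>0\<close>, the
  identified upper points of \<open>P\<close> and lower points of \<open>Q\<close> on line \<open>1\<close>, and the upper points of \<open>Q\<close>
  on line \<open>2\<close>.  The strands of the composite are the paths between outer points; a middle point
  from which no outer point can be reached lies on a closed loop.
\<close>

fun on_lines :: "nat \<Rightarrow> nat \<Rightarrow> bpoint \<Rightarrow> nat \<times> nat" where
  "on_lines k l (Lower i) = (k, i)"
| "on_lines k l (Upper j) = (l, j)"

definition glued :: "pairing \<Rightarrow> pairing \<Rightarrow> ((nat \<times> nat) \<times> (nat \<times> nat)) set" where
  "glued Q P = {(on_lines 0 1 p, on_lines 0 1 q) | p q. {p, q} \<in> P} \<union>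
               {(on_lines 1 2 p, on_lines 1 2 q) | p q. {p, q} \<in> Q}"

definition stack :: "pairing \<Rightarrow> pairing \<Rightarrow> pairing" where
  "stack Q P = {{p, q} | p q. p \<noteq> q \<and> (on_lines 0 2 p, on_lines 0 2 q) \<in> (glued Q P)\<^sup>+}"

definition loop_free :: "nat \<Rightarrow> pairing \<Rightarrow> pairing \<Rightarrow> bool" where
  "loop_free c Q P \<longleftrightarrow> (\<forall>i<c. \<exists>p. ((1, i), on_lines 0 2 p) \<in> (glued Q P)\<^sup>+)"

text \<open>\<open>drawing f a b P\<close>: the expression \<open>f\<close> is a drawing, without dots and closed loops, of the
  \<open>(a, b)\<close>-Brauer diagram with underlying pairing \<open>P\<close>.\<close>

inductive drawing :: "'k brterm \<Rightarrow> nat \<Rightarrow> nat \<Rightarrow> pairing \<Rightarrow> bool" where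
  "drawing Cup 0 2 {{Upper 0, Upper 1}}"
| "drawing Cap 2 0 {{Lower 0, Lower 1}}"
| "drawing Cross 2 2 {{Lower 0, Upper 1}, {Lower 1, Upper 0}}"
| "drawing (One a) a a {{Lower i, Upper i} | i. i < a}"
| "\<lbrakk>drawing f a b P; drawing g c d Q\<rbrakk>
    \<Longrightarrow> drawing (f \<^bold>\<otimes> g) (a + c) (b + d) (P \<union> (`) (shift_point a b) ` Q)"
| "\<lbrakk>drawing f a c P; drawing g c b Q; loop_free c Q P\<rbrakk>
    \<Longrightarrow> drawing (g \<^bold>\<circ> f) a b (stack Q P)"

definition strand_at :: "pairing \<Rightarrow> bpoint \<Rightarrow> bpoint set" where
  "strand_at P p = (THE s. s \<in> P \<and> p \<in> s)"

text \<open>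
  Given the numbers \<open>n s\<close> of dots on the strands \<open>s\<close>, the dots to be drawn at each endpoint:
  a lower point carries the dots of its strand unless it is the right endpoint of a cap, and an
  upper point carries them only if it is the right endpoint of a cup.
\<close>

definition lower_dots :: "pairing \<Rightarrow> (bpoint set \<Rightarrow> nat) \<Rightarrow> nat \<Rightarrow> nat" where
  "lower_dots P n i =
     (if \<exists>j<i. Lower j \<in> strand_at P (Lower i) then 0 else n (strand_at P (Lower i)))"

definition upper_dots :: "pairing \<Rightarrow> (bpoint set \<Rightarrow> nat) \<Rightarrow> nat \<Rightarrow> nat" where
  "upper_dots P n j =
     (if \<exists>i<j. Upper i \<in> strand_at P (Upper j) then n (strand_at P (Upper j)) else 0)"

definition dot_row :: "nat list \<Rightarrow> 'k brterm" where
  "dot_row ks = foldr (\<lambda>k f. dot_power k \<^bold>\<otimes> f) ks (One 0)"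

type_synonym 'k dotted_diagram = "'k brterm \<times> pairing \<times> (bpoint set \<Rightarrow> nat)"

definition dotted_diagrams :: "nat \<Rightarrow> nat \<Rightarrow> nat \<Rightarrow> 'k dotted_diagram set" where
  "dotted_diagrams m a b = {(f, P, n). drawing f a b P \<and> (\<forall>s\<in>P. n s \<le> m - 1)}"

fun diagram_term :: "nat \<Rightarrow> nat \<Rightarrow> 'k dotted_diagram \<Rightarrow> 'k brterm" where
  "diagram_term a b (f, P, n) =
     dot_row (map (upper_dots P n) [0..<b]) \<^bold>\<circ> f \<^bold>\<circ> dot_row (map (lower_dots P n) [0..<a])"

definition diagram_equiv :: "('k dotted_diagram \<times> 'k dotted_diagram) set" where
  "diagram_equiv = {((f, P, n), (f', P', n')). P = P' \<and> (\<forall>s\<in>P. n s = n' s)}"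

definition dotted_classes :: "nat \<Rightarrow> nat \<Rightarrow> nat \<Rightarrow> 'k dotted_diagram set set" where
  "dotted_classes m a b =
     dotted_diagrams m a b // (diagram_equiv \<inter> dotted_diagrams m a b \<times> dotted_diagrams m a b)"

text \<open>
  Admissibility in its equivalent form: for all \<open>a\<close>, \<open>b\<close> the Hom space has maximal dimension, that
  is, the set of equivalence classes of normally ordered dotted \<open>(a, b)\<close>-Brauer diagrams is a basis
  of it.  Here a class \<open>\<beta>\<close> is identified with the morphism \<open>v \<beta>\<close> which each of its diagrams
  represents.  (By the coherence theorem for Brauer diagrams, all diagrams in a class represent the
  same morphism, whatever the scalars are.)
\<close>

definition admissible :: "'k::field list \<Rightarrow> (nat \<Rightarrow> 'k) \<Rightarrow> bool" where
  "admissible us \<omega> \<longleftrightarrow>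
     (\<forall>a b. \<exists>v. (\<forall>\<beta> \<in> dotted_classes (length us) a b. \<forall>D\<in>\<beta>.
                   v \<beta> = cb_mor us \<omega> a b (diagram_term a b D)) \<and>
                inj_on v (dotted_classes (length us) a b) \<and>
                vectorspace.basis class_ring (hom_sp (CB us \<omega>) a b)
                  (v ` dotted_classes (length us) a b))"

section \<open>Weakly triangular categories\<close>

subsection \<open>The associated algebra\<close>

text \<open>
  Elements of the associated algebra are finitely supported families whose entry at \<open>(a, b)\<close> is a
  morphism from \<open>b\<close> to \<open>a\<close>; the product is matrix multiplication.  The algebra need not have a
  unit, and \<open>one\<close> is not used.
\<close>

definition assoc_alg ::
  "('j, 'm, 'k, 'z) lincat_scheme \<Rightarrow> ('k, 'j \<times> 'j \<Rightarrow> 'm) module" where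
  "assoc_alg C = (let J = objs C in
     \<lparr>carrier = {x \<in> (\<Pi>\<^sub>E (a, b) \<in> J \<times> J. mor C b a).
                    finite {(a, b) \<in> J \<times> J. x (a, b) \<noteq> \<zero>\<^bsub>hom_sp C b a\<^esub>}},
      mult = (\<lambda>x y. \<lambda>(a, b) \<in> J \<times> J.
        \<Oplus>\<^bsub>hom_sp C b a\<^esub> c \<in> {c \<in> J. x (a, c) \<noteq> \<zero>\<^bsub>hom_sp C c a\<^esub>}.
          cmp C b c a (x (a, c)) (y (c, b))),
      one = undefined,
      zero = (\<lambda>(a, b) \<in> J \<times> J. \<zero>\<^bsub>hom_sp C b a\<^esub>),
      add = (\<lambda>x y. \<lambda>(a, b) \<in> J \<times> J. x (a, b) \<oplus>\<^bsub>hom_sp C b a\<^esub> y (a, b)),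
      smult = (\<lambda>r x. \<lambda>(a, b) \<in> J \<times> J. r \<odot>\<^bsub>hom_sp C b a\<^esub> x (a, b))\<rparr>)"

definition idem :: "('j, 'm, 'k, 'z) lincat_scheme \<Rightarrow> 'j \<Rightarrow> 'j \<times> 'j \<Rightarrow> 'm" where
  "idem C a = (\<lambda>(b, c) \<in> objs C \<times> objs C.
     if b = a \<and> c = a then idm C a else \<zero>\<^bsub>hom_sp C c b\<^esub>)"

definition idem_class :: "('j, 'm, 'k, 'z) lincat_scheme \<Rightarrow> 'j set \<Rightarrow> 'j \<times> 'j \<Rightarrow> 'm" where
  "idem_class C aa = (\<Oplus>\<^bsub>assoc_alg C\<^esub> b \<in> aa. idem C b)"

definition corner :: "('k, 'x) module \<Rightarrow> 'x \<Rightarrow> 'x set \<Rightarrow> 'x \<Rightarrow> 'x set" where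
  "corner A e B f = {e \<otimes>\<^bsub>A\<^esub> (x \<otimes>\<^bsub>A\<^esub> f) | x. x \<in> B}"

abbreviation corner_obj ::
  "('j, 'm, 'k, 'z) lincat_scheme \<Rightarrow> 'j \<Rightarrow> ('j \<times> 'j \<Rightarrow> 'm) set \<Rightarrow> 'j \<Rightarrow> ('j \<times> 'j \<Rightarrow> 'm) set" where
  "corner_obj C a B b \<equiv> corner (assoc_alg C) (idem C a) B (idem C b)"

abbreviation corner_class ::
  "('j, 'm, 'k, 'z) lincat_scheme \<Rightarrow> 'j set \<Rightarrow> ('j \<times> 'j \<Rightarrow> 'm) set \<Rightarrow> 'j set
    \<Rightarrow> ('j \<times> 'j \<Rightarrow> 'm) set" where
  "corner_class C aa B bb \<equiv> corner (assoc_alg C) (idem_class C aa) B (idem_class C bb)"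

definition internal_sum :: "('k, 'x) module \<Rightarrow> 'i set \<Rightarrow> ('i \<Rightarrow> 'x set) \<Rightarrow> 'x set" where
  "internal_sum A S W = {finsum A w F | w F. finite F \<and> F \<subseteq> S \<and> (\<forall>i\<in>F. w i \<in> W i)}"

definition internal_direct_sum ::
  "('k, 'x) module \<Rightarrow> 'i set \<Rightarrow> ('i \<Rightarrow> 'x set) \<Rightarrow> 'x set \<Rightarrow> bool" where
  "internal_direct_sum A S W B \<longleftrightarrow> B = internal_sum A S W \<and>
     (\<forall>F w. finite F \<and> F \<subseteq> S \<and> (\<forall>i\<in>F. w i \<in> W i) \<and> finsum A w F = \<zero>\<^bsub>A\<^esub> \<longrightarrow>
        (\<forall>i\<in>F. w i = \<zero>\<^bsub>A\<^esub>))"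

definition line :: "('k, 'x) module \<Rightarrow> 'x \<Rightarrow> 'x set" where
  "line A x = {r \<odot>\<^bsub>A\<^esub> x | r. True}"

definition idem_alg :: "('j, 'm, 'k, 'z) lincat_scheme \<Rightarrow> ('j \<times> 'j \<Rightarrow> 'm) set" where
  "idem_alg C = internal_sum (assoc_alg C) (objs C) (\<lambda>b. line (assoc_alg C) (idem C b))"

subsection \<open>Triple tensor products over a subalgebra\<close>

text \<open>The triple tensor product of subspaces \<open>X\<close>, \<open>Y\<close>, \<open>Z\<close> of an algebra over a subalgebra \<open>K\<close>
  acting on them by multiplication: the free vector space on \<open>X \<times> Y \<times> Z\<close>, modulo the relations
  which make \<open>(x, y, z)\<close> linear in each argument and \<open>K\<close>-balanced.\<close>

abbreviation free_gen :: "'t \<Rightarrow> 't \<Rightarrow>\<^sub>0 'k::field" where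
  "free_gen t \<equiv> Poly_Mapping.single t 1"

definition free_scale :: "'k::field \<Rightarrow> ('t \<Rightarrow>\<^sub>0 'k) \<Rightarrow> ('t \<Rightarrow>\<^sub>0 'k)" where
  "free_scale r p = Poly_Mapping.map ((*) r) p"

definition free_space :: "'t set \<Rightarrow> ('t \<Rightarrow>\<^sub>0 'k::field) set" where
  "free_space T = {p. Poly_Mapping.keys p \<subseteq> T}"

inductive_set tensor_null ::
  "('k::field, 'x) module \<Rightarrow> 'x set \<Rightarrow> 'x set \<Rightarrow> 'x set \<Rightarrow> 'x set \<Rightarrow> ('x \<times> 'x \<times> 'x \<Rightarrow>\<^sub>0 'k) set"
  for A :: "('k, 'x) module" (structure) and K X Y Z :: "'x set" where
  "0 \<in> tensor_null A K X Y Z"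
| "\<lbrakk>p \<in> tensor_null A K X Y Z; q \<in> tensor_null A K X Y Z\<rbrakk> \<Longrightarrow> p + q \<in> tensor_null A K X Y Z"
| "p \<in> tensor_null A K X Y Z \<Longrightarrow> free_scale r p \<in> tensor_null A K X Y Z"
| "\<lbrakk>x \<in> X; x' \<in> X; y \<in> Y; z \<in> Z\<rbrakk>
    \<Longrightarrow> free_gen (x \<oplus> x', y, z) - free_gen (x, y, z) - free_gen (x', y, z) \<in> tensor_null A K X Y Z"
| "\<lbrakk>x \<in> X; y \<in> Y; y' \<in> Y; z \<in> Z\<rbrakk>
    \<Longrightarrow> free_gen (x, y \<oplus> y', z) - free_gen (x, y, z) - free_gen (x, y', z) \<in> tensor_null A K X Y Z"
| "\<lbrakk>x \<in> X; y \<in> Y; z \<in> Z; z' \<in> Z\<rbrakk>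
    \<Longrightarrow> free_gen (x, y, z \<oplus> z') - free_gen (x, y, z) - free_gen (x, y, z') \<in> tensor_null A K X Y Z"
| "\<lbrakk>x \<in> X; y \<in> Y; z \<in> Z\<rbrakk>
    \<Longrightarrow> free_gen (r \<odot> x, y, z) - free_scale r (free_gen (x, y, z)) \<in> tensor_null A K X Y Z"
| "\<lbrakk>x \<in> X; y \<in> Y; z \<in> Z\<rbrakk>
    \<Longrightarrow> free_gen (x, r \<odot> y, z) - free_scale r (free_gen (x, y, z)) \<in> tensor_null A K X Y Z"
| "\<lbrakk>x \<in> X; y \<in> Y; z \<in> Z\<rbrakk>
    \<Longrightarrow> free_gen (x, y, r \<odot> z) - free_scale r (free_gen (x, y, z)) \<in> tensor_null A K X Y Z"
| "\<lbrakk>x \<in> X; y \<in> Y; z \<in> Z; e \<in> K\<rbrakk>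
    \<Longrightarrow> free_gen (x \<otimes> e, y, z) - free_gen (x, e \<otimes> y, z) \<in> tensor_null A K X Y Z"
| "\<lbrakk>x \<in> X; y \<in> Y; z \<in> Z; e \<in> K\<rbrakk>
    \<Longrightarrow> free_gen (x, y \<otimes> e, z) - free_gen (x, y, e \<otimes> z) \<in> tensor_null A K X Y Z"

definition tensor3 ::
  "('k::field, 'x) module \<Rightarrow> 'x set \<Rightarrow> 'x set \<Rightarrow> 'x set \<Rightarrow> 'x set
    \<Rightarrow> ('x \<times> 'x \<times> 'x \<Rightarrow>\<^sub>0 'k) set set" where
  "tensor3 A K X Y Z = free_space (X \<times> Y \<times> Z) //
     {(p, q). p \<in> free_space (X \<times> Y \<times> Z) \<and> q \<in> free_space (X \<times> Y \<times> Z) \<and>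
              p - q \<in> tensor_null A K X Y Z}"

definition multiply3 :: "('k::field, 'x) module \<Rightarrow> ('x \<times> 'x \<times> 'x \<Rightarrow>\<^sub>0 'k) \<Rightarrow> 'x" where
  "multiply3 A p = (\<Oplus>\<^bsub>A\<^esub> t \<in> Poly_Mapping.keys p.
     Poly_Mapping.lookup p t \<odot>\<^bsub>A\<^esub> (case t of (x, y, z) \<Rightarrow> x \<otimes>\<^bsub>A\<^esub> (y \<otimes>\<^bsub>A\<^esub> z)))"

text \<open>Multiplication induces an isomorphism from the tensor product to the whole algebra; the
  induced map \<open>\<phi>\<close> is linear because \<open>multiply3\<close> is.\<close>

definition multiplication_iso ::
  "('k::field, 'x) module \<Rightarrow> 'x set \<Rightarrow> 'x set \<Rightarrow> 'x set \<Rightarrow> 'x set \<Rightarrow> bool" where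
  "multiplication_iso A K X Y Z \<longleftrightarrow>
     (\<exists>\<phi>. (\<forall>t \<in> tensor3 A K X Y Z. \<forall>p\<in>t. \<phi> t = multiply3 A p) \<and>
          bij_betw \<phi> (tensor3 A K X Y Z) (carrier A))"

subsection \<open>Weakly triangular decompositions\<close>

text \<open>\<open>sim\<close> is the equivalence relation on objects, \<open>po\<close> the partial order on its classes, and
  \<open>Am\<close>, \<open>Ao\<close>, \<open>Ap\<close> are the three subspaces \<open>A\<^sup>-\<close>, \<open>A\<^sup>\<circ>\<close>, \<open>A\<^sup>+\<close>.\<close>

definition weakly_triangular_decomposition ::
  "('j, 'm, 'k::field, 'z) lincat_scheme \<Rightarrow> 'j rel \<Rightarrow> 'j set rel
    \<Rightarrow> ('j \<times> 'j \<Rightarrow> 'm) set \<Rightarrow> ('j \<times> 'j \<Rightarrow> 'm) set \<Rightarrow> ('j \<times> 'j \<Rightarrow> 'm) set \<Rightarrow> bool" where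
  "weakly_triangular_decomposition C sim po Am Ao Ap \<longleftrightarrow>
     (let J = objs C; I = J // sim; A = assoc_alg C in
      partial_order_on I po \<and>
      subspace class_ring Am A \<and> subspace class_ring Ao A \<and> subspace class_ring Ap A \<and>
      internal_direct_sum A (J \<times> J) (\<lambda>(b, c). corner_obj C b Am c) Am \<and>
      internal_direct_sum A (J \<times> J) (\<lambda>(b, c). corner_obj C b Ap c) Ap \<and>
      internal_direct_sum A (\<Union>aa\<in>I. aa \<times> aa) (\<lambda>(b, c). corner_obj C b Ao c) Ao \<and>
      (\<forall>aa\<in>I. \<forall>bb\<in>I. (aa, bb) \<notin> po \<longrightarrow>
         corner_class C aa Am bb = {\<zero>\<^bsub>A\<^esub>} \<and> corner_class C bb Ap aa = {\<zero>\<^bsub>A\<^esub>}) \<and>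
      (\<forall>aa\<in>I. corner_class C aa Am aa = corner_class C aa Ap aa \<and>
         internal_direct_sum A aa (\<lambda>c. line A (idem C c)) (corner_class C aa Am aa)) \<and>
      multiplication_iso A (idem_alg C) Am Ao Ap)"

definition upper_finite :: "'i set \<Rightarrow> 'i rel \<Rightarrow> bool" where
  "upper_finite I po \<longleftrightarrow> (\<forall>a\<in>I. finite {b \<in> I. (a, b) \<in> po})"

definition upper_finite_weakly_triangular_category ::
  "('j, 'm, 'k::field, 'z) lincat_scheme \<Rightarrow> bool" where
  "upper_finite_weakly_triangular_category C \<longleftrightarrow>
     linear_category C \<and> finite_dim_homs C \<and>
     (\<exists>sim. equiv (objs C) sim \<and> (\<forall>aa \<in> objs C // sim. finite aa) \<and>
        (\<exists>po Am Ao Ap. weakly_triangular_decomposition C sim po Am Ao Ap \<and>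
           upper_finite (objs C // sim) po))"

end

(*
  Diagrams are filtered by the number c of vertical strands.  Modulo diagrams with fewer vertical
  strands, a dotted (a, b)-Brauer diagram is a cup part on top of a dotted permutation of c points on
  top of a cap part.  Here a cup part has no caps, dots only on its cups, and vertical strands which do
  not cross one another; a cap part is a cup part turned upside down.  The three kinds of diagrams span the three subspaces A^-, A^0, A^+, the order
  on objects being the reverse of the usual one.

  That such composites span a Hom space needs no diagram calculus for dots.  The basis given by
  admissibility may be represented by any drawings: a diagram from c to b without caps can be drawn so
  that it is literally a cup part composed with a dotted permutation, and one with a cap so that it
  factors through c - 2.  Applying the flip, which is an antiautomorphism of the cyclotomic Brauer
  category, gives the dual factorisation, and induction on c does the rest.  Linear independence is
  then a matter of counting: the triples inject into the dotted pairings of points, whose number is the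
  dimension of the Hom space.
*)

theory Submission
  imports Defs
begin

text \<open>Admissibility gives a basis whose elements may be represented by any drawing of their
  pairing. This freedom replaces the straightening of dots: a drawing is chosen that already
  factors, and the dots lie on its outer lines. Two points become essential. The classes in
  \<open>dotted_classes\<close> come from pairings that have a drawing, so the dimension is the
  number of all dotted perfect matchings only once drawings and perfect matchings are known to
  correspond; this includes the analysis of paths in stacked pairings. And the flip has to respect
  the relations, although the slide and the sign rule for dots are imposed on caps only and the
  affine relation on one side of the crossing only; their upside-down forms are derived from the
  zigzags and the crossing. The parts of a weakly triangular decomposition are mere subspaces, so
  each may be spanned by any convenient set of morphisms, and (W4) says that the products of basis
  triples with matching inner objects span every Hom space and are independent.\<close>

section \<open>Typed expressions and their equality up to the relations\<close>

text \<open>Typing as a partial function: through \<open>arrow_iff\<close> the simplifier settles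
  side conditions that the rules of \<open>arrow\<close>, with sums in their conclusions, would
  leave to unification.\<close>

fun brtype :: "'k brterm \<Rightarrow> (nat \<times> nat) option" where
  "brtype Cup = Some (0, 2)"
| "brtype Cap = Some (2, 0)"
| "brtype Cross = Some (2, 2)"
| "brtype Dot = Some (1, 1)"
| "brtype (One a) = Some (a, a)"
| "brtype (Zer a b) = Some (a, b)"
| "brtype (Add f g) = (if brtype f = brtype g then brtype f else None)"
| "brtype (Scl r f) = brtype f"
| "brtype (g \<^bold>\<circ> f) = (case (brtype f, brtype g) of
     (Some (a, b), Some (b', c)) \<Rightarrow> if b = b' then Some (a, c) else None | _ \<Rightarrow> None)"
| "brtype (f \<^bold>\<otimes> g) = (case (brtype f, brtype g) of
     (Some (a, b), Some (c, d)) \<Rightarrow> Some (a + c, b + d) | _ \<Rightarrow> None)"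

lemma arrow_iff: "arrow f a b \<longleftrightarrow> brtype f = Some (a, b)"
proof
  show "arrow f a b \<Longrightarrow> brtype f = Some (a, b)"
    by (induction rule: arrow.induct) auto
  show "brtype f = Some (a, b) \<Longrightarrow> arrow f a b"
  proof (induction f arbitrary: a b)
    case (Cmp g f)
    then obtain c where "brtype f = Some (a, c)" "brtype g = Some (c, b)"
      by (auto split: option.splits if_splits)
    then show ?case
      by (intro arrow.intros(9)[OF Cmp.IH(2) Cmp.IH(1)])
  next
    case (Tns f g)
    then obtain a' b' c d where "brtype f = Some (a', b')" "brtype g = Some (c, d)" "a = a' + c" "b = b' + d"
      by (auto split: option.splits)
    then show ?case
      by (simp add: arrow.intros(10)[OF Tns.IH])
  qed (auto intro: arrow.intros arrow.intros(4)[unfolded One_nat_def] split: if_splits)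
qed

lemma ab_eq_brtype:
  assumes "ab_eq a b f g"
  shows "brtype f = Some (a, b)" "brtype g = Some (a, b)"
  using assms by (induction rule: ab_eq.induct) (auto simp: arrow_iff)

text \<open>The endpoints are suppressed because either side determines them; chains of equations
  then need no agreement between indices such as \<open>a + c + e\<close> and
  \<open>a + (c + e)\<close>.\<close>

definition abeq :: "'k::field brterm \<Rightarrow> 'k brterm \<Rightarrow> bool"  (infix \<open>\<simeq>\<close> 55) where
  "f \<simeq> g \<longleftrightarrow> (\<exists>a b. ab_eq a b f g)"

lemma abeqI: "ab_eq a b f g \<Longrightarrow> f \<simeq> g"
  by (auto simp: abeq_def)

lemma abeqD: "f \<simeq> g \<Longrightarrow> brtype f = Some (a, b) \<Longrightarrow> ab_eq a b f g"
  unfolding abeq_def by (elim exE) (frule ab_eq_brtype(1), simp)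

lemma abeq_typed: "f \<simeq> g \<Longrightarrow> \<exists>a b. brtype f = Some (a, b) \<and> brtype g = Some (a, b)"
  by (auto simp: abeq_def dest: ab_eq_brtype)

lemma abeq_refl: "brtype f \<noteq> None \<Longrightarrow> f \<simeq> f"
  by (auto simp: arrow_iff intro: abeqI[OF ab_eq.refl])

lemma abeq_sym: "f \<simeq> g \<Longrightarrow> g \<simeq> f"
  by (auto simp: abeq_def dest: ab_eq.sym)

lemma abeq_trans [trans]:
  assumes "f \<simeq> g" "g \<simeq> h"
  shows "f \<simeq> h"
proof -
  obtain a b where "brtype f = Some (a, b)" "brtype g = Some (a, b)"
    using abeq_typed[OF assms(1)] by blast
  then show ?thesis
    by (intro abeqI[OF ab_eq.trans[OF abeqD[OF assms(1)] abeqD[OF assms(2)]]])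
qed

lemma abeq_add:
  assumes "f \<simeq> f'" "g \<simeq> g'" "brtype f = brtype g"
  shows "Add f g \<simeq> Add f' g'"
proof -
  obtain a b where "brtype f = Some (a, b)" "brtype g = Some (a, b)"
    using abeq_typed[OF assms(1)] assms(3) by auto
  then show ?thesis
    by (intro abeqI[OF ab_eq.add_cong[OF abeqD[OF assms(1)] abeqD[OF assms(2)]]])
qed

lemma abeq_scl: "f \<simeq> f' \<Longrightarrow> Scl r f \<simeq> Scl r f'"
  by (auto simp: abeq_def dest: ab_eq.scl_cong)

lemma abeq_cmp:
  assumes "g \<simeq> g'" "f \<simeq> f'" "brtype (g \<^bold>\<circ> f) \<noteq> None"
  shows "g \<^bold>\<circ> f \<simeq> g' \<^bold>\<circ> f'"
proof -
  obtain a b c where "brtype f = Some (a, b)" "brtype g = Some (b, c)"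
    using assms(3) by (auto split: option.splits if_splits)
  then show ?thesis
    by (intro abeqI[OF ab_eq.cmp_cong[OF abeqD[OF assms(2)] abeqD[OF assms(1)]]])
qed

lemma abeq_tns: "f \<simeq> f' \<Longrightarrow> g \<simeq> g' \<Longrightarrow> f \<^bold>\<otimes> g \<simeq> f' \<^bold>\<otimes> g'"
  unfolding abeq_def by (blast intro: ab_eq.tns_cong)

lemma abeq_assoc:
  "brtype (h \<^bold>\<circ> (g \<^bold>\<circ> f)) \<noteq> None \<Longrightarrow> (h \<^bold>\<circ> g) \<^bold>\<circ> f \<simeq> h \<^bold>\<circ> (g \<^bold>\<circ> f)"
  by (auto split: option.splits if_splits simp: arrow_iff intro!: abeqI ab_eq.cmp_assoc)

lemma abeq_one_left: "brtype f = Some (a, b) \<Longrightarrow> One b \<^bold>\<circ> f \<simeq> f"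
  by (auto simp: arrow_iff intro!: abeqI ab_eq.one_left)

lemma abeq_one_right: "brtype f = Some (a, b) \<Longrightarrow> f \<^bold>\<circ> One a \<simeq> f"
  by (auto simp: arrow_iff intro!: abeqI ab_eq.one_right)

lemma abeq_tns_assoc:
  assumes "brtype (f \<^bold>\<otimes> g \<^bold>\<otimes> h) \<noteq> None"
  shows "(f \<^bold>\<otimes> g) \<^bold>\<otimes> h \<simeq> f \<^bold>\<otimes> g \<^bold>\<otimes> h"
proof -
  obtain a b c d k l where "arrow f a b" "arrow g c d" "arrow h k l"
    using assms by (auto simp: arrow_iff split: option.splits)
  then show ?thesis
    by (rule abeqI[OF ab_eq.tns_assoc])
qed

lemma abeq_unit_left: "brtype f \<noteq> None \<Longrightarrow> One 0 \<^bold>\<otimes> f \<simeq> f"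
  by (auto simp: arrow_iff intro: abeqI[OF ab_eq.tns_unit_left])

lemma abeq_unit_right: "brtype f \<noteq> None \<Longrightarrow> f \<^bold>\<otimes> One 0 \<simeq> f"
  by (auto simp: arrow_iff intro: abeqI[OF ab_eq.tns_unit_right])

lemma abeq_tns_one: "One a \<^bold>\<otimes> One b \<simeq> One (a + b)"
  by (auto intro!: abeqI ab_eq.tns_one)

lemma abeq_interchange:
  assumes "brtype (g \<^bold>\<circ> f) \<noteq> None" "brtype (g' \<^bold>\<circ> f') \<noteq> None"
  shows "(g \<^bold>\<circ> f) \<^bold>\<otimes> (g' \<^bold>\<circ> f') \<simeq> (g \<^bold>\<otimes> g') \<^bold>\<circ> (f \<^bold>\<otimes> f')"
proof -
  obtain a b c where "arrow f a b" "arrow g b c"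
    using assms(1) by (auto simp: arrow_iff split: option.splits if_splits)
  moreover obtain a' b' c' where "arrow f' a' b'" "arrow g' b' c'"
    using assms(2) by (auto simp: arrow_iff split: option.splits if_splits)
  ultimately show ?thesis
    by (rule abeqI[OF ab_eq.interchange])
qed

text \<open>Insert an identity below \<open>f\<close> and one above \<open>g\<close>, then
  interchange: pieces side by side may be moved to different heights.\<close>

lemma abeq_slide_right:
  "brtype f = Some (a, b) \<Longrightarrow> brtype g = Some (c, d) \<Longrightarrow> f \<^bold>\<otimes> g \<simeq> (f \<^bold>\<otimes> One d) \<^bold>\<circ> (One a \<^bold>\<otimes> g)"
  by (rule abeq_trans[OF abeq_tns[of _ "f \<^bold>\<circ> One a" _ "One d \<^bold>\<circ> g"] abeq_interchange])
    (simp_all add: abeq_refl abeq_one_left[THEN abeq_sym] abeq_one_right[THEN abeq_sym])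

lemma abeq_slide_left:
  "brtype f = Some (a, b) \<Longrightarrow> brtype g = Some (c, d) \<Longrightarrow> f \<^bold>\<otimes> g \<simeq> (One b \<^bold>\<otimes> g) \<^bold>\<circ> (f \<^bold>\<otimes> One c)"
  by (rule abeq_trans[OF abeq_tns[of _ "One b \<^bold>\<circ> f" _ "g \<^bold>\<circ> One c"] abeq_interchange])
    (simp_all add: abeq_refl abeq_one_left[THEN abeq_sym] abeq_one_right[THEN abeq_sym])

lemma abeq_cmp_tns_one:
  "brtype (g \<^bold>\<circ> f) \<noteq> None \<Longrightarrow> (g \<^bold>\<circ> f) \<^bold>\<otimes> One k \<simeq> (g \<^bold>\<otimes> One k) \<^bold>\<circ> (f \<^bold>\<otimes> One k)"
  by (rule abeq_trans[OF abeq_tns[of _ "g \<^bold>\<circ> f" _ "One k \<^bold>\<circ> One k"] abeq_interchange])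
    (simp_all add: abeq_refl abeq_one_left[THEN abeq_sym] abeq_one_right[THEN abeq_sym])

lemma abeq_one_tns_cmp:
  "brtype (g \<^bold>\<circ> f) \<noteq> None \<Longrightarrow> One k \<^bold>\<otimes> (g \<^bold>\<circ> f) \<simeq> (One k \<^bold>\<otimes> g) \<^bold>\<circ> (One k \<^bold>\<otimes> f)"
  by (rule abeq_trans[OF abeq_tns[of _ "One k \<^bold>\<circ> One k" _ "g \<^bold>\<circ> f"] abeq_interchange])
    (simp_all add: abeq_refl abeq_one_left[THEN abeq_sym] abeq_one_right[THEN abeq_sym])


section \<open>The upside-down flip\<close>

text \<open>Reverses composition but keeps the left-to-right order of tensor factors, so that right
  tensor ideals are carried to right tensor ideals.\<close>

primrec flip :: "'k brterm \<Rightarrow> 'k brterm" where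
  "flip Cup = Cap"
| "flip Cap = Cup"
| "flip Cross = Cross"
| "flip Dot = Dot"
| "flip (One a) = One a"
| "flip (Zer a b) = Zer b a"
| "flip (Add f g) = Add (flip f) (flip g)"
| "flip (Scl r f) = Scl r (flip f)"
| "flip (g \<^bold>\<circ> f) = flip f \<^bold>\<circ> flip g"
| "flip (f \<^bold>\<otimes> g) = flip f \<^bold>\<otimes> flip g"

lemma flip_flip [simp]: "flip (flip f) = f"
  by (induction f) auto

lemma arrow_flip: "arrow f a b \<Longrightarrow> arrow (flip f) b a"
  by (induction rule: arrow.induct) (auto intro: arrow.intros arrow.intros(4)[unfolded One_nat_def])

lemma abeq_slice:
  "brtype g = Some (c, d) \<Longrightarrow> brtype f = Some (a, b)
    \<Longrightarrow> (One b \<^bold>\<otimes> g) \<^bold>\<circ> (f \<^bold>\<otimes> One c) \<simeq> (f \<^bold>\<otimes> One d) \<^bold>\<circ> (One a \<^bold>\<otimes> g)"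
  by (rule abeq_trans[OF abeq_sym[OF abeq_slide_left] abeq_slide_right])

lemma zigzag_left_tns: "(One 1 \<^bold>\<otimes> Cap \<^bold>\<otimes> One k) \<^bold>\<circ> (Cup \<^bold>\<otimes> One (1 + k)) \<simeq> One (1 + k)"
proof -
  have "Cup \<^bold>\<otimes> One (1 + k) \<simeq> (Cup \<^bold>\<otimes> One 1) \<^bold>\<otimes> One k"
    by (rule abeq_trans[OF abeq_tns[OF abeq_refl abeq_sym[OF abeq_tns_one]] abeq_sym[OF abeq_tns_assoc]])
      simp_all
  then have "(One 1 \<^bold>\<otimes> Cap \<^bold>\<otimes> One k) \<^bold>\<circ> (Cup \<^bold>\<otimes> One (1 + k))
      \<simeq> ((One 1 \<^bold>\<otimes> Cap) \<^bold>\<otimes> One k) \<^bold>\<circ> ((Cup \<^bold>\<otimes> One 1) \<^bold>\<otimes> One k)"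
    by (intro abeq_cmp abeq_sym[OF abeq_tns_assoc]) simp_all
  also have "\<dots> \<simeq> ((One 1 \<^bold>\<otimes> Cap) \<^bold>\<circ> (Cup \<^bold>\<otimes> One 1)) \<^bold>\<otimes> One k"
    by (rule abeq_sym[OF abeq_cmp_tns_one]) simp
  also have "\<dots> \<simeq> One 1 \<^bold>\<otimes> One k"
    by (intro abeq_tns abeq_refl abeqI[OF ab_eq.zigzag_left]) simp
  also have "\<dots> \<simeq> One (1 + k)"
    by (rule abeq_tns_one)
  finally show ?thesis .
qed

lemma zigzag_right_tns: "(One k \<^bold>\<otimes> Cap \<^bold>\<otimes> One 1) \<^bold>\<circ> (One (k + 1) \<^bold>\<otimes> Cup) \<simeq> One (k + 1)"
proof -
  have "One (k + 1) \<^bold>\<otimes> Cup \<simeq> One k \<^bold>\<otimes> One 1 \<^bold>\<otimes> Cup"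
    by (rule abeq_trans[OF abeq_tns[OF abeq_sym[OF abeq_tns_one] abeq_refl] abeq_tns_assoc]) simp_all
  then have "(One k \<^bold>\<otimes> Cap \<^bold>\<otimes> One 1) \<^bold>\<circ> (One (k + 1) \<^bold>\<otimes> Cup)
      \<simeq> (One k \<^bold>\<otimes> Cap \<^bold>\<otimes> One 1) \<^bold>\<circ> (One k \<^bold>\<otimes> One 1 \<^bold>\<otimes> Cup)"
    by (intro abeq_cmp abeq_refl) simp_all
  also have "\<dots> \<simeq> One k \<^bold>\<otimes> ((Cap \<^bold>\<otimes> One 1) \<^bold>\<circ> (One 1 \<^bold>\<otimes> Cup))"
    by (rule abeq_sym[OF abeq_one_tns_cmp]) simp
  also have "\<dots> \<simeq> One k \<^bold>\<otimes> One 1"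
    by (intro abeq_tns abeq_refl abeqI[OF ab_eq.zigzag_right]) simp
  also have "\<dots> \<simeq> One (k + 1)"
    by (rule abeq_tns_one)
  finally show ?thesis .
qed

text \<open>The two mates of an expression, obtained by bending its outer legs to the top, turn the
  relations for caps into the corresponding relations for cups.\<close>

definition mate :: "nat \<Rightarrow> 'k brterm \<Rightarrow> 'k brterm" where
  "mate k f = (One 1 \<^bold>\<otimes> f \<^bold>\<otimes> One 1) \<^bold>\<circ> (Cup \<^bold>\<otimes> One k \<^bold>\<otimes> Cup)"

lemma mate_cong: "f \<simeq> f' \<Longrightarrow> brtype f = Some (k + 2, l) \<Longrightarrow> mate k f \<simeq> mate k f'"
  unfolding mate_def by (intro abeq_cmp abeq_tns abeq_refl) simp_all

text \<open>The right leg of the left cup runs straight into the cap, and the two straighten out by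
  the left zigzag; \<open>g\<close> survives, fed by the \<open>k\<close> strands and the right
  cup.\<close>

lemma mate_left_cap:
  assumes g: "brtype g = Some (k + 1, k + 1)"
  shows "mate k ((Cap \<^bold>\<otimes> One k) \<^bold>\<circ> (One 1 \<^bold>\<otimes> g)) \<simeq> (g \<^bold>\<otimes> One 1) \<^bold>\<circ> (One k \<^bold>\<otimes> Cup)"
proof -
  let ?Z = "One 1 \<^bold>\<otimes> Cap \<^bold>\<otimes> One (k + 1)"
  let ?C = "Cup \<^bold>\<otimes> One (1 + (k + 1))"
  have 1: "One 1 \<^bold>\<otimes> ((Cap \<^bold>\<otimes> One k) \<^bold>\<circ> (One 1 \<^bold>\<otimes> g)) \<^bold>\<otimes> One 1
      \<simeq> ?Z \<^bold>\<circ> (One 2 \<^bold>\<otimes> g \<^bold>\<otimes> One 1)"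
  proof -
    have "One 1 \<^bold>\<otimes> ((Cap \<^bold>\<otimes> One k) \<^bold>\<circ> (One 1 \<^bold>\<otimes> g)) \<^bold>\<otimes> One 1
        \<simeq> One 1 \<^bold>\<otimes> (((Cap \<^bold>\<otimes> One k) \<^bold>\<otimes> One 1) \<^bold>\<circ> ((One 1 \<^bold>\<otimes> g) \<^bold>\<otimes> One 1))"
      using g by (intro abeq_tns abeq_refl abeq_cmp_tns_one) simp_all
    also have "\<dots> \<simeq> One 1 \<^bold>\<otimes> ((Cap \<^bold>\<otimes> One (k + 1)) \<^bold>\<circ> (One 1 \<^bold>\<otimes> (g \<^bold>\<otimes> One 1)))"
      using g by (intro abeq_tns[OF abeq_refl] abeq_cmp abeq_tns_assoc
          abeq_trans[OF abeq_tns_assoc abeq_tns[OF abeq_refl abeq_tns_one]]) simp_all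
    also have "\<dots> \<simeq> ?Z \<^bold>\<circ> (One 1 \<^bold>\<otimes> One 1 \<^bold>\<otimes> (g \<^bold>\<otimes> One 1))"
      using g by (intro abeq_one_tns_cmp) simp
    also have "\<dots> \<simeq> ?Z \<^bold>\<circ> (One (1 + 1) \<^bold>\<otimes> (g \<^bold>\<otimes> One 1))"
      using g by (intro abeq_cmp abeq_refl abeq_trans[OF abeq_sym[OF abeq_tns_assoc]
            abeq_tns[OF abeq_tns_one abeq_refl]]) simp_all
    finally show ?thesis
      by (simp add: numeral_2_eq_2)
  qed
  have 2: "Cup \<^bold>\<otimes> One k \<^bold>\<otimes> Cup \<simeq> (Cup \<^bold>\<otimes> One (k + 2)) \<^bold>\<circ> (One k \<^bold>\<otimes> Cup)"
  proof -
    have "Cup \<^bold>\<otimes> One k \<^bold>\<otimes> Cup \<simeq> (Cup \<^bold>\<otimes> One (k + 2)) \<^bold>\<circ> (One 0 \<^bold>\<otimes> One k \<^bold>\<otimes> Cup)"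
      by (rule abeq_slide_right) simp_all
    also have "\<dots> \<simeq> (Cup \<^bold>\<otimes> One (k + 2)) \<^bold>\<circ> (One k \<^bold>\<otimes> Cup)"
      by (intro abeq_cmp abeq_refl abeq_unit_left) simp_all
    finally show ?thesis .
  qed
  \<comment> \<open>\<open>g\<close> lies to the right of the left cup, so it slides below it and
    clears the way for the zigzag.\<close>
  have 3: "(One 2 \<^bold>\<otimes> g \<^bold>\<otimes> One 1) \<^bold>\<circ> (Cup \<^bold>\<otimes> One (k + 2)) \<simeq> ?C \<^bold>\<circ> (g \<^bold>\<otimes> One 1)"
  proof -
    have "(One 2 \<^bold>\<otimes> g \<^bold>\<otimes> One 1) \<^bold>\<circ> (Cup \<^bold>\<otimes> One (k + 2)) \<simeq> ?C \<^bold>\<circ> (One 0 \<^bold>\<otimes> g \<^bold>\<otimes> One 1)"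
      using g by (intro abeq_slice) simp_all
    also have "\<dots> \<simeq> ?C \<^bold>\<circ> (g \<^bold>\<otimes> One 1)"
      using g by (intro abeq_cmp abeq_refl abeq_unit_left) simp_all
    finally show ?thesis .
  qed
  have "mate k ((Cap \<^bold>\<otimes> One k) \<^bold>\<circ> (One 1 \<^bold>\<otimes> g))
      \<simeq> (?Z \<^bold>\<circ> (One 2 \<^bold>\<otimes> g \<^bold>\<otimes> One 1)) \<^bold>\<circ> ((Cup \<^bold>\<otimes> One (k + 2)) \<^bold>\<circ> (One k \<^bold>\<otimes> Cup))"
    unfolding mate_def using g by (intro abeq_cmp 1 2) simp_all
  also have "\<dots> \<simeq> ?Z \<^bold>\<circ> ((One 2 \<^bold>\<otimes> g \<^bold>\<otimes> One 1) \<^bold>\<circ> ((Cup \<^bold>\<otimes> One (k + 2)) \<^bold>\<circ> (One k \<^bold>\<otimes> Cup)))"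
    using g by (intro abeq_assoc) simp
  also have "\<dots> \<simeq> ?Z \<^bold>\<circ> (((One 2 \<^bold>\<otimes> g \<^bold>\<otimes> One 1) \<^bold>\<circ> (Cup \<^bold>\<otimes> One (k + 2))) \<^bold>\<circ> (One k \<^bold>\<otimes> Cup))"
    using g by (intro abeq_cmp abeq_refl abeq_sym[OF abeq_assoc]) simp_all
  also have "\<dots> \<simeq> ?Z \<^bold>\<circ> ((?C \<^bold>\<circ> (g \<^bold>\<otimes> One 1)) \<^bold>\<circ> (One k \<^bold>\<otimes> Cup))"
    using g by (intro abeq_cmp 3 abeq_refl) simp_all
  also have "\<dots> \<simeq> ?Z \<^bold>\<circ> (?C \<^bold>\<circ> ((g \<^bold>\<otimes> One 1) \<^bold>\<circ> (One k \<^bold>\<otimes> Cup)))"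
    using g by (intro abeq_cmp abeq_refl abeq_assoc) simp_all
  also have "\<dots> \<simeq> (?Z \<^bold>\<circ> ?C) \<^bold>\<circ> ((g \<^bold>\<otimes> One 1) \<^bold>\<circ> (One k \<^bold>\<otimes> Cup))"
    using g by (intro abeq_sym[OF abeq_assoc]) simp
  also have "\<dots> \<simeq> One (1 + (k + 1)) \<^bold>\<circ> ((g \<^bold>\<otimes> One 1) \<^bold>\<circ> (One k \<^bold>\<otimes> Cup))"
    using g by (intro abeq_cmp abeq_refl zigzag_left_tns) simp_all
  also have "\<dots> \<simeq> (g \<^bold>\<otimes> One 1) \<^bold>\<circ> (One k \<^bold>\<otimes> Cup)"
    using g by (intro abeq_one_left) simp
  finally show ?thesis .
qed

text \<open>The mirror image: the left leg of the right cup meets the cap, and the right zigzag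
  removes both.\<close>

lemma mate_right_cap:
  assumes g: "brtype g = Some (k + 1, k + 1)"
  shows "mate k ((One k \<^bold>\<otimes> Cap) \<^bold>\<circ> (g \<^bold>\<otimes> One 1)) \<simeq> (One 1 \<^bold>\<otimes> g) \<^bold>\<circ> (Cup \<^bold>\<otimes> One k)"
proof -
  let ?Z = "One (1 + k) \<^bold>\<otimes> Cap \<^bold>\<otimes> One 1"
  let ?C = "One (1 + k + 1) \<^bold>\<otimes> Cup"
  let ?G = "(One 1 \<^bold>\<otimes> g) \<^bold>\<otimes> One 2"
  have 1: "One 1 \<^bold>\<otimes> ((One k \<^bold>\<otimes> Cap) \<^bold>\<circ> (g \<^bold>\<otimes> One 1)) \<^bold>\<otimes> One 1 \<simeq> ?Z \<^bold>\<circ> ?G"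
  proof -
    have "One 1 \<^bold>\<otimes> ((One k \<^bold>\<otimes> Cap) \<^bold>\<circ> (g \<^bold>\<otimes> One 1)) \<^bold>\<otimes> One 1
        \<simeq> One 1 \<^bold>\<otimes> (((One k \<^bold>\<otimes> Cap) \<^bold>\<otimes> One 1) \<^bold>\<circ> ((g \<^bold>\<otimes> One 1) \<^bold>\<otimes> One 1))"
      using g by (intro abeq_tns abeq_refl abeq_cmp_tns_one) simp_all
    also have "\<dots> \<simeq> One 1 \<^bold>\<otimes> ((One k \<^bold>\<otimes> Cap \<^bold>\<otimes> One 1) \<^bold>\<circ> (g \<^bold>\<otimes> One (1 + 1)))"
      using g by (intro abeq_tns[OF abeq_refl] abeq_cmp abeq_tns_assoc
          abeq_trans[OF abeq_tns_assoc abeq_tns[OF abeq_refl abeq_tns_one]]) simp_all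
    also have "\<dots> \<simeq> (One 1 \<^bold>\<otimes> One k \<^bold>\<otimes> Cap \<^bold>\<otimes> One 1) \<^bold>\<circ> (One 1 \<^bold>\<otimes> g \<^bold>\<otimes> One (1 + 1))"
      using g by (intro abeq_one_tns_cmp) simp
    also have "\<dots> \<simeq> ?Z \<^bold>\<circ> ((One 1 \<^bold>\<otimes> g) \<^bold>\<otimes> One (1 + 1))"
      using g by (intro abeq_cmp abeq_trans[OF abeq_sym[OF abeq_tns_assoc]
            abeq_tns[OF abeq_tns_one abeq_refl]] abeq_sym[OF abeq_tns_assoc]) simp_all
    finally show ?thesis
      by (simp add: numeral_2_eq_2)
  qed
  have 2: "Cup \<^bold>\<otimes> One k \<^bold>\<otimes> Cup \<simeq> (One (k + 2) \<^bold>\<otimes> Cup) \<^bold>\<circ> (Cup \<^bold>\<otimes> One k)"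
  proof -
    have "Cup \<^bold>\<otimes> One k \<^bold>\<otimes> Cup \<simeq> (Cup \<^bold>\<otimes> One k) \<^bold>\<otimes> Cup"
      by (intro abeq_sym[OF abeq_tns_assoc]) simp
    also have "\<dots> \<simeq> (One (k + 2) \<^bold>\<otimes> Cup) \<^bold>\<circ> ((Cup \<^bold>\<otimes> One k) \<^bold>\<otimes> One 0)"
      by (rule abeq_slide_left) simp_all
    also have "\<dots> \<simeq> (One (k + 2) \<^bold>\<otimes> Cup) \<^bold>\<circ> (Cup \<^bold>\<otimes> One k)"
      by (intro abeq_cmp abeq_refl abeq_unit_right) simp_all
    finally show ?thesis .
  qed
  have 3: "?G \<^bold>\<circ> (One (k + 2) \<^bold>\<otimes> Cup) \<simeq> ?C \<^bold>\<circ> (One 1 \<^bold>\<otimes> g)"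
  proof -
    have "?G \<^bold>\<circ> (One (k + 2) \<^bold>\<otimes> Cup) \<simeq> ?C \<^bold>\<circ> ((One 1 \<^bold>\<otimes> g) \<^bold>\<otimes> One 0)"
      using g by (intro abeq_sym[OF abeq_slice]) simp_all
    also have "\<dots> \<simeq> ?C \<^bold>\<circ> (One 1 \<^bold>\<otimes> g)"
      using g by (intro abeq_cmp abeq_refl abeq_unit_right) simp_all
    finally show ?thesis .
  qed
  have "mate k ((One k \<^bold>\<otimes> Cap) \<^bold>\<circ> (g \<^bold>\<otimes> One 1))
      \<simeq> (?Z \<^bold>\<circ> ?G) \<^bold>\<circ> ((One (k + 2) \<^bold>\<otimes> Cup) \<^bold>\<circ> (Cup \<^bold>\<otimes> One k))"
    unfolding mate_def using g by (intro abeq_cmp 1 2) simp_all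
  also have "\<dots> \<simeq> ?Z \<^bold>\<circ> (?G \<^bold>\<circ> ((One (k + 2) \<^bold>\<otimes> Cup) \<^bold>\<circ> (Cup \<^bold>\<otimes> One k)))"
    using g by (intro abeq_assoc) simp
  also have "\<dots> \<simeq> ?Z \<^bold>\<circ> ((?G \<^bold>\<circ> (One (k + 2) \<^bold>\<otimes> Cup)) \<^bold>\<circ> (Cup \<^bold>\<otimes> One k))"
    using g by (intro abeq_cmp abeq_refl abeq_sym[OF abeq_assoc]) simp_all
  also have "\<dots> \<simeq> ?Z \<^bold>\<circ> ((?C \<^bold>\<circ> (One 1 \<^bold>\<otimes> g)) \<^bold>\<circ> (Cup \<^bold>\<otimes> One k))"
    using g by (intro abeq_cmp 3 abeq_refl) simp_all
  also have "\<dots> \<simeq> ?Z \<^bold>\<circ> (?C \<^bold>\<circ> ((One 1 \<^bold>\<otimes> g) \<^bold>\<circ> (Cup \<^bold>\<otimes> One k)))"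
    using g by (intro abeq_cmp abeq_refl abeq_assoc) simp_all
  also have "\<dots> \<simeq> (?Z \<^bold>\<circ> ?C) \<^bold>\<circ> ((One 1 \<^bold>\<otimes> g) \<^bold>\<circ> (Cup \<^bold>\<otimes> One k))"
    using g by (intro abeq_sym[OF abeq_assoc]) simp
  also have "\<dots> \<simeq> One (1 + k + 1) \<^bold>\<circ> ((One 1 \<^bold>\<otimes> g) \<^bold>\<circ> (Cup \<^bold>\<otimes> One k))"
    using g by (intro abeq_cmp abeq_refl zigzag_right_tns) simp_all
  also have "\<dots> \<simeq> (One 1 \<^bold>\<otimes> g) \<^bold>\<circ> (Cup \<^bold>\<otimes> One k)"
    using g by (intro abeq_one_left) simp
  finally show ?thesis .
qed

text \<open>\<open>mate_left_cap\<close> and \<open>mate_right_cap\<close> with \<open>k = 1\<close>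
  and \<open>g = Cross\<close> evaluate the mates of the two sides of
  \<open>ab_eq.cap_slide\<close>.\<close>

lemma cup_slide: "(Cross \<^bold>\<otimes> One 1) \<^bold>\<circ> (One 1 \<^bold>\<otimes> Cup) \<simeq> (One 1 \<^bold>\<otimes> Cross) \<^bold>\<circ> (Cup \<^bold>\<otimes> One 1)"
  by (rule abeq_trans[OF abeq_sym[OF mate_left_cap] abeq_trans[OF mate_cong[OF abeqI[OF ab_eq.cap_slide]]
        mate_right_cap]]) simp_all

text \<open>The case \<open>k = 0\<close>, freed from empty tensor factors: \<open>g\<close> passes
  from one leg of the cap to the opposite leg of the cup.\<close>

lemma cap_mate:
  "brtype g = Some (1, 1) \<Longrightarrow> mate 0 (Cap \<^bold>\<circ> (One 1 \<^bold>\<otimes> g)) \<simeq> (g \<^bold>\<otimes> One 1) \<^bold>\<circ> Cup"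
  "brtype g = Some (1, 1) \<Longrightarrow> mate 0 (Cap \<^bold>\<circ> (g \<^bold>\<otimes> One 1)) \<simeq> (One 1 \<^bold>\<otimes> g) \<^bold>\<circ> Cup"
proof -
  assume g: "brtype g = Some (1, 1)"
  have "mate 0 (Cap \<^bold>\<circ> (One 1 \<^bold>\<otimes> g)) \<simeq> mate 0 ((Cap \<^bold>\<otimes> One 0) \<^bold>\<circ> (One 1 \<^bold>\<otimes> g))"
    using g by (intro mate_cong abeq_cmp abeq_refl abeq_sym[OF abeq_unit_right]) simp_all
  also have "\<dots> \<simeq> (g \<^bold>\<otimes> One 1) \<^bold>\<circ> (One 0 \<^bold>\<otimes> Cup)"
    using g by (intro mate_left_cap) simp
  also have "\<dots> \<simeq> (g \<^bold>\<otimes> One 1) \<^bold>\<circ> Cup"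
    using g by (intro abeq_cmp abeq_refl abeq_unit_left) simp_all
  finally show "mate 0 (Cap \<^bold>\<circ> (One 1 \<^bold>\<otimes> g)) \<simeq> (g \<^bold>\<otimes> One 1) \<^bold>\<circ> Cup" .
  have "mate 0 (Cap \<^bold>\<circ> (g \<^bold>\<otimes> One 1)) \<simeq> mate 0 ((One 0 \<^bold>\<otimes> Cap) \<^bold>\<circ> (g \<^bold>\<otimes> One 1))"
    using g by (intro mate_cong abeq_cmp abeq_refl abeq_sym[OF abeq_unit_left]) simp_all
  also have "\<dots> \<simeq> (One 1 \<^bold>\<otimes> g) \<^bold>\<circ> (Cup \<^bold>\<otimes> One 0)"
    using g by (intro mate_right_cap) simp
  also have "\<dots> \<simeq> (One 1 \<^bold>\<otimes> g) \<^bold>\<circ> Cup"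
    using g by (intro abeq_cmp abeq_refl abeq_unit_right) simp_all
  finally show "mate 0 (Cap \<^bold>\<circ> (g \<^bold>\<otimes> One 1)) \<simeq> (One 1 \<^bold>\<otimes> g) \<^bold>\<circ> Cup" .
qed

lemma abeq_tns_scl_left:
  "brtype (f \<^bold>\<otimes> g) \<noteq> None \<Longrightarrow> Scl r f \<^bold>\<otimes> g \<simeq> Scl r (f \<^bold>\<otimes> g)"
  by (auto split: option.splits) (rule abeqI[OF ab_eq.tns_scl_left], simp_all add: arrow_iff)

lemma abeq_tns_scl_right:
  "brtype (f \<^bold>\<otimes> g) \<noteq> None \<Longrightarrow> f \<^bold>\<otimes> Scl r g \<simeq> Scl r (f \<^bold>\<otimes> g)"
  by (auto split: option.splits) (rule abeqI[OF ab_eq.tns_scl_right], simp_all add: arrow_iff)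

lemma abeq_cmp_scl_left:
  "brtype (g \<^bold>\<circ> f) \<noteq> None \<Longrightarrow> Scl r g \<^bold>\<circ> f \<simeq> Scl r (g \<^bold>\<circ> f)"
  by (auto simp: arrow_iff split: option.splits if_splits intro!: abeqI[OF ab_eq.cmp_scl_left])

lemma abeq_cmp_scl_right:
  "brtype (g \<^bold>\<circ> f) \<noteq> None \<Longrightarrow> g \<^bold>\<circ> Scl r f \<simeq> Scl r (g \<^bold>\<circ> f)"
  by (auto simp: arrow_iff split: option.splits if_splits intro!: abeqI[OF ab_eq.cmp_scl_right])

lemma abeq_cmp_add_left:
  "brtype (Add (g \<^bold>\<circ> f) (g' \<^bold>\<circ> f)) \<noteq> None \<Longrightarrow> Add g g' \<^bold>\<circ> f \<simeq> Add (g \<^bold>\<circ> f) (g' \<^bold>\<circ> f)"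
  by (auto simp: arrow_iff split: option.splits if_splits intro!: abeqI[OF ab_eq.cmp_add_left])

lemma abeq_cmp_add_right:
  "brtype (Add (g \<^bold>\<circ> f) (g \<^bold>\<circ> f')) \<noteq> None \<Longrightarrow> g \<^bold>\<circ> Add f f' \<simeq> Add (g \<^bold>\<circ> f) (g \<^bold>\<circ> f')"
  by (auto simp: arrow_iff split: option.splits if_splits intro!: abeqI[OF ab_eq.cmp_add_right])

lemma mate_scl: "brtype f = Some (k + 2, l) \<Longrightarrow> mate k (Scl r f) \<simeq> Scl r (mate k f)"
  unfolding mate_def
  by (rule abeq_trans[OF abeq_cmp[OF abeq_trans[OF abeq_tns[OF abeq_refl abeq_tns_scl_left]
            abeq_tns_scl_right] abeq_refl] abeq_cmp_scl_left]) simp_all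

text \<open>Mating exchanges the legs, so \<open>ab_eq.cap_dot\<close> says that the dot on the
  right leg is minus the dot on the left leg; one more factor -1 moves the sign to the other
  side.\<close>

lemma cup_dot: "(Dot \<^bold>\<otimes> One 1) \<^bold>\<circ> Cup \<simeq> Scl (- 1) ((One 1 \<^bold>\<otimes> Dot) \<^bold>\<circ> Cup)"
proof -
  have "Scl (- 1) ((Dot \<^bold>\<otimes> One 1) \<^bold>\<circ> Cup) \<simeq> Scl (- 1) (mate 0 (Cap \<^bold>\<circ> (One 1 \<^bold>\<otimes> Dot)))"
    by (intro abeq_scl abeq_sym[OF cap_mate(1)]) simp
  also have "\<dots> \<simeq> mate 0 (Scl (- 1) (Cap \<^bold>\<circ> (One 1 \<^bold>\<otimes> Dot)))"
    by (rule abeq_sym, rule mate_scl) simp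
  also have "\<dots> \<simeq> mate 0 (Cap \<^bold>\<circ> (Dot \<^bold>\<otimes> One 1))"
    by (rule mate_cong[OF abeq_sym[OF abeqI[OF ab_eq.cap_dot]]]) simp
  also have "\<dots> \<simeq> (One 1 \<^bold>\<otimes> Dot) \<^bold>\<circ> Cup"
    by (intro cap_mate(2)) simp
  finally have *: "Scl (- 1) (Scl (- 1) ((Dot \<^bold>\<otimes> One 1) \<^bold>\<circ> Cup)) \<simeq> Scl (- 1) ((One 1 \<^bold>\<otimes> Dot) \<^bold>\<circ> Cup)"
    by (rule abeq_scl)
  have t: "arrow ((Dot \<^bold>\<otimes> One 1) \<^bold>\<circ> Cup) 0 2"
    by (simp add: arrow_iff)
  have "(Dot \<^bold>\<otimes> One 1) \<^bold>\<circ> Cup \<simeq> Scl (- 1 * - 1) ((Dot \<^bold>\<otimes> One 1) \<^bold>\<circ> Cup)"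
    using abeq_sym[OF abeqI[OF ab_eq.scl_one[OF t]]] by simp
  also have "\<dots> \<simeq> Scl (- 1) (Scl (- 1) ((Dot \<^bold>\<otimes> One 1) \<^bold>\<circ> Cup))"
    by (rule abeq_sym[OF abeqI[OF ab_eq.scl_scl[OF t]]])
  finally show ?thesis
    using * by (rule abeq_trans)
qed

lemma conj_cross_sub:
  assumes "brtype f = Some (2, 2)" "brtype g = Some (2, 2)"
  shows "(Cross \<^bold>\<circ> (f \<^bold>- g)) \<^bold>\<circ> Cross \<simeq> ((Cross \<^bold>\<circ> f) \<^bold>\<circ> Cross) \<^bold>- ((Cross \<^bold>\<circ> g) \<^bold>\<circ> Cross)"
proof -
  have "(Cross \<^bold>\<circ> (f \<^bold>- g)) \<^bold>\<circ> Cross \<simeq> ((Cross \<^bold>\<circ> f) \<^bold>- (Cross \<^bold>\<circ> g)) \<^bold>\<circ> Cross"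
    using assms by (intro abeq_cmp abeq_refl abeq_trans[OF abeq_cmp_add_right]
        abeq_add abeq_cmp_scl_right) simp_all
  also have "\<dots> \<simeq> ((Cross \<^bold>\<circ> f) \<^bold>\<circ> Cross) \<^bold>- ((Cross \<^bold>\<circ> g) \<^bold>\<circ> Cross)"
    using assms by (intro abeq_trans[OF abeq_cmp_add_left] abeq_add abeq_refl abeq_cmp_scl_left) simp_all
  finally show ?thesis .
qed

text \<open>Conjugating the affine relation by the crossing turns it upside down.\<close>

lemma cross_dot:
  "(Cross \<^bold>\<circ> (Dot \<^bold>\<otimes> One 1)) \<^bold>- ((One 1 \<^bold>\<otimes> Dot) \<^bold>\<circ> Cross) \<simeq> (Cup \<^bold>\<circ> Cap) \<^bold>- One 2"
proof -
  let ?x = "Dot \<^bold>\<otimes> One 1" and ?y = "One 1 \<^bold>\<otimes> Dot"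
  let ?conj = "\<lambda>f. (Cross \<^bold>\<circ> f) \<^bold>\<circ> Cross"
  have ss: "Cross \<^bold>\<circ> Cross \<simeq> One 2"
    by (rule abeqI[OF ab_eq.cross_cross])
  have a: "Cross \<^bold>\<circ> ?x \<simeq> ?conj (?x \<^bold>\<circ> Cross)"
  proof -
    have "Cross \<^bold>\<circ> ?x \<simeq> (Cross \<^bold>\<circ> ?x) \<^bold>\<circ> (Cross \<^bold>\<circ> Cross)"
      by (rule abeq_trans[OF abeq_sym[OF abeq_one_right] abeq_cmp[OF abeq_refl abeq_sym[OF ss]]]) simp_all
    also have "\<dots> \<simeq> ((Cross \<^bold>\<circ> ?x) \<^bold>\<circ> Cross) \<^bold>\<circ> Cross"
      by (rule abeq_sym[OF abeq_assoc]) simp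
    also have "\<dots> \<simeq> ?conj (?x \<^bold>\<circ> Cross)"
      by (intro abeq_cmp abeq_assoc abeq_refl) simp_all
    finally show ?thesis .
  qed
  have b: "?y \<^bold>\<circ> Cross \<simeq> ?conj (Cross \<^bold>\<circ> ?y)"
  proof -
    have "?y \<^bold>\<circ> Cross \<simeq> (Cross \<^bold>\<circ> Cross) \<^bold>\<circ> (?y \<^bold>\<circ> Cross)"
      by (rule abeq_trans[OF abeq_sym[OF abeq_one_left] abeq_cmp[OF abeq_sym[OF ss] abeq_refl]]) simp_all
    also have "\<dots> \<simeq> ((Cross \<^bold>\<circ> Cross) \<^bold>\<circ> ?y) \<^bold>\<circ> Cross"
      by (rule abeq_sym[OF abeq_assoc]) simp
    also have "\<dots> \<simeq> ?conj (Cross \<^bold>\<circ> ?y)"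
      by (intro abeq_cmp abeq_assoc abeq_refl) simp_all
    finally show ?thesis .
  qed
  have c: "?conj (Cup \<^bold>\<circ> Cap) \<simeq> Cup \<^bold>\<circ> Cap"
  proof -
    have "?conj (Cup \<^bold>\<circ> Cap) \<simeq> ((Cross \<^bold>\<circ> Cup) \<^bold>\<circ> Cap) \<^bold>\<circ> Cross"
      by (intro abeq_cmp abeq_refl abeq_sym[OF abeq_assoc]) simp_all
    also have "\<dots> \<simeq> (Cross \<^bold>\<circ> Cup) \<^bold>\<circ> (Cap \<^bold>\<circ> Cross)"
      by (intro abeq_assoc) simp_all
    also have "\<dots> \<simeq> Cup \<^bold>\<circ> Cap"
      by (intro abeq_cmp abeqI[OF ab_eq.cross_cup] abeqI[OF ab_eq.cap_cross]) simp_all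
    finally show ?thesis .
  qed
  have d: "?conj (One 2) \<simeq> One 2"
    by (rule abeq_trans[OF abeq_cmp[OF abeq_one_right abeq_refl] ss]) simp_all
  have "(Cross \<^bold>\<circ> ?x) \<^bold>- (?y \<^bold>\<circ> Cross) \<simeq> ?conj (?x \<^bold>\<circ> Cross) \<^bold>- ?conj (Cross \<^bold>\<circ> ?y)"
    by (intro abeq_add abeq_scl a b) simp_all
  also have "\<dots> \<simeq> ?conj ((?x \<^bold>\<circ> Cross) \<^bold>- (Cross \<^bold>\<circ> ?y))"
    by (rule abeq_sym[OF conj_cross_sub]) simp_all
  also have "\<dots> \<simeq> ?conj ((Cup \<^bold>\<circ> Cap) \<^bold>- One 2)"
    by (intro abeq_cmp abeq_refl abeqI[OF ab_eq.dot_cross]) simp_all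
  also have "\<dots> \<simeq> ?conj (Cup \<^bold>\<circ> Cap) \<^bold>- ?conj (One 2)"
    by (rule conj_cross_sub) simp_all
  also have "\<dots> \<simeq> (Cup \<^bold>\<circ> Cap) \<^bold>- One 2"
    by (intro abeq_add abeq_scl c d) simp_all
  finally show ?thesis .
qed

text \<open>Most relations are self-dual up to bracketing or come in dual pairs, such as the
  zigzags. The exceptions \<open>cap_slide\<close>, \<open>dot_cross\<close> and
  \<open>cap_dot\<close> are answered by the derived relations \<open>cup_slide\<close>,
  \<open>cross_dot\<close> and \<open>cup_dot\<close>.\<close>

lemma ab_eq_flip: "ab_eq a b f g \<Longrightarrow> ab_eq b a (flip f) (flip g)"
proof (induction rule: ab_eq.induct)
  case (trans a b f g h)
  then show ?case by (blast intro: ab_eq.trans)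
next
  case (sym a b f g)
  then show ?case by (blast intro: ab_eq.sym)
next
  case (cmp_assoc f a b g c h d)
  then show ?case
    by (auto intro!: ab_eq.sym[OF ab_eq.cmp_assoc] arrow_flip)
next
  case braid
  have "((Cross \<^bold>\<otimes> One 1) \<^bold>\<circ> (One 1 \<^bold>\<otimes> Cross)) \<^bold>\<circ> (Cross \<^bold>\<otimes> One 1)
      \<simeq> ((One 1 \<^bold>\<otimes> Cross) \<^bold>\<circ> (Cross \<^bold>\<otimes> One 1)) \<^bold>\<circ> (One 1 \<^bold>\<otimes> Cross)"
    by (rule abeq_trans[OF abeq_assoc abeq_trans[OF abeqI[OF ab_eq.braid] abeq_sym[OF abeq_assoc]]])
      simp_all
  then show ?case
    unfolding flip.simps by (rule abeqD) simp
next
  case cap_slide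
  show ?case
    unfolding flip.simps by (rule abeqD[OF abeq_sym[OF cup_slide]]) simp
next
  case dot_cross
  show ?case
    unfolding flip.simps by (rule abeqD[OF cross_dot]) simp
next
  case cap_dot
  show ?case
    unfolding flip.simps by (rule abeqD[OF cup_dot]) simp
next
  case zigzag_left
  show ?case
    unfolding flip.simps by (rule ab_eq.zigzag_right)
next
  case zigzag_right
  show ?case
    unfolding flip.simps by (rule ab_eq.zigzag_left)
qed (auto intro: ab_eq.intros arrow_flip)

section \<open>Quotients of linear categories\<close>

text \<open>Additive inverses come from scaling by -1, since
  \<open>(-1 + 1) x = 0 x = 0\<close>.\<close>

lemma vectorspace_class_ringI:
  fixes V :: "('k::field, 'm) module"
  assumes "\<And>x y. x \<in> carrier V \<Longrightarrow> y \<in> carrier V \<Longrightarrow> x \<oplus>\<^bsub>V\<^esub> y \<in> carrier V"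
    and "\<zero>\<^bsub>V\<^esub> \<in> carrier V"
    and "\<And>r x. x \<in> carrier V \<Longrightarrow> r \<odot>\<^bsub>V\<^esub> x \<in> carrier V"
    and "\<And>x y z. x \<in> carrier V \<Longrightarrow> y \<in> carrier V \<Longrightarrow> z \<in> carrier V
      \<Longrightarrow> (x \<oplus>\<^bsub>V\<^esub> y) \<oplus>\<^bsub>V\<^esub> z = x \<oplus>\<^bsub>V\<^esub> (y \<oplus>\<^bsub>V\<^esub> z)"
    and "\<And>x y. x \<in> carrier V \<Longrightarrow> y \<in> carrier V \<Longrightarrow> x \<oplus>\<^bsub>V\<^esub> y = y \<oplus>\<^bsub>V\<^esub> x"
    and "\<And>x. x \<in> carrier V \<Longrightarrow> \<zero>\<^bsub>V\<^esub> \<oplus>\<^bsub>V\<^esub> x = x"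
    and "\<And>x. x \<in> carrier V \<Longrightarrow> 0 \<odot>\<^bsub>V\<^esub> x = \<zero>\<^bsub>V\<^esub>"
    and "\<And>r s x. x \<in> carrier V \<Longrightarrow> (r + s) \<odot>\<^bsub>V\<^esub> x = r \<odot>\<^bsub>V\<^esub> x \<oplus>\<^bsub>V\<^esub> s \<odot>\<^bsub>V\<^esub> x"
    and "\<And>r x y. x \<in> carrier V \<Longrightarrow> y \<in> carrier V
      \<Longrightarrow> r \<odot>\<^bsub>V\<^esub> (x \<oplus>\<^bsub>V\<^esub> y) = r \<odot>\<^bsub>V\<^esub> x \<oplus>\<^bsub>V\<^esub> r \<odot>\<^bsub>V\<^esub> y"
    and "\<And>r s x. x \<in> carrier V \<Longrightarrow> (r * s) \<odot>\<^bsub>V\<^esub> x = r \<odot>\<^bsub>V\<^esub> (s \<odot>\<^bsub>V\<^esub> x)"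
    and "\<And>x. x \<in> carrier V \<Longrightarrow> 1 \<odot>\<^bsub>V\<^esub> x = x"
  shows "vectorspace class_ring V"
proof -
  have inv: "(- 1) \<odot>\<^bsub>V\<^esub> x \<oplus>\<^bsub>V\<^esub> x = \<zero>\<^bsub>V\<^esub>" if "x \<in> carrier V" for x
    using assms(8)[of x "- 1" 1] assms(7,11) that by simp
  have "abelian_group V"
    using assms(1-6) inv assms(3) by (intro abelian_groupI) (auto intro!: bexI[of _ "(- 1) \<odot>\<^bsub>V\<^esub> _"])
  moreover have "cring (class_ring :: 'k ring)" "field (class_ring :: 'k ring)"
    using class_cring.cring_axioms class_field by auto
  ultimately show ?thesis
    unfolding vectorspace_def using assms by (auto intro!: moduleI)
qed

text \<open>Operations on classes are unions over all representatives, so well-definedness always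
  means that a union over a nonempty set has constant terms.\<close>

lemma UN_eq_const: "A \<noteq> {} \<Longrightarrow> (\<And>x. x \<in> A \<Longrightarrow> F x = B) \<Longrightarrow> (\<Union>x\<in>A. F x) = B"
  by auto

text \<open>The scalars form the record \<open>class_ring\<close>; the module laws are restated with
  the operations of the field type itself.\<close>

locale class_vectorspace = vectorspace class_ring V
  for V :: "('k::field, 'm) module" (structure)
begin

lemma scale_closed: "x \<in> carrier V \<Longrightarrow> r \<odot> x \<in> carrier V"
  using smult_closed by simp

lemma scale_add_left: "x \<in> carrier V \<Longrightarrow> (r + s) \<odot> x = r \<odot> x \<oplus> s \<odot> x"
  using smult_l_distr by simp

lemma scale_add_right:
  "x \<in> carrier V \<Longrightarrow> y \<in> carrier V \<Longrightarrow> r \<odot> (x \<oplus> y) = r \<odot> x \<oplus> r \<odot> y"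
  using smult_r_distr by simp

lemma scale_scale: "x \<in> carrier V \<Longrightarrow> r \<odot> (s \<odot> x) = (r * s) \<odot> x"
  using smult_assoc1 by simp

lemma scale_one: "x \<in> carrier V \<Longrightarrow> 1 \<odot> x = x"
  using smult_one by simp

lemma scale_zero: "x \<in> carrier V \<Longrightarrow> 0 \<odot> x = \<zero>"
  using smult_l_null by simp

lemma scale_zero_right: "r \<odot> \<zero> = \<zero>"
  using smult_r_null by simp

lemma scale_minus_one: "x \<in> carrier V \<Longrightarrow> (- 1) \<odot> x = \<ominus> x"
  using scale_add_left[of x "- 1" 1] minus_equality scale_closed scale_one scale_zero by simp

lemma minus_eq_scale: "y \<in> carrier V \<Longrightarrow> x \<ominus> y = x \<oplus> (- 1) \<odot> y"
  by (simp add: a_minus_def scale_minus_one)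

end

locale subspace_coset =
  fixes V :: "('k::field, 'm) module" and W :: "'m set"
  assumes subspace: "subspace class_ring W V"
begin

sublocale class_vectorspace V
  using subspace by (simp add: subspace_def class_vectorspace_def)

sublocale sub: submodule class_ring W V
  using subspace by (simp add: subspace_def)

lemma W_carrier: "x \<in> W \<Longrightarrow> x \<in> carrier V"
  using sub.subset by auto

sublocale abelian_subgroup W V
proof (rule abelian_subgroupI3)
  show "additive_subgroup W V"
  proof (intro additive_subgroup.intro group.subgroupI[OF add.is_group])
    fix x
    assume "x \<in> W"
    then have "\<ominus>\<^bsub>V\<^esub> x \<in> W"
      using sub.smult_closed[of "- 1" x] scale_minus_one[of x] W_carrier by simp
    then show "inv\<^bsub>add_monoid V\<^esub> x \<in> W"
      by (simp add: a_inv_def)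
  qed (use sub.subset sub.zero_closed in \<open>auto simp del: sub.zero_closed\<close>)
qed (rule abelian_group_axioms)

lemma coset_eq_iff:
  assumes "x \<in> carrier V" "y \<in> carrier V"
  shows "W +>\<^bsub>V\<^esub> x = W +>\<^bsub>V\<^esub> y \<longleftrightarrow> x \<ominus>\<^bsub>V\<^esub> y \<in> W"
proof
  assume "W +>\<^bsub>V\<^esub> x = W +>\<^bsub>V\<^esub> y"
  then show "x \<ominus>\<^bsub>V\<^esub> y \<in> W"
    using a_rcos_self[OF assms(1)] a_rcos_module_imp[OF assms(2)] by (simp add: a_minus_def)
next
  assume "x \<ominus>\<^bsub>V\<^esub> y \<in> W"
  then have "x \<in> W +>\<^bsub>V\<^esub> y"
    using a_rcos_module_rev[OF assms(2,1)] by (simp add: a_minus_def)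
  then show "W +>\<^bsub>V\<^esub> x = W +>\<^bsub>V\<^esub> y"
    using a_repr_independence'[of x y] assms(2) by simp
qed

lemma coset_add:
  "x \<in> carrier V \<Longrightarrow> y \<in> carrier V
    \<Longrightarrow> (W +>\<^bsub>V\<^esub> x) \<oplus>\<^bsub>quotient_space V W\<^esub> (W +>\<^bsub>V\<^esub> y) = W +>\<^bsub>V\<^esub> (x \<oplus>\<^bsub>V\<^esub> y)"
  by (simp add: quotient_space_def a_rcos_sum)

lemma coset_smult:
  assumes x: "x \<in> carrier V"
  shows "r \<odot>\<^bsub>quotient_space V W\<^esub> (W +>\<^bsub>V\<^esub> x) = W +>\<^bsub>V\<^esub> (r \<odot>\<^bsub>V\<^esub> x)"
proof -
  have *: "W +>\<^bsub>V\<^esub> (r \<odot>\<^bsub>V\<^esub> y) = W +>\<^bsub>V\<^esub> (r \<odot>\<^bsub>V\<^esub> x)" if y: "y \<in> W +>\<^bsub>V\<^esub> x" for y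
  proof -
    obtain w where w: "w \<in> W" "y = w \<oplus>\<^bsub>V\<^esub> x"
      using y by (auto simp: a_r_coset_def')
    have "r \<odot>\<^bsub>V\<^esub> y = r \<odot>\<^bsub>V\<^esub> w \<oplus>\<^bsub>V\<^esub> r \<odot>\<^bsub>V\<^esub> x"
      unfolding w(2) by (rule scale_add_right[OF W_carrier[OF w(1)] x])
    moreover have "r \<odot>\<^bsub>V\<^esub> w \<in> W"
      using w(1) by (simp add: sub.smult_closed)
    ultimately have "r \<odot>\<^bsub>V\<^esub> y \<in> W +>\<^bsub>V\<^esub> (r \<odot>\<^bsub>V\<^esub> x)"
      using a_rcosI[OF _ a_subset scale_closed[OF x]] by simp
    then show ?thesis
      by (rule a_repr_independence'[symmetric]) (rule scale_closed[OF x])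
  qed
  have "(\<Union>y\<in>W +>\<^bsub>V\<^esub> x. W +>\<^bsub>V\<^esub> (r \<odot>\<^bsub>V\<^esub> y)) = W +>\<^bsub>V\<^esub> (r \<odot>\<^bsub>V\<^esub> x)"
    by (rule UN_eq_const[OF _ *]) (use a_rcos_self[OF x] in blast)
  then show ?thesis
    by (simp add: quotient_space_def)
qed

lemma quotient_carrier: "carrier (quotient_space V W) = (\<lambda>x. W +>\<^bsub>V\<^esub> x) ` carrier V"
  by (auto simp: quotient_space_def A_RCOSETS_def')

lemma coset_zero: "\<zero>\<^bsub>quotient_space V W\<^esub> = W +>\<^bsub>V\<^esub> \<zero>\<^bsub>V\<^esub>"
  using sub.subset by (simp add: quotient_space_def)

lemma quotient_vectorspace: "vectorspace class_ring (quotient_space V W)"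
proof (rule vectorspace_class_ringI)
  fix x y
  assume "x \<in> carrier (quotient_space V W)" "y \<in> carrier (quotient_space V W)"
  then show "x \<oplus>\<^bsub>quotient_space V W\<^esub> y = y \<oplus>\<^bsub>quotient_space V W\<^esub> x"
    by (auto simp: quotient_carrier coset_add) (simp_all add: add.m_comm)
qed (auto simp: quotient_carrier coset_add coset_smult coset_zero a_assoc scale_closed
    scale_add_left scale_add_right scale_scale scale_one scale_zero)

end

text \<open>What remains of a right tensor ideal when the tensor product is forgotten, as in
  \<open>quotient_category\<close>.\<close>

definition two_sided_ideal ::
  "('j, 'm, 'k::field, 'z) lincat_scheme \<Rightarrow> ('j \<Rightarrow> 'j \<Rightarrow> 'm set) \<Rightarrow> bool" where
  "two_sided_ideal C N \<longleftrightarrow>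
     (\<forall>a\<in>objs C. \<forall>b\<in>objs C. subspace class_ring (N a b) (hom_sp C a b)) \<and>
     (\<forall>a\<in>objs C. \<forall>b\<in>objs C. \<forall>c\<in>objs C. \<forall>d\<in>objs C.
        \<forall>f\<in>mor C a b. \<forall>g\<in>N b c. \<forall>h\<in>mor C c d.
          cmp C a c d h (cmp C a b c g f) \<in> N a d)"

locale quotient_by_ideal = linear_category C
  for C :: "('j, 'm, 'k::field, 'z) lincat_scheme" +
  fixes N :: "'j \<Rightarrow> 'j \<Rightarrow> 'm set"
  assumes ideal: "two_sided_ideal C N"
begin

abbreviation Q where "Q \<equiv> quotient_category C N"

abbreviation cls :: "'j \<Rightarrow> 'j \<Rightarrow> 'm \<Rightarrow> 'm set" where
  "cls a b f \<equiv> N a b +>\<^bsub>hom_sp C a b\<^esub> f"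

lemma hom_coset: "a \<in> objs C \<Longrightarrow> b \<in> objs C \<Longrightarrow> subspace_coset (hom_sp C a b) (N a b)"
  using ideal by (simp add: two_sided_ideal_def subspace_coset_def)

lemma idealD:
  assumes "a \<in> objs C" "b \<in> objs C" "c \<in> objs C" "d \<in> objs C"
    and "f \<in> mor C a b" "g \<in> N b c" "h \<in> mor C c d"
  shows "cmp C a c d h (cmp C a b c g f) \<in> N a d"
  using ideal assms by (simp add: two_sided_ideal_def)

lemma ideal_left:
  assumes o: "a \<in> objs C" "b \<in> objs C" "c \<in> objs C" and "g \<in> N a b" "h \<in> mor C b c"
  shows "cmp C a b c h g \<in> N a c"
proof -
  have "g \<in> mor C a b"
    by (rule subspace_coset.W_carrier[OF hom_coset[OF o(1,2)] assms(4)])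
  then have "cmp C a a b g (idm C a) = g"
    by (rule id_right[OF o(1,2)])
  moreover have "cmp C a b c h (cmp C a a b g (idm C a)) \<in> N a c"
    by (rule idealD[OF o(1,1,2,3) id_closed[OF o(1)] assms(4,5)])
  ultimately show ?thesis by simp
qed

lemma ideal_right:
  assumes o: "a \<in> objs C" "b \<in> objs C" "c \<in> objs C" and "f \<in> mor C a b" "g \<in> N b c"
  shows "cmp C a b c g f \<in> N a c"
proof -
  have "g \<in> mor C b c"
    by (rule subspace_coset.W_carrier[OF hom_coset[OF o(2,3)] assms(5)])
  then have "cmp C a c c (idm C c) (cmp C a b c g f) = cmp C a b c g f"
    using assms by (intro id_left comp_closed)
  moreover have "cmp C a c c (idm C c) (cmp C a b c g f) \<in> N a c"
    by (rule idealD[OF o(1,2,3,3) assms(4,5) id_closed[OF o(3)]])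
  ultimately show ?thesis by simp
qed

lemma mor_quotient: "a \<in> objs C \<Longrightarrow> b \<in> objs C \<Longrightarrow> mor Q a b = cls a b ` mor C a b"
  using subspace_coset.quotient_carrier[OF hom_coset] by (simp add: quotient_category_def)

lemma cls_add:
  "a \<in> objs C \<Longrightarrow> b \<in> objs C \<Longrightarrow> f \<in> mor C a b \<Longrightarrow> g \<in> mor C a b
    \<Longrightarrow> cls a b f \<oplus>\<^bsub>hom_sp Q a b\<^esub> cls a b g = cls a b (f \<oplus>\<^bsub>hom_sp C a b\<^esub> g)"
  using subspace_coset.coset_add[OF hom_coset] by (simp add: quotient_category_def)

lemma cls_smult:
  "a \<in> objs C \<Longrightarrow> b \<in> objs C \<Longrightarrow> f \<in> mor C a b
    \<Longrightarrow> r \<odot>\<^bsub>hom_sp Q a b\<^esub> cls a b f = cls a b (r \<odot>\<^bsub>hom_sp C a b\<^esub> f)"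
  using subspace_coset.coset_smult[OF hom_coset] by (simp add: quotient_category_def)

lemma cls_zero:
  "a \<in> objs C \<Longrightarrow> b \<in> objs C \<Longrightarrow> \<zero>\<^bsub>hom_sp Q a b\<^esub> = cls a b \<zero>\<^bsub>hom_sp C a b\<^esub>"
  using subspace_coset.coset_zero[OF hom_coset] by (simp add: quotient_category_def)

lemma cls_id: "idm Q a = cls a a (idm C a)"
  by (simp add: quotient_category_def)

lemma cls_eq_iff:
  "a \<in> objs C \<Longrightarrow> b \<in> objs C \<Longrightarrow> f \<in> mor C a b \<Longrightarrow> g \<in> mor C a b
    \<Longrightarrow> cls a b f = cls a b g \<longleftrightarrow> f \<ominus>\<^bsub>hom_sp C a b\<^esub> g \<in> N a b"
  by (rule subspace_coset.coset_eq_iff[OF hom_coset])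

text \<open>For representatives \<open>f' = w + f\<close> and \<open>g' = v + g\<close> one has
  \<open>g' f' = v f' + g w + g f\<close>, and the first two terms lie in the ideal.\<close>

lemma cls_cmp:
  assumes o: "a \<in> objs C" "b \<in> objs C" "c \<in> objs C" and f: "f \<in> mor C a b" and g: "g \<in> mor C b c"
  shows "cmp Q a b c (cls b c g) (cls a b f) = cls a c (cmp C a b c g f)"
proof -
  interpret ab: subspace_coset "hom_sp C a b" "N a b" by (intro hom_coset o)
  interpret bc: subspace_coset "hom_sp C b c" "N b c" by (intro hom_coset o)
  interpret ac: subspace_coset "hom_sp C a c" "N a c" by (intro hom_coset o)
  have *: "cls a c (cmp C a b c g' f') = cls a c (cmp C a b c g f)"
    if f': "f' \<in> cls a b f" and g': "g' \<in> cls b c g" for f' g'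
  proof -
    obtain w where w: "w \<in> N a b" "f' = w \<oplus>\<^bsub>hom_sp C a b\<^esub> f"
      using f' by (auto simp: a_r_coset_def')
    obtain v where v: "v \<in> N b c" "g' = v \<oplus>\<^bsub>hom_sp C b c\<^esub> g"
      using g' by (auto simp: a_r_coset_def')
    have wm: "w \<in> mor C a b" and vm: "v \<in> mor C b c"
      using w v ab.W_carrier bc.W_carrier by auto
    have f'm: "f' \<in> mor C a b"
      using w wm f by simp
    have "cmp C a b c g' f' = cmp C a b c v f' \<oplus>\<^bsub>hom_sp C a c\<^esub> cmp C a b c g f'"
      unfolding v(2) by (rule comp_add_left[OF o f'm vm g])
    moreover have "cmp C a b c g f' = cmp C a b c g w \<oplus>\<^bsub>hom_sp C a c\<^esub> cmp C a b c g f"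
      unfolding w(2) by (rule comp_add_right[OF o wm f g])
    moreover have "cmp C a b c v f' \<oplus>\<^bsub>hom_sp C a c\<^esub> (cmp C a b c g w \<oplus>\<^bsub>hom_sp C a c\<^esub> cmp C a b c g f)
        = (cmp C a b c v f' \<oplus>\<^bsub>hom_sp C a c\<^esub> cmp C a b c g w) \<oplus>\<^bsub>hom_sp C a c\<^esub> cmp C a b c g f"
      by (rule ac.a_assoc[symmetric]) (intro comp_closed o f g wm vm f'm)+
    ultimately have "cmp C a b c g' f' \<in> cls a c (cmp C a b c g f)"
      using ac.a_rcosI[OF ac.a_closed[OF ideal_right[OF o f'm v(1)] ideal_left[OF o w(1) g]]
          ac.a_subset comp_closed[OF o f g]] by simp
    then show ?thesis
      by (rule ac.a_repr_independence'[symmetric]) (intro comp_closed o f g)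
  qed
  have "(\<Union>g'\<in>cls b c g. \<Union>f'\<in>cls a b f. cls a c (cmp C a b c g' f')) = cls a c (cmp C a b c g f)"
    by (intro UN_eq_const *) (use ab.a_rcos_self[OF f] bc.a_rcos_self[OF g] in blast)+
  then show ?thesis
    by (simp add: quotient_category_def)
qed

lemma quotient_linear_category: "linear_category Q"
proof (intro linear_category.intro)
  show "vectorspace class_ring (hom_sp Q a b)" if "a \<in> objs Q" "b \<in> objs Q" for a b
    using subspace_coset.quotient_vectorspace[OF hom_coset] that by (simp add: quotient_category_def)
  have vs: "class_vectorspace (hom_sp C a b)" if "a \<in> objs C" "b \<in> objs C" for a b
    using that by (simp add: class_vectorspace_def hom_vectorspace)
  have hv: "f \<oplus>\<^bsub>hom_sp C a b\<^esub> g \<in> mor C a b"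
    if "a \<in> objs C" "b \<in> objs C" "f \<in> mor C a b" "g \<in> mor C a b" for a b f g
  proof -
    interpret class_vectorspace "hom_sp C a b" by (rule vs) fact+
    show ?thesis using that by simp
  qed
  have hs: "r \<odot>\<^bsub>hom_sp C a b\<^esub> f \<in> mor C a b"
    if "a \<in> objs C" "b \<in> objs C" "f \<in> mor C a b" for a b f r
    using class_vectorspace.scale_closed[OF vs] that by simp
  have [simp]: "objs Q = objs C"
    by (simp add: quotient_category_def)
  note [simp] = mor_quotient cls_add cls_smult cls_zero cls_id cls_cmp comp_closed id_closed hv hs
    id_left id_right comp_add_left comp_add_right comp_smult_left comp_smult_right
  show "idm Q a \<in> mor Q a a" if "a \<in> objs Q" for a
    using that by simp
  show "cmp Q a b c g f \<in> mor Q a c"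
    if "a \<in> objs Q" "b \<in> objs Q" "c \<in> objs Q" "f \<in> mor Q a b" "g \<in> mor Q b c" for a b c f g
    using that by auto
  show "cmp Q a b b (idm Q b) f = f" if "a \<in> objs Q" "b \<in> objs Q" "f \<in> mor Q a b" for a b f
    using that by auto
  show "cmp Q a a b f (idm Q a) = f" if "a \<in> objs Q" "b \<in> objs Q" "f \<in> mor Q a b" for a b f
    using that by auto
  show "cmp Q a c d h (cmp Q a b c g f) = cmp Q a b d (cmp Q b c d h g) f"
    if "a \<in> objs Q" "b \<in> objs Q" "c \<in> objs Q" "d \<in> objs Q"
      "f \<in> mor Q a b" "g \<in> mor Q b c" "h \<in> mor Q c d" for a b c d f g h
    using that by (auto simp: comp_assoc)
  show "cmp Q a b c (g \<oplus>\<^bsub>hom_sp Q b c\<^esub> g') f = cmp Q a b c g f \<oplus>\<^bsub>hom_sp Q a c\<^esub> cmp Q a b c g' f"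
    if "a \<in> objs Q" "b \<in> objs Q" "c \<in> objs Q" "f \<in> mor Q a b" "g \<in> mor Q b c" "g' \<in> mor Q b c"
    for a b c f g g'
    using that by auto
  show "cmp Q a b c g (f \<oplus>\<^bsub>hom_sp Q a b\<^esub> f') = cmp Q a b c g f \<oplus>\<^bsub>hom_sp Q a c\<^esub> cmp Q a b c g f'"
    if "a \<in> objs Q" "b \<in> objs Q" "c \<in> objs Q" "f \<in> mor Q a b" "f' \<in> mor Q a b" "g \<in> mor Q b c"
    for a b c f f' g
    using that by auto
  show "cmp Q a b c (r \<odot>\<^bsub>hom_sp Q b c\<^esub> g) f = r \<odot>\<^bsub>hom_sp Q a c\<^esub> cmp Q a b c g f"
    if "a \<in> objs Q" "b \<in> objs Q" "c \<in> objs Q" "f \<in> mor Q a b" "g \<in> mor Q b c" for a b c f g r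
    using that by auto
  show "cmp Q a b c g (r \<odot>\<^bsub>hom_sp Q a b\<^esub> f) = r \<odot>\<^bsub>hom_sp Q a c\<^esub> cmp Q a b c g f"
    if "a \<in> objs Q" "b \<in> objs Q" "c \<in> objs Q" "f \<in> mor Q a b" "g \<in> mor Q b c" for a b c f g r
    using that by auto
qed

end

section \<open>The cyclotomic Brauer category as a linear category\<close>

lemma ab_class_eq_iff: "arrow f a b \<Longrightarrow> ab_class a b f = ab_class a b g \<longleftrightarrow> ab_eq a b f g"
  unfolding ab_class_def using ab_eq.refl ab_eq.sym ab_eq.trans by blast

lemma ab_class_cong: "ab_eq a b f g \<Longrightarrow> ab_class a b f = ab_class a b g"
  unfolding ab_class_def using ab_eq.sym ab_eq.trans by blast

lemma objs_AB [simp]: "objs AB = UNIV"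
  by (simp add: AB_def)

lemma tens_obj_AB [simp]: "tens_obj AB = (+)"
  by (simp add: AB_def)

lemma mor_AB: "mor AB a b = ab_class a b ` {f. arrow f a b}"
  by (auto simp: AB_def quotient_def ab_class_def)

lemma ab_eq_arrow: "ab_eq a b f g \<Longrightarrow> arrow f a b" "ab_eq a b f g \<Longrightarrow> arrow g a b"
  by (simp_all add: arrow_iff ab_eq_brtype)

lemma zero_AB: "\<zero>\<^bsub>hom_sp AB a b\<^esub> = ab_class a b (Zer a b)"
  by (simp add: AB_def)

lemma idm_AB: "idm AB a = ab_class a a (One a)"
  by (simp add: AB_def)

lemma add_AB:
  assumes "arrow f a b" "arrow g a b"
  shows "ab_class a b f \<oplus>\<^bsub>hom_sp AB a b\<^esub> ab_class a b g = ab_class a b (Add f g)"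
proof -
  have "(\<Union>f'\<in>ab_class a b f. \<Union>g'\<in>ab_class a b g. ab_class a b (Add f' g')) = ab_class a b (Add f g)"
  proof (intro UN_eq_const)
    fix f' g'
    assume "f' \<in> ab_class a b f" "g' \<in> ab_class a b g"
    then show "ab_class a b (Add f' g') = ab_class a b (Add f g)"
      by (intro ab_class_cong ab_eq.add_cong) (simp_all add: ab_class_def ab_eq.sym)
  qed (use assms in \<open>auto simp: ab_class_def intro: ab_eq.refl\<close>)
  then show ?thesis
    by (simp add: AB_def)
qed

lemma smult_AB:
  assumes "arrow f a b"
  shows "r \<odot>\<^bsub>hom_sp AB a b\<^esub> ab_class a b f = ab_class a b (Scl r f)"
proof -
  have "(\<Union>f'\<in>ab_class a b f. ab_class a b (Scl r f')) = ab_class a b (Scl r f)"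
  proof (intro UN_eq_const)
    fix f'
    assume "f' \<in> ab_class a b f"
    then show "ab_class a b (Scl r f') = ab_class a b (Scl r f)"
      by (intro ab_class_cong ab_eq.scl_cong) (simp add: ab_class_def ab_eq.sym)
  qed (use assms in \<open>auto simp: ab_class_def intro: ab_eq.refl\<close>)
  then show ?thesis
    by (simp add: AB_def)
qed

lemma cmp_AB:
  assumes "arrow f a b" "arrow g b c"
  shows "cmp AB a b c (ab_class b c g) (ab_class a b f) = ab_class a c (g \<^bold>\<circ> f)"
proof -
  have "(\<Union>g'\<in>ab_class b c g. \<Union>f'\<in>ab_class a b f. ab_class a c (g' \<^bold>\<circ> f')) = ab_class a c (g \<^bold>\<circ> f)"
  proof (intro UN_eq_const)
    fix f' g'
    assume "f' \<in> ab_class a b f" "g' \<in> ab_class b c g"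
    then show "ab_class a c (g' \<^bold>\<circ> f') = ab_class a c (g \<^bold>\<circ> f)"
      by (intro ab_class_cong ab_eq.cmp_cong[where b = b]) (simp_all add: ab_class_def ab_eq.sym)
  qed (use assms in \<open>auto simp: ab_class_def intro: ab_eq.refl\<close>)
  then show ?thesis
    by (simp add: AB_def)
qed

lemma tens_AB:
  assumes "arrow f a b" "arrow g c d"
  shows "tens AB a b c d (ab_class a b f) (ab_class c d g) = ab_class (a + c) (b + d) (f \<^bold>\<otimes> g)"
proof -
  have "(\<Union>f'\<in>ab_class a b f. \<Union>g'\<in>ab_class c d g. ab_class (a + c) (b + d) (f' \<^bold>\<otimes> g'))
      = ab_class (a + c) (b + d) (f \<^bold>\<otimes> g)"
  proof (intro UN_eq_const)
    fix f' g'
    assume "f' \<in> ab_class a b f" "g' \<in> ab_class c d g"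
    then show "ab_class (a + c) (b + d) (f' \<^bold>\<otimes> g') = ab_class (a + c) (b + d) (f \<^bold>\<otimes> g)"
      by (intro ab_class_cong ab_eq.tns_cong) (simp_all add: ab_class_def ab_eq.sym)
  qed (use assms in \<open>auto simp: ab_class_def intro: ab_eq.refl\<close>)
  then show ?thesis
    by (simp add: AB_def)
qed

lemma mor_ABE:
  assumes "x \<in> mor AB a b"
  obtains f where "arrow f a b" "x = ab_class a b f"
  using assms by (auto simp: mor_AB)

lemma ab_class_mor_AB [simp]: "arrow f a b \<Longrightarrow> ab_class a b f \<in> mor AB a b"
  by (simp add: mor_AB)

lemma vectorspace_AB: "vectorspace class_ring (hom_sp AB a b)"
proof (rule vectorspace_class_ringI)
  note [simp] = zero_AB add_AB smult_AB arrow.intros(6-8) ab_class_cong[OF ab_eq.scl_zero]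
    ab_class_cong[OF ab_eq.scl_one] ab_class_cong[OF ab_eq.scl_scl] ab_class_cong[OF ab_eq.scl_add_left]
    ab_class_cong[OF ab_eq.scl_add_right] ab_class_cong[OF ab_eq.add_assoc] ab_class_cong[OF ab_eq.add_zero]
  fix x y z :: "'a brterm set" and r s
  assume "x \<in> mor AB a b"
  then obtain f where f: "arrow f a b" and x: "x = ab_class a b f"
    by (rule mor_ABE)
  show "r \<odot>\<^bsub>hom_sp AB a b\<^esub> x \<in> mor AB a b" "0 \<odot>\<^bsub>hom_sp AB a b\<^esub> x = \<zero>\<^bsub>hom_sp AB a b\<^esub>"
    "1 \<odot>\<^bsub>hom_sp AB a b\<^esub> x = x"
    "(r * s) \<odot>\<^bsub>hom_sp AB a b\<^esub> x = r \<odot>\<^bsub>hom_sp AB a b\<^esub> (s \<odot>\<^bsub>hom_sp AB a b\<^esub> x)"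
    "(r + s) \<odot>\<^bsub>hom_sp AB a b\<^esub> x
      = r \<odot>\<^bsub>hom_sp AB a b\<^esub> x \<oplus>\<^bsub>hom_sp AB a b\<^esub> s \<odot>\<^bsub>hom_sp AB a b\<^esub> x"
    using f by (simp_all add: x)
  show "\<zero>\<^bsub>hom_sp AB a b\<^esub> \<oplus>\<^bsub>hom_sp AB a b\<^esub> x = x"
    using f ab_class_cong[OF ab_eq.add_comm[of "Zer a b" a b f]] by (simp add: x)
  assume "y \<in> mor AB a b"
  then obtain g where g: "arrow g a b" and y: "y = ab_class a b g"
    by (rule mor_ABE)
  show "x \<oplus>\<^bsub>hom_sp AB a b\<^esub> y \<in> mor AB a b"
    "r \<odot>\<^bsub>hom_sp AB a b\<^esub> (x \<oplus>\<^bsub>hom_sp AB a b\<^esub> y)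
      = r \<odot>\<^bsub>hom_sp AB a b\<^esub> x \<oplus>\<^bsub>hom_sp AB a b\<^esub> r \<odot>\<^bsub>hom_sp AB a b\<^esub> y"
    using f g by (simp_all add: x y)
  show "x \<oplus>\<^bsub>hom_sp AB a b\<^esub> y = y \<oplus>\<^bsub>hom_sp AB a b\<^esub> x"
    using f g ab_class_cong[OF ab_eq.add_comm[of f a b g]] by (simp add: x y)
  assume "z \<in> mor AB a b"
  then obtain h where h: "arrow h a b" and z: "z = ab_class a b h"
    by (rule mor_ABE)
  show "(x \<oplus>\<^bsub>hom_sp AB a b\<^esub> y) \<oplus>\<^bsub>hom_sp AB a b\<^esub> z
      = x \<oplus>\<^bsub>hom_sp AB a b\<^esub> (y \<oplus>\<^bsub>hom_sp AB a b\<^esub> z)"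
    using f g h by (simp add: x y z)
qed (simp add: zero_AB arrow.intros)

lemma linear_category_AB: "linear_category AB"
proof (intro linear_category.intro)
  note [simp] = idm_AB add_AB smult_AB cmp_AB arrow.intros(5,7-8) arrow.intros(9)
  fix a b c d :: nat and r and f f' g g' h :: "'a brterm set"
  show "vectorspace class_ring (hom_sp AB a b)"
    by (rule vectorspace_AB)
  show "idm AB a \<in> mor AB a a"
    by simp
  assume "f \<in> mor AB a b"
  then obtain f1 where f: "arrow f1 a b" "f = ab_class a b f1"
    by (rule mor_ABE)
  show "cmp AB a b b (idm AB b) f = f" "cmp AB a a b f (idm AB a) = f"
    using f by (simp_all add: ab_class_cong[OF ab_eq.one_left] ab_class_cong[OF ab_eq.one_right])
  {
    assume "g \<in> mor AB b c"
    then obtain g1 where g: "arrow g1 b c" "g = ab_class b c g1"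
      by (rule mor_ABE)
    note gf = arrow.intros(9)[OF f(1) g(1)]
    show "cmp AB a b c g f \<in> mor AB a c"
      using f g gf by simp
    show "cmp AB a b c (r \<odot>\<^bsub>hom_sp AB b c\<^esub> g) f = r \<odot>\<^bsub>hom_sp AB a c\<^esub> cmp AB a b c g f"
      "cmp AB a b c g (r \<odot>\<^bsub>hom_sp AB a b\<^esub> f) = r \<odot>\<^bsub>hom_sp AB a c\<^esub> cmp AB a b c g f"
      using f g gf by (simp_all add: ab_class_cong[OF ab_eq.cmp_scl_left] ab_class_cong[OF ab_eq.cmp_scl_right])
    {
      assume "g' \<in> mor AB b c"
      then obtain g2 where g': "arrow g2 b c" "g' = ab_class b c g2"
        by (rule mor_ABE)
      show "cmp AB a b c (g \<oplus>\<^bsub>hom_sp AB b c\<^esub> g') f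
          = cmp AB a b c g f \<oplus>\<^bsub>hom_sp AB a c\<^esub> cmp AB a b c g' f"
        using f g g' gf arrow.intros(9)[OF f(1) g'(1)] by (simp add: ab_class_cong[OF ab_eq.cmp_add_left])
    }
    {
      assume "f' \<in> mor AB a b"
      then obtain f2 where f': "arrow f2 a b" "f' = ab_class a b f2"
        by (rule mor_ABE)
      show "cmp AB a b c g (f \<oplus>\<^bsub>hom_sp AB a b\<^esub> f')
          = cmp AB a b c g f \<oplus>\<^bsub>hom_sp AB a c\<^esub> cmp AB a b c g f'"
        using f g f' gf arrow.intros(9)[OF f'(1) g(1)] by (simp add: ab_class_cong[OF ab_eq.cmp_add_right])
    }
    assume "h \<in> mor AB c d"
    then obtain h1 where h: "arrow h1 c d" "h = ab_class c d h1"
      by (rule mor_ABE)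
    show "cmp AB a c d h (cmp AB a b c g f) = cmp AB a b d (cmp AB b c d h g) f"
      using f g h gf arrow.intros(9)[OF g(1) h(1)] ab_class_cong[OF ab_eq.cmp_assoc[OF f(1) g(1) h(1)]] by simp
  }
qed

section \<open>The cyclotomic ideal as an inductive family\<close>

text \<open>The generated ideal is an intersection of ideals; this least family of expressions
  describes it from inside and makes induction possible, on which the invariance under
  \<open>flip\<close> relies.\<close>

inductive cyc_null :: "'k::field list \<Rightarrow> (nat \<Rightarrow> 'k) \<Rightarrow> nat \<Rightarrow> nat \<Rightarrow> 'k brterm \<Rightarrow> bool"
  for us \<omega> where
  poly: "cyc_null us \<omega> 1 1 (cyclotomic_poly us)"
| bubble: "cyc_null us \<omega> 0 0 (bubble k \<^bold>- Scl (\<omega> k) (One 0))"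
| cong: "\<lbrakk>cyc_null us \<omega> a b f; ab_eq a b f g\<rbrakk> \<Longrightarrow> cyc_null us \<omega> a b g"
| zero: "cyc_null us \<omega> a b (Zer a b)"
| add: "\<lbrakk>cyc_null us \<omega> a b f; cyc_null us \<omega> a b g\<rbrakk> \<Longrightarrow> cyc_null us \<omega> a b (Add f g)"
| scl: "cyc_null us \<omega> a b f \<Longrightarrow> cyc_null us \<omega> a b (Scl r f)"
| cmp: "\<lbrakk>arrow f a b; cyc_null us \<omega> b c g; arrow h c d\<rbrakk> \<Longrightarrow> cyc_null us \<omega> a d (h \<^bold>\<circ> (g \<^bold>\<circ> f))"
| tns: "\<lbrakk>cyc_null us \<omega> a b g; arrow h c d\<rbrakk> \<Longrightarrow> cyc_null us \<omega> (a + c) (b + d) (g \<^bold>\<otimes> h)"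

lemma arrow_dot_power: "arrow (dot_power k) 1 1"
  by (induction k) (auto simp: arrow_iff)

lemma arrow_cyclotomic_poly: "arrow (cyclotomic_poly us) 1 1"
  by (induction us) (auto simp: arrow_iff)

lemma arrow_bubble: "arrow (bubble k) 0 0"
  by (simp add: arrow_iff bubble_def arrow_dot_power[unfolded arrow_iff One_nat_def])

lemma cyc_null_arrow: "cyc_null us \<omega> a b f \<Longrightarrow> arrow f a b"
proof (induction rule: cyc_null.induct)
  case (bubble k)
  show ?case
    using arrow_bubble by (intro arrow.intros)
qed (auto intro: arrow.intros arrow_cyclotomic_poly[unfolded One_nat_def] dest: ab_eq_arrow)

lemma right_tensor_ideal_cyc_null:
  "right_tensor_ideal AB (\<lambda>a b. ab_class a b ` {f. cyc_null us \<omega> a b f})"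
  (is "right_tensor_ideal AB ?N")
  unfolding right_tensor_ideal_def tens_obj_AB
proof (intro conjI ballI)
  fix a b :: nat
  show "subspace class_ring (?N a b) (hom_sp AB a b)"
    using vectorspace_AB
    by (auto simp: subspace_def submodule_def vectorspace_def mor_AB zero_AB add_AB smult_AB
        cyc_null_arrow[of us \<omega>] intro: cyc_null.intros)
next
  fix a b c d :: nat and f g h :: "'a brterm set"
  assume "f \<in> mor AB a b" "g \<in> ?N b c" "h \<in> mor AB c d"
  then obtain f' g' h' where "arrow f' a b" "f = ab_class a b f'" "cyc_null us \<omega> b c g'"
      "g = ab_class b c g'" "arrow h' c d" "h = ab_class c d h'"
    by (auto simp: mor_AB)
  moreover from this have "arrow g' b c" "arrow (g' \<^bold>\<circ> f') a c"
    by (auto intro: arrow.intros dest: cyc_null_arrow)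
  ultimately show "cmp AB a c d h (cmp AB a b c g f) \<in> ?N a d"
    by (simp add: cmp_AB) (blast intro: cyc_null.cmp)
next
  fix a b c d :: nat and g h :: "'a brterm set"
  assume "g \<in> ?N a b" "h \<in> mor AB c d"
  then obtain g' h' where "cyc_null us \<omega> a b g'" "g = ab_class a b g'" "arrow h' c d" "h = ab_class c d h'"
    by (auto simp: mor_AB)
  moreover from this have "arrow g' a b"
    by (auto dest: cyc_null_arrow)
  ultimately show "tens AB a b c d g h \<in> ?N (a + c) (b + d)"
    by (auto simp: tens_AB intro: cyc_null.tns)
qed

text \<open>The classes of null expressions form a right tensor ideal containing the relators, which
  gives one inclusion; rule induction inside an arbitrary such ideal gives the other.\<close>

lemma cyclotomic_ideal_eq: "cyclotomic_ideal us \<omega> a b = ab_class a b ` {f. cyc_null us \<omega> a b f}"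
proof
  show "cyclotomic_ideal us \<omega> a b \<subseteq> ab_class a b ` {f. cyc_null us \<omega> a b f}"
  proof
    fix X
    assume "X \<in> cyclotomic_ideal us \<omega> a b"
    then have *: "X \<in> N a b"
      if "right_tensor_ideal AB N" "\<forall>c d. cyclotomic_relators us \<omega> c d \<subseteq> N c d" for N
      using that unfolding cyclotomic_ideal_def generated_right_ideal_def by auto
    show "X \<in> ab_class a b ` {f. cyc_null us \<omega> a b f}"
      by (rule *[OF right_tensor_ideal_cyc_null])
        (auto simp: cyclotomic_relators_def intro: cyc_null.bubble cyc_null.poly[unfolded One_nat_def])
  qed
  have "ab_class a b f \<in> N a b"
    if "cyc_null us \<omega> a b f" and N: "right_tensor_ideal AB N"
      and S: "\<forall>c d. cyclotomic_relators us \<omega> c d \<subseteq> N c d" for f N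
    using that(1)
  proof (induction rule: cyc_null.induct)
    case poly
    show ?case
      using S[THEN spec, THEN spec, of 1 1] by (auto simp: cyclotomic_relators_def)
  next
    case (bubble k)
    show ?case
      using S[THEN spec, THEN spec, of 0 0] by (auto simp: cyclotomic_relators_def)
  next
    case (cong a b f g)
    then show ?case
      using ab_class_cong by metis
  next
    case (zero a b)
    have "submodule class_ring (N a b) (hom_sp AB a b)"
      using N by (simp add: right_tensor_ideal_def subspace_def)
    then show ?case
      using submodule.zero_closed zero_AB by metis
  next
    case (add a b f g)
    have "submodule class_ring (N a b) (hom_sp AB a b)"
      using N by (simp add: right_tensor_ideal_def subspace_def)
    then show ?case
      using add submodule.m_closed add_AB cyc_null_arrow by metis
  next
    case (scl a b f r)
    have "submodule class_ring (N a b) (hom_sp AB a b)"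
      using N by (simp add: right_tensor_ideal_def subspace_def)
    then have "r \<odot>\<^bsub>hom_sp AB a b\<^esub> ab_class a b f \<in> N a b"
      using scl submodule.smult_closed by fastforce
    then show ?case
      using scl smult_AB cyc_null_arrow by metis
  next
    case (cmp f a b c g h d)
    have "cmp AB a c d (ab_class c d h) (cmp AB a b c (ab_class b c g) (ab_class a b f)) \<in> N a d"
      using N cmp by (simp add: right_tensor_ideal_def mor_AB)
    moreover have "arrow g b c"
      using cmp cyc_null_arrow by blast
    ultimately show ?case
      using cmp by (simp add: cmp_AB arrow.intros)
  next
    case (tns a b g h c d)
    have "tens AB a b c d (ab_class a b g) (ab_class c d h) \<in> N (a + c) (b + d)"
      using N tns by (simp add: right_tensor_ideal_def mor_AB)
    moreover have "arrow g a b"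
      using tns cyc_null_arrow by blast
    ultimately show ?case
      using tns by (simp add: tens_AB)
  qed
  then show "ab_class a b ` {f. cyc_null us \<omega> a b f} \<subseteq> cyclotomic_ideal us \<omega> a b"
    by (auto simp: cyclotomic_ideal_def generated_right_ideal_def mor_AB dest: cyc_null_arrow)
qed

lemma ab_class_in_ideal_iff:
  assumes "arrow f a b"
  shows "ab_class a b f \<in> cyclotomic_ideal us \<omega> a b \<longleftrightarrow> cyc_null us \<omega> a b f"
proof
  assume "ab_class a b f \<in> cyclotomic_ideal us \<omega> a b"
  then obtain g where "cyc_null us \<omega> a b g" "ab_class a b f = ab_class a b g"
    by (auto simp: cyclotomic_ideal_eq)
  then show "cyc_null us \<omega> a b f"
    using ab_class_eq_iff[OF assms] by (blast intro: cyc_null.cong ab_eq.sym)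
qed (auto simp: cyclotomic_ideal_eq)

lemma quotient_by_cyclotomic_ideal: "quotient_by_ideal AB (cyclotomic_ideal us \<omega>)"
proof -
  have "two_sided_ideal AB (cyclotomic_ideal us \<omega>)"
    using right_tensor_ideal_cyc_null[of us \<omega>]
    unfolding right_tensor_ideal_def two_sided_ideal_def cyclotomic_ideal_eq by blast
  then show ?thesis
    by (simp add: quotient_by_ideal_def quotient_by_ideal_axioms_def linear_category_AB)
qed

lemma linear_category_CB: "linear_category (CB us \<omega>)"
  unfolding CB_def by (rule quotient_by_ideal.quotient_linear_category[OF quotient_by_cyclotomic_ideal])

context
  fixes us :: "'k::field list" and \<omega> :: "nat \<Rightarrow> 'k"
begin

interpretation CB: quotient_by_ideal AB "cyclotomic_ideal us \<omega>"
  by (rule quotient_by_cyclotomic_ideal)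

lemma objs_CB [simp]: "objs (CB us \<omega>) = UNIV"
  by (simp add: CB_def quotient_category_def)

lemma mor_CB: "mor (CB us \<omega>) a b = cb_mor us \<omega> a b ` {f. arrow f a b}"
  by (simp add: CB_def CB.mor_quotient mor_AB image_image cb_mor_def[abs_def])

lemma cb_mor_closed: "arrow f a b \<Longrightarrow> cb_mor us \<omega> a b f \<in> mor (CB us \<omega>) a b"
  by (simp add: mor_CB)

lemma zero_CB: "\<zero>\<^bsub>hom_sp (CB us \<omega>) a b\<^esub> = cb_mor us \<omega> a b (Zer a b)"
  by (simp add: CB_def CB.cls_zero zero_AB cb_mor_def)

lemma idm_CB: "idm (CB us \<omega>) a = cb_mor us \<omega> a a (One a)"
  by (simp add: CB_def CB.cls_id idm_AB cb_mor_def)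

lemma add_CB:
  "arrow f a b \<Longrightarrow> arrow g a b
    \<Longrightarrow> cb_mor us \<omega> a b f \<oplus>\<^bsub>hom_sp (CB us \<omega>) a b\<^esub> cb_mor us \<omega> a b g = cb_mor us \<omega> a b (Add f g)"
  by (simp add: CB_def CB.cls_add add_AB cb_mor_def mor_AB)

lemma smult_CB:
  "arrow f a b \<Longrightarrow> r \<odot>\<^bsub>hom_sp (CB us \<omega>) a b\<^esub> cb_mor us \<omega> a b f = cb_mor us \<omega> a b (Scl r f)"
  by (simp add: CB_def CB.cls_smult smult_AB cb_mor_def mor_AB)

lemma cmp_CB:
  "arrow f a b \<Longrightarrow> arrow g b c
    \<Longrightarrow> cmp (CB us \<omega>) a b c (cb_mor us \<omega> b c g) (cb_mor us \<omega> a b f) = cb_mor us \<omega> a c (g \<^bold>\<circ> f)"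
  by (simp add: CB_def CB.cls_cmp cmp_AB cb_mor_def mor_AB)

lemma cb_mor_cong: "ab_eq a b f g \<Longrightarrow> cb_mor us \<omega> a b f = cb_mor us \<omega> a b g"
  by (simp add: cb_mor_def ab_class_cong)

lemma cb_mor_eq_iff:
  assumes "arrow f a b" "arrow g a b"
  shows "cb_mor us \<omega> a b f = cb_mor us \<omega> a b g \<longleftrightarrow> cyc_null us \<omega> a b (f \<^bold>- g)"
proof -
  interpret class_vectorspace "hom_sp AB a b"
    by (simp add: class_vectorspace_def vectorspace_AB)
  have "ab_class a b f \<ominus>\<^bsub>hom_sp AB a b\<^esub> ab_class a b g = ab_class a b (f \<^bold>- g)"
    using assms by (simp add: minus_eq_scale mor_AB smult_AB add_AB arrow.intros)
  then show ?thesis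
    using assms by (simp add: cb_mor_def CB.cls_eq_iff mor_AB ab_class_in_ideal_iff arrow.intros)
qed

end

section \<open>Invariance of the cyclotomic ideal under the flip\<close>

lemma dot_commutes_cyclotomic_poly: "Dot \<^bold>\<circ> cyclotomic_poly us \<simeq> cyclotomic_poly us \<^bold>\<circ> Dot"
proof (induction us)
  case Nil
  show ?case
    by (simp del: One_nat_def) (rule abeq_trans[OF abeq_one_right abeq_sym[OF abeq_one_left]]; simp)
next
  case (Cons v us)
  let ?p = "cyclotomic_poly us" and ?l = "Dot \<^bold>- Scl v (One 1)"
  have p: "brtype ?p = Some (1, 1)"
    using arrow_cyclotomic_poly by (simp add: arrow_iff)
  have l: "Dot \<^bold>\<circ> ?l \<simeq> ?l \<^bold>\<circ> Dot"
  proof -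
    have "Dot \<^bold>\<circ> ?l \<simeq> (Dot \<^bold>\<circ> Dot) \<^bold>- (Dot \<^bold>\<circ> Scl v (One 1))"
      by (rule abeq_trans[OF abeq_cmp_add_right abeq_add[OF abeq_refl abeq_cmp_scl_right]]) simp_all
    also have "\<dots> \<simeq> (Dot \<^bold>\<circ> Dot) \<^bold>- (Scl v (One 1) \<^bold>\<circ> Dot)"
      by (rule abeq_add[OF abeq_refl abeq_scl[OF abeq_trans[OF abeq_cmp_scl_right abeq_trans[OF
          abeq_scl[OF abeq_trans[OF abeq_one_right abeq_sym[OF abeq_one_left]]] abeq_sym[OF abeq_cmp_scl_left]]]]])
        simp_all
    also have "\<dots> \<simeq> ?l \<^bold>\<circ> Dot"
      by (rule abeq_sym[OF abeq_trans[OF abeq_cmp_add_left abeq_add[OF abeq_refl abeq_cmp_scl_left]]]) simp_all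
    finally show ?thesis .
  qed
  have "Dot \<^bold>\<circ> (?l \<^bold>\<circ> ?p) \<simeq> (Dot \<^bold>\<circ> ?l) \<^bold>\<circ> ?p"
    using p by (intro abeq_sym[OF abeq_assoc]) simp
  also have "\<dots> \<simeq> (?l \<^bold>\<circ> Dot) \<^bold>\<circ> ?p"
    using p by (intro abeq_cmp l abeq_refl) simp_all
  also have "\<dots> \<simeq> ?l \<^bold>\<circ> (Dot \<^bold>\<circ> ?p)"
    using p by (intro abeq_assoc) simp
  also have "\<dots> \<simeq> ?l \<^bold>\<circ> (?p \<^bold>\<circ> Dot)"
    using p by (intro abeq_cmp Cons.IH abeq_refl) simp_all
  also have "\<dots> \<simeq> (?l \<^bold>\<circ> ?p) \<^bold>\<circ> Dot"
    using p by (intro abeq_sym[OF abeq_assoc]) simp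
  finally show ?case
    by simp
qed

text \<open>Turning upside down reverses the order of the linear factors, which is harmless because
  polynomials in the dot commute with the dot.\<close>

lemma flip_cyclotomic_poly: "flip (cyclotomic_poly us) \<simeq> cyclotomic_poly us"
proof (induction us)
  case (Cons v us)
  let ?p = "cyclotomic_poly us" and ?l = "Dot \<^bold>- Scl v (One 1)"
  have p: "brtype ?p = Some (1, 1)" "brtype (flip ?p) = Some (1, 1)"
    using arrow_cyclotomic_poly arrow_flip by (auto simp: arrow_iff[symmetric])
  have "flip ?p \<^bold>\<circ> ?l \<simeq> ?p \<^bold>\<circ> ?l"
    using p by (intro abeq_cmp Cons.IH abeq_refl) simp_all
  also have "\<dots> \<simeq> (?p \<^bold>\<circ> Dot) \<^bold>- (?p \<^bold>\<circ> Scl v (One 1))"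
    using p by (intro abeq_trans[OF abeq_cmp_add_right abeq_add[OF abeq_refl abeq_cmp_scl_right]]) simp_all
  also have "\<dots> \<simeq> (Dot \<^bold>\<circ> ?p) \<^bold>- (Scl v (One 1) \<^bold>\<circ> ?p)"
    using p by (intro abeq_add abeq_scl abeq_sym[OF dot_commutes_cyclotomic_poly]
       abeq_trans[OF abeq_cmp_scl_right abeq_trans[OF
          abeq_scl[OF abeq_trans[OF abeq_one_right abeq_sym[OF abeq_one_left]]] abeq_sym[OF abeq_cmp_scl_left]]])
      simp_all
  also have "\<dots> \<simeq> ?l \<^bold>\<circ> ?p"
    using p by (intro abeq_sym[OF abeq_trans[OF abeq_cmp_add_left abeq_add[OF abeq_refl abeq_cmp_scl_left]]]) simp_all
  finally show ?case
    by simp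
qed (simp add: abeq_refl)

lemma dot_commutes_dot_power: "Dot \<^bold>\<circ> dot_power k \<simeq> dot_power k \<^bold>\<circ> Dot"
proof (induction k)
  case 0
  show ?case
    by (simp del: One_nat_def) (rule abeq_trans[OF abeq_one_right abeq_sym[OF abeq_one_left]]; simp)
next
  case (Suc k)
  have p: "brtype (dot_power k :: 'a brterm) = Some (1, 1)"
    using arrow_dot_power by (simp add: arrow_iff)
  have "Dot \<^bold>\<circ> (Dot \<^bold>\<circ> dot_power k) \<simeq> Dot \<^bold>\<circ> (dot_power k \<^bold>\<circ> (Dot :: 'a brterm))"
    using p by (intro abeq_cmp[OF abeq_refl Suc.IH]) simp_all
  also have "\<dots> \<simeq> (Dot \<^bold>\<circ> dot_power k) \<^bold>\<circ> (Dot :: 'a brterm)"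
    using p by (intro abeq_sym[OF abeq_assoc]) simp_all
  finally show ?case
    by simp
qed

lemma flip_dot_power: "flip (dot_power k) \<simeq> dot_power k"
proof (induction k)
  case (Suc k)
  have p: "brtype (dot_power k :: 'a brterm) = Some (1, 1)" "brtype (flip (dot_power k) :: 'a brterm) = Some (1, 1)"
    using arrow_dot_power arrow_flip by (auto simp: arrow_iff[symmetric])
  have "flip (dot_power k) \<^bold>\<circ> Dot \<simeq> dot_power k \<^bold>\<circ> (Dot :: 'a brterm)"
    using p by (intro abeq_cmp Suc.IH abeq_refl) simp_all
  then show ?case
    using abeq_trans abeq_sym[OF dot_commutes_dot_power] by (simp, blast)
qed (simp add: abeq_refl)

text \<open>Cup and cap trade places and the dots stay on the left strand, so beyond the order of
  the dots only the bracketing changes.\<close>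

lemma flip_bubble: "flip (bubble k) \<simeq> bubble k"
proof -
  have p: "brtype (dot_power k :: 'a brterm) = Some (1, 1)" "brtype (flip (dot_power k) :: 'a brterm) = Some (1, 1)"
    using arrow_dot_power arrow_flip by (auto simp: arrow_iff[symmetric])
  have "(Cap \<^bold>\<circ> (flip (dot_power k) \<^bold>\<otimes> One 1)) \<^bold>\<circ> Cup \<simeq> (Cap \<^bold>\<circ> (dot_power k \<^bold>\<otimes> One 1)) \<^bold>\<circ> (Cup :: 'a brterm)"
    using p by (intro abeq_cmp abeq_tns flip_dot_power abeq_refl) simp_all
  also have "\<dots> \<simeq> bubble k"
    unfolding bubble_def using p by (intro abeq_assoc) simp
  finally show ?thesis
    by (simp add: bubble_def)
qed

text \<open>The generators are invariant, and every closure rule is carried to itself: composites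
  are reversed, and what is tensored on the right stays on the right.\<close>

lemma cyc_null_flip: "cyc_null us \<omega> a b f \<Longrightarrow> cyc_null us \<omega> b a (flip f)"
proof (induction rule: cyc_null.induct)
  case poly
  have "brtype (cyclotomic_poly us) = Some (1, 1)"
    using arrow_cyclotomic_poly arrow_iff by blast
  then show ?case
    by (intro cyc_null.cong[OF cyc_null.poly] abeqD abeq_sym[OF flip_cyclotomic_poly])
next
  case (bubble k)
  have t: "brtype (bubble k \<^bold>- Scl (\<omega> k) (One 0)) = Some (0, 0)"
    using arrow_bubble[of k, where ?'a = 'a] by (simp add: arrow_iff)
  then have "bubble k \<^bold>- Scl (\<omega> k) (One 0) \<simeq> flip (bubble k) \<^bold>- Scl (\<omega> k) (One 0)"
    by (intro abeq_add abeq_sym[OF flip_bubble] abeq_refl) (simp_all split: if_splits)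
  then have "ab_eq 0 0 (bubble k \<^bold>- Scl (\<omega> k) (One 0)) (flip (bubble k) \<^bold>- Scl (\<omega> k) (One 0))"
    using t by (rule abeqD)
  with cyc_null.bubble have "cyc_null us \<omega> 0 0 (flip (bubble k) \<^bold>- Scl (\<omega> k) (One 0))"
    by (rule cyc_null.cong)
  then show ?case
    by simp
next
  case (cong a b f g)
  then show ?case
    by (blast intro: cyc_null.cong ab_eq_flip)
next
  case (cmp f a b c g h d)
  have "ab_eq d a (flip f \<^bold>\<circ> (flip g \<^bold>\<circ> flip h)) ((flip f \<^bold>\<circ> flip g) \<^bold>\<circ> flip h)"
    using cmp by (intro ab_eq.sym[OF ab_eq.cmp_assoc] arrow_flip) (auto dest: cyc_null_arrow)
  moreover have "cyc_null us \<omega> d a (flip f \<^bold>\<circ> (flip g \<^bold>\<circ> flip h))"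
    using cmp by (intro cyc_null.cmp[OF arrow_flip _ arrow_flip])
  ultimately show ?case
    by (simp add: cyc_null.cong)
qed (auto intro: cyc_null.intros arrow_flip)

text \<open>Hence the flip descends to the Hom spaces of the quotient.\<close>

lemma cb_mor_flip:
  assumes "cb_mor us \<omega> a b f = cb_mor us \<omega> a b g" "arrow f a b" "arrow g a b"
  shows "cb_mor us \<omega> b a (flip f) = cb_mor us \<omega> b a (flip g)"
  using assms cyc_null_flip[of us \<omega> a b "f \<^bold>- g"] by (simp add: cb_mor_eq_iff arrow_flip)

section \<open>Associated algebras\<close>

lemma (in class_vectorspace) span_induct' [consumes 2, case_names zero base add scale]:
  assumes "v \<in> span B" "B \<subseteq> carrier V"
    and "P \<zero>" "\<And>v. v \<in> B \<Longrightarrow> P v"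
    and "\<And>v w. v \<in> span B \<Longrightarrow> w \<in> span B \<Longrightarrow> P v \<Longrightarrow> P w \<Longrightarrow> P (v \<oplus> w)"
    and "\<And>r v. v \<in> span B \<Longrightarrow> P v \<Longrightarrow> P (r \<odot> v)"
  shows "P v"
proof -
  have sub: "submodule class_ring (span B) V"
    using span_is_submodule[OF assms(2)] .
  have "submodule class_ring {v \<in> span B. P v} V"
    using assms(3,5,6) sub unfolding submodule_def by (auto simp: module_axioms)
  moreover have "B \<subseteq> {v \<in> span B. P v}"
    using in_own_span[OF assms(2)] assms(4) by auto
  ultimately have "span B \<subseteq> {v \<in> span B. P v}"
    by (intro span_is_subset)
  then show ?thesis
    using assms(1) by auto
qed

text \<open>With every element of the type an object, the laws lose their object conditions, and
  elements of the algebra are plain functions on pairs.\<close>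

locale total_category = linear_category C
  for C :: "('j, 'm, 'k::field, 'z) lincat_scheme" +
  assumes objs_UNIV [simp]: "objs C = UNIV"
begin

sublocale hom: class_vectorspace "hom_sp C a b" for a b
  by (simp add: class_vectorspace_def hom_vectorspace)

abbreviation nul :: "'j \<Rightarrow> 'j \<Rightarrow> 'm" where
  "nul a b \<equiv> \<zero>\<^bsub>hom_sp C a b\<^esub>"

lemma cmp_closed [simp]: "f \<in> mor C a b \<Longrightarrow> g \<in> mor C b c \<Longrightarrow> cmp C a b c g f \<in> mor C a c"
  by (rule comp_closed) simp_all

lemma idm_closed [simp]: "idm C a \<in> mor C a a"
  by (rule id_closed) simp

lemma cmp_idm_left [simp]: "f \<in> mor C a b \<Longrightarrow> cmp C a b b (idm C b) f = f"
  by (rule id_left) simp_all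

lemma cmp_idm_right [simp]: "f \<in> mor C a b \<Longrightarrow> cmp C a a b f (idm C a) = f"
  by (rule id_right) simp_all

lemma cmp_assoc:
  "f \<in> mor C a b \<Longrightarrow> g \<in> mor C b c \<Longrightarrow> h \<in> mor C c d
    \<Longrightarrow> cmp C a c d h (cmp C a b c g f) = cmp C a b d (cmp C b c d h g) f"
  by (rule comp_assoc) simp_all

lemma cmp_add_left:
  "f \<in> mor C a b \<Longrightarrow> g \<in> mor C b c \<Longrightarrow> g' \<in> mor C b c
    \<Longrightarrow> cmp C a b c (g \<oplus>\<^bsub>hom_sp C b c\<^esub> g') f
      = cmp C a b c g f \<oplus>\<^bsub>hom_sp C a c\<^esub> cmp C a b c g' f"
  by (rule comp_add_left) simp_all

lemma cmp_add_right:
  "f \<in> mor C a b \<Longrightarrow> f' \<in> mor C a b \<Longrightarrow> g \<in> mor C b c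
    \<Longrightarrow> cmp C a b c g (f \<oplus>\<^bsub>hom_sp C a b\<^esub> f')
      = cmp C a b c g f \<oplus>\<^bsub>hom_sp C a c\<^esub> cmp C a b c g f'"
  by (rule comp_add_right) simp_all

lemma cmp_smult_left:
  "f \<in> mor C a b \<Longrightarrow> g \<in> mor C b c
    \<Longrightarrow> cmp C a b c (r \<odot>\<^bsub>hom_sp C b c\<^esub> g) f = r \<odot>\<^bsub>hom_sp C a c\<^esub> cmp C a b c g f"
  by (rule comp_smult_left) simp_all

lemma cmp_smult_right:
  "f \<in> mor C a b \<Longrightarrow> g \<in> mor C b c
    \<Longrightarrow> cmp C a b c g (r \<odot>\<^bsub>hom_sp C a b\<^esub> f) = r \<odot>\<^bsub>hom_sp C a c\<^esub> cmp C a b c g f"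
  by (rule comp_smult_right) simp_all

lemma cmp_nul_left [simp]: "f \<in> mor C a b \<Longrightarrow> cmp C a b c (nul b c) f = nul a c"
  using cmp_smult_left[of f a b "nul b c" c 0] by (simp add: hom.scale_zero)

lemma cmp_nul_right [simp]: "g \<in> mor C b c \<Longrightarrow> cmp C a b c g (nul a b) = nul a c"
  using cmp_smult_right[of "nul a b" a b g c 0] by (simp add: hom.scale_zero)

abbreviation A where "A \<equiv> assoc_alg C"

lemma carrier_A:
  "x \<in> carrier A \<longleftrightarrow> (\<forall>a b. x (a, b) \<in> mor C b a) \<and> finite {(a, b). x (a, b) \<noteq> nul b a}"
  by (auto simp: assoc_alg_def PiE_def Pi_def extensional_def)

lemma A_entry [simp]: "x \<in> carrier A \<Longrightarrow> x (a, b) \<in> mor C b a"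
  by (simp add: carrier_A)

lemma add_entry [simp]: "(x \<oplus>\<^bsub>A\<^esub> y) (a, b) = x (a, b) \<oplus>\<^bsub>hom_sp C b a\<^esub> y (a, b)"
  by (simp add: assoc_alg_def)

lemma zero_entry [simp]: "\<zero>\<^bsub>A\<^esub> (a, b) = nul b a"
  by (simp add: assoc_alg_def)

lemma smult_entry [simp]: "(r \<odot>\<^bsub>A\<^esub> x) (a, b) = r \<odot>\<^bsub>hom_sp C b a\<^esub> x (a, b)"
  by (simp add: assoc_alg_def)

lemma entry_ext: "(\<And>a b. x (a, b) = y (a, b)) \<Longrightarrow> x = y"
  by auto

lemma add_closed_A: "x \<in> carrier A \<Longrightarrow> y \<in> carrier A \<Longrightarrow> x \<oplus>\<^bsub>A\<^esub> y \<in> carrier A"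
proof -
  assume x: "x \<in> carrier A" and y: "y \<in> carrier A"
  have "finite {(a, b). (x \<oplus>\<^bsub>A\<^esub> y) (a, b) \<noteq> nul b a}"
    by (rule finite_subset[of _ "{(a, b). x (a, b) \<noteq> nul b a} \<union> {(a, b). y (a, b) \<noteq> nul b a}"])
      (use x y in \<open>auto simp: carrier_A\<close>)
  then show ?thesis
    using x y by (simp add: carrier_A)
qed

lemma smult_closed_A: "x \<in> carrier A \<Longrightarrow> r \<odot>\<^bsub>A\<^esub> x \<in> carrier A"
proof -
  assume x: "x \<in> carrier A"
  have "finite {(a, b). (r \<odot>\<^bsub>A\<^esub> x) (a, b) \<noteq> nul b a}"
    by (rule finite_subset[of _ "{(a, b). x (a, b) \<noteq> nul b a}"])
      (use x in \<open>auto simp: carrier_A hom.scale_zero_right\<close>)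
  then show ?thesis
    using x by (simp add: carrier_A hom.scale_closed)
qed

sublocale alg: class_vectorspace A
  unfolding class_vectorspace_def
proof (rule vectorspace_class_ringI)
  show "\<zero>\<^bsub>A\<^esub> \<in> carrier A"
    by (simp add: carrier_A)
  show "x \<oplus>\<^bsub>A\<^esub> y = y \<oplus>\<^bsub>A\<^esub> x" if "x \<in> carrier A" "y \<in> carrier A" for x y
    using that by (intro entry_ext) (simp add: hom.add.m_comm)
qed (auto intro!: entry_ext add_closed_A smult_closed_A
    simp: hom.a_assoc hom.scale_add_left hom.scale_add_right hom.scale_scale hom.scale_one hom.scale_zero)

text \<open>Matrix unit: the entry \<open>f\<close> in row \<open>a\<close> and column
  \<open>b\<close>, where \<open>f\<close> runs from \<open>b\<close> to \<open>a\<close>.\<close>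

definition unit :: "'j \<Rightarrow> 'j \<Rightarrow> 'm \<Rightarrow> 'j \<times> 'j \<Rightarrow> 'm" where
  "unit a b f = (\<lambda>(a', b'). if a' = a \<and> b' = b then f else nul b' a')"

lemma unit_entry: "unit a b f (a', b') = (if a' = a \<and> b' = b then f else nul b' a')"
  by (simp add: unit_def)

lemma unit_closed [simp]: "f \<in> mor C b a \<Longrightarrow> unit a b f \<in> carrier A"
  by (auto simp: carrier_A unit_entry intro: finite_subset[of _ "{(a, b)}"])

lemma unit_nul [simp]: "unit a b (nul b a) = \<zero>\<^bsub>A\<^esub>"
  by (intro entry_ext) (simp add: unit_entry)

lemma unit_add: "unit a b (f \<oplus>\<^bsub>hom_sp C b a\<^esub> g) = unit a b f \<oplus>\<^bsub>A\<^esub> unit a b g"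
  by (intro entry_ext) (simp add: unit_entry)

lemma unit_smult: "unit a b (r \<odot>\<^bsub>hom_sp C b a\<^esub> f) = r \<odot>\<^bsub>A\<^esub> unit a b f"
  by (intro entry_ext) (simp add: unit_entry hom.scale_zero_right)

lemma idem_eq_unit: "idem C a = unit a a (idm C a)"
  by (intro entry_ext) (simp add: idem_def unit_entry)

lemma idem_closed [simp]: "idem C a \<in> carrier A"
  by (simp add: idem_eq_unit)

lemma finsum_unit:
  assumes "finite F" "\<And>a b. (a, b) \<in> F \<Longrightarrow> f (a, b) \<in> mor C b a"
  shows "finsum A (\<lambda>(a, b). unit a b (f (a, b))) F = (\<lambda>(a, b). if (a, b) \<in> F then f (a, b) else nul b a)"
  using assms
proof (induction F rule: finite_induct)
  case empty
  show ?case
    by (intro entry_ext) simp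
next
  case (insert p F)
  obtain a b where p: "p = (a, b)"
    by (cases p)
  have "finsum A (\<lambda>(a, b). unit a b (f (a, b))) (insert p F)
      = unit a b (f (a, b)) \<oplus>\<^bsub>A\<^esub> finsum A (\<lambda>(a, b). unit a b (f (a, b))) F"
    using insert.hyps insert.prems by (subst alg.finsum_insert) (auto simp: p)
  also have "\<dots> = (\<lambda>(a, b). if (a, b) \<in> insert p F then f (a, b) else nul b a)"
    using insert.IH insert.hyps insert.prems by (intro entry_ext) (auto simp: p unit_entry)
  finally show ?case .
qed

lemma entries_finsum:
  assumes "x \<in> carrier A" "finite F" "{(a, b). x (a, b) \<noteq> nul b a} \<subseteq> F"
  shows "finsum A (\<lambda>(a, b). unit a b (x (a, b))) F = x"
proof -
  have "x (a, b) = nul b a" if "(a, b) \<notin> F" for a b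
    using assms(3) that by blast
  then show ?thesis
    using assms(1,2) by (subst finsum_unit) (auto intro!: entry_ext)
qed

subsection \<open>Subspaces given by families of subspaces of the Hom spaces\<close>

text \<open>Matrices whose entries range independently over prescribed subspaces. All three parts of
  the decomposition have this shape, which makes them direct sums of their corners.\<close>

definition blocks :: "('j \<Rightarrow> 'j \<Rightarrow> 'm set) \<Rightarrow> ('j \<times> 'j \<Rightarrow> 'm) set" where
  "blocks H = {x \<in> carrier A. \<forall>a b. x (a, b) \<in> H a b}"

lemma blocks_carrier: "x \<in> blocks H \<Longrightarrow> x \<in> carrier A"
  by (simp add: blocks_def)

lemma unit_blocks:
  assumes "\<And>a b. subspace class_ring (H a b) (hom_sp C b a)" "f \<in> H a b"
  shows "unit a b f \<in> blocks H"
  using assms submodule.zero_closed[of class_ring "H _ _" "hom_sp C _ _"] submodule.subset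
  by (fastforce simp: blocks_def unit_entry subspace_def)

lemma blocks_subspace:
  assumes H: "\<And>a b. subspace class_ring (H a b) (hom_sp C b a)"
  shows "subspace class_ring (blocks H) A"
proof -
  interpret H: subspace_coset "hom_sp C b a" "H a b" for a b
    by (simp add: subspace_coset_def H)
  have "submodule class_ring (blocks H) A"
    by unfold_locales (auto simp: blocks_def alg.scale_closed H.sub.smult_closed)
  then show ?thesis
    by (simp add: subspace_def alg.vectorspace_axioms)
qed

text \<open>A matrix is a finite sum of matrix units, and each entry is a combination of elements of
  \<open>B\<close>; linear claims need checking only on units of elements of
  \<open>B\<close>.\<close>

lemma blocks_induct [consumes 2, case_names zero base add scale]:
  assumes "x \<in> blocks (\<lambda>a b. hom.span b a (B a b))" "\<And>a b. B a b \<subseteq> mor C b a"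
    and "P \<zero>\<^bsub>A\<^esub>" "\<And>a b f. f \<in> B a b \<Longrightarrow> P (unit a b f)"
    and "\<And>x y. x \<in> blocks (\<lambda>a b. hom.span b a (B a b)) \<Longrightarrow> y \<in> blocks (\<lambda>a b. hom.span b a (B a b))
      \<Longrightarrow> P x \<Longrightarrow> P y \<Longrightarrow> P (x \<oplus>\<^bsub>A\<^esub> y)"
    and "\<And>r x. x \<in> blocks (\<lambda>a b. hom.span b a (B a b)) \<Longrightarrow> P x \<Longrightarrow> P (r \<odot>\<^bsub>A\<^esub> x)"
  shows "P x"
proof -
  let ?H = "\<lambda>a b. hom.span b a (B a b)"
  have sub: "subspace class_ring (?H a b) (hom_sp C b a)" for a b
    using hom.span_is_subspace[OF assms(2)] .
  then have bl: "subspace class_ring (blocks ?H) A"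
    by (rule blocks_subspace)
  have u: "P (unit a b f)" if "f \<in> ?H a b" for a b f
    using that assms(2)
  proof (induction rule: hom.span_induct')
    case zero
    then show ?case using assms(3) by simp
  next
    case (add v w)
    then show ?case by (simp add: unit_add assms(5) unit_blocks[OF sub])
  next
    case (scale r v)
    then show ?case by (simp add: unit_smult assms(6) unit_blocks[OF sub])
  qed (rule assms(4))
  have "P (finsum A (\<lambda>(a, b). unit a b (x (a, b))) F) \<and>
      finsum A (\<lambda>(a, b). unit a b (x (a, b))) F \<in> blocks ?H" if "finite F" for F
    using that
  proof (induction F rule: finite_induct)
    case empty
    then show ?case
      using assms(3) bl submodule.zero_closed by (auto simp: subspace_def)
  next
    case (insert p F)
    obtain a b where p: "p = (a, b)"
      by (cases p)
    have "x (a, b) \<in> ?H a b"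
      using assms(1) by (simp add: blocks_def)
    then have "P (unit a b (x (a, b)))" "unit a b (x (a, b)) \<in> blocks ?H"
      by (auto intro: u unit_blocks[OF sub])
    moreover have "finsum A (\<lambda>(a, b). unit a b (x (a, b))) (insert p F)
        = unit a b (x (a, b)) \<oplus>\<^bsub>A\<^esub> finsum A (\<lambda>(a, b). unit a b (x (a, b))) F"
      using insert.hyps blocks_carrier[OF assms(1)] by (subst alg.finsum_insert) (auto simp: p)
    ultimately show ?case
      using insert.IH assms(5) bl submodule.m_closed[of class_ring "blocks ?H" A]
      by (simp add: subspace_def)
  qed
  then show ?thesis
    using entries_finsum[OF blocks_carrier[OF assms(1)] _ subset_refl] blocks_carrier[OF assms(1)]
    by (metis (no_types, lifting) carrier_A)
qed

text \<open>Reduces multilinear identities of the algebra to matrix units, where they are laws of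
  the category.\<close>

lemma carrier_induct [consumes 1, case_names zero unit add]:
  assumes "x \<in> carrier A" "P \<zero>\<^bsub>A\<^esub>" "\<And>a b f. f \<in> mor C b a \<Longrightarrow> P (unit a b f)"
    and "\<And>x y. x \<in> carrier A \<Longrightarrow> y \<in> carrier A \<Longrightarrow> P x \<Longrightarrow> P y \<Longrightarrow> P (x \<oplus>\<^bsub>A\<^esub> y)"
  shows "P x"
proof -
  have "P (finsum A (\<lambda>(a, b). unit a b (x (a, b))) F)" if "finite F" for F
    using that
  proof (induction F rule: finite_induct)
    case (insert p F)
    obtain a b where p: "p = (a, b)"
      by (cases p)
    have "finsum A (\<lambda>(a, b). unit a b (x (a, b))) (insert p F)
        = unit a b (x (a, b)) \<oplus>\<^bsub>A\<^esub> finsum A (\<lambda>(a, b). unit a b (x (a, b))) F"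
      using insert.hyps assms(1) by (subst alg.finsum_insert) (auto simp: p)
    moreover have "finsum A (\<lambda>(a, b). unit a b (x (a, b))) F \<in> carrier A"
      using assms(1) by (intro alg.finsum_closed) auto
    ultimately show ?case
      using insert.IH assms by simp
  qed (simp add: assms(2))
  then show ?thesis
    using entries_finsum[OF assms(1) _ subset_refl] assms(1) by (metis (no_types, lifting) carrier_A)
qed

subsection \<open>The product\<close>

lemma row_finite: "x \<in> carrier A \<Longrightarrow> finite {c. x (a, c) \<noteq> nul c a}"
  by (rule finite_subset[of _ "snd ` {(a, b). x (a, b) \<noteq> nul b a}"]) (force simp: carrier_A)+

text \<open>The product is defined by summing over the support of a row; enlarging this set by zero
  terms lets different products share one index set.\<close>

lemma mult_entry:
  assumes "x \<in> carrier A" "y \<in> carrier A" "finite F" "{c. x (a, c) \<noteq> nul c a} \<subseteq> F"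
  shows "(x \<otimes>\<^bsub>A\<^esub> y) (a, b) = (\<Oplus>\<^bsub>hom_sp C b a\<^esub> c \<in> F. cmp C b c a (x (a, c)) (y (c, b)))"
proof -
  have "(x \<otimes>\<^bsub>A\<^esub> y) (a, b)
      = (\<Oplus>\<^bsub>hom_sp C b a\<^esub> c \<in> {c. x (a, c) \<noteq> nul c a}. cmp C b c a (x (a, c)) (y (c, b)))"
    by (simp add: assoc_alg_def)
  also have "\<dots> = (\<Oplus>\<^bsub>hom_sp C b a\<^esub> c \<in> F. cmp C b c a (x (a, c)) (y (c, b)))"
    using assms by (intro hom.add.finprod_mono_neutral_cong_left) auto
  finally show ?thesis .
qed

lemma mult_entry_single:
  assumes "x \<in> carrier A" "y \<in> carrier A" "{c. x (a, c) \<noteq> nul c a} \<subseteq> {c}"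
  shows "(x \<otimes>\<^bsub>A\<^esub> y) (a, b) = cmp C b c a (x (a, c)) (y (c, b))"
  using assms by (subst mult_entry[where F = "{c}"]) simp_all

text \<open>Nonzero entries of the product need a nonzero row of \<open>x\<close> and a nonzero
  column of \<open>y\<close>, of which there are finitely many.\<close>

lemma mult_closed [simp]:
  assumes x: "x \<in> carrier A" and y: "y \<in> carrier A"
  shows "x \<otimes>\<^bsub>A\<^esub> y \<in> carrier A"
proof -
  let ?sx = "{(a, b). x (a, b) \<noteq> nul b a}" and ?sy = "{(a, b). y (a, b) \<noteq> nul b a}"
  have e: "(x \<otimes>\<^bsub>A\<^esub> y) (a, b) \<in> mor C b a" for a b
    using x y by (subst mult_entry[OF x y row_finite[OF x] subset_refl]) (auto intro: hom.finsum_closed)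
  have "(x \<otimes>\<^bsub>A\<^esub> y) (a, b) = nul b a" if "a \<notin> fst ` ?sx \<or> b \<notin> snd ` ?sy" for a b
  proof -
    have "cmp C b c a (x (a, c)) (y (c, b)) = nul b a" for c
    proof (cases "a \<in> fst ` ?sx")
      case True
      then have "y (c, b) = nul b c"
        using that by force
      then show ?thesis
        using x by simp
    next
      case False
      then have "x (a, c) = nul c a"
        by force
      then show ?thesis
        using y by simp
    qed
    then show ?thesis
      by (subst mult_entry[OF x y row_finite[OF x] subset_refl]) simp
  qed
  then have "{(a, b). (x \<otimes>\<^bsub>A\<^esub> y) (a, b) \<noteq> nul b a} \<subseteq> fst ` ?sx \<times> snd ` ?sy"
    by auto
  then have "finite {(a, b). (x \<otimes>\<^bsub>A\<^esub> y) (a, b) \<noteq> nul b a}"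
    by (rule finite_subset) (use x y in \<open>simp add: carrier_A\<close>)
  then show ?thesis
    using e by (simp add: carrier_A)
qed

lemma mult_add_left:
  assumes x: "x \<in> carrier A" and x': "x' \<in> carrier A" and y: "y \<in> carrier A"
  shows "(x \<oplus>\<^bsub>A\<^esub> x') \<otimes>\<^bsub>A\<^esub> y = x \<otimes>\<^bsub>A\<^esub> y \<oplus>\<^bsub>A\<^esub> x' \<otimes>\<^bsub>A\<^esub> y"
proof (rule entry_ext)
  fix a b
  let ?F = "{c. x (a, c) \<noteq> nul c a} \<union> {c. x' (a, c) \<noteq> nul c a}"
  have F: "finite ?F"
    using row_finite x x' by auto
  have "((x \<oplus>\<^bsub>A\<^esub> x') \<otimes>\<^bsub>A\<^esub> y) (a, b)
      = (\<Oplus>\<^bsub>hom_sp C b a\<^esub> c \<in> ?F. cmp C b c a ((x \<oplus>\<^bsub>A\<^esub> x') (a, c)) (y (c, b)))"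
    using x x' y F by (intro mult_entry) auto
  also have "\<dots> = (\<Oplus>\<^bsub>hom_sp C b a\<^esub> c \<in> ?F. cmp C b c a (x (a, c)) (y (c, b)) \<oplus>\<^bsub>hom_sp C b a\<^esub>
      cmp C b c a (x' (a, c)) (y (c, b)))"
    using x x' y by (intro hom.add.finprod_cong') (auto simp: cmp_add_left)
  also have "\<dots> = (x \<otimes>\<^bsub>A\<^esub> y) (a, b) \<oplus>\<^bsub>hom_sp C b a\<^esub> (x' \<otimes>\<^bsub>A\<^esub> y) (a, b)"
    using x x' y F by (subst hom.finsum_addf) (auto simp: mult_entry[where F = ?F])
  finally show "((x \<oplus>\<^bsub>A\<^esub> x') \<otimes>\<^bsub>A\<^esub> y) (a, b) = (x \<otimes>\<^bsub>A\<^esub> y \<oplus>\<^bsub>A\<^esub> x' \<otimes>\<^bsub>A\<^esub> y) (a, b)"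
    by simp
qed

lemma mult_add_right:
  assumes x: "x \<in> carrier A" and y: "y \<in> carrier A" and y': "y' \<in> carrier A"
  shows "x \<otimes>\<^bsub>A\<^esub> (y \<oplus>\<^bsub>A\<^esub> y') = x \<otimes>\<^bsub>A\<^esub> y \<oplus>\<^bsub>A\<^esub> x \<otimes>\<^bsub>A\<^esub> y'"
proof (rule entry_ext)
  fix a b
  let ?F = "{c. x (a, c) \<noteq> nul c a}"
  have F: "finite ?F"
    using row_finite x by auto
  have "(x \<otimes>\<^bsub>A\<^esub> (y \<oplus>\<^bsub>A\<^esub> y')) (a, b)
      = (\<Oplus>\<^bsub>hom_sp C b a\<^esub> c \<in> ?F. cmp C b c a (x (a, c)) ((y \<oplus>\<^bsub>A\<^esub> y') (c, b)))"
    using x y y' F by (intro mult_entry) auto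
  also have "\<dots> = (\<Oplus>\<^bsub>hom_sp C b a\<^esub> c \<in> ?F. cmp C b c a (x (a, c)) (y (c, b)) \<oplus>\<^bsub>hom_sp C b a\<^esub>
      cmp C b c a (x (a, c)) (y' (c, b)))"
    using x y y' by (intro hom.add.finprod_cong') (auto simp: cmp_add_right)
  also have "\<dots> = (x \<otimes>\<^bsub>A\<^esub> y) (a, b) \<oplus>\<^bsub>hom_sp C b a\<^esub> (x \<otimes>\<^bsub>A\<^esub> y') (a, b)"
    using x y y' F by (subst hom.finsum_addf) (auto simp: mult_entry[where F = ?F])
  finally show "(x \<otimes>\<^bsub>A\<^esub> (y \<oplus>\<^bsub>A\<^esub> y')) (a, b) = (x \<otimes>\<^bsub>A\<^esub> y \<oplus>\<^bsub>A\<^esub> x \<otimes>\<^bsub>A\<^esub> y') (a, b)"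
    by simp
qed

lemma mult_unit_unit:
  assumes "f \<in> mor C b a" "g \<in> mor C d c"
  shows "unit a b f \<otimes>\<^bsub>A\<^esub> unit c d g = (if b = c then unit a d (cmp C d b a f g) else \<zero>\<^bsub>A\<^esub>)"
proof (rule entry_ext)
  fix a' d'
  have "(unit a b f \<otimes>\<^bsub>A\<^esub> unit c d g) (a', d') = cmp C d' b a' (unit a b f (a', b)) (unit c d g (b, d'))"
    using assms by (intro mult_entry_single) (auto simp: unit_entry)
  then show "(unit a b f \<otimes>\<^bsub>A\<^esub> unit c d g) (a', d')
      = (if b = c then unit a d (cmp C d b a f g) else \<zero>\<^bsub>A\<^esub>) (a', d')"
    using assms by (auto simp: unit_entry)
qed

lemma mult_zero_left [simp]: "y \<in> carrier A \<Longrightarrow> \<zero>\<^bsub>A\<^esub> \<otimes>\<^bsub>A\<^esub> y = \<zero>\<^bsub>A\<^esub>"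
  by (rule entry_ext) (subst mult_entry[where F = "{}"], auto)

lemma mult_zero_right [simp]: "x \<in> carrier A \<Longrightarrow> x \<otimes>\<^bsub>A\<^esub> \<zero>\<^bsub>A\<^esub> = \<zero>\<^bsub>A\<^esub>"
proof (rule entry_ext)
  fix a b
  assume x: "x \<in> carrier A"
  show "(x \<otimes>\<^bsub>A\<^esub> \<zero>\<^bsub>A\<^esub>) (a, b) = \<zero>\<^bsub>A\<^esub> (a, b)"
    using x by (subst mult_entry[OF x _ row_finite[OF x] subset_refl]) simp_all
qed

lemma mult_smult_left:
  assumes x: "x \<in> carrier A" and y: "y \<in> carrier A"
  shows "(r \<odot>\<^bsub>A\<^esub> x) \<otimes>\<^bsub>A\<^esub> y = r \<odot>\<^bsub>A\<^esub> (x \<otimes>\<^bsub>A\<^esub> y)"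
  using x y
proof (induction x rule: carrier_induct)
  case zero
  then show ?case by (simp add: alg.scale_zero_right)
next
  case (add x x')
  then show ?case by (simp add: alg.scale_add_right mult_add_left alg.scale_closed)
next
  case (unit a b f)
  show ?case
    using unit(2)
  proof (induction y rule: carrier_induct)
    case zero
    then show ?case using unit(1) by (simp add: alg.scale_zero_right alg.scale_closed)
  next
    case (add y y')
    then show ?case using unit(1) by (simp add: alg.scale_add_right mult_add_right alg.scale_closed)
  next
    case (unit c d g)
    with \<open>f \<in> mor C b a\<close> show ?case
      by (cases "b = c")
        (simp_all add: unit_smult[symmetric] mult_unit_unit hom.scale_closed cmp_smult_left alg.scale_zero_right)
  qed
qed

lemma mult_smult_right:
  assumes x: "x \<in> carrier A" and y: "y \<in> carrier A"
  shows "x \<otimes>\<^bsub>A\<^esub> (r \<odot>\<^bsub>A\<^esub> y) = r \<odot>\<^bsub>A\<^esub> (x \<otimes>\<^bsub>A\<^esub> y)"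
  using x y
proof (induction x rule: carrier_induct)
  case zero
  then show ?case by (simp add: alg.scale_zero_right alg.scale_closed)
next
  case (add x x')
  then show ?case by (simp add: alg.scale_add_right mult_add_left alg.scale_closed)
next
  case (unit a b f)
  show ?case
    using unit(2)
  proof (induction y rule: carrier_induct)
    case zero
    then show ?case using unit(1) by (simp add: alg.scale_zero_right)
  next
    case (add y y')
    then show ?case using unit(1) by (simp add: alg.scale_add_right mult_add_right alg.scale_closed)
  next
    case (unit c d g)
    with \<open>f \<in> mor C b a\<close> show ?case
      by (cases "b = c")
        (simp_all add: unit_smult[symmetric] mult_unit_unit hom.scale_closed cmp_smult_right alg.scale_zero_right)
  qed
qed

lemma mult_assoc:
  assumes "x \<in> carrier A" "y \<in> carrier A" "z \<in> carrier A"
  shows "(x \<otimes>\<^bsub>A\<^esub> y) \<otimes>\<^bsub>A\<^esub> z = x \<otimes>\<^bsub>A\<^esub> (y \<otimes>\<^bsub>A\<^esub> z)"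
  using assms
proof (induction x rule: carrier_induct)
  case (add x x')
  then show ?case by (simp add: mult_add_left)
next
  case x: (unit a b f)
  show ?case
    using x(2,1,3)
  proof (induction y rule: carrier_induct)
    case (add y y')
    then show ?case by (simp add: mult_add_left mult_add_right)
  next
    case y: (unit c d g)
    show ?case
      using y(3,1,2)
    proof (induction z rule: carrier_induct)
      case (add z z')
      then show ?case by (simp add: mult_add_right)
    next
      case (unit c' d' h)
      then show ?case
        by (cases "b = c"; cases "d = c'") (simp_all add: mult_unit_unit cmp_assoc)
    qed simp
  qed simp
qed simp

lemma mult_idem_right:
  assumes x: "x \<in> carrier A"
  shows "x \<otimes>\<^bsub>A\<^esub> idem C b = (\<lambda>(a, c). if c = b then x (a, c) else nul c a)"
  using x
proof (induction x rule: carrier_induct)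
  case zero
  show ?case by (intro entry_ext) simp
next
  case (unit c d f)
  then show ?case
    by (intro entry_ext) (auto simp: idem_eq_unit mult_unit_unit unit_entry)
next
  case (add x y)
  then show ?case
    by (intro entry_ext) (auto simp: mult_add_left)
qed

lemma mult_idem_left:
  assumes x: "x \<in> carrier A"
  shows "idem C b \<otimes>\<^bsub>A\<^esub> x = (\<lambda>(a, c). if a = b then x (a, c) else nul c a)"
  using x
proof (induction x rule: carrier_induct)
  case zero
  show ?case by (intro entry_ext) simp
next
  case (unit c d f)
  then show ?case
    by (intro entry_ext) (auto simp: idem_eq_unit mult_unit_unit unit_entry)
next
  case (add x y)
  then show ?case
    by (intro entry_ext) (auto simp: mult_add_right)
qed

lemma idem_mult_idem:
  assumes x: "x \<in> carrier A"
  shows "idem C a \<otimes>\<^bsub>A\<^esub> (x \<otimes>\<^bsub>A\<^esub> idem C b) = unit a b (x (a, b))"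
  using x by (intro entry_ext) (simp add: mult_idem_left, simp add: mult_idem_right unit_entry)

lemma corner_blocks:
  assumes H: "\<And>a b. subspace class_ring (H a b) (hom_sp C b a)"
  shows "corner_obj C a (blocks H) b = unit a b ` H a b"
proof (intro equalityI subsetI)
  fix x
  assume "x \<in> corner_obj C a (blocks H) b"
  then obtain y where "y \<in> blocks H" "x = idem C a \<otimes>\<^bsub>A\<^esub> (y \<otimes>\<^bsub>A\<^esub> idem C b)"
    by (auto simp: corner_def)
  then show "x \<in> unit a b ` H a b"
    by (simp add: blocks_def idem_mult_idem)
next
  fix x
  assume "x \<in> unit a b ` H a b"
  then obtain f where f: "f \<in> H a b" "x = unit a b f"
    by auto
  then have u: "unit a b f \<in> blocks H"
    using unit_blocks[OF H] by auto
  then have "x = idem C a \<otimes>\<^bsub>A\<^esub> (unit a b f \<otimes>\<^bsub>A\<^esub> idem C b)"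
    by (simp add: f(2) idem_mult_idem blocks_carrier unit_entry)
  then show "x \<in> corner_obj C a (blocks H) b"
    using u by (auto simp: corner_def)
qed

lemma idem_class_singleton: "idem_class C {a} = idem C a"
  by (simp add: idem_class_def)

text \<open>A finite sum of corner elements at distinct places has their morphisms as its entries,
  so a vanishing sum has vanishing terms. The index set \<open>S\<close> may omit places where
  \<open>H\<close> is zero, as the middle part does off the diagonal.\<close>

lemma direct_sum_blocks:
  assumes H: "\<And>a b. subspace class_ring (H a b) (hom_sp C b a)"
    and S: "\<And>a b. (a, b) \<notin> S \<Longrightarrow> H a b = {nul b a}"
  shows "internal_direct_sum A S (\<lambda>(a, b). corner_obj C a (blocks H) b) (blocks H)"
proof -
  interpret H: subspace_coset "hom_sp C b a" "H a b" for a b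
    by (simp add: subspace_coset_def H)
  let ?W = "\<lambda>(a, b). corner_obj C a (blocks H) b"
  have W: "?W = (\<lambda>(a, b). unit a b ` H a b)"
    using corner_blocks[OF H] by auto
  have repr: "\<exists>f. finsum A w F = (\<lambda>(a, b). if (a, b) \<in> F then f (a, b) else nul b a) \<and>
      (\<forall>(a, b)\<in>F. w (a, b) = unit a b (f (a, b)) \<and> f (a, b) \<in> H a b)"
    if F: "finite F" "\<forall>p\<in>F. w p \<in> ?W p" for F w
  proof -
    have "\<exists>f. w p = unit (fst p) (snd p) f \<and> f \<in> H (fst p) (snd p)" if "p \<in> F" for p
      using F(2)[rule_format, OF that] by (cases p) (auto simp: W)
    then obtain f where f: "\<forall>p\<in>F. w p = unit (fst p) (snd p) (f p) \<and> f p \<in> H (fst p) (snd p)"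
      by metis
    have "finsum A w F = finsum A (\<lambda>(a, b). unit a b (f (a, b))) F"
      using f H.W_carrier by (intro alg.finsum_cong') auto
    also have "\<dots> = (\<lambda>(a, b). if (a, b) \<in> F then f (a, b) else nul b a)"
      using F f H.W_carrier by (intro finsum_unit) auto
    finally show ?thesis
      using f by (intro exI[of _ f] conjI) auto
  qed
  show ?thesis
    unfolding internal_direct_sum_def
  proof (intro conjI allI impI)
    show "blocks H = internal_sum A S ?W"
    proof (intro equalityI subsetI)
      fix x
      assume x: "x \<in> blocks H"
      let ?F = "{(a, b). x (a, b) \<noteq> nul b a}"
      have "?F \<subseteq> S"
        using S x unfolding blocks_def by blast
      moreover have "finsum A (\<lambda>(a, b). unit a b (x (a, b))) ?F = x" "finite ?F"
        using blocks_carrier[OF x] by (auto simp: carrier_A intro!: entries_finsum)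
      ultimately show "x \<in> internal_sum A S ?W"
        unfolding internal_sum_def W using x
        by (intro CollectI exI[of _ "\<lambda>(a, b). unit a b (x (a, b))"] exI[of _ ?F]) (auto simp: blocks_def)
    next
      fix x
      assume "x \<in> internal_sum A S ?W"
      then obtain w F where F: "finite F" "\<forall>p\<in>F. w p \<in> ?W p" and x: "x = finsum A w F"
        by (auto simp: internal_sum_def)
      obtain f where f: "finsum A w F = (\<lambda>(a, b). if (a, b) \<in> F then f (a, b) else nul b a)"
          "\<forall>(a, b)\<in>F. w (a, b) = unit a b (f (a, b)) \<and> f (a, b) \<in> H a b"
        using repr[OF F] by blast
      have "x \<in> carrier A"
        unfolding x using F(2) H.W_carrier by (intro alg.finsum_closed) (auto simp: W)
      then show "x \<in> blocks H"
        using f by (auto simp: blocks_def x)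
    qed
  next
    fix F w
    assume *: "finite F \<and> F \<subseteq> S \<and> (\<forall>p\<in>F. w p \<in> ?W p) \<and> finsum A w F = \<zero>\<^bsub>A\<^esub>"
    then obtain f where f: "finsum A w F = (\<lambda>(a, b). if (a, b) \<in> F then f (a, b) else nul b a)"
        "\<forall>(a, b)\<in>F. w (a, b) = unit a b (f (a, b)) \<and> f (a, b) \<in> H a b"
      using repr[of F w] by blast
    show "\<forall>p\<in>F. w p = \<zero>\<^bsub>A\<^esub>"
    proof
      fix p
      assume p: "p \<in> F"
      obtain a b where ab: "p = (a, b)"
        by (cases p)
      have "finsum A w F (a, b) = \<zero>\<^bsub>A\<^esub> (a, b)"
        using * by simp
      then have "f (a, b) = nul b a"
        using p ab by (simp add: f(1))
      then show "w p = \<zero>\<^bsub>A\<^esub>"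
        using f(2) p ab by auto
    qed
  qed
qed

end

section \<open>Weakly triangular decompositions from bases\<close>

lemma lookup_free_scale: "Poly_Mapping.lookup (free_scale r p) t = r * Poly_Mapping.lookup p t"
  by (simp add: free_scale_def Poly_Mapping.map.rep_eq when_def)

lemma free_scale_sum: "free_scale r (\<Sum>i\<in>F. p i) = (\<Sum>i\<in>F. free_scale r (p i))"
  by (rule poly_mapping_eqI) (simp add: lookup_free_scale lookup_sum sum_distrib_left)

lemma free_scale_diff: "free_scale r (p - q) = free_scale r p - free_scale r q"
  by (rule poly_mapping_eqI) (simp add: lookup_free_scale lookup_minus algebra_simps)

lemma free_scale_scale: "free_scale r (free_scale s p) = free_scale (r * s) p"
  by (rule poly_mapping_eqI) (simp add: lookup_free_scale mult.assoc)

lemma minus_eq_free_scale: "p - q = p + free_scale (- 1) q"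
  by (rule poly_mapping_eqI) (simp add: lookup_free_scale lookup_add lookup_minus)

lemma free_scale_zero [simp]: "free_scale 0 p = 0"
  by (rule poly_mapping_eqI) (simp add: lookup_free_scale)

lemma poly_mapping_eq_sum_free_gen:
  "p = (\<Sum>t\<in>Poly_Mapping.keys p. free_scale (Poly_Mapping.lookup p t) (free_gen t))"
proof (rule poly_mapping_eqI)
  fix s
  have "(\<Sum>t\<in>Poly_Mapping.keys p. Poly_Mapping.lookup p t * Poly_Mapping.lookup (free_gen t) s)
      = (\<Sum>t\<in>Poly_Mapping.keys p. if t = s then Poly_Mapping.lookup p s else 0)"
    by (intro sum.cong) (auto simp: lookup_single when_def)
  also have "\<dots> = Poly_Mapping.lookup p s"
    by (simp add: sum.delta' in_keys_iff)
  finally show "Poly_Mapping.lookup p s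
      = Poly_Mapping.lookup (\<Sum>t\<in>Poly_Mapping.keys p. free_scale (Poly_Mapping.lookup p t) (free_gen t)) s"
    by (simp add: lookup_sum lookup_free_scale)
qed

lemma free_space_add: "p \<in> free_space T \<Longrightarrow> q \<in> free_space T \<Longrightarrow> p + q \<in> free_space T"
  using Poly_Mapping.keys_add[of p q] by (auto simp: free_space_def)

lemma free_space_scale: "p \<in> free_space T \<Longrightarrow> free_scale r p \<in> free_space T"
  by (auto simp: free_space_def in_keys_iff lookup_free_scale)

lemma free_space_diff: "p \<in> free_space T \<Longrightarrow> q \<in> free_space T \<Longrightarrow> p - q \<in> free_space T"
  by (simp add: minus_eq_free_scale free_space_add free_space_scale)

lemma free_space_gen: "t \<in> T \<Longrightarrow> free_gen t \<in> free_space T"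
  by (auto simp: free_space_def in_keys_iff lookup_single when_def)

lemma free_space_zero: "0 \<in> free_space T"
  by (simp add: free_space_def)

lemma free_space_sum: "(\<And>i. i \<in> F \<Longrightarrow> p i \<in> free_space T) \<Longrightarrow> (\<Sum>i\<in>F. p i) \<in> free_space T"
  by (induction F rule: infinite_finite_induct) (auto intro: free_space_add free_space_zero)

context total_category
begin

lemma idem_alg_induct [consumes 1, case_names zero line add]:
  assumes "e \<in> idem_alg C" "P \<zero>\<^bsub>A\<^esub>" "\<And>r b. P (r \<odot>\<^bsub>A\<^esub> idem C b)"
    and "\<And>x y. x \<in> carrier A \<Longrightarrow> y \<in> carrier A \<Longrightarrow> P x \<Longrightarrow> P y \<Longrightarrow> P (x \<oplus>\<^bsub>A\<^esub> y)"
  shows "e \<in> carrier A" "P e"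
proof -
  obtain w F where F: "finite F" "\<forall>i\<in>F. w i \<in> line A (idem C i)" and e: "e = finsum A w F"
    using assms(1) by (auto simp: idem_alg_def internal_sum_def)
  have "finsum A w F \<in> carrier A \<and> P (finsum A w F)"
    using F
  proof (induction F rule: finite_induct)
    case (insert i F)
    have w: "w j \<in> carrier A" if "j \<in> insert i F" for j
      using insert.prems that by (auto simp: line_def alg.scale_closed)
    then have "finsum A w (insert i F) = w i \<oplus>\<^bsub>A\<^esub> finsum A w F"
      using insert.hyps by (intro alg.finsum_insert) auto
    moreover have "P (w i)"
      using insert.prems assms(3) by (auto simp: line_def)
    ultimately show ?case
      using insert.IH insert.prems w assms(4) by simp
  qed (simp add: assms(2))
  then show "e \<in> carrier A" "P e"
    by (simp_all add: e)
qed

text \<open>An idempotent erases all but one column or row of \<open>x\<close>, and zero entries are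
  always allowed.\<close>

lemma blocks_mult_idem:
  assumes "\<And>a b. nul b a \<in> H a b" "x \<in> blocks H"
  shows "x \<otimes>\<^bsub>A\<^esub> idem C b \<in> blocks H" "idem C b \<otimes>\<^bsub>A\<^esub> x \<in> blocks H"
proof -
  have x: "x \<in> carrier A" "\<And>a b. x (a, b) \<in> H a b"
    using assms(2) by (auto simp: blocks_def)
  have "(x \<otimes>\<^bsub>A\<^esub> idem C b) (a, c) \<in> H a c" "(idem C b \<otimes>\<^bsub>A\<^esub> x) (a, c) \<in> H a c" for a c
    using x(2) assms(1) by (simp_all add: mult_idem_right[OF x(1)] mult_idem_left[OF x(1)])
  then show "x \<otimes>\<^bsub>A\<^esub> idem C b \<in> blocks H" "idem C b \<otimes>\<^bsub>A\<^esub> x \<in> blocks H"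
    using x(1) by (simp_all add: blocks_def)
qed

text \<open>Balancing moves elements of the idempotent subalgebra across the tensor sign, so the
  parts must be stable under it on both sides.\<close>

lemma blocks_mult_idem_alg:
  assumes H: "\<And>a b. subspace class_ring (H a b) (hom_sp C b a)"
    and x: "x \<in> blocks H" and e: "e \<in> idem_alg C"
  shows "x \<otimes>\<^bsub>A\<^esub> e \<in> blocks H" "e \<otimes>\<^bsub>A\<^esub> x \<in> blocks H"
proof -
  interpret H: subspace_coset "hom_sp C b a" "H a b" for a b
    by (simp add: subspace_coset_def H)
  interpret B: subspace_coset A "blocks H"
    by (simp add: subspace_coset_def blocks_subspace[OF H])
  have x': "x \<in> carrier A"
    by (rule blocks_carrier[OF x])
  have "x \<otimes>\<^bsub>A\<^esub> e \<in> blocks H \<and> e \<otimes>\<^bsub>A\<^esub> x \<in> blocks H"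
    using e
  proof (induction e rule: idem_alg_induct(2))
    case (line r b)
    have "x \<otimes>\<^bsub>A\<^esub> idem C b \<in> blocks H" "idem C b \<otimes>\<^bsub>A\<^esub> x \<in> blocks H"
      using blocks_mult_idem[OF _ x] H.sub.zero_closed by blast+
    then show ?case
      using x' by (simp add: mult_smult_left mult_smult_right B.sub.smult_closed)
  qed (use x' in \<open>simp_all add: mult_add_left mult_add_right\<close>)
  then show "x \<otimes>\<^bsub>A\<^esub> e \<in> blocks H" "e \<otimes>\<^bsub>A\<^esub> x \<in> blocks H"
    by auto
qed

lemma multiply3_eq:
  assumes "finite F" "Poly_Mapping.keys p \<subseteq> F" "F \<subseteq> carrier A \<times> carrier A \<times> carrier A"
  shows "multiply3 A p = (\<Oplus>\<^bsub>A\<^esub> t \<in> F. Poly_Mapping.lookup p t \<odot>\<^bsub>A\<^esub>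
    (case t of (x, y, z) \<Rightarrow> x \<otimes>\<^bsub>A\<^esub> (y \<otimes>\<^bsub>A\<^esub> z)))"
  unfolding multiply3_def
  using assms by (intro alg.add.finprod_mono_neutral_cong_left)
    (auto simp: in_keys_iff alg.scale_zero alg.scale_closed)

abbreviation free_A where "free_A \<equiv> free_space (carrier A \<times> carrier A \<times> carrier A)"

lemma multiply3_closed: "p \<in> free_A \<Longrightarrow> multiply3 A p \<in> carrier A"
  unfolding multiply3_def by (intro alg.finsum_closed) (auto simp: free_space_def alg.scale_closed)

lemma multiply3_add:
  assumes p: "p \<in> free_A" and q: "q \<in> free_A"
  shows "multiply3 A (p + q) = multiply3 A p \<oplus>\<^bsub>A\<^esub> multiply3 A q"
proof -
  let ?F = "Poly_Mapping.keys p \<union> Poly_Mapping.keys q"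
  let ?m = "\<lambda>(x, y, z). x \<otimes>\<^bsub>A\<^esub> (y \<otimes>\<^bsub>A\<^esub> z)"
  have F: "?F \<subseteq> carrier A \<times> carrier A \<times> carrier A"
    using p q by (auto simp: free_space_def)
  then have "multiply3 A (p + q) = (\<Oplus>\<^bsub>A\<^esub> t \<in> ?F. Poly_Mapping.lookup p t \<odot>\<^bsub>A\<^esub> ?m t \<oplus>\<^bsub>A\<^esub>
      Poly_Mapping.lookup q t \<odot>\<^bsub>A\<^esub> ?m t)"
    using Poly_Mapping.keys_add[of p q]
    by (subst multiply3_eq[where F = ?F])
      (auto intro!: alg.finsum_cong' simp: lookup_add alg.scale_add_left alg.scale_closed)
  also have "\<dots> = multiply3 A p \<oplus>\<^bsub>A\<^esub> multiply3 A q"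
    using F by (subst alg.finsum_addf) (auto simp: multiply3_eq[where F = ?F] alg.scale_closed)
  finally show ?thesis .
qed

lemma multiply3_scale:
  assumes p: "p \<in> free_A"
  shows "multiply3 A (free_scale r p) = r \<odot>\<^bsub>A\<^esub> multiply3 A p"
proof -
  let ?F = "Poly_Mapping.keys p"
  let ?m = "\<lambda>(x, y, z). x \<otimes>\<^bsub>A\<^esub> (y \<otimes>\<^bsub>A\<^esub> z)"
  have F: "?F \<subseteq> carrier A \<times> carrier A \<times> carrier A"
    using p by (auto simp: free_space_def)
  then have "multiply3 A (free_scale r p) = (\<Oplus>\<^bsub>A\<^esub> t \<in> ?F. r \<odot>\<^bsub>A\<^esub> (Poly_Mapping.lookup p t \<odot>\<^bsub>A\<^esub> ?m t))"
    by (subst multiply3_eq[where F = ?F])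
      (auto intro!: alg.finsum_cong' simp: lookup_free_scale in_keys_iff alg.scale_scale alg.scale_closed)
  also have "\<dots> = r \<odot>\<^bsub>A\<^esub> multiply3 A p"
    using F by (subst alg.finsum_smult[symmetric]) (auto simp: multiply3_eq[where F = ?F] alg.scale_closed)
  finally show ?thesis .
qed

lemma multiply3_diff:
  assumes "p \<in> free_A" "q \<in> free_A"
  shows "multiply3 A (p - q) = multiply3 A p \<ominus>\<^bsub>A\<^esub> multiply3 A q"
  using assms
  by (simp add: minus_eq_free_scale multiply3_add multiply3_scale free_space_scale alg.minus_eq_scale
      multiply3_closed)

lemma multiply3_gen:
  assumes "x \<in> carrier A" "y \<in> carrier A" "z \<in> carrier A"
  shows "multiply3 A (free_gen (x, y, z)) = x \<otimes>\<^bsub>A\<^esub> (y \<otimes>\<^bsub>A\<^esub> z)"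
  using assms by (subst multiply3_eq[where F = "{(x, y, z)}"]) (auto simp: alg.scale_one split: if_splits)

lemma multiply3_sum:
  assumes "finite F" "\<And>i. i \<in> F \<Longrightarrow> p i \<in> free_A"
  shows "multiply3 A (\<Sum>i\<in>F. p i) = (\<Oplus>\<^bsub>A\<^esub> i \<in> F. multiply3 A (p i))"
  using assms
proof (induction F rule: finite_induct)
  case empty
  show ?case
    by (simp add: multiply3_def)
next
  case (insert i F)
  then have "multiply3 A (\<Sum>i\<in>insert i F. p i) = multiply3 A (p i) \<oplus>\<^bsub>A\<^esub> multiply3 A (\<Sum>i\<in>F. p i)"
    by (simp add: multiply3_add free_space_sum)
  also have "\<dots> = (\<Oplus>\<^bsub>A\<^esub> i \<in> insert i F. multiply3 A (p i))"
    using insert by (subst alg.finsum_insert) (auto simp: multiply3_closed)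
  finally show ?case .
qed

lemma finsum_entry:
  assumes "finite F" "\<And>i. i \<in> F \<Longrightarrow> w i \<in> carrier A"
  shows "finsum A w F (a, b) = (\<Oplus>\<^bsub>hom_sp C b a\<^esub> i \<in> F. w i (a, b))"
  using assms
proof (induction F rule: finite_induct)
  case (insert i F)
  have "finsum A w (insert i F) = w i \<oplus>\<^bsub>A\<^esub> finsum A w F"
    using insert by (intro alg.finsum_insert) auto
  moreover have "(\<Oplus>\<^bsub>hom_sp C b a\<^esub> i \<in> insert i F. w i (a, b))
      = w i (a, b) \<oplus>\<^bsub>hom_sp C b a\<^esub> (\<Oplus>\<^bsub>hom_sp C b a\<^esub> i \<in> F. w i (a, b))"
    using insert by (intro hom.finsum_insert) auto
  ultimately show ?case
    using insert by simp
qed simp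

end

section \<open>A criterion: triples of basis elements with spanning and independent products\<close>

type_synonym ('j, 'm) product_index = "('j \<times> 'j) \<times> ('j \<times> 'm \<times> 'm \<times> 'm)"

lemma (in class_vectorspace) add_minus_add:
  "x \<in> carrier V \<Longrightarrow> y \<in> carrier V \<Longrightarrow> x \<oplus> (y \<oplus> (\<ominus> x \<oplus> \<ominus> y)) = \<zero>"
  using a_lcomm[of y "\<ominus> x" "\<ominus> y"] by (simp add: r_neg)

lemma (in class_vectorspace) minus_eq_zero_iff:
  "x \<in> carrier V \<Longrightarrow> y \<in> carrier V \<Longrightarrow> x \<ominus> y = \<zero> \<longleftrightarrow> x = y"
  by (metis a_inv_closed a_minus_def minus_equality minus_minus r_neg)

text \<open>What a linear category has to provide. Elements of \<open>Bm b c\<close> go from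
  \<open>c\<close> to \<open>b\<close>, those of \<open>Bp c a\<close> from \<open>a\<close> to
  \<open>c\<close>; equality will be the equivalence relation on objects. Independence refers to the
  family of quadruples, not to the set of its products, so it includes that distinct quadruples have
  distinct products.\<close>

locale triangular_data = total_category C
  for C :: "('j::order, 'm, 'k::field, 'z) lincat_scheme" +
  fixes Bm :: "'j \<Rightarrow> 'j \<Rightarrow> 'm set" and Bo :: "'j \<Rightarrow> 'm set" and Bp :: "'j \<Rightarrow> 'j \<Rightarrow> 'm set"
  assumes finite_below: "finite {b::'j. b \<le> a}"
    and Bm_closed: "Bm b c \<subseteq> mor C c b"
    and Bo_closed: "Bo c \<subseteq> mor C c c"
    and Bp_closed: "Bp c a \<subseteq> mor C a c"
    and Bm_order: "Bm b c \<noteq> {} \<Longrightarrow> c \<le> b"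
    and Bp_order: "Bp c a \<noteq> {} \<Longrightarrow> c \<le> a"
    and Bm_diag: "Bm b b = {idm C b}"
    and Bp_diag: "Bp b b = {idm C b}"
    and fin_dim_hom: "vectorspace.fin_dim class_ring (hom_sp C a b)"
    and products_span: "mor C a b \<subseteq> hom.span a b
      ((\<lambda>(c, f, g, h). cmp C a c b f (cmp C a c c g h)) ` (SIGMA c:UNIV. Bm b c \<times> Bo c \<times> Bp c a))"
    and products_indep: "\<lbrakk>finite F; F \<subseteq> (SIGMA c:UNIV. Bm b c \<times> Bo c \<times> Bp c a);
      (\<Oplus>\<^bsub>hom_sp C a b\<^esub> t\<in>F. l t \<odot>\<^bsub>hom_sp C a b\<^esub>
        (case t of (c, f, g, h) \<Rightarrow> cmp C a c b f (cmp C a c c g h))) = \<zero>\<^bsub>hom_sp C a b\<^esub>; t \<in> F\<rbrakk>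
      \<Longrightarrow> l t = 0"
begin

text \<open>Extended by the empty set off the diagonal, so that the middle part is given by a family
  on pairs like the other two.\<close>

definition Bo' :: "'j \<Rightarrow> 'j \<Rightarrow> 'm set" where
  "Bo' b c = (if b = c then Bo b else {})"

abbreviation Am where "Am \<equiv> blocks (\<lambda>b c. hom.span c b (Bm b c))"
abbreviation Ao where "Ao \<equiv> blocks (\<lambda>b c. hom.span c b (Bo' b c))"
abbreviation Ap where "Ap \<equiv> blocks (\<lambda>b c. hom.span c b (Bp b c))"

lemma Bo'_closed: "Bo' b c \<subseteq> mor C c b"
  using Bo_closed by (simp add: Bo'_def)

lemmas span_Bm = hom.span_is_subspace[OF Bm_closed]
lemmas span_Bo' = hom.span_is_subspace[OF Bo'_closed]
lemmas span_Bp = hom.span_is_subspace[OF Bp_closed]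

lemma unit_Am: "f \<in> Bm b c \<Longrightarrow> unit b c f \<in> Am"
  by (rule unit_blocks[OF span_Bm]) (use hom.in_own_span[OF Bm_closed] in blast)

lemma unit_Ao: "g \<in> Bo c \<Longrightarrow> unit c c g \<in> Ao"
  by (rule unit_blocks[OF span_Bo']) (use hom.in_own_span[OF Bo'_closed[of c c]] in \<open>auto simp: Bo'_def\<close>)

lemma unit_Ap: "h \<in> Bp c a \<Longrightarrow> unit c a h \<in> Ap"
  by (rule unit_blocks[OF span_Bp]) (use hom.in_own_span[OF Bp_closed] in blast)

abbreviation K where "K \<equiv> idem_alg C"
abbreviation free where "free \<equiv> free_space (Am \<times> Ao \<times> Ap)"
abbreviation tnull where "tnull \<equiv> tensor_null A K Am Ao Ap"

lemma free_subset: "p \<in> free \<Longrightarrow> p \<in> free_A"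
  using blocks_carrier by (force simp: free_space_def)

sublocale Am: subspace_coset A Am
  by (simp add: subspace_coset_def blocks_subspace[OF span_Bm])

sublocale Ao: subspace_coset A Ao
  by (simp add: subspace_coset_def blocks_subspace[OF span_Bo'])

sublocale Ap: subspace_coset A Ap
  by (simp add: subspace_coset_def blocks_subspace[OF span_Bp])

lemmas mult_K = blocks_mult_idem_alg[OF span_Bm] blocks_mult_idem_alg[OF span_Bo']
  blocks_mult_idem_alg[OF span_Bp]

lemma tnull_free: "p \<in> tnull \<Longrightarrow> p \<in> free"
  by (induction rule: tensor_null.induct)
    (auto intro!: free_space_zero free_space_add free_space_scale free_space_diff free_space_gen
      intro: mult_K Am.sub.m_closed Ao.sub.m_closed Ap.sub.m_closed
        Am.sub.smult_closed Ao.sub.smult_closed Ap.sub.smult_closed)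

text \<open>Multiplication is linear in each argument and associative, which is all that the
  relations ask for.\<close>

lemma tnull_multiply3: "p \<in> tnull \<Longrightarrow> multiply3 A p = \<zero>\<^bsub>A\<^esub>"
proof (induction rule: tensor_null.induct)
  case 1
  show ?case by (simp add: multiply3_def)
next
  case (2 p q)
  then show ?case
    by (simp add: multiply3_add free_subset[OF tnull_free])
next
  case (3 p r)
  then show ?case
    by (simp add: multiply3_scale free_subset[OF tnull_free] alg.scale_zero_right)
qed (auto simp: multiply3_diff multiply3_scale multiply3_gen free_space_gen free_space_diff free_space_scale
    blocks_carrier mult_add_left mult_add_right mult_smult_left mult_smult_right mult_assoc
    alg.scale_closed idem_alg_induct(1)[where P = "\<lambda>_. True"] alg.add.inv_mult_group
    alg.minus_eq alg.a_assoc alg.minus_add alg.add_minus_add alg.r_neg)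

definition products :: "'j \<Rightarrow> 'j \<Rightarrow> ('j \<times> 'm \<times> 'm \<times> 'm) set" where
  "products b a = (SIGMA c:UNIV. Bm b c \<times> Bo c \<times> Bp c a)"

definition product :: "'j \<Rightarrow> 'j \<Rightarrow> 'j \<times> 'm \<times> 'm \<times> 'm \<Rightarrow> 'm" where
  "product b a = (\<lambda>(c, f, g, h). cmp C a c b f (cmp C a c c g h))"

definition generator :: "('j, 'm) product_index \<Rightarrow> ('j \<times> 'j \<Rightarrow> 'm) \<times> ('j \<times> 'j \<Rightarrow> 'm) \<times> ('j \<times> 'j \<Rightarrow> 'm)" where
  "generator = (\<lambda>((b, a), (c, f, g, h)). (unit b c f, unit c c g, unit c a h))"

abbreviation indices :: "('j, 'm) product_index set" where
  "indices \<equiv> (SIGMA ba:UNIV. products (fst ba) (snd ba))"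

abbreviation combination :: "('j, 'm) product_index set \<Rightarrow> (('j, 'm) product_index \<Rightarrow> 'k)
    \<Rightarrow> (('j \<times> 'j \<Rightarrow> 'm) \<times> ('j \<times> 'j \<Rightarrow> 'm) \<times> ('j \<times> 'j \<Rightarrow> 'm)) \<Rightarrow>\<^sub>0 'k" where
  "combination F l \<equiv> (\<Sum>i\<in>F. free_scale (l i) (free_gen (generator i)))"

lemma product_closed: "t \<in> products b a \<Longrightarrow> product b a t \<in> mor C a b"
proof -
  assume "t \<in> products b a"
  then obtain c f g h where t: "t = (c, f, g, h)" "f \<in> Bm b c" "g \<in> Bo c" "h \<in> Bp c a"
    by (auto simp: products_def)
  then have "f \<in> mor C c b" "g \<in> mor C c c" "h \<in> mor C a c"
    using Bm_closed Bo_closed Bp_closed by blast+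
  then show ?thesis
    by (simp add: product_def t)
qed

lemma generator_mem: "i \<in> indices \<Longrightarrow> generator i \<in> Am \<times> Ao \<times> Ap"
  by (auto simp: generator_def products_def unit_Am unit_Ao unit_Ap)

lemma multiply3_generator:
  "t \<in> products b a \<Longrightarrow> multiply3 A (free_gen (generator ((b, a), t))) = unit b a (product b a t)"
  using Bm_closed Bo_closed Bp_closed
  by (auto simp: generator_def products_def product_def multiply3_gen mult_unit_unit subset_iff)

text \<open>Reducing every element to basis triples bounds the tensor product from above;
  \<open>products_indep\<close> then shows that nothing more collapses.\<close>

definition reducible where
  "reducible p \<longleftrightarrow> (\<exists>F l. finite F \<and> F \<subseteq> indices \<and> p - combination F l \<in> tnull)"

lemma reducible_zero: "reducible 0"
  unfolding reducible_def by (intro exI[of _ "{}"]) (simp add: tensor_null.intros(1))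

lemma reducible_cong:
  assumes "p - q \<in> tnull" "reducible q"
  shows "reducible p"
proof -
  obtain F l where q: "finite F" "F \<subseteq> indices" "q - combination F l \<in> tnull"
    using assms(2) unfolding reducible_def by blast
  have "p - combination F l = (p - q) + (q - combination F l)"
    by simp
  also have "\<dots> \<in> tnull"
    using assms(1) q(3) by (rule tensor_null.intros(2))
  finally show ?thesis
    unfolding reducible_def using q(1,2) by blast
qed

lemma reducible_add:
  assumes "reducible p" "reducible q"
  shows "reducible (p + q)"
proof -
  obtain F l where p: "finite F" "F \<subseteq> indices" "p - combination F l \<in> tnull"
    using assms(1) unfolding reducible_def by blast
  obtain G k where q: "finite G" "G \<subseteq> indices" "q - combination G k \<in> tnull"
    using assms(2) unfolding reducible_def by blast
  define l' where "l' i = (if i \<in> F then l i else 0) + (if i \<in> G then k i else 0)" for i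
  have split: "free_scale (l' i) v = free_scale (if i \<in> F then l i else 0) v + free_scale (if i \<in> G then k i else 0) v"
    for i and v :: "('j \<times> 'j \<Rightarrow> 'm) \<times> ('j \<times> 'j \<Rightarrow> 'm) \<times> ('j \<times> 'j \<Rightarrow> 'm) \<Rightarrow>\<^sub>0 'k"
    unfolding l'_def by (rule poly_mapping_eqI) (simp add: lookup_free_scale lookup_add algebra_simps)
  have "combination (F \<union> G) (\<lambda>i. if i \<in> F then l i else 0) = combination F l"
    using p(1) q(1) by (intro sum.mono_neutral_cong_right) auto
  moreover have "combination (F \<union> G) (\<lambda>i. if i \<in> G then k i else 0) = combination G k"
    using p(1) q(1) by (intro sum.mono_neutral_cong_right) auto
  ultimately have "combination (F \<union> G) l' = combination F l + combination G k"
    by (simp only: split sum.distrib)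
  then have "p + q - combination (F \<union> G) l' = (p - combination F l) + (q - combination G k)"
    by simp
  also have "\<dots> \<in> tnull"
    using p(3) q(3) by (rule tensor_null.intros(2))
  finally show ?thesis
    unfolding reducible_def using p q by (intro exI[of _ "F \<union> G"] exI[of _ l']) auto
qed

lemma reducible_scale:
  assumes "reducible p"
  shows "reducible (free_scale r p)"
proof -
  obtain F l where p: "finite F" "F \<subseteq> indices" "p - combination F l \<in> tnull"
    using assms(1) unfolding reducible_def by blast
  have "free_scale r p - combination F (\<lambda>i. r * l i) = free_scale r (p - combination F l)"
    by (simp add: free_scale_diff free_scale_sum free_scale_scale)
  also have "\<dots> \<in> tnull"
    using p(3) by (rule tensor_null.intros(3))
  finally show ?thesis
    unfolding reducible_def using p(1,2) by (intro exI[of _ F] exI[of _ "\<lambda>i. r * l i"] conjI)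
qed

lemma reducible_null: "p \<in> tnull \<Longrightarrow> reducible p"
  using reducible_cong[of p 0] reducible_zero by simp

lemma null_zero_entry:
  assumes "x \<in> Am" "y \<in> Ao" "z \<in> Ap"
  shows "free_gen (\<zero>\<^bsub>A\<^esub>, y, z) \<in> tnull" "free_gen (x, \<zero>\<^bsub>A\<^esub>, z) \<in> tnull" "free_gen (x, y, \<zero>\<^bsub>A\<^esub>) \<in> tnull"
proof -
  have "free_gen (0 \<odot>\<^bsub>A\<^esub> x, y, z) - free_scale 0 (free_gen (x, y, z)) \<in> tnull"
    using assms by (rule tensor_null.intros(7))
  then show "free_gen (\<zero>\<^bsub>A\<^esub>, y, z) \<in> tnull"
    using assms blocks_carrier by (simp add: alg.scale_zero)
  have "free_gen (x, 0 \<odot>\<^bsub>A\<^esub> y, z) - free_scale 0 (free_gen (x, y, z)) \<in> tnull"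
    using assms by (rule tensor_null.intros(8))
  then show "free_gen (x, \<zero>\<^bsub>A\<^esub>, z) \<in> tnull"
    using assms blocks_carrier by (simp add: alg.scale_zero)
  have "free_gen (x, y, 0 \<odot>\<^bsub>A\<^esub> z) - free_scale 0 (free_gen (x, y, z)) \<in> tnull"
    using assms by (rule tensor_null.intros(9))
  then show "free_gen (x, y, \<zero>\<^bsub>A\<^esub>) \<in> tnull"
    using assms blocks_carrier by (simp add: alg.scale_zero)
qed

lemma idem_K: "idem C c \<in> K"
proof -
  have "idem C c = finsum A (idem C) {c}"
    by simp
  moreover have "idem C c \<in> line A (idem C c)"
    unfolding line_def by (intro CollectI exI[of _ 1]) (simp add: alg.scale_one)
  ultimately show ?thesis
    unfolding idem_alg_def internal_sum_def
    by (intro CollectI exI[of _ "idem C"] exI[of _ "{c}"]) simp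
qed

text \<open>If neighbouring inner objects differ, an idempotent that fixes one factor moves across
  the tensor sign and kills the next one; if all agree, the tensor is a generator.\<close>

lemma reducible_units:
  assumes f: "f \<in> Bm b c" and g: "g \<in> Bo d" and h: "h \<in> Bp e a"
  shows "reducible (free_gen (unit b c f, unit d d g, unit e a h))"
proof -
  note u = unit_Am[OF f] unit_Ao[OF g] unit_Ap[OF h]
  have fgh: "f \<in> mor C c b" "g \<in> mor C d d" "h \<in> mor C a e"
    using f g h Bm_closed Bo_closed Bp_closed by blast+
  have 1: "unit b c f \<otimes>\<^bsub>A\<^esub> idem C c = unit b c f"
    using fgh by (simp add: idem_eq_unit mult_unit_unit)
  have 2: "unit d d g \<otimes>\<^bsub>A\<^esub> idem C d = unit d d g"
    using fgh by (simp add: idem_eq_unit mult_unit_unit)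
  have 3: "idem C c \<otimes>\<^bsub>A\<^esub> unit d d g = (if c = d then unit d d g else \<zero>\<^bsub>A\<^esub>)"
    using fgh by (simp add: idem_eq_unit mult_unit_unit)
  have 4: "idem C d \<otimes>\<^bsub>A\<^esub> unit e a h = (if d = e then unit e a h else \<zero>\<^bsub>A\<^esub>)"
    using fgh by (simp add: idem_eq_unit mult_unit_unit)
  consider "c \<noteq> d" | "d \<noteq> e" | "c = d" "d = e"
    by blast
  then show ?thesis
  proof cases
    case 1
    then show ?thesis
      using tensor_null.intros(10)[OF u idem_K[of c], where A = A] null_zero_entry(2)[OF u]
      by (intro reducible_cong[OF _ reducible_null]) (simp_all add: \<open>unit b c f \<otimes>\<^bsub>A\<^esub> idem C c = unit b c f\<close> 3)
  next
    case 2
    then show ?thesis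
      using tensor_null.intros(11)[OF u idem_K[of d], where A = A] null_zero_entry(3)[OF u]
      by (intro reducible_cong[OF _ reducible_null]) (simp_all add: \<open>unit d d g \<otimes>\<^bsub>A\<^esub> idem C d = unit d d g\<close> 4)
  next
    case 3
    have "free_gen (unit b c f, unit d d g, unit e a h) = combination {((b, a), (c, f, g, h))} (\<lambda>_. 1)"
      using 3 by (auto intro!: poly_mapping_eqI simp: generator_def lookup_free_scale)
    moreover have "((b, a), (c, f, g, h)) \<in> indices"
      using f g h 3 by (simp add: products_def)
    ultimately show ?thesis
      unfolding reducible_def
      by (intro exI[of _ "{((b, a), (c, f, g, h))}"] exI[of _ "\<lambda>_. 1"]) (simp add: tensor_null.intros(1))
  qed
qed

lemma reducible_by_add: "p - q - q' \<in> tnull \<Longrightarrow> reducible q \<Longrightarrow> reducible q' \<Longrightarrow> reducible p"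
  using reducible_cong[of p "q + q'"] reducible_add by (simp add: diff_diff_eq)

lemma reducible_by_scale: "p - free_scale r q \<in> tnull \<Longrightarrow> reducible q \<Longrightarrow> reducible p"
  using reducible_cong reducible_scale by blast

text \<open>Linearity replaces one argument at a time by units of basis elements: here the last, in
  \<open>reducible_unit\<close> the middle, in \<open>reducible_free_gen\<close> the first.\<close>

lemma reducible_unit_unit:
  assumes f: "f \<in> Bm b c" and g: "g \<in> Bo d" and z: "z \<in> Ap"
  shows "reducible (free_gen (unit b c f, unit d d g, z))"
  using z Bp_closed
proof (induction rule: blocks_induct)
  case zero
  show ?case
    by (rule reducible_null[OF null_zero_entry(3)[OF unit_Am[OF f] unit_Ao[OF g] Ap.sub.zero_closed]])
next
  case (base e a h)
  then show ?case
    by (rule reducible_units[OF f g])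
next
  case (add z z')
  then show ?case
    using reducible_by_add[OF tensor_null.intros(6)[OF unit_Am[OF f] unit_Ao[OF g]]] by blast
next
  case (scale r z)
  then show ?case
    using reducible_by_scale[OF tensor_null.intros(9)[OF unit_Am[OF f] unit_Ao[OF g]]] by blast
qed

lemma reducible_unit:
  assumes f: "f \<in> Bm b c" and y: "y \<in> Ao" and z: "z \<in> Ap"
  shows "reducible (free_gen (unit b c f, y, z))"
  using y Bo'_closed
proof (induction rule: blocks_induct)
  case zero
  show ?case
    by (rule reducible_null[OF null_zero_entry(2)[OF unit_Am[OF f] Ao.sub.zero_closed z]])
next
  case (base d e g)
  then show ?case
    by (auto simp: Bo'_def intro: reducible_unit_unit[OF f _ z] split: if_splits)
next
  case (add y y')
  then show ?case
    using reducible_by_add[OF tensor_null.intros(5)[OF unit_Am[OF f] _ _ z]] by blast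
next
  case (scale r y)
  then show ?case
    using reducible_by_scale[OF tensor_null.intros(8)[OF unit_Am[OF f] _ z]] by blast
qed

lemma reducible_free_gen:
  assumes x: "x \<in> Am" and y: "y \<in> Ao" and z: "z \<in> Ap"
  shows "reducible (free_gen (x, y, z))"
  using x Bm_closed
proof (induction rule: blocks_induct)
  case zero
  show ?case
    by (rule reducible_null[OF null_zero_entry(1)[OF Am.sub.zero_closed y z]])
next
  case (base b c f)
  then show ?case
    by (rule reducible_unit[OF _ y z])
next
  case (add x x')
  then show ?case
    using reducible_by_add[OF tensor_null.intros(4)[OF _ _ y z]] by blast
next
  case (scale r x)
  then show ?case
    using reducible_by_scale[OF tensor_null.intros(7)[OF _ y z]] by blast
qed

lemma reducible_free:
  assumes "p \<in> free"
  shows "reducible p"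
proof -
  have "reducible (\<Sum>t\<in>F. free_scale (Poly_Mapping.lookup p t) (free_gen t))"
    if "finite F" "F \<subseteq> Am \<times> Ao \<times> Ap" for F
    using that by (induction F rule: finite_induct)
      (auto intro: reducible_zero reducible_add reducible_scale reducible_free_gen)
  from this[of "Poly_Mapping.keys p"] show ?thesis
    using assms poly_mapping_eq_sum_free_gen[of p] by (simp add: free_space_def)
qed

lemma combination_free: "F \<subseteq> indices \<Longrightarrow> combination F l \<in> free"
  using generator_mem by (intro free_space_sum free_space_scale free_space_gen) blast

text \<open>The \<open>(b, a)\<close> entry of the product only sees indices placed at
  \<open>(b, a)\<close>, and for these \<open>products_indep\<close> applies.\<close>

lemma combination_coefficient:
  assumes F: "finite F" "F \<subseteq> indices" and zero: "multiply3 A (combination F l) = \<zero>\<^bsub>A\<^esub>" and i: "i \<in> F"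
  shows "l i = 0"
proof -
  obtain b a t where i_eq: "i = ((b, a), t)"
    by (metis prod.exhaust)
  let ?G = "Pair (b, a) -` F"
  have prods: "snd j \<in> products (fst (fst j)) (snd (fst j))" if "j \<in> F" for j
    using that F(2) by auto
  have gen: "multiply3 A (free_scale (l j) (free_gen (generator j)))
      = l j \<odot>\<^bsub>A\<^esub> unit (fst (fst j)) (snd (fst j)) (product (fst (fst j)) (snd (fst j)) (snd j))"
    if "j \<in> F" for j
  proof -
    have "generator j \<in> Am \<times> Ao \<times> Ap"
      using generator_mem that F(2) by blast
    then have "multiply3 A (free_scale (l j) (free_gen (generator j)))
        = l j \<odot>\<^bsub>A\<^esub> multiply3 A (free_gen (generator j))"
      by (intro multiply3_scale free_subset free_space_gen)
    then show ?thesis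
      using multiply3_generator[OF prods[OF that]] by simp
  qed
  have fin: "finite ?G"
    using F(1) by (intro finite_vimageI) (auto simp: inj_on_def)
  have "multiply3 A (combination F l)
      = (\<Oplus>\<^bsub>A\<^esub> j \<in> F. multiply3 A (free_scale (l j) (free_gen (generator j))))"
    using F generator_mem by (intro multiply3_sum free_subset free_space_scale free_space_gen) blast+
  also have "\<dots> = (\<Oplus>\<^bsub>A\<^esub> j \<in> F. l j \<odot>\<^bsub>A\<^esub>
      unit (fst (fst j)) (snd (fst j)) (product (fst (fst j)) (snd (fst j)) (snd j)))"
    using gen prods product_closed by (intro alg.finsum_cong') (auto simp: alg.scale_closed)
  finally have "\<zero>\<^bsub>A\<^esub> = (\<Oplus>\<^bsub>A\<^esub> j \<in> F. l j \<odot>\<^bsub>A\<^esub>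
      unit (fst (fst j)) (snd (fst j)) (product (fst (fst j)) (snd (fst j)) (snd j)))"
    by (simp only: zero)
  then have "nul a b = (\<Oplus>\<^bsub>A\<^esub> j \<in> F. l j \<odot>\<^bsub>A\<^esub>
      unit (fst (fst j)) (snd (fst j)) (product (fst (fst j)) (snd (fst j)) (snd j))) (b, a)"
    by (metis zero_entry)
  also have "\<dots> = (\<Oplus>\<^bsub>hom_sp C a b\<^esub> j \<in> F. (l j \<odot>\<^bsub>A\<^esub>
      unit (fst (fst j)) (snd (fst j)) (product (fst (fst j)) (snd (fst j)) (snd j))) (b, a))"
    using F(1) prods product_closed by (intro finsum_entry) (auto simp: alg.scale_closed)
  also have "\<dots> = (\<Oplus>\<^bsub>hom_sp C a b\<^esub> j \<in> Pair (b, a) ` ?G. l j \<odot>\<^bsub>hom_sp C a b\<^esub> product b a (snd j))"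
    using F(1) prods product_closed
    by (intro hom.add.finprod_mono_neutral_cong_right)
      (force simp: unit_entry hom.scale_zero_right hom.scale_closed image_iff)+
  also have "\<dots> = (\<Oplus>\<^bsub>hom_sp C a b\<^esub> t \<in> ?G. l ((b, a), t) \<odot>\<^bsub>hom_sp C a b\<^esub> product b a t)"
    using prods product_closed
    by (subst hom.finsum_reindex) (force simp: inj_on_def hom.scale_closed)+
  finally have "(\<Oplus>\<^bsub>hom_sp C a b\<^esub> t \<in> ?G. l ((b, a), t) \<odot>\<^bsub>hom_sp C a b\<^esub> product b a t) = nul a b"
    by simp
  moreover have "?G \<subseteq> products b a"
    using prods by force
  ultimately have "l ((b, a), t) = 0" if "t \<in> ?G" for t
    using products_indep[OF fin, of b a "\<lambda>t. l ((b, a), t)" t] that by (simp add: products_def product_def)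
  then show ?thesis
    using i by (simp add: i_eq)
qed

text \<open>Modulo null elements \<open>p\<close> is a combination of basis triples. Its product
  vanishes as well, hence so do its coefficients.\<close>

lemma multiply3_injective:
  assumes "p \<in> free" "multiply3 A p = \<zero>\<^bsub>A\<^esub>"
  shows "p \<in> tnull"
proof -
  obtain F l where F: "finite F" "F \<subseteq> indices" "p - combination F l \<in> tnull"
    using reducible_free[OF assms(1)] unfolding reducible_def by blast
  have "\<zero>\<^bsub>A\<^esub> = multiply3 A p \<ominus>\<^bsub>A\<^esub> multiply3 A (combination F l)"
    using tnull_multiply3[OF F(3)]
    by (simp add: multiply3_diff[OF free_subset[OF assms(1)] free_subset[OF combination_free[OF F(2)]]])
  then have "\<zero>\<^bsub>A\<^esub> = \<ominus>\<^bsub>A\<^esub> multiply3 A (combination F l)"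
    using multiply3_closed[OF free_subset[OF combination_free[OF F(2), of l]]]
    by (simp add: assms(2) a_minus_def)
  then have "multiply3 A (combination F l) = \<zero>\<^bsub>A\<^esub>"
    using multiply3_closed[OF free_subset[OF combination_free[OF F(2), of l]]]
      alg.r_neg[of "multiply3 A (combination F l)"] by simp
  from combination_coefficient[OF F(1,2) this] have "combination F l = 0"
    by (intro sum.neutral) simp
  then show ?thesis
    using F(3) by simp
qed

lemma multiply3_surjective:
  assumes "x \<in> carrier A"
  shows "\<exists>p\<in>free. multiply3 A p = x"
  using assms
proof (induction x rule: carrier_induct)
  case zero
  show ?case
    by (intro bexI[of _ 0]) (simp_all add: multiply3_def free_space_zero)
next
  case (add x y)
  then obtain p q where "p \<in> free" "multiply3 A p = x" "q \<in> free" "multiply3 A q = y"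
    by blast
  then show ?case
    by (intro bexI[of _ "p + q"]) (simp_all add: multiply3_add free_subset free_space_add)
next
  case (unit b a f)
  have cl: "product b a ` products b a \<subseteq> mor C a b"
    using product_closed by blast
  have "f \<in> hom.span a b (product b a ` products b a)"
    using products_span[of a b] unit by (auto simp: products_def product_def)
  from this cl show ?case
  proof (induction rule: hom.span_induct')
    case zero
    show ?case
      by (intro bexI[of _ 0]) (simp_all add: multiply3_def free_space_zero)
  next
    case (base v)
    then obtain t where t: "t \<in> products b a" "v = product b a t"
      by blast
    then show ?case
      using multiply3_generator[OF t(1)] generator_mem[of "((b, a), t)"]
      by (intro bexI[of _ "free_gen (generator ((b, a), t))"]) (auto intro: free_space_gen)
  next
    case (add v w)
    then obtain p q where "p \<in> free" "multiply3 A p = unit b a v" "q \<in> free" "multiply3 A q = unit b a w"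
      by blast
    then show ?case
      by (intro bexI[of _ "p + q"]) (simp_all add: multiply3_add free_subset free_space_add unit_add)
  next
    case (scale r v)
    then obtain p where "p \<in> free" "multiply3 A p = unit b a v"
      by blast
    then show ?case
      by (intro bexI[of _ "free_scale r p"]) (simp_all add: multiply3_scale free_subset free_space_scale unit_smult)
  qed
qed

text \<open>Null elements are exactly the kernel of \<open>multiply3\<close> on the free space, so
  the classes in \<open>tensor3\<close> are its fibres and any representative computes the induced
  map.\<close>

lemma multiplication_iso: "multiplication_iso A K Am Ao Ap"
proof -
  let ?R = "{(p, q). p \<in> free \<and> q \<in> free \<and> p - q \<in> tnull}"
  let ?T = "tensor3 A K Am Ao Ap"
  have T: "?T = free // ?R"
    by (simp add: tensor3_def)
  have eq: "multiply3 A p = multiply3 A q \<longleftrightarrow> p - q \<in> tnull" if "p \<in> free" "q \<in> free" for p q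
  proof -
    have "p - q \<in> tnull \<longleftrightarrow> multiply3 A (p - q) = \<zero>\<^bsub>A\<^esub>"
      using tnull_multiply3 multiply3_injective free_space_diff[OF that] by blast
    also have "\<dots> \<longleftrightarrow> multiply3 A p = multiply3 A q"
      using that by (simp add: multiply3_diff free_subset alg.minus_eq_zero_iff multiply3_closed)
    finally show ?thesis by simp
  qed
  define \<phi> where "\<phi> t = multiply3 A (SOME p. p \<in> t)" for t
  have R: "?R `` {p} = {q \<in> free. multiply3 A p = multiply3 A q}" if "p \<in> free" for p
    using that by (auto simp: eq)
  have \<phi>: "\<phi> (?R `` {p}) = multiply3 A p" if "p \<in> free" for p
    unfolding \<phi>_def R[OF that] by (rule someI2[of _ p]) (use that in auto)
  have "bij_betw \<phi> ?T (carrier A)"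
    unfolding bij_betw_def
  proof (intro conjI inj_onI)
    fix t t'
    assume "t \<in> ?T" "t' \<in> ?T" and e: "\<phi> t = \<phi> t'"
    then obtain p q where pq: "p \<in> free" "q \<in> free" "t = ?R `` {p}" "t' = ?R `` {q}"
      by (auto simp: T quotient_def)
    have "multiply3 A p = multiply3 A q"
      using e \<phi>[OF pq(1)] \<phi>[OF pq(2)] unfolding pq(3,4) by simp
    then show "t = t'"
      unfolding pq(3,4) R[OF pq(1)] R[OF pq(2)] by simp
  next
    show "\<phi> ` ?T = carrier A"
    proof (intro equalityI subsetI)
      fix x
      assume "x \<in> \<phi> ` ?T"
      then obtain p where "p \<in> free" "x = \<phi> (?R `` {p})"
        by (auto simp: T quotient_def)
      then show "x \<in> carrier A"
        using \<phi> multiply3_closed[OF free_subset] by simp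
    next
      fix x
      assume "x \<in> carrier A"
      then obtain p where p: "p \<in> free" "multiply3 A p = x"
        using multiply3_surjective by blast
      then have "\<phi> (?R `` {p}) = x" "?R `` {p} \<in> ?T"
        unfolding T by (simp_all only: \<phi> quotientI)
      then show "x \<in> \<phi> ` ?T"
        by blast
    qed
  qed
  moreover have "\<forall>t\<in>?T. \<forall>p\<in>t. \<phi> t = multiply3 A p"
  proof (intro ballI)
    fix t p
    assume t: "t \<in> ?T" and p: "p \<in> t"
    obtain q where q: "q \<in> free" "t = ?R `` {q}"
      using t unfolding T by (rule quotientE)
    show "\<phi> t = multiply3 A p"
      using \<phi>[OF q(1)] p unfolding q(2) R[OF q(1)] by simp
  qed
  ultimately show ?thesis
    unfolding multiplication_iso_def by blast
qed

lemma line_idem: "unit a a ` hom.span a a {idm C a} = line A (idem C a)"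
proof -
  have "hom.span a a {idm C a} = {r \<odot>\<^bsub>hom_sp C a a\<^esub> idm C a | r. True}"
    by (subst hom.finite_span) (auto simp: hom.lincomb_def hom.scale_closed)
  then show ?thesis
    by (auto simp: line_def idem_eq_unit unit_smult[symmetric])
qed

lemma direct_sum_line: "internal_direct_sum A {a} (\<lambda>c. line A (idem C c)) (line A (idem C a))"
proof -
  have cl: "x \<in> carrier A" if "x \<in> line A (idem C a)" for x
    using that by (auto simp: line_def alg.scale_closed)
  have z: "\<zero>\<^bsub>A\<^esub> \<in> line A (idem C a)"
    unfolding line_def by (intro CollectI exI[of _ 0]) (simp add: alg.scale_zero)
  have F: "F = {} \<or> F = {a}" if "F \<subseteq> {a}" for F
    using that by blast
  show ?thesis
    unfolding internal_direct_sum_def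
  proof (intro conjI allI impI ballI)
    show "line A (idem C a) = internal_sum A {a} (\<lambda>c. line A (idem C c))"
    proof (intro equalityI subsetI)
      fix x
      assume "x \<in> line A (idem C a)"
      then show "x \<in> internal_sum A {a} (\<lambda>c. line A (idem C c))"
        unfolding internal_sum_def using cl
        by (intro CollectI exI[of _ "\<lambda>_. x"] exI[of _ "{a}"]) simp
    next
      fix x
      assume "x \<in> internal_sum A {a} (\<lambda>c. line A (idem C c))"
      then obtain w F where "F \<subseteq> {a}" "\<forall>i\<in>F. w i \<in> line A (idem C i)" "x = finsum A w F"
        by (auto simp: internal_sum_def)
      then show "x \<in> line A (idem C a)"
        using F[of F] z cl by auto
    qed
  next
    fix F w i
    assume "finite F \<and> F \<subseteq> {a} \<and> (\<forall>i\<in>F. w i \<in> line A (idem C i)) \<and> finsum A w F = \<zero>\<^bsub>A\<^esub>" "i \<in> F"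
    then show "w i = \<zero>\<^bsub>A\<^esub>"
      using F[of F] cl by auto
  qed
qed

theorem upper_finite_weakly_triangular: "upper_finite_weakly_triangular_category C"
proof -
  \<comment> \<open>(W3) asks that the corner of \<open>Am\<close> at \<open>({a}, {b})\<close>
    vanish unless \<open>{a}\<close> precedes \<open>{b}\<close>, while \<open>Bm a b\<close> is
    empty unless \<open>b \<le> a\<close>. Smaller objects therefore come later, and upper
    finiteness is \<open>finite_below\<close>.\<close>
  let ?po = "{({a}, {b}) | a b :: 'j. b \<le> a}"
  have I: "(UNIV :: 'j set) // Id = range (\<lambda>a. {a})"
    by (auto simp: quotient_def)
  have po: "partial_order_on (range (\<lambda>a :: 'j. {a})) ?po"
    unfolding partial_order_on_def preorder_on_def refl_on_def trans_def antisym_def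
    by (auto intro: order_trans)
  have corner_Am: "corner_class C {a} Am {b} = unit a b ` hom.span b a (Bm a b)" for a b
    by (simp only: idem_class_singleton corner_blocks[OF span_Bm])
  have corner_Ap: "corner_class C {a} Ap {b} = unit a b ` hom.span b a (Bp a b)" for a b
    by (simp only: idem_class_singleton corner_blocks[OF span_Bp])
  have sum_Ao: "internal_direct_sum A (\<Union>aa\<in>range (\<lambda>a. {a}). aa \<times> aa) (\<lambda>(b, c). corner_obj C b Ao c) Ao"
    by (rule direct_sum_blocks[OF span_Bo']) (auto simp: Bo'_def hom.span_empty)
  have sum_Am: "internal_direct_sum A (UNIV \<times> UNIV) (\<lambda>(b, c). corner_obj C b Am c) Am"
    by (rule direct_sum_blocks[OF span_Bm]) simp
  have sum_Ap: "internal_direct_sum A (UNIV \<times> UNIV) (\<lambda>(b, c). corner_obj C b Ap c) Ap"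
    by (rule direct_sum_blocks[OF span_Bp]) simp
  have order: "\<forall>aa\<in>range (\<lambda>a. {a}). \<forall>bb\<in>range (\<lambda>a. {a}). (aa, bb) \<notin> ?po \<longrightarrow>
      corner_class C aa Am bb = {\<zero>\<^bsub>A\<^esub>} \<and> corner_class C bb Ap aa = {\<zero>\<^bsub>A\<^esub>}"
  proof (intro ballI impI)
    fix aa bb :: "'j set"
    assume "aa \<in> range (\<lambda>a. {a})" "bb \<in> range (\<lambda>a. {a})" "(aa, bb) \<notin> ?po"
    then obtain a b where ab: "aa = {a}" "bb = {b}" "\<not> b \<le> a"
      by auto
    then have "Bm a b = {}" "Bp b a = {}"
      using Bm_order Bp_order by blast+
    then show "corner_class C aa Am bb = {\<zero>\<^bsub>A\<^esub>} \<and> corner_class C bb Ap aa = {\<zero>\<^bsub>A\<^esub>}"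
      by (simp add: ab(1,2) corner_Am corner_Ap hom.span_empty)
  qed
  have diag: "\<forall>aa\<in>range (\<lambda>a. {a}). corner_class C aa Am aa = corner_class C aa Ap aa \<and>
      internal_direct_sum A aa (\<lambda>c. line A (idem C c)) (corner_class C aa Am aa)"
  proof (rule ballI)
    fix aa :: "'j set"
    assume "aa \<in> range (\<lambda>a. {a})"
    then obtain a where a: "aa = {a}"
      by auto
    show "corner_class C aa Am aa = corner_class C aa Ap aa \<and>
        internal_direct_sum A aa (\<lambda>c. line A (idem C c)) (corner_class C aa Am aa)"
      unfolding a corner_Am corner_Ap Bm_diag Bp_diag line_idem using direct_sum_line by simp
  qed
  have "weakly_triangular_decomposition C Id ?po Am Ao Ap"
    unfolding weakly_triangular_decomposition_def Let_def objs_UNIV I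
    by (intro conjI po Am.subspace Ao.subspace Ap.subspace sum_Am sum_Ap sum_Ao order diag multiplication_iso)
  moreover have "upper_finite (UNIV // Id) ?po"
    unfolding upper_finite_def I
  proof
    fix aa :: "'j set"
    assume "aa \<in> range (\<lambda>a. {a})"
    then obtain a where "aa = {a}"
      by blast
    then have "{b \<in> range (\<lambda>a. {a}). (aa, b) \<in> ?po} \<subseteq> (\<lambda>a. {a}) ` {b. b \<le> a}"
      by auto
    then show "finite {b \<in> range (\<lambda>a. {a}). (aa, b) \<in> ?po}"
      by (rule finite_subset) (intro finite_imageI finite_below)
  qed
  moreover have "\<forall>aa\<in>UNIV // Id. finite (aa :: 'j set)"
    unfolding I by simp
  moreover have "equiv UNIV (Id :: 'j rel)"
    by (simp add: equiv_def refl_on_def sym_def trans_def)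
  moreover have "finite_dim_homs C"
    unfolding finite_dim_homs_def using fin_dim_hom by blast
  ultimately show ?thesis
    unfolding upper_finite_weakly_triangular_category_def objs_UNIV
    using linear_category_axioms by blast
qed

end

section \<open>Drawable pairings are perfect matchings\<close>

definition perfect_matching :: "'a set \<Rightarrow> 'a set set \<Rightarrow> bool" where
  "perfect_matching S P \<longleftrightarrow> (\<forall>s\<in>P. s \<subseteq> S \<and> card s = 2) \<and> (\<forall>x\<in>S. \<exists>!s. s \<in> P \<and> x \<in> s)"

definition points :: "nat \<Rightarrow> nat \<Rightarrow> bpoint set" where
  "points a b = Lower ` {..<a} \<union> Upper ` {..<b}"

lemma Lower_points [simp]: "Lower i \<in> points a b \<longleftrightarrow> i < a"
  by (auto simp: points_def)

lemma Upper_points [simp]: "Upper j \<in> points a b \<longleftrightarrow> j < b"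
  by (auto simp: points_def)

lemma matching_pairE:
  assumes "perfect_matching S P" "s \<in> P"
  obtains x y where "s = {x, y}" "x \<noteq> y" "x \<in> S" "y \<in> S"
proof -
  have "s \<subseteq> S" "card s = 2"
    using assms by (auto simp: perfect_matching_def)
  then show ?thesis
    using that by (auto simp: card_2_iff)
qed

lemma matching_pairD:
  assumes "perfect_matching S P" "{x, y} \<in> P"
  shows "x \<in> S" "y \<in> S" "x \<noteq> y"
proof -
  have "{x, y} \<subseteq> S" "card {x, y} = 2"
    using assms unfolding perfect_matching_def by blast+
  then show "x \<in> S" "y \<in> S" "x \<noteq> y"
    by (auto simp: card_insert_if split: if_splits)
qed

lemma matching_strand_unique:
  assumes "perfect_matching S P" "s \<in> P" "t \<in> P" "x \<in> s" "x \<in> t"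
  shows "s = t"
proof -
  have "x \<in> S"
    using assms unfolding perfect_matching_def by blast
  then show ?thesis
    using assms unfolding perfect_matching_def by blast
qed

lemma matching_unique:
  assumes "perfect_matching S P" "{x, y} \<in> P" "{x, z} \<in> P"
  shows "y = z"
  using matching_strand_unique[OF assms(1,2,3), of x] by (auto simp: doubleton_eq_iff)

lemma matching_partner:
  assumes "perfect_matching S P" "x \<in> S"
  obtains y where "{x, y} \<in> P"
proof -
  obtain s where s: "s \<in> P" "x \<in> s"
    using assms unfolding perfect_matching_def by blast
  then show ?thesis
    using matching_pairE[OF assms(1) s(1)] that by (metis insert_commute insertE singletonD)
qed

lemma perfect_matchingI:
  assumes "\<And>s. s \<in> P \<Longrightarrow> \<exists>x y. s = {x, y} \<and> x \<noteq> y \<and> x \<in> S \<and> y \<in> S"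
    and "\<And>x. x \<in> S \<Longrightarrow> \<exists>y. {x, y} \<in> P"
    and "\<And>x y z. {x, y} \<in> P \<Longrightarrow> {x, z} \<in> P \<Longrightarrow> y = z"
  shows "perfect_matching S P"
  unfolding perfect_matching_def
proof (intro conjI ballI)
  fix s
  assume "s \<in> P"
  then show "s \<subseteq> S" "card s = 2"
    using assms(1)[of s] by auto
next
  fix x
  assume "x \<in> S"
  then obtain y where y: "{x, y} \<in> P"
    using assms(2) by blast
  show "\<exists>!s. s \<in> P \<and> x \<in> s"
  proof (rule ex1I[of _ "{x, y}"])
    fix s
    assume s: "s \<in> P \<and> x \<in> s"
    then obtain z where "s = {x, z}"
      using assms(1)[of s] by (metis insertE insert_commute singletonD)
    then show "s = {x, y}"
      using assms(3) s y by blast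
  qed (use y in simp)
qed

lemma perfect_matching_Un:
  assumes P: "perfect_matching S P" and Q: "perfect_matching T Q" and "S \<inter> T = {}"
  shows "perfect_matching (S \<union> T) (P \<union> Q)"
proof (rule perfect_matchingI)
  show "\<exists>x y. s = {x, y} \<and> x \<noteq> y \<and> x \<in> S \<union> T \<and> y \<in> S \<union> T" if "s \<in> P \<union> Q" for s
    using that matching_pairE[OF P, of s] matching_pairE[OF Q, of s] by (metis UnE UnI1 UnI2)
  show "\<exists>y. {x, y} \<in> P \<union> Q" if "x \<in> S \<union> T" for x
    using that matching_partner[OF P, of x] matching_partner[OF Q, of x] by (metis UnE UnI1 UnI2)
  show "y = z" if "{x, y} \<in> P \<union> Q" "{x, z} \<in> P \<union> Q" for x y z
    using that matching_unique[OF P] matching_unique[OF Q] matching_pairD[OF P] matching_pairD[OF Q]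
      assms(3) by (metis UnE disjoint_iff)
qed

lemma perfect_matching_image:
  assumes P: "perfect_matching S P" and g: "inj_on g S"
  shows "perfect_matching (g ` S) ((`) g ` P)"
  unfolding perfect_matching_def
proof (intro conjI ballI)
  fix s
  assume "s \<in> (`) g ` P"
  then obtain t where t: "t \<in> P" "s = g ` t"
    by blast
  have "t \<subseteq> S" "card t = 2"
    using P t(1) by (auto simp: perfect_matching_def)
  then show "s \<subseteq> g ` S" "card s = 2"
    using g by (auto simp: t(2) card_image inj_on_subset)
next
  fix x
  assume "x \<in> g ` S"
  then obtain y where y: "y \<in> S" "x = g y"
    by blast
  then obtain s where s: "s \<in> P" "y \<in> s"
    using P unfolding perfect_matching_def by blast
  show "\<exists>!s. s \<in> (`) g ` P \<and> x \<in> s"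
  proof (rule ex1I[of _ "g ` s"])
    show "g ` s \<in> (`) g ` P \<and> x \<in> g ` s"
      using s(1,2) y(2) by blast
    fix s'
    assume "s' \<in> (`) g ` P \<and> x \<in> s'"
    then obtain t where t: "t \<in> P" "s' = g ` t" "x \<in> g ` t"
      by blast
    obtain z where z: "z \<in> t" "g z = g y"
      using t(3) y(2) by auto
    have "z \<in> S"
      using P t(1) z(1) unfolding perfect_matching_def by blast
    with g z(2) have "z = y"
      using y(1) by (rule inj_onD)
    then have "y \<in> t"
      using z(1) by simp
    then show "s' = g ` s"
      using matching_strand_unique[OF P t(1) s(1) _ s(2)] t(2) by blast
  qed
qed

lemma perfect_matching_remove:
  assumes P: "perfect_matching S P" and s: "s \<in> P"
  shows "perfect_matching (S - s) (P - {s})"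
proof (rule perfect_matchingI)
  fix t
  assume t: "t \<in> P - {s}"
  then obtain x y where "t = {x, y}" "x \<noteq> y" "x \<in> S" "y \<in> S"
    using matching_pairE[OF P] by blast
  then show "\<exists>x y. t = {x, y} \<and> x \<noteq> y \<and> x \<in> S - s \<and> y \<in> S - s"
    using matching_strand_unique[OF P _ s, of t] t by blast
next
  fix x
  assume x: "x \<in> S - s"
  then obtain y where "{x, y} \<in> P"
    using matching_partner[OF P] by blast
  then show "\<exists>y. {x, y} \<in> P - {s}"
    using x by blast
next
  show "y = z" if "{x, y} \<in> P - {s}" "{x, z} \<in> P - {s}" for x y z
    using that matching_unique[OF P] by blast
qed

subsection \<open>Orbits of a pair of involutions\<close>

text \<open>The walk along a path whose edges come from two matchings in turn, starting with
  \<open>p\<close>.\<close>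

primrec alternate :: "('a \<Rightarrow> 'a) \<Rightarrow> ('a \<Rightarrow> 'a) \<Rightarrow> 'a \<Rightarrow> nat \<Rightarrow> 'a" where
  "alternate p q v 0 = v"
| "alternate p q v (Suc n) = (if even n then p else q) (alternate p q v n)"

text \<open>The component of \<open>v\<close> is a path, because the only neighbours of
  \<open>x\<close> are \<open>p x\<close> and \<open>q x\<close>. It starts at \<open>v\<close>,
  which \<open>q\<close> fixes; its other end \<open>u\<close> is where the alternating walk first
  stands still.\<close>

lemma involutions_orbit:
  assumes fin: "finite V" and v: "v \<in> V"
    and p: "\<And>x. x \<in> V \<Longrightarrow> p x \<in> V" "\<And>x. x \<in> V \<Longrightarrow> p (p x) = x"
    and q: "\<And>x. x \<in> V \<Longrightarrow> q x \<in> V" "\<And>x. x \<in> V \<Longrightarrow> q (q x) = x"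
    and fixed: "q v = v" "p v \<noteq> v"
  defines "R \<equiv> {(x, y). x \<in> V \<and> (y = p x \<or> y = q x)}"
  shows "\<exists>u\<in>V. u \<noteq> v \<and> (p u = u \<or> q u = u) \<and> (v, u) \<in> R\<^sup>* \<and>
    (\<forall>w. (v, w) \<in> R\<^sup>* \<longrightarrow> p w = w \<or> q w = w \<longrightarrow> w = v \<or> w = u)"
proof -
  let ?x = "alternate p q v"
  let ?m = "\<lambda>n. if even n then p else q"
  have x: "?x n \<in> V" for n
    by (induction n) (use v p q in auto)
  have backward: "?m n (?x (Suc n)) = ?x n" for n
    using x[of n] p(2) q(2) by simp
  \<comment> \<open>Pigeonhole on points together with the parity of the step yields a repetition
    after an even number \<open>d\<close> of steps. Walking back, it already occurs at the start, so
    \<open>?x d = v\<close>; the step leading there is a \<open>q\<close>-step, and \<open>q\<close>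
    fixes \<open>v\<close>, so the walk did not move.\<close>
  have "\<exists>k. ?x (Suc k) = ?x k"
  proof -
    have "\<not> inj (\<lambda>n. (?x n, even n))"
    proof
      assume "inj (\<lambda>n. (?x n, even n))"
      then have "infinite (range (\<lambda>n. (?x n, even n)))"
        by (rule range_inj_infinite)
      moreover have "range (\<lambda>n. (?x n, even n)) \<subseteq> V \<times> UNIV"
        using x by auto
      ultimately show False
        using finite_subset[of _ "V \<times> (UNIV :: bool set)"] fin by simp
    qed
    then obtain i j where "?x i = ?x j" "even i = even j" "i \<noteq> j"
      by (auto simp: inj_on_def)
    then obtain i d where d: "?x i = ?x (i + d)" "even d" "0 < d"
    proof (cases "i < j")
      case True
      then show ?thesis
        using that[of i "j - i"] \<open>?x i = ?x j\<close> \<open>even i = even j\<close> by simp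
    next
      case False
      then show ?thesis
        using that[of j "i - j"] \<open>?x i = ?x j\<close> \<open>even i = even j\<close> \<open>i \<noteq> j\<close> by simp
    qed
    have "?x 0 = ?x (0 + d)"
      using d(1)
    proof (induction i)
      case (Suc i)
      have "?x i = ?x (i + d)"
        using Suc.prems backward[of i] backward[of "i + d"] d(2) by (simp del: alternate.simps)
      then show ?case
        by (rule Suc.IH)
    qed simp
    then have *: "?x d = v"
      by simp
    obtain k where k: "d = Suc k"
      using d(3) by (cases d) auto
    have "?x k = ?m k (?x d)"
      unfolding k by (rule backward[symmetric])
    also have "\<dots> = v"
      using * d(2) fixed(1) by (simp add: k)
    finally show ?thesis
      using * k by metis
  qed
  define k where "k = (LEAST k. ?x (Suc k) = ?x k)"
  have k: "?x (Suc k) = ?x k"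
    unfolding k_def using \<open>\<exists>k. ?x (Suc k) = ?x k\<close> by (rule LeastI_ex)
  have least: "?x (Suc n) \<noteq> ?x n" if "n < k" for n
    using that not_less_Least unfolding k_def by blast
  have forward: "?m n (?x n) = ?x (Suc n)" for n
    by simp
  have other: "?m (Suc n) (?x n) = (if n = 0 then v else ?x (n - 1))" for n
  proof (cases n)
    case (Suc l)
    then show ?thesis
      using backward[of l] by (simp del: alternate.simps(2))
  qed (use fixed in simp)
  have step: "{p (?x n), q (?x n)} = {?x (Suc n), if n = 0 then v else ?x (n - 1)}" for n
    using forward[of n] other[of n] by (cases "even n") (simp_all del: alternate.simps add: insert_commute)
  have closed: "\<exists>n\<le>k. w = ?x n" if "(v, w) \<in> R\<^sup>*" for w
    using that
  proof (induction rule: rtrancl_induct)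
    case base
    show ?case
      by (intro exI[of _ 0]) simp
  next
    case (step y z)
    then obtain n where n: "n \<le> k" "y = ?x n"
      by blast
    have "z \<in> {p (?x n), q (?x n)}"
      using step.hyps(2) n by (auto simp: R_def)
    then have "z = ?x (Suc n) \<or> z = ?x (n - 1)"
      unfolding \<open>{p (?x n), q (?x n)} = _\<close> by (auto simp del: alternate.simps(2) split: if_splits)
    moreover have "\<exists>l\<le>k. ?x (Suc n) = ?x l"
    proof (cases "n = k")
      case True
      then show ?thesis
        using k by blast
    next
      case False
      then show ?thesis
        using n(1) by (intro exI[of _ "Suc n"]) simp
    qed
    moreover have "n - 1 \<le> k"
      using n(1) by simp
    ultimately show ?case
      by blast
  qed
  have reach: "(v, ?x n) \<in> R\<^sup>*" for n
  proof (induction n)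
    case (Suc n)
    have "(?x n, ?x (Suc n)) \<in> R"
      using x[of n] by (simp add: R_def)
    then show ?case
      using Suc.IH by (rule rtrancl_into_rtrancl[rotated])
  qed simp
  \<comment> \<open>Suppose the walk stops at \<open>v\<close>. For even \<open>k\<close> this
    contradicts \<open>p v \<noteq> v\<close>; for odd \<open>k\<close> the walk reads the same
    backwards and would already have stood still in its middle, against the choice of
    \<open>k\<close>.\<close>
  have ne: "?x k \<noteq> v"
  proof
    assume xk: "?x k = v"
    show False
    proof (cases "even k")
      case True
      then show False
        using k xk fixed(2) by simp
    next
      case False
      have refl: "n \<le> k \<Longrightarrow> ?x (k - n) = ?x n" for n
      proof (induction n)
        case (Suc n)
        have e: "even (k - Suc n) = even n"
          using Suc.prems False by (auto simp: even_diff_nat)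
        have "?x (k - Suc n) = ?m (k - Suc n) (?x (k - n))"
          using backward[of "k - Suc n"] Suc.prems by (simp del: alternate.simps add: Suc_diff_Suc Suc_le_eq)
        also have "\<dots> = ?m n (?x n)"
          using Suc e by simp
        finally show ?case
          by simp
      qed (use xk in simp)
      obtain l where l: "k = 2 * l + 1"
        using False oddE by blast
      then have "?x (Suc l) = ?x l"
        using refl[of l] by (simp del: alternate.simps)
      then show False
        using least[of l] l by simp
    qed
  qed
  show ?thesis
  proof (intro bexI[of _ "?x k"] conjI allI impI)
    show "p (?x k) = ?x k \<or> q (?x k) = ?x k"
      using k by (cases "even k") auto
    show "?x k \<noteq> v" "(v, ?x k) \<in> R\<^sup>*" "?x k \<in> V"
      by (rule ne reach x)+
    fix w
    assume w: "(v, w) \<in> R\<^sup>*" "p w = w \<or> q w = w"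
    then obtain n where n: "n \<le> k" "w = ?x n"
      using closed by blast
    \<comment> \<open>A point of the walk fixed by \<open>p\<close> or \<open>q\<close> equals a
      neighbour on the walk, which the minimality of \<open>k\<close> excludes away from the two
      ends.\<close>
    then have "?x (Suc n) = ?x n \<or> n = 0 \<or> ?x (n - 1) = ?x n"
      using w(2) step[of n] n(2) by (auto simp del: alternate.simps simp: doubleton_eq_iff split: if_splits)
    moreover have "?x (n - 1) \<noteq> ?x n" if "n \<noteq> 0"
      using least[of "n - 1"] n(1) that by (metis Suc_diff_1 Suc_le_eq bot_nat_0.not_eq_extremum)
    ultimately show "w = v \<or> w = ?x k"
      using least[of n] n by (metis alternate.simps(1) le_neq_implies_less)
  qed
qed

section \<open>Partner maps and the stacking of pairings\<close>

text \<open>The identity outside the matched points makes it a total involution whose fixed points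
  are exactly the unmatched points.\<close>

definition partner :: "'a set set \<Rightarrow> 'a \<Rightarrow> 'a" where
  "partner P x = (if \<exists>y. {x, y} \<in> P then THE y. {x, y} \<in> P else x)"

lemma partner_eq: "perfect_matching S P \<Longrightarrow> {x, y} \<in> P \<Longrightarrow> partner P x = y"
  unfolding partner_def using matching_unique[of S P x] by (auto intro!: the_equality)

lemma partner_mem: "perfect_matching S P \<Longrightarrow> x \<in> S \<Longrightarrow> {x, partner P x} \<in> P"
  using matching_partner partner_eq by metis

lemma partner_outside: "perfect_matching S P \<Longrightarrow> x \<notin> S \<Longrightarrow> partner P x = x"
  unfolding partner_def using matching_pairD(1)[of S P x] by auto

lemma partner_partner: "perfect_matching S P \<Longrightarrow> partner P (partner P x) = x"
  using partner_mem[of S P x] partner_eq[of S P "partner P x" x] partner_outside[of S P x]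
  by (cases "x \<in> S") (simp_all add: insert_commute)

lemma partner_closed: "perfect_matching S P \<Longrightarrow> x \<in> S \<Longrightarrow> partner P x \<in> S"
  using partner_mem matching_pairD(2) by metis

lemma partner_neq: "perfect_matching S P \<Longrightarrow> x \<in> S \<Longrightarrow> partner P x \<noteq> x"
  using partner_mem matching_pairD(3) by metis

lemma matching_pair_iff: "perfect_matching S P \<Longrightarrow> {x, y} \<in> P \<longleftrightarrow> x \<in> S \<and> y = partner P x"
  using partner_eq[of S P x y] partner_mem[of S P x] matching_pairD(1)[of S P x y] by blast

lemma matching_image_pair_iff:
  assumes P: "perfect_matching S P" and e: "inj e"
  shows "(\<exists>s t. x = e s \<and> y = e t \<and> {s, t} \<in> P) \<longleftrightarrow> {x, y} \<in> (`) e ` P"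
proof
  assume "\<exists>s t. x = e s \<and> y = e t \<and> {s, t} \<in> P"
  then obtain s t where st: "x = e s" "y = e t" "{s, t} \<in> P"
    by blast
  then have "e ` {s, t} \<in> (`) e ` P"
    by blast
  then show "{x, y} \<in> (`) e ` P"
    by (simp add: st)
next
  assume "{x, y} \<in> (`) e ` P"
  then obtain r where r: "r \<in> P" "{x, y} = e ` r"
    by blast
  obtain s t where st: "x = e s" "y = e t" "s \<in> r" "t \<in> r"
    using r(2) by blast
  have "e ` r = e ` {s, t}"
    using r(2) st by simp
  then have "r = {s, t}"
    using e by (simp only: inj_image_eq_iff)
  then show "\<exists>s t. x = e s \<and> y = e t \<and> {s, t} \<in> P"
    using st r by blast
qed

lemma on_lines_inj: "k \<noteq> l \<Longrightarrow> on_lines k l x = on_lines k l y \<Longrightarrow> x = y"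
  by (cases x; cases y) auto

lemma inj_on_lines: "k \<noteq> l \<Longrightarrow> inj (on_lines k l)"
  by (auto intro: injI on_lines_inj)

text \<open>A point of only one of \<open>S\<close> and \<open>T\<close> is fixed by exactly one of
  the two partner maps. The superposed strands differ from the relation in
  \<open>involutions_orbit\<close> only by loops, so both connect the same distinct points.\<close>

lemma matching_orbit':
  assumes fin: "finite S" "finite T" and P: "perfect_matching S P" and Q: "perfect_matching T Q"
    and v: "v \<in> S" "v \<notin> T"
  shows "\<exists>u. u \<in> (S - T) \<union> (T - S) \<and> u \<noteq> v \<and> (v, u) \<in> {(x, y). {x, y} \<in> P \<or> {x, y} \<in> Q}\<^sup>+ \<and>
    (\<forall>w \<in> (S - T) \<union> (T - S). (v, w) \<in> {(x, y). {x, y} \<in> P \<or> {x, y} \<in> Q}\<^sup>+ \<longrightarrow> w = v \<or> w = u)"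
proof -
  define p where "p = partner P"
  define q where "q = partner Q"
  define V where "V = S \<union> T"
  define R where "R = {(x, y). x \<in> V \<and> (y = p x \<or> y = q x)}"
  define G where "G = {(x, y). {x, y} \<in> P \<or> {x, y} \<in> Q}"
  have p: "x \<in> S \<Longrightarrow> p x \<in> S" "x \<in> S \<Longrightarrow> p x \<noteq> x" "x \<notin> S \<Longrightarrow> p x = x" "p (p x) = x"
      "{x, y} \<in> P \<longleftrightarrow> x \<in> S \<and> y = p x" for x y
    unfolding p_def
    by (rule partner_closed[OF P] partner_neq[OF P] partner_outside[OF P] partner_partner[OF P]
        matching_pair_iff[OF P]; assumption?)+
  have q: "x \<in> T \<Longrightarrow> q x \<in> T" "x \<in> T \<Longrightarrow> q x \<noteq> x" "x \<notin> T \<Longrightarrow> q x = x" "q (q x) = x"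
      "{x, y} \<in> Q \<longleftrightarrow> x \<in> T \<and> y = q x" for x y
    unfolding q_def
    by (rule partner_closed[OF Q] partner_neq[OF Q] partner_outside[OF Q] partner_partner[OF Q]
        matching_pair_iff[OF Q]; assumption?)+
  have closed_p: "p x \<in> V" if "x \<in> V" for x
    using that p(1,3)[of x] by (cases "x \<in> S") (simp_all add: V_def)
  have closed_q: "q x \<in> V" if "x \<in> V" for x
    using that q(1,3)[of x] by (cases "x \<in> T") (simp_all add: V_def)
  have G: "G = {(x, y) \<in> R. x \<noteq> y}"
  proof -
    have "(x, y) \<in> G \<longleftrightarrow> (x, y) \<in> R \<and> x \<noteq> y" for x y
      using p(2,3,5)[of x] q(2,3,5)[of x] unfolding G_def R_def V_def
      by (cases "x \<in> S"; cases "x \<in> T") auto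
    then show ?thesis
      by auto
  qed
  have GR: "G\<^sup>* = R\<^sup>*"
    by (rule rtrancl_subset[symmetric]) (unfold G, blast+)
  have reach: "(x, y) \<in> G\<^sup>+ \<longleftrightarrow> (x, y) \<in> R\<^sup>*" if "x \<noteq> y" for x y
    using that rtrancl_eq_or_trancl[of x y G] unfolding GR by blast
  have v': "v \<in> V" "finite V" "q v = v" "p v \<noteq> v"
    using v fin p(2) q(3) unfolding V_def by simp_all
  obtain u where u: "u \<in> V" "u \<noteq> v" "p u = u \<or> q u = u" "(v, u) \<in> R\<^sup>*"
    "\<And>w. (v, w) \<in> R\<^sup>* \<Longrightarrow> p w = w \<or> q w = w \<Longrightarrow> w = v \<or> w = u"
    using involutions_orbit[OF v'(2,1) closed_p p(4) closed_q q(4) v'(3,4), folded R_def] by blast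
  have "w = v \<or> w = u" if w: "w \<in> (S - T) \<union> (T - S)" "(v, w) \<in> G\<^sup>+" for w
  proof -
    have "p w = w \<or> q w = w"
      using w(1) p(3)[of w] q(3)[of w] by blast
    then show ?thesis
      using u(5)[of w] reach[of v w] w(2) by auto
  qed
  moreover have "u \<in> (S - T) \<union> (T - S)"
  proof -
    have "u \<notin> S \<or> u \<notin> T"
      using u(3) p(2)[of u] q(2)[of u] by blast
    then show ?thesis
      using u(1) unfolding V_def by blast
  qed
  moreover have "(v, u) \<in> G\<^sup>+"
    using reach[OF u(2)[symmetric]] u(4) by simp
  ultimately show ?thesis
    using u(2) unfolding G_def[symmetric] by (intro exI[of _ u]) simp
qed

lemma matching_orbit:
  assumes fin: "finite S" "finite T" and P: "perfect_matching S P" and Q: "perfect_matching T Q"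
    and v: "v \<in> (S - T) \<union> (T - S)"
  shows "\<exists>u. u \<in> (S - T) \<union> (T - S) \<and> u \<noteq> v \<and> (v, u) \<in> {(x, y). {x, y} \<in> P \<or> {x, y} \<in> Q}\<^sup>+ \<and>
    (\<forall>w \<in> (S - T) \<union> (T - S). (v, w) \<in> {(x, y). {x, y} \<in> P \<or> {x, y} \<in> Q}\<^sup>+ \<longrightarrow> w = v \<or> w = u)"
proof (cases "v \<in> S")
  case True
  then show ?thesis
    using v by (intro matching_orbit'[OF fin P Q]) auto
next
  case False
  have swap: "{(x, y). {x, y} \<in> Q \<or> {x, y} \<in> P} = {(x, y). {x, y} \<in> P \<or> {x, y} \<in> Q}"
      "(T - S) \<union> (S - T) = (S - T) \<union> (T - S)"
    by auto
  have "v \<in> T"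
    using v False by blast
  from matching_orbit'[OF fin(2,1) Q P this False, unfolded swap] show ?thesis .
qed

text \<open>Brings the gluing into the form required by \<open>matching_orbit\<close>: two
  superposed matchings on the points of three lines.\<close>

lemma glued_eq:
  assumes P: "perfect_matching (points a c) P" and Q: "perfect_matching (points c b) Q"
  shows "glued Q P = {(x, y). {x, y} \<in> (`) (on_lines 0 1) ` P \<or> {x, y} \<in> (`) (on_lines 1 2) ` Q}"
proof -
  have i: "inj (on_lines 0 1)" "inj (on_lines 1 2)"
    by (rule inj_on_lines, simp)+
  have iff: "(x, y) \<in> glued Q P \<longleftrightarrow> {x, y} \<in> (`) (on_lines 0 1) ` P \<or> {x, y} \<in> (`) (on_lines 1 2) ` Q" for x y
  proof -
    have "(x, y) \<in> glued Q P \<longleftrightarrow> (\<exists>s t. x = on_lines 0 1 s \<and> y = on_lines 0 1 t \<and> {s, t} \<in> P) \<or>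
        (\<exists>s t. x = on_lines 1 2 s \<and> y = on_lines 1 2 t \<and> {s, t} \<in> Q)"
      unfolding glued_def by blast
    then show ?thesis
      by (simp only: matching_image_pair_iff[OF P i(1)] matching_image_pair_iff[OF Q i(2)])
  qed
  show ?thesis
  proof (rule Set.set_eqI)
    fix z
    show "z \<in> glued Q P \<longleftrightarrow>
        z \<in> {(x, y). {x, y} \<in> (`) (on_lines 0 1) ` P \<or> {x, y} \<in> (`) (on_lines 1 2) ` Q}"
      by (cases z) (simp only: iff mem_Collect_eq prod.case)
  qed
qed

text \<open>Middle points are matched from both sides and outer points from one side, so the path
  from an outer point ends at exactly one other outer point.\<close>

lemma perfect_matching_stack:
  assumes P: "perfect_matching (points a c) P" and Q: "perfect_matching (points c b) Q"
  shows "perfect_matching (points a b) (stack Q P)"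
proof -
  define S where "S = on_lines 0 1 ` points a c"
  define T where "T = on_lines 1 2 ` points c b"
  define e where "e = on_lines 0 2"
  define G where "G = (glued Q P)\<^sup>+"
  have P': "perfect_matching S ((`) (on_lines 0 1) ` P)"
    unfolding S_def using P by (rule perfect_matching_image) (rule inj_on_subset[OF inj_on_lines], simp_all)
  have Q': "perfect_matching T ((`) (on_lines 1 2) ` Q)"
    unfolding T_def using Q by (rule perfect_matching_image) (rule inj_on_subset[OF inj_on_lines], simp_all)
  have fin: "finite S" "finite T"
    by (simp_all add: S_def T_def points_def)
  have outer: "(S - T) \<union> (T - S) = e ` points a b"
    unfolding S_def T_def e_def by (auto simp: points_def image_Un image_image)
  have e: "e x = e y \<longleftrightarrow> x = y" for x y
    unfolding e_def using on_lines_inj[of 0 2 x y] by auto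
  have sym: "(y, x) \<in> G" if "(x, y) \<in> G" for x y
  proof -
    have "sym (glued Q P)"
      unfolding glued_eq[OF P Q] sym_def by (simp add: insert_commute)
    then show ?thesis
      using that unfolding G_def by (metis sym_trancl symD)
  qed
  have field: "x \<in> S \<union> T" if "(x, y) \<in> G" for x y
  proof -
    from tranclD[OF that[unfolded G_def]] obtain z where "(x, z) \<in> glued Q P"
      by blast
    then show ?thesis
      unfolding glued_eq[OF P Q] using matching_pairD(1)[OF P'] matching_pairD(1)[OF Q'] by blast
  qed
  have field': "x \<in> points a b" if "(e x, y) \<in> G" for x y
    using field[OF that] unfolding S_def T_def e_def by (cases x) (auto simp: points_def)
  have orbit: "\<exists>t\<in>points a b. t \<noteq> s \<and> (e s, e t) \<in> G \<and>
      (\<forall>r\<in>points a b. (e s, e r) \<in> G \<longrightarrow> r = s \<or> r = t)" if "s \<in> points a b" for s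
  proof -
    have "e s \<in> (S - T) \<union> (T - S)"
      unfolding outer using that by blast
    from matching_orbit[OF fin P' Q' this, folded glued_eq[OF P Q], folded G_def, unfolded outer]
    obtain u where u: "u \<in> e ` points a b" "u \<noteq> e s" "(e s, u) \<in> G"
      "\<And>w. w \<in> e ` points a b \<Longrightarrow> (e s, w) \<in> G \<Longrightarrow> w = e s \<or> w = u"
      by blast
    obtain t where t: "t \<in> points a b" "u = e t"
      using u(1) by blast
    have "r = s \<or> r = t" if "r \<in> points a b" "(e s, e r) \<in> G" for r
      using u(4)[of "e r"] that e unfolding t(2) by blast
    then show ?thesis
      using t u(2,3) by (intro bexI[of _ t]) auto
  qed
  have mem: "{s, t} \<in> stack Q P \<longleftrightarrow> s \<noteq> t \<and> (e s, e t) \<in> G" for s t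
    unfolding stack_def e_def[symmetric] G_def[symmetric] using sym[of "e s" "e t"] sym[of "e t" "e s"]
    by (auto simp: doubleton_eq_iff)
  show ?thesis
  proof (rule perfect_matchingI)
    fix s
    assume s: "s \<in> stack Q P"
    then obtain x y where xy: "s = {x, y}"
      unfolding stack_def by blast
    then have "x \<noteq> y" "(e x, e y) \<in> G"
      using s mem by auto
    then show "\<exists>x y. s = {x, y} \<and> x \<noteq> y \<and> x \<in> points a b \<and> y \<in> points a b"
      using xy field' sym by blast
  next
    fix x
    assume "x \<in> points a b"
    then show "\<exists>y. {x, y} \<in> stack Q P"
      using orbit[of x] unfolding mem by metis
  next
    fix x y z
    assume "{x, y} \<in> stack Q P" "{x, z} \<in> stack Q P"
    then have *: "x \<noteq> y" "(e x, e y) \<in> G" "x \<noteq> z" "(e x, e z) \<in> G"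
      unfolding mem by auto
    then have "x \<in> points a b" "y \<in> points a b" "z \<in> points a b"
      using field' sym by blast+
    then show "y = z"
      using orbit[of x] * by blast
  qed
qed

lemma shift_point_inj: "inj (shift_point a b)"
proof (rule injI)
  show "shift_point a b x = shift_point a b y \<Longrightarrow> x = y" for x y
    by (cases x; cases y) auto
qed

lemma points_add: "points (a + c) (b + d) = points a b \<union> shift_point a b ` points c d"
proof -
  have "{..<a + c} = {..<a} \<union> (+) a ` {..<c}" for a c :: nat
    by (simp add: lessThan_atLeast0 image_add_atLeastLessThan add.commute ivl_disj_un)
  then show ?thesis
    by (auto simp: points_def image_Un image_image)
qed

lemma points_disjoint: "points a b \<inter> shift_point a b ` points c d = {}"
  by (auto simp: points_def)

lemma drawing_perfect_matching: "drawing f a b P \<Longrightarrow> perfect_matching (points a b) P"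
proof (induction rule: drawing.induct)
  case 1
  show ?case
    by (rule perfect_matchingI) (auto simp: points_def doubleton_eq_iff less_Suc_eq numeral_2_eq_2)
next
  case 2
  show ?case
    by (rule perfect_matchingI) (auto simp: points_def doubleton_eq_iff less_Suc_eq numeral_2_eq_2)
next
  case 3
  show ?case
    by (rule perfect_matchingI) (auto simp: points_def doubleton_eq_iff less_Suc_eq numeral_2_eq_2)
next
  case (4 a)
  show ?case
  proof (rule perfect_matchingI)
    show "\<exists>x y. s = {x, y} \<and> x \<noteq> y \<and> x \<in> points a a \<and> y \<in> points a a"
      if "s \<in> {{Lower i, Upper i} | i. i < a}" for s
      using that by (force intro: exI[of _ "Lower _"] exI[of _ "Upper _"])
    show "\<exists>y. {x, y} \<in> {{Lower i, Upper i} | i. i < a}" if "x \<in> points a a" for x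
      using that by (cases x) (auto simp: doubleton_eq_iff)
  qed (auto simp: doubleton_eq_iff)
next
  case (5 f a b P g c d Q)
  have "perfect_matching (shift_point a b ` points c d) ((`) (shift_point a b) ` Q)"
    using 5 by (intro perfect_matching_image) (auto intro: inj_on_subset[OF shift_point_inj])
  then show ?case
    unfolding points_add using 5 points_disjoint by (intro perfect_matching_Un)
next
  case (6 f a c P g b Q)
  then show ?case
    by (intro perfect_matching_stack)
qed

section \<open>Perfect matchings are drawable\<close>

text \<open>The strands of \<open>R\<close> already cover \<open>S\<close> and leave no room for
  others; one inclusion thus proves equality of matchings.\<close>

lemma perfect_matching_subset_eq:
  assumes P: "perfect_matching S P" and R: "perfect_matching S R" and sub: "R \<subseteq> P"
  shows "P = R"
proof (intro equalityI sub subsetI)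
  fix s
  assume s: "s \<in> P"
  then obtain x y where xy: "s = {x, y}" "x \<in> S"
    using matching_pairE[OF P] by blast
  then obtain z where "{x, z} \<in> R"
    using matching_partner[OF R] by blast
  moreover from this have "s = {x, z}"
    using matching_strand_unique[OF P s, of "{x, z}" x] sub xy by auto
  ultimately show "s \<in> R"
    by simp
qed

text \<open>Stacking yields a perfect matching, so it is enough to find a path for each strand of
  \<open>R\<close>.\<close>

lemma stack_eqI:
  assumes P: "perfect_matching (points a c) P" and Q: "perfect_matching (points c b) Q"
    and R: "perfect_matching (points a b) R"
    and reach: "\<And>s t. {s, t} \<in> R \<Longrightarrow> (on_lines 0 2 s, on_lines 0 2 t) \<in> (glued Q P)\<^sup>*"
  shows "stack Q P = R"
proof (rule perfect_matching_subset_eq[OF perfect_matching_stack[OF P Q] R])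
  show "R \<subseteq> stack Q P"
  proof
    fix r
    assume r: "r \<in> R"
    then obtain s t where st: "r = {s, t}" "s \<noteq> t"
      using matching_pairE[OF R] by blast
    then have "on_lines 0 2 s \<noteq> on_lines 0 2 t"
      using on_lines_inj[of 0 2 s t] by auto
    then have "(on_lines 0 2 s, on_lines 0 2 t) \<in> (glued Q P)\<^sup>+"
      using reach[of s t] r st by (auto simp: rtrancl_eq_or_trancl)
    then show "r \<in> stack Q P"
      unfolding stack_def using st by blast
  qed
qed

section \<open>Relabelling points by stacking with permutations\<close>

fun map_lower :: "(nat \<Rightarrow> nat) \<Rightarrow> bpoint \<Rightarrow> bpoint" where
  "map_lower \<sigma> (Lower i) = Lower (\<sigma> i)"
| "map_lower \<sigma> (Upper j) = Upper j"

fun map_upper :: "(nat \<Rightarrow> nat) \<Rightarrow> bpoint \<Rightarrow> bpoint" where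
  "map_upper \<sigma> (Lower i) = Lower i"
| "map_upper \<sigma> (Upper j) = Upper (\<sigma> j)"

definition perm_pairing :: "(nat \<Rightarrow> nat) \<Rightarrow> nat \<Rightarrow> pairing" where
  "perm_pairing \<sigma> a = {{Lower i, Upper (\<sigma> i)} | i. i < a}"

lemma perm_pairing_matching:
  assumes "\<sigma> permutes {..<a}"
  shows "perfect_matching (points a a) (perm_pairing \<sigma> a)"
proof (rule perfect_matchingI)
  fix s
  assume "s \<in> perm_pairing \<sigma> a"
  then obtain i where i: "i < a" "s = {Lower i, Upper (\<sigma> i)}"
    by (auto simp: perm_pairing_def)
  then have "\<sigma> i < a"
    using permutes_in_image[OF assms, of i] by simp
  then show "\<exists>x y. s = {x, y} \<and> x \<noteq> y \<and> x \<in> points a a \<and> y \<in> points a a"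
    using i by (intro exI[of _ "Lower i"] exI[of _ "Upper (\<sigma> i)"]) simp
next
  fix x
  assume x: "x \<in> points a a"
  show "\<exists>y. {x, y} \<in> perm_pairing \<sigma> a"
  proof (cases x)
    case (Lower i)
    then show ?thesis
      using x by (auto simp: perm_pairing_def)
  next
    case (Upper j)
    then have "j \<in> \<sigma> ` {..<a}"
      using x permutes_image[OF assms] by simp
    then show ?thesis
      using Upper by (auto simp: perm_pairing_def insert_commute)
  qed
next
  fix x y z
  assume "{x, y} \<in> perm_pairing \<sigma> a" "{x, z} \<in> perm_pairing \<sigma> a"
  then show "y = z"
    using permutes_inj[OF assms] by (auto simp: perm_pairing_def doubleton_eq_iff dest: injD)
qed

lemma map_lower_inj: "inj \<sigma> \<Longrightarrow> inj (map_lower \<sigma>)"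
proof (rule injI)
  show "inj \<sigma> \<Longrightarrow> map_lower \<sigma> x = map_lower \<sigma> y \<Longrightarrow> x = y" for x y
    by (cases x; cases y) (auto dest: injD)
qed

lemma map_upper_inj: "inj \<sigma> \<Longrightarrow> inj (map_upper \<sigma>)"
proof (rule injI)
  show "inj \<sigma> \<Longrightarrow> map_upper \<sigma> x = map_upper \<sigma> y \<Longrightarrow> x = y" for x y
    by (cases x; cases y) (auto dest: injD)
qed

lemma map_lower_points: "\<sigma> permutes {..<a} \<Longrightarrow> map_lower \<sigma> ` points a b = points a b"
  using permutes_image[of \<sigma> "{..<a}"] by (simp add: points_def image_Un image_image) (metis image_image)

lemma map_upper_points: "\<sigma> permutes {..<b} \<Longrightarrow> map_upper \<sigma> ` points a b = points a b"
  using permutes_image[of \<sigma> "{..<b}"] by (simp add: points_def image_Un image_image) (metis image_image)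

lemma map_lower_matching:
  "\<sigma> permutes {..<a} \<Longrightarrow> perfect_matching (points a b) P
    \<Longrightarrow> perfect_matching (points a b) ((`) (map_lower \<sigma>) ` P)"
  using perfect_matching_image[of "points a b" P "map_lower \<sigma>"]
  by (simp add: map_lower_points inj_on_subset[OF map_lower_inj[OF permutes_inj]])

lemma map_upper_matching:
  "\<sigma> permutes {..<b} \<Longrightarrow> perfect_matching (points a b) P
    \<Longrightarrow> perfect_matching (points a b) ((`) (map_upper \<sigma>) ` P)"
  using perfect_matching_image[of "points a b" P "map_upper \<sigma>"]
  by (simp add: map_upper_points inj_on_subset[OF map_upper_inj[OF permutes_inj]])

lemma glued_lowerI: "{s, t} \<in> P \<Longrightarrow> (on_lines 0 1 s, on_lines 0 1 t) \<in> glued Q P"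
  unfolding glued_def by blast

lemma glued_upperI: "{s, t} \<in> Q \<Longrightarrow> (on_lines 1 2 s, on_lines 1 2 t) \<in> glued Q P"
  unfolding glued_def by blast

lemma stack_perm_right:
  assumes \<sigma>: "\<sigma> permutes {..<a}" and R: "perfect_matching (points a b) R"
  shows "stack ((`) (map_lower \<sigma>) ` R) (perm_pairing \<sigma> a) = R"
    "loop_free a ((`) (map_lower \<sigma>) ` R) (perm_pairing \<sigma> a)"
proof -
  let ?Q = "(`) (map_lower \<sigma>) ` R" and ?P = "perm_pairing \<sigma> a"
  have edge: "((0, i), (1, \<sigma> i)) \<in> glued ?Q ?P" "((1, \<sigma> i), (0, i)) \<in> glued ?Q ?P" if "i < a" for i
    using glued_lowerI[of "Lower i" "Upper (\<sigma> i)" ?P ?Q] glued_lowerI[of "Upper (\<sigma> i)" "Lower i" ?P ?Q] that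
    by (auto simp: perm_pairing_def insert_commute)
  have path: "(on_lines 0 2 s, on_lines 1 2 (map_lower \<sigma> s)) \<in> (glued ?Q ?P)\<^sup>*"
    "(on_lines 1 2 (map_lower \<sigma> s), on_lines 0 2 s) \<in> (glued ?Q ?P)\<^sup>*" if "s \<in> points a b" for s
    using that edge by (cases s; auto)+
  show "stack ?Q ?P = R"
  proof (rule stack_eqI[OF perm_pairing_matching[OF \<sigma>] map_lower_matching[OF \<sigma> R] R])
    fix s t
    assume st: "{s, t} \<in> R"
    then have "map_lower \<sigma> ` {s, t} \<in> ?Q"
      by blast
    then have "(on_lines 1 2 (map_lower \<sigma> s), on_lines 1 2 (map_lower \<sigma> t)) \<in> glued ?Q ?P"
      by (intro glued_upperI) simp
    then show "(on_lines 0 2 s, on_lines 0 2 t) \<in> (glued ?Q ?P)\<^sup>*"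
      using path(1)[of s] path(2)[of t] matching_pairD[OF R st] by (meson rtrancl.rtrancl_into_rtrancl rtrancl_trans)
  qed
  show "loop_free a ?Q ?P"
    unfolding loop_free_def
  proof (intro allI impI)
    fix j
    assume "j < a"
    then obtain i where "i < a" "j = \<sigma> i"
      using permutes_image[OF \<sigma>] by (metis imageE lessThan_iff)
    then show "\<exists>p. ((1, j), on_lines 0 2 p) \<in> (glued ?Q ?P)\<^sup>+"
      using edge(2)[of i] by (intro exI[of _ "Lower i"]) auto
  qed
qed

lemma stack_perm_left:
  assumes \<sigma>: "\<sigma> permutes {..<b}" and P: "perfect_matching (points a b) P"
  shows "stack (perm_pairing \<sigma> b) P = (`) (map_upper \<sigma>) ` P"
    "loop_free b (perm_pairing \<sigma> b) P"
proof -
  let ?Q = "perm_pairing \<sigma> b"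
  have edge: "((1, i), (2, \<sigma> i)) \<in> glued ?Q P" "((2, \<sigma> i), (1, i)) \<in> glued ?Q P" if "i < b" for i
    using glued_upperI[of "Lower i" "Upper (\<sigma> i)" ?Q P] glued_upperI[of "Upper (\<sigma> i)" "Lower i" ?Q P] that
    by (auto simp: perm_pairing_def insert_commute)
  have path: "(on_lines 0 2 (map_upper \<sigma> s), on_lines 0 1 s) \<in> (glued ?Q P)\<^sup>*"
    "(on_lines 0 1 s, on_lines 0 2 (map_upper \<sigma> s)) \<in> (glued ?Q P)\<^sup>*" if "s \<in> points a b" for s
    using that edge by (cases s; auto)+
  show "stack ?Q P = (`) (map_upper \<sigma>) ` P"
  proof (rule stack_eqI[OF P perm_pairing_matching[OF \<sigma>] map_upper_matching[OF \<sigma> P]])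
    fix s t
    assume "{s, t} \<in> (`) (map_upper \<sigma>) ` P"
    then obtain s' t' where st: "s = map_upper \<sigma> s'" "t = map_upper \<sigma> t'" "{s', t'} \<in> P"
      using matching_image_pair_iff[OF P map_upper_inj[OF permutes_inj[OF \<sigma>]]] by blast
    then have "(on_lines 0 1 s', on_lines 0 1 t') \<in> glued ?Q P"
      by (intro glued_lowerI)
    then show "(on_lines 0 2 s, on_lines 0 2 t) \<in> (glued ?Q P)\<^sup>*"
      using path(1)[of s'] path(2)[of t'] matching_pairD[OF P st(3)] unfolding st(1,2)
      by (meson rtrancl.rtrancl_into_rtrancl rtrancl_trans)
  qed
  show "loop_free b ?Q P"
    unfolding loop_free_def
  proof (intro allI impI)
    fix i
    assume "i < b"
    then show "\<exists>p. ((1, i), on_lines 0 2 p) \<in> (glued ?Q P)\<^sup>+"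
      using edge(1)[of i] by (intro exI[of _ "Upper (\<sigma> i)"]) auto
  qed
qed

lemma drawing_adjacent_swap:
  assumes "Suc i < a"
  shows "drawing (One i \<^bold>\<otimes> Cross \<^bold>\<otimes> One (a - Suc (Suc i))) a a (perm_pairing (transpose i (Suc i)) a)"
proof -
  obtain r where r: "a = i + (2 + r)"
    using assms less_eq_Suc_le le_Suc_ex[of "Suc (Suc i)" a] by auto
  let ?P = "{{Lower j, Upper j} | j. j < i} \<union> (`) (shift_point i i) `
      ({{Lower 0, Upper 1}, {Lower 1, Upper 0}} \<union> (`) (shift_point 2 2) ` {{Lower j, Upper j} | j. j < r})"
  have "drawing (One i \<^bold>\<otimes> Cross \<^bold>\<otimes> One r) (i + (2 + r)) (i + (2 + r)) ?P"
    by (intro drawing.intros)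
  \<comment> \<open>The drawing rules produce the pairing as nested shifted unions; as both sides
    are perfect matchings, only one inclusion has to be checked.\<close>
  moreover have "?P = perm_pairing (transpose i (Suc i)) a"
  proof (rule perfect_matching_subset_eq[symmetric])
    show "perfect_matching (points a a) (perm_pairing (transpose i (Suc i)) a)"
      using assms by (intro perm_pairing_matching permutes_swap_id) auto
    show "perfect_matching (points a a) ?P"
      using calculation unfolding r by (rule drawing_perfect_matching)
    show "?P \<subseteq> perm_pairing (transpose i (Suc i)) a"
    proof
      fix s
      assume "s \<in> ?P"
      then consider j where "j < i" "s = {Lower j, Upper j}" | "s = {Lower i, Upper (Suc i)}"
        | "s = {Lower (Suc i), Upper i}" | j where "j < r" "s = {Lower (i + (2 + j)), Upper (i + (2 + j))}"
        by auto
      then show "s \<in> perm_pairing (transpose i (Suc i)) a"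
      proof cases
        case (1 j)
        then show ?thesis
          by (auto simp: perm_pairing_def r intro!: exI[of _ j])
      next
        case 2
        then show ?thesis
          by (auto simp: perm_pairing_def r intro!: exI[of _ i])
      next
        case 3
        then show ?thesis
          by (auto simp: perm_pairing_def r intro!: exI[of _ "Suc i"])
      next
        case (4 j)
        then show ?thesis
          by (auto simp: perm_pairing_def r intro!: exI[of _ "i + (2 + j)"])
      qed
    qed
  qed
  ultimately show ?thesis
    by (simp add: r)
qed

text \<open>A crossing attached below undoes a swap of neighbouring lower points, so a strand end
  may be moved one place at a time.\<close>

lemma drawable_swap_lower:
  assumes P: "perfect_matching (points a b) P" and i: "Suc i < a"
    and f: "drawing (f :: 'k brterm) a b ((`) (map_lower (transpose i (Suc i))) ` P)"
  shows "\<exists>g :: 'k brterm. drawing g a b P"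
proof -
  have \<sigma>: "transpose i (Suc i) permutes {..<a}"
    using i by (intro permutes_swap_id) auto
  show ?thesis
    using drawing.intros(6)[OF drawing_adjacent_swap[OF i] f] stack_perm_right[OF \<sigma> P] by auto
qed

lemma drawable_swap_upper:
  assumes P: "perfect_matching (points a b) P" and i: "Suc i < b"
    and f: "drawing (f :: 'k brterm) a b ((`) (map_upper (transpose i (Suc i))) ` P)"
  shows "\<exists>g :: 'k brterm. drawing g a b P"
proof -
  have \<sigma>: "transpose i (Suc i) permutes {..<b}"
    using i by (intro permutes_swap_id) auto
  \<comment> \<open>Stacking a permutation on top applies it instead of undoing it, so here the swap
    being an involution is used.\<close>
  have "map_upper (transpose i (Suc i)) (map_upper (transpose i (Suc i)) x) = x" for x
    by (cases x) simp_all
  then have "(`) (map_upper (transpose i (Suc i))) ` (`) (map_upper (transpose i (Suc i))) ` P = P"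
    by (simp add: image_image)
  then show ?thesis
    using drawing.intros(6)[OF f drawing_adjacent_swap[OF i]]
      stack_perm_left[OF \<sigma> map_upper_matching[OF \<sigma> P]] by auto
qed

lemma remove_cup:
  assumes "perfect_matching (points a (b + 2)) P" "{Upper b, Upper (Suc b)} \<in> P"
  shows "perfect_matching (points a b) (P - {{Upper b, Upper (Suc b)}})"
proof -
  have "points a (b + 2) - {Upper b, Upper (Suc b)} = points a b"
    by (auto simp: points_def)
  then show ?thesis
    using perfect_matching_remove[OF assms] by simp
qed

lemma remove_cap:
  assumes "perfect_matching (points (a + 2) b) P" "{Lower a, Lower (Suc a)} \<in> P"
  shows "perfect_matching (points a b) (P - {{Lower a, Lower (Suc a)}})"
proof -
  have "points (a + 2) b - {Lower a, Lower (Suc a)} = points a b"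
    by (auto simp: points_def)
  then show ?thesis
    using perfect_matching_remove[OF assms] by simp
qed

lemma remove_vertical:
  assumes "perfect_matching (points (a + 1) (b + 1)) P" "{Lower a, Upper b} \<in> P"
  shows "perfect_matching (points a b) (P - {{Lower a, Upper b}})"
proof -
  have "points (a + 1) (b + 1) - {Lower a, Upper b} = points a b"
    by (auto simp: points_def)
  then show ?thesis
    using perfect_matching_remove[OF assms] by simp
qed

lemma drawing_tns_cup:
  assumes "drawing f a b (P - {{Upper b, Upper (Suc b)}})" "{Upper b, Upper (Suc b)} \<in> P"
  shows "drawing (f \<^bold>\<otimes> Cup) a (b + 2) P"
  using drawing.intros(5)[OF assms(1) drawing.intros(1)] insert_Diff[OF assms(2)] by simp

lemma drawing_tns_cap:
  assumes "drawing f a b (P - {{Lower a, Lower (Suc a)}})" "{Lower a, Lower (Suc a)} \<in> P"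
  shows "drawing (f \<^bold>\<otimes> Cap) (a + 2) b P"
  using drawing.intros(5)[OF assms(1) drawing.intros(2)] insert_Diff[OF assms(2)] by simp

lemma drawing_tns_vertical:
  assumes "drawing f a b (P - {{Lower a, Upper b}})" "{Lower a, Upper b} \<in> P"
  shows "drawing (f \<^bold>\<otimes> One 1) (a + 1) (b + 1) P"
proof -
  have "{{Lower i, Upper i} | i. i < 1} = {{Lower 0, Upper 0}}"
    by auto
  then show ?thesis
    using drawing.intros(5)[OF assms(1) drawing.intros(4)[of 1]] insert_Diff[OF assms(2)] by simp
qed

lemma mem_map_lower: "{x, y} \<in> P \<Longrightarrow> {map_lower \<sigma> x, map_lower \<sigma> y} \<in> (`) (map_lower \<sigma>) ` P"
  using imageI[of "{x, y}" P "(`) (map_lower \<sigma>)"] by simp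

lemma mem_map_upper: "{x, y} \<in> P \<Longrightarrow> {map_upper \<sigma> x, map_upper \<sigma> y} \<in> (`) (map_upper \<sigma>) ` P"
  using imageI[of "{x, y}" P "(`) (map_upper \<sigma>)"] by simp

text \<open>Consider the strand at the last upper point, or at the last lower point if there are no
  upper ones. Adjacent crossings bring its other end as far right as possible, and it splits off as
  the rightmost tensor factor. Drawability of all matchings is what allows classes of diagrams to be
  counted by pairings.\<close>

theorem perfect_matching_drawable:
  "perfect_matching (points a b) P \<Longrightarrow> \<exists>f :: 'k brterm. drawing f a b P"
proof (induction "a + b" arbitrary: a b P rule: less_induct)
  case less
  \<comment> \<open>\<open>k\<close> counts the crossings still needed before the two ends are
    neighbours; the pairing varies in the induction because each crossing relabels it.\<close>
  have cup: "\<exists>f :: 'k brterm. drawing f a b P"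
    if "perfect_matching (points a b) P" "{Upper j, Upper (b - 1)} \<in> P" "j + Suc k = b - 1" for j k P
    using that
  proof (induction k arbitrary: j P)
    case 0
    have b: "b = j + 2"
      using 0(3) by simp
    then have mem: "{Upper j, Upper (Suc j)} \<in> P"
      using 0(2) by simp
    have "perfect_matching (points a j) (P - {{Upper j, Upper (Suc j)}})"
      using 0(1) mem unfolding b by (rule remove_cup)
    then obtain f :: "'k brterm" where "drawing f a j (P - {{Upper j, Upper (Suc j)}})"
      using less.hyps[of a j] b by auto
    then show ?case
      using drawing_tns_cup[OF _ mem] unfolding b by blast
  next
    case (Suc k)
    let ?s = "transpose j (Suc j)"
    have s: "?s permutes {..<b}" "Suc j < b"
      using Suc.prems by (auto intro!: permutes_swap_id)
    have "{Upper (Suc j), Upper (b - 1)} \<in> (`) (map_upper ?s) ` P"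
      using mem_map_upper[OF Suc.prems(2), of ?s] Suc.prems(3) by simp
    then show ?case
      using Suc.IH[OF map_upper_matching[OF s(1) Suc.prems(1)], of "Suc j"] Suc.prems(3)
        drawable_swap_upper[OF Suc.prems(1) s(2)] by auto
  qed
  have cap: "\<exists>f :: 'k brterm. drawing f a b P"
    if "perfect_matching (points a b) P" "{Lower j, Lower (a - 1)} \<in> P" "j + Suc k = a - 1" for j k P
    using that
  proof (induction k arbitrary: j P)
    case 0
    have a: "a = j + 2"
      using 0(3) by simp
    then have mem: "{Lower j, Lower (Suc j)} \<in> P"
      using 0(2) by simp
    have "perfect_matching (points j b) (P - {{Lower j, Lower (Suc j)}})"
      using 0(1) mem unfolding a by (rule remove_cap)
    then obtain f :: "'k brterm" where "drawing f j b (P - {{Lower j, Lower (Suc j)}})"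
      using less.hyps[of j b] a by auto
    then show ?case
      using drawing_tns_cap[OF _ mem] unfolding a by blast
  next
    case (Suc k)
    let ?s = "transpose j (Suc j)"
    have s: "?s permutes {..<a}" "Suc j < a"
      using Suc.prems by (auto intro!: permutes_swap_id)
    have "{Lower (Suc j), Lower (a - 1)} \<in> (`) (map_lower ?s) ` P"
      using mem_map_lower[OF Suc.prems(2), of ?s] Suc.prems(3) by simp
    then show ?case
      using Suc.IH[OF map_lower_matching[OF s(1) Suc.prems(1)], of "Suc j"] Suc.prems(3)
        drawable_swap_lower[OF Suc.prems(1) s(2)] by auto
  qed
  have vertical: "\<exists>f :: 'k brterm. drawing f a b P"
    if "perfect_matching (points a b) P" "{Lower i, Upper (b - 1)} \<in> P" "i + k = a - 1" "0 < a" "0 < b" for i k P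
    using that
  proof (induction k arbitrary: i P)
    case 0
    obtain b' where b: "b = b' + 1"
      using 0(5) by (cases b) auto
    have a: "a = i + 1"
      using 0(3,4) by simp
    have mem: "{Lower i, Upper b'} \<in> P"
      using 0(2) b by simp
    have "perfect_matching (points i b') (P - {{Lower i, Upper b'}})"
      using 0(1) mem unfolding a b by (rule remove_vertical)
    then obtain f :: "'k brterm" where "drawing f i b' (P - {{Lower i, Upper b'}})"
      using less.hyps[of i b'] a b by auto
    then show ?case
      using drawing_tns_vertical[OF _ mem] unfolding a b by blast
  next
    case (Suc k)
    let ?s = "transpose i (Suc i)"
    have s: "?s permutes {..<a}" "Suc i < a"
      using Suc.prems by (auto intro!: permutes_swap_id)
    have "{Lower (Suc i), Upper (b - 1)} \<in> (`) (map_lower ?s) ` P"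
      using mem_map_lower[OF Suc.prems(2), of ?s] by simp
    then show ?case
      using Suc.IH[OF map_lower_matching[OF s(1) Suc.prems(1)], of "Suc i"] Suc.prems(3-5)
        drawable_swap_lower[OF Suc.prems(1) s(2)] by auto
  qed
  note P = \<open>perfect_matching (points a b) P\<close>
  consider "0 < b" | "b = 0" "0 < a" | "a = 0" "b = 0"
    by blast
  then show ?case
  proof cases
    case 1
    then obtain y where y: "{Upper (b - 1), y} \<in> P"
      using matching_partner[OF P, of "Upper (b - 1)"] by auto
    show ?thesis
    proof (cases y)
      case (Lower i)
      then have "i < a"
        using matching_pairD(2)[OF P y] by simp
      then show ?thesis
        using vertical[OF P, of i "a - 1 - i"] y 1 Lower by (auto simp: insert_commute)
    next
      case (Upper j)
      then have "j < b" "j \<noteq> b - 1"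
        using matching_pairD(2,3)[OF P y] by auto
      then show ?thesis
        using cup[OF P, of j "b - 2 - j"] y Upper by (auto simp: insert_commute)
    qed
  next
    case 2
    then obtain y where y: "{Lower (a - 1), y} \<in> P"
      using matching_partner[OF P, of "Lower (a - 1)"] by auto
    obtain j where j: "y = Lower j"
      using matching_pairD(2)[OF P y] 2 by (cases y) auto
    then have "j < a" "j \<noteq> a - 1"
      using matching_pairD(2,3)[OF P y] by auto
    then show ?thesis
      using cap[OF P, of j "a - 2 - j"] y j by (auto simp: insert_commute)
  next
    case 3
    have "s \<notin> P" for s
    proof
      assume "s \<in> P"
      then obtain x where "x \<in> points a b"
        using matching_pairE[OF P] by metis
      then show False
        using 3 by (simp add: points_def)
    qed
    then have "P = {}"
      by blast
    then show ?thesis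
      using drawing.intros(4)[of 0] 3 by auto
  qed
qed

subsection \<open>Factorisation of drawings\<close>

lemma arrow_drawing: "drawing f a b P \<Longrightarrow> arrow f a b"
  by (induction rule: drawing.induct) (auto intro: arrow.intros)

lemma permutes_two_points:
  fixes i j c :: nat
  assumes "i < c" "j < c" "i \<noteq> j"
  obtains \<sigma> where "\<sigma> permutes {..<c}" "\<sigma> i = c - 2" "\<sigma> j = c - 1"
proof -
  let ?s = "transpose i (c - 2)"
  \<comment> \<open>The second swap starts from \<open>?s j\<close>, where the first one has put
    \<open>j\<close>. As \<open>?s j\<close> is not \<open>c - 2\<close>, it does not disturb the
    image of \<open>i\<close>.\<close>
  let ?t = "transpose (?s j) (c - 1)"
  have c: "c - 2 < c" "c - 1 < c" "c - 2 \<noteq> c - 1"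
    using assms by auto
  have s: "?s permutes {..<c}"
    using assms c by (intro permutes_swap_id) auto
  have sj: "?s j < c" "?s j \<noteq> c - 2"
    using permutes_in_image[OF s, of j] assms by (auto simp: transpose_eq_iff transpose_def)
  have "?t permutes {..<c}"
    using sj c by (intro permutes_swap_id) auto
  then have "?t \<circ> ?s permutes {..<c}"
    by (rule permutes_compose[OF s])
  moreover have "(?t \<circ> ?s) i = c - 2"
    using sj c by (simp add: transpose_def)
  moreover have "(?t \<circ> ?s) j = c - 1"
    by simp
  ultimately show ?thesis
    using that by blast
qed

text \<open>A permutation below moves the ends of the cap to the last two lower positions, where the
  cap is a tensor factor; the rest of the diagram has only \<open>c - 2\<close> lower
  points.\<close>

lemma drawing_through_cap:
  assumes P: "perfect_matching (points c b) P" and ij: "{Lower i, Lower j} \<in> P"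
  obtains f w :: "'k brterm" where "2 \<le> c" "arrow f (c - 2) b" "arrow w c c" "drawing ((f \<^bold>\<otimes> Cap) \<^bold>\<circ> w) c b P"
proof -
  have "i < c" "j < c" "i \<noteq> j"
    using matching_pairD[OF P ij] by auto
  then obtain \<sigma> where \<sigma>: "\<sigma> permutes {..<c}" "\<sigma> i = c - 2" "\<sigma> j = c - 1"
    by (rule permutes_two_points)
  let ?a = "c - 2" and ?Q = "(`) (map_lower \<sigma>) ` P"
  have c: "c = ?a + 2"
    using \<open>i < c\<close> \<open>j < c\<close> \<open>i \<noteq> j\<close> by auto
  have Q: "perfect_matching (points (?a + 2) b) ?Q"
    using map_lower_matching[OF \<sigma>(1) P] c by simp
  have mem: "{Lower ?a, Lower (Suc ?a)} \<in> ?Q"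
    using mem_map_lower[OF ij, of \<sigma>] \<sigma>(2,3) c by (simp add: Suc_diff_Suc numeral_2_eq_2)
  obtain f :: "'k brterm" where f: "drawing f ?a b (?Q - {{Lower ?a, Lower (Suc ?a)}})"
    using perfect_matching_drawable[OF remove_cap[OF Q mem]] by blast
  have fc: "drawing (f \<^bold>\<otimes> Cap) c b ?Q"
    using drawing_tns_cap[OF f mem] c by simp
  obtain w :: "'k brterm" where w: "drawing w c c (perm_pairing \<sigma> c)"
    using perfect_matching_drawable[OF perm_pairing_matching[OF \<sigma>(1)]] by blast
  have "drawing ((f \<^bold>\<otimes> Cap) \<^bold>\<circ> w) c b P"
    using drawing.intros(6)[OF w fc] stack_perm_right[OF \<sigma>(1) P] by simp
  then show ?thesis
    using that c arrow_drawing[OF f] arrow_drawing[OF w] by simp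
qed

definition no_caps :: "pairing \<Rightarrow> bool" where
  "no_caps P \<longleftrightarrow> (\<forall>i j. {Lower i, Lower j} \<notin> P)"

text \<open>Selects one representative among the cap-free diagrams that differ by a permutation of
  their lower points.\<close>

definition increasing :: "pairing \<Rightarrow> bool" where
  "increasing P \<longleftrightarrow> (\<forall>i j i' j'. {Lower i, Upper j} \<in> P \<longrightarrow> {Lower i', Upper j'} \<in> P \<longrightarrow> i < i' \<longrightarrow> j < j')"

definition vertical_ends :: "pairing \<Rightarrow> nat set" where
  "vertical_ends P = {j. \<exists>i. {Lower i, Upper j} \<in> P}"

lemma no_caps_partner:
  assumes P: "perfect_matching (points c b) P" "no_caps P" and i: "i < c"
  obtains j where "{Lower i, Upper j} \<in> P" "j < b"
proof -
  obtain y where y: "{Lower i, y} \<in> P"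
    using matching_partner[OF P(1), of "Lower i"] i by auto
  then obtain j where j: "y = Upper j"
    using P(2) by (cases y) (auto simp: no_caps_def)
  then show ?thesis
    using that y matching_pairD(2)[OF P(1) y] by simp
qed

lemma vertical_ends_enumeration:
  assumes P: "perfect_matching (points c b) P" "no_caps P"
  obtains u where "\<And>i j. {Lower i, Upper j} \<in> P \<longleftrightarrow> i < c \<and> j = u i" "inj_on u {..<c}"
    "vertical_ends P = u ` {..<c}"
proof -
  have "\<forall>i. \<exists>j. i < c \<longrightarrow> {Lower i, Upper j} \<in> P"
    using no_caps_partner[OF P] by metis
  then obtain u where u: "\<And>i. i < c \<Longrightarrow> {Lower i, Upper (u i)} \<in> P"
    by metis
  have iff: "{Lower i, Upper j} \<in> P \<longleftrightarrow> i < c \<and> j = u i" for i j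
  proof
    assume ij: "{Lower i, Upper j} \<in> P"
    then have "i < c"
      using matching_pairD(1)[OF P(1)] by fastforce
    then show "i < c \<and> j = u i"
      using matching_unique[OF P(1) ij u] by simp
  qed (use u in auto)
  moreover have "inj_on u {..<c}"
  proof (rule inj_onI)
    fix i i'
    assume i: "i \<in> {..<c}" "i' \<in> {..<c}" "u i = u i'"
    then have "{Upper (u i), Lower i} \<in> P" "{Upper (u i'), Lower i'} \<in> P"
      using u[of i] u[of i'] by (simp_all only: lessThan_iff insert_commute)
    then have "{Upper (u i), Lower i} \<in> P" "{Upper (u i), Lower i'} \<in> P"
      using i(3) by simp_all
    then show "i = i'"
      using matching_unique[OF P(1)] by blast
  qed
  moreover have "vertical_ends P = u ` {..<c}"
    unfolding vertical_ends_def iff by auto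
  ultimately show ?thesis
    using that by blast
qed

text \<open>Uncrossed verticals preserve order, so the lower end of a vertical is the number of
  vertical ends to the left of its upper end. Hence the set of vertical ends determines all
  verticals.\<close>

lemma increasing_rank:
  assumes P: "perfect_matching (points c b) P" "no_caps P" "increasing P"
  shows "card (vertical_ends P) = c"
    "{Lower i, Upper j} \<in> P \<longleftrightarrow> j \<in> vertical_ends P \<and> i = card {k \<in> vertical_ends P. k < j}"
proof -
  obtain u where u: "\<And>i j. {Lower i, Upper j} \<in> P \<longleftrightarrow> i < c \<and> j = u i" "inj_on u {..<c}"
    "vertical_ends P = u ` {..<c}"
    using vertical_ends_enumeration[OF P(1,2)] by blast
  show "card (vertical_ends P) = c"
    unfolding u(3) using card_image[OF u(2)] by simp
  have mono: "u i < u i'" if "i < i'" "i' < c" for i i'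
    using P(3) that unfolding increasing_def u(1) by auto
  have rank: "card {k \<in> vertical_ends P. k < u i} = i" if "i < c" for i
  proof -
    have "u i' < u i \<longleftrightarrow> i' < i" if "i' < c" for i'
      using mono[of i' i] mono[of i i'] that \<open>i < c\<close> by (cases i' i rule: linorder_cases) auto
    then have "{k \<in> vertical_ends P. k < u i} = u ` {..<i}"
      unfolding u(3) using that by auto
    moreover have "inj_on u {..<i}"
      using that by (intro inj_on_subset[OF u(2)]) auto
    ultimately show ?thesis
      using card_image by fastforce
  qed
  show "{Lower i, Upper j} \<in> P \<longleftrightarrow> j \<in> vertical_ends P \<and> i = card {k \<in> vertical_ends P. k < j}"
    unfolding u(1) using rank by (auto simp: u(3))
qed

text \<open>Lower point \<open>i\<close> is renumbered by the rank \<open>r i\<close> of its upper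
  end, which uncrosses the verticals; a permutation drawn below restores the original order.\<close>

lemma drawing_through_perm:
  assumes P: "perfect_matching (points c b) P" "no_caps P"
  obtains \<sigma> and f w :: "'k brterm" where "\<sigma> permutes {..<c}" "increasing ((`) (map_lower \<sigma>) ` P)"
    "drawing f c b ((`) (map_lower \<sigma>) ` P)" "drawing w c c (perm_pairing \<sigma> c)" "drawing (f \<^bold>\<circ> w) c b P"
proof -
  obtain u where u: "\<And>i j. {Lower i, Upper j} \<in> P \<longleftrightarrow> i < c \<and> j = u i" "inj_on u {..<c}"
    "vertical_ends P = u ` {..<c}"
    using vertical_ends_enumeration[OF P] by blast
  define r where "r i = card {k. k < c \<and> u k < u i}" for i
  have less: "r i < r i'" if "u i < u i'" "i < c" for i i'
    unfolding r_def using that by (intro psubset_card_mono) auto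
  have less_iff: "r i < r i' \<longleftrightarrow> u i < u i'" if "i < c" "i' < c" for i i'
  proof (cases "u i" "u i'" rule: linorder_cases)
    case equal
    then show ?thesis
      by (simp add: r_def)
  next
    case greater
    then show ?thesis
      using less[of i' i] that by auto
  qed (use less that in auto)
  have r_c: "r i < c" if "i < c" for i
  proof -
    have "r i < card {..<c}"
      unfolding r_def using that by (intro psubset_card_mono) auto
    then show ?thesis
      by simp
  qed
  have r_inj: "inj_on r {..<c}"
  proof (rule inj_onI)
    fix i i'
    assume i: "i \<in> {..<c}" "i' \<in> {..<c}" "r i = r i'"
    then have "u i = u i'"
      using less_iff[of i i'] less_iff[of i' i] by auto
    then show "i = i'"
      using u(2) i by (auto dest: inj_onD)
  qed
  have "bij_betw r {..<c} {..<c}"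
  proof -
    have "r ` {..<c} \<subseteq> {..<c}"
      using r_c by auto
    then have "r ` {..<c} = {..<c}"
      using r_inj by (intro endo_inj_surj) auto
    then show ?thesis
      using r_inj by (simp add: bij_betw_def)
  qed
  \<comment> \<open>Extended by the identity, since \<open>permutes\<close> demands this outside the
    set.\<close>
  define \<sigma> where "\<sigma> i = (if i < c then r i else i)" for i
  have \<sigma>: "\<sigma> permutes {..<c}"
  proof (rule bij_imp_permutes)
    show "bij_betw \<sigma> {..<c} {..<c}"
      using \<open>bij_betw r {..<c} {..<c}\<close> by (rule bij_betw_cong[THEN iffD1, rotated]) (simp add: \<sigma>_def)
  qed (simp add: \<sigma>_def)
  let ?Q = "(`) (map_lower \<sigma>) ` P"
  have inc: "increasing ?Q"
    unfolding increasing_def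
  proof (intro allI impI)
    fix i j i' j'
    assume q: "{Lower i, Upper j} \<in> ?Q" "{Lower i', Upper j'} \<in> ?Q" "i < i'"
    have pre: "\<exists>k. k < c \<and> i = r k \<and> j = u k" if q: "{Lower i, Upper j} \<in> ?Q" for i j
    proof -
      obtain s t where st: "Lower i = map_lower \<sigma> s" "Upper j = map_lower \<sigma> t" "{s, t} \<in> P"
        using matching_image_pair_iff[OF P(1) map_lower_inj[OF permutes_inj[OF \<sigma>]]] q by blast
      then obtain k where k: "s = Lower k" "i = \<sigma> k" "t = Upper j"
        by (cases s; cases t) auto
      then show ?thesis
        using st(3) u(1) by (auto simp: \<sigma>_def)
    qed
    show "j < j'"
      using pre[OF q(1)] pre[OF q(2)] q(3) less_iff by blast
  qed
  obtain f :: "'k brterm" where f: "drawing f c b ?Q"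
    using perfect_matching_drawable[OF map_lower_matching[OF \<sigma> P(1)]] by blast
  obtain w :: "'k brterm" where w: "drawing w c c (perm_pairing \<sigma> c)"
    using perfect_matching_drawable[OF perm_pairing_matching[OF \<sigma>]] by blast
  have "drawing (f \<^bold>\<circ> w) c b P"
    using drawing.intros(6)[OF w f] stack_perm_right[OF \<sigma> P(1)] by simp
  then show ?thesis
    using that \<sigma> inc f w by blast
qed

section \<open>Counting dotted diagrams\<close>

lemma strand_at_eq: "perfect_matching S P \<Longrightarrow> s \<in> P \<Longrightarrow> x \<in> s \<Longrightarrow> strand_at P x = s"
  unfolding strand_at_def by (rule the_equality) (simp, elim conjE, rule matching_strand_unique[of S P _ s x])

text \<open>Dot numbers are extensional because \<open>diagram_equiv\<close> compares them on the
  strands of the pairing only; each pair then stands for exactly one class.\<close>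

definition dotted :: "nat \<Rightarrow> nat \<Rightarrow> nat \<Rightarrow> (pairing \<times> (bpoint set \<Rightarrow> nat)) set" where
  "dotted m a b = (SIGMA P:{P. perfect_matching (points a b) P}. P \<rightarrow>\<^sub>E {..m - 1})"

lemma finite_points: "finite (points a b)"
  by (simp add: points_def)

lemma finite_matching: "perfect_matching (points a b) P \<Longrightarrow> finite P"
  by (rule finite_subset[of _ "Pow (points a b)"]) (auto simp: perfect_matching_def finite_points)

lemma finite_dotted: "finite (dotted m a b)"
proof -
  have "{P. perfect_matching (points a b) P} \<subseteq> Pow (Pow (points a b))"
    by (auto simp: perfect_matching_def)
  then have "finite {P. perfect_matching (points a b) P}"
    by (rule finite_subset) (simp add: finite_points)
  then show ?thesis
    unfolding dotted_def by (intro finite_SigmaI finite_PiE) (auto intro: finite_matching)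
qed

definition dotted_class :: "nat \<Rightarrow> nat \<Rightarrow> nat \<Rightarrow> pairing \<times> (bpoint set \<Rightarrow> nat) \<Rightarrow> 'k dotted_diagram set" where
  "dotted_class m a b = (\<lambda>(P, n). {(f, P', n'). P' = P \<and> drawing f a b P \<and> (\<forall>s\<in>P. n' s = n s)})"

lemma dotted_class_mem:
  assumes "(f, P, n) \<in> dotted_diagrams m a b"
  shows "(P, restrict n P) \<in> dotted m a b" "(f, P, n) \<in> dotted_class m a b (P, restrict n P)"
  using assms drawing_perfect_matching
  by (auto simp: dotted_diagrams_def dotted_def dotted_class_def)

lemma dotted_class_quotient:
  assumes "(f, P, n) \<in> dotted_diagrams m a b"
  shows "(diagram_equiv \<inter> dotted_diagrams m a b \<times> dotted_diagrams m a b) `` {(f, P, n)}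
    = dotted_class m a b (P, restrict n P)"
  using assms by (auto simp: dotted_diagrams_def dotted_class_def diagram_equiv_def)

text \<open>A matching with dot numbers gives a class because it has a drawing; conversely every
  drawing has a perfect matching underneath.\<close>

lemma dotted_classes_eq:
  "(dotted_classes m a b :: 'k dotted_diagram set set) = dotted_class m a b ` dotted m a b"
proof (intro equalityI subsetI)
  fix X :: "'k dotted_diagram set"
  assume "X \<in> dotted_classes m a b"
  then obtain D where "D \<in> dotted_diagrams m a b"
      "X = (diagram_equiv \<inter> dotted_diagrams m a b \<times> dotted_diagrams m a b) `` {D}"
    unfolding dotted_classes_def by (rule quotientE)
  moreover obtain f P n where "D = (f, P, n)"
    by (cases D)
  ultimately show "X \<in> dotted_class m a b ` dotted m a b"
    using dotted_class_quotient[of f P n m a b] dotted_class_mem(1)[of f P n m a b] by auto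
next
  fix X :: "'k dotted_diagram set"
  assume "X \<in> dotted_class m a b ` dotted m a b"
  then obtain P n where Pn: "(P, n) \<in> dotted m a b" "X = dotted_class m a b (P, n)"
    by auto
  then have P: "perfect_matching (points a b) P" "n \<in> P \<rightarrow>\<^sub>E {..m - 1}"
    by (auto simp: dotted_def)
  obtain f :: "'k brterm" where "drawing f a b P"
    using perfect_matching_drawable[OF P(1)] by blast
  then have D: "(f, P, n) \<in> dotted_diagrams m a b"
    using P(2) by (auto simp: dotted_diagrams_def)
  have "restrict n P = n"
    using P(2) by (simp add: PiE_restrict)
  then have "X = (diagram_equiv \<inter> dotted_diagrams m a b \<times> dotted_diagrams m a b) `` {(f, P, n)}"
    using dotted_class_quotient[OF D] Pn(2) by simp
  then show "X \<in> dotted_classes m a b"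
    unfolding dotted_classes_def using D by (simp add: quotientI)
qed

text \<open>By drawability a class is nonempty, and any member reveals the pairing and the dots on
  its strands.\<close>

lemma dotted_class_inj: "inj_on (dotted_class m a b :: _ \<Rightarrow> 'k dotted_diagram set) (dotted m a b)"
proof (rule inj_onI)
  fix x y
  assume x: "x \<in> dotted m a b" and y: "y \<in> dotted m a b"
    and eq: "(dotted_class m a b x :: 'k dotted_diagram set) = dotted_class m a b y"
  obtain P n where Pn: "x = (P, n)" by (cases x)
  obtain Q l where Ql: "y = (Q, l)" by (cases y)
  have P: "perfect_matching (points a b) P" "n \<in> P \<rightarrow>\<^sub>E {..m - 1}" "l \<in> Q \<rightarrow>\<^sub>E {..m - 1}"
    using x y Pn Ql by (auto simp: dotted_def)
  obtain f :: "'k brterm" where "drawing f a b P"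
    using perfect_matching_drawable[OF P(1)] by blast
  then have "(f, P, n) \<in> dotted_class m a b x"
    by (auto simp: dotted_class_def Pn)
  then have "(f, P, n) \<in> dotted_class m a b y"
    unfolding eq .
  then have "P = Q" "\<forall>s\<in>P. n s = l s"
    by (auto simp: dotted_class_def Ql)
  moreover from this have "n = l"
    using P(2,3) by (intro PiE_ext) auto
  ultimately show "x = y"
    by (simp add: Pn Ql)
qed

lemma card_dotted_classes: "card (dotted_classes m a b :: 'k dotted_diagram set set) = card (dotted m a b)"
  unfolding dotted_classes_eq by (rule card_image[OF dotted_class_inj])

section \<open>Splicing cup parts, dotted permutations and cap parts\<close>

definition all_vertical :: "pairing \<Rightarrow> bool" where
  "all_vertical P \<longleftrightarrow> (\<forall>s\<in>P. \<exists>i j. s = {Lower i, Upper j})"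

definition undotted_verticals :: "pairing \<Rightarrow> (bpoint set \<Rightarrow> nat) \<Rightarrow> bool" where
  "undotted_verticals P n \<longleftrightarrow> (\<forall>i j. {Lower i, Upper j} \<in> P \<longrightarrow> n {Lower i, Upper j} = 0)"

text \<open>The dots of vertical strands are left to \<open>perm_part\<close>; otherwise they would
  be counted twice.\<close>

definition cup_part :: "nat \<Rightarrow> nat \<Rightarrow> nat \<Rightarrow> (pairing \<times> (bpoint set \<Rightarrow> nat)) set" where
  "cup_part m b c = {(Q, n) \<in> dotted m c b. no_caps Q \<and> increasing Q \<and> undotted_verticals Q n}"

definition perm_part :: "nat \<Rightarrow> nat \<Rightarrow> (pairing \<times> (bpoint set \<Rightarrow> nat)) set" where
  "perm_part m c = {(W, k) \<in> dotted m c c. all_vertical W}"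

text \<open>The pairing of the composite of \<open>Q\<close>, \<open>W\<close> and \<open>Q'\<close> turned upside down.  Only its injectivity in
  \<open>(Q, W, Q')\<close> matters, so it is not compared with \<open>stack\<close>.\<close>

definition splice_pairing :: "pairing \<Rightarrow> pairing \<Rightarrow> pairing \<Rightarrow> pairing" where
  "splice_pairing Q W Q' = {{Upper i, Upper j} | i j. {Upper i, Upper j} \<in> Q} \<union>
     {{Lower i, Lower j} | i j. {Upper i, Upper j} \<in> Q'} \<union>
     {{Lower i, Upper j} | i j. \<exists>x y. {Lower y, Upper i} \<in> Q' \<and> {Lower y, Upper x} \<in> W \<and> {Lower x, Upper j} \<in> Q}"

lemma splice_mem:
  "{Upper i, Upper j} \<in> splice_pairing Q W Q' \<longleftrightarrow> {Upper i, Upper j} \<in> Q"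
  "{Lower i, Lower j} \<in> splice_pairing Q W Q' \<longleftrightarrow> {Upper i, Upper j} \<in> Q'"
  "{Lower i, Upper j} \<in> splice_pairing Q W Q' \<longleftrightarrow>
    (\<exists>x y. {Lower y, Upper i} \<in> Q' \<and> {Lower y, Upper x} \<in> W \<and> {Lower x, Upper j} \<in> Q)"
  by (auto simp: splice_pairing_def doubleton_eq_iff insert_commute)

text \<open>Carries a cap of the composite back to the cup of \<open>Q'\<close> from which it
  comes.\<close>

fun raise :: "bpoint \<Rightarrow> bpoint" where
  "raise (Lower i) = Upper i"
| "raise (Upper j) = Upper j"

text \<open>A vertical strand of the composite takes its dots from the strand of the permutation
  that it passes through, the verticals of the outer parts being undotted. The description finds
  this strand by the two outer verticals that meet it.\<close>

definition spliced_dots :: "pairing \<Rightarrow> (bpoint set \<Rightarrow> nat) \<Rightarrow> (bpoint set \<Rightarrow> nat) \<Rightarrow> pairing \<Rightarrow> (bpoint set \<Rightarrow> nat)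
    \<Rightarrow> bpoint set \<Rightarrow> nat" where
  "spliced_dots Q n k Q' n' s =
     (if \<exists>i j. s = {Upper i, Upper j} then n s
      else if \<exists>i j. s = {Lower i, Lower j} then n' (raise ` s)
      else k (THE t. \<exists>i j x y. s = {Lower i, Upper j} \<and> {Lower y, Upper i} \<in> Q' \<and> {Lower x, Upper j} \<in> Q \<and>
        t = {Lower y, Upper x}))"

lemma spliced_dots_cup: "spliced_dots Q n k Q' n' {Upper i, Upper j} = n {Upper i, Upper j}"
  unfolding spliced_dots_def by auto

lemma spliced_dots_cap: "spliced_dots Q n k Q' n' {Lower i, Lower j} = n' {Upper i, Upper j}"
  unfolding spliced_dots_def by (auto simp: doubleton_eq_iff)

lemma spliced_dots_vertical:
  assumes Q: "perfect_matching S Q" and Q': "perfect_matching S' Q'"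
    and "{Lower y, Upper i} \<in> Q'" "{Lower x, Upper j} \<in> Q"
  shows "spliced_dots Q n k Q' n' {Lower i, Upper j} = k {Lower y, Upper x}"
proof -
  have "y' = y" if "{Lower y', Upper i} \<in> Q'" for y'
    using matching_unique[OF Q', of "Upper i"] that assms(3) by (auto simp: insert_commute)
  moreover have "x' = x" if "{Lower x', Upper j} \<in> Q" for x'
    using matching_unique[OF Q, of "Upper j"] that assms(4) by (auto simp: insert_commute)
  ultimately have "(THE t. \<exists>i' j' x y. {Lower i, Upper j} = {Lower i', Upper j'} \<and> {Lower y, Upper i'} \<in> Q' \<and>
      {Lower x, Upper j'} \<in> Q \<and> t = {Lower y, Upper x}) = {Lower y, Upper x}"
  proof (intro the_equality)
    show "\<exists>i' j' x' y'. {Lower i, Upper j} = {Lower i', Upper j'} \<and> {Lower y', Upper i'} \<in> Q' \<and>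
        {Lower x', Upper j'} \<in> Q \<and> {Lower y, Upper x} = {Lower y', Upper x'}"
      using assms(3,4) by blast
  next
    fix t
    assume "\<exists>i' j' x' y'. {Lower i, Upper j} = {Lower i', Upper j'} \<and> {Lower y', Upper i'} \<in> Q' \<and>
        {Lower x', Upper j'} \<in> Q \<and> t = {Lower y', Upper x'}"
    then obtain i' j' x' y' where *: "{Lower i, Upper j} = {Lower i', Upper j'}" "{Lower y', Upper i'} \<in> Q'"
        "{Lower x', Upper j'} \<in> Q" "t = {Lower y', Upper x'}"
      by blast
    then have "i' = i" "j' = j"
      by (simp_all add: doubleton_eq_iff)
    then show "t = {Lower y, Upper x}"
      using * \<open>\<And>y'. {Lower y', Upper i} \<in> Q' \<Longrightarrow> y' = y\<close> \<open>\<And>x'. {Lower x', Upper j} \<in> Q \<Longrightarrow> x' = x\<close> by simp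
  qed
  then show ?thesis
    unfolding spliced_dots_def by (simp add: doubleton_eq_iff)
qed

text \<open>A vertical of the composite follows one strand each of \<open>Q'\<close>,
  \<open>W\<close> and \<open>Q\<close>. As \<open>Q\<close> and \<open>Q'\<close> have no caps, a
  path entering the middle always leaves on the other side.\<close>

lemma splice_matching:
  assumes Q: "perfect_matching (points c b) Q" "no_caps Q"
    and W: "perfect_matching (points c c) W" "all_vertical W"
    and Q': "perfect_matching (points c a) Q'" "no_caps Q'"
  shows "perfect_matching (points a b) (splice_pairing Q W Q')"
proof (rule perfect_matchingI)
  fix s
  assume "s \<in> splice_pairing Q W Q'"
  then consider i j where "s = {Upper i, Upper j}" "{Upper i, Upper j} \<in> Q"
    | i j where "s = {Lower i, Lower j}" "{Upper i, Upper j} \<in> Q'"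
    | i j x y where "s = {Lower i, Upper j}" "{Lower y, Upper i} \<in> Q'" "{Lower x, Upper j} \<in> Q"
    unfolding splice_pairing_def by blast
  then show "\<exists>x y. s = {x, y} \<and> x \<noteq> y \<and> x \<in> points a b \<and> y \<in> points a b"
  proof cases
    case (1 i j)
    then show ?thesis
      using matching_pairD[OF Q(1) 1(2)] by (intro exI[of _ "Upper i"] exI[of _ "Upper j"]) simp
  next
    case (2 i j)
    then show ?thesis
      using matching_pairD[OF Q'(1) 2(2)] by (intro exI[of _ "Lower i"] exI[of _ "Lower j"]) simp
  next
    case (3 i j x y)
    then show ?thesis
      using matching_pairD[OF Q'(1) 3(2)] matching_pairD[OF Q(1) 3(3)]
      by (intro exI[of _ "Lower i"] exI[of _ "Upper j"]) simp
  qed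
next
  have W_upper: "\<exists>x. {Lower y, Upper x} \<in> W \<and> x < c" if y: "y < c" for y
  proof -
    obtain t where t: "{Lower y, t} \<in> W"
      using matching_partner[OF W(1), of "Lower y"] y by auto
    then obtain x where "t = Upper x"
      using W(2) by (fastforce simp: all_vertical_def doubleton_eq_iff)
    then show ?thesis
      using t matching_pairD(2)[OF W(1) t] by auto
  qed
  have W_lower: "\<exists>y. {Lower y, Upper x} \<in> W \<and> y < c" if x: "x < c" for x
  proof -
    obtain t where t: "{Upper x, t} \<in> W"
      using matching_partner[OF W(1), of "Upper x"] x by auto
    then obtain y where "t = Lower y"
      using W(2) by (fastforce simp: all_vertical_def doubleton_eq_iff)
    then show ?thesis
      using t matching_pairD(2)[OF W(1) t] by (auto simp: insert_commute)
  qed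
  have V: "\<exists>j. {Lower i, Upper j} \<in> R" if "perfect_matching (points c d) R" "no_caps R" "i < c" for i d R
    using no_caps_partner[OF that] by blast
  fix v
  assume v: "v \<in> points a b"
  show "\<exists>w. {v, w} \<in> splice_pairing Q W Q'"
  proof (cases v)
    case (Lower i)
    then obtain t where t: "{Upper i, t} \<in> Q'"
      using matching_partner[OF Q'(1), of "Upper i"] v by auto
    show ?thesis
    proof (cases t)
      case (Lower y)
      then have y: "{Lower y, Upper i} \<in> Q'" "y < c"
        using t matching_pairD(2)[OF Q'(1) t] by (auto simp: insert_commute)
      obtain x where "{Lower y, Upper x} \<in> W" "x < c"
        using W_upper[OF y(2)] by blast
      moreover obtain j where "{Lower x, Upper j} \<in> Q"
        using V[OF Q \<open>x < c\<close>] by blast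
      ultimately show ?thesis
        using y splice_mem(3) \<open>v = Lower i\<close> by blast
    next
      case (Upper j)
      then show ?thesis
        using t splice_mem(2) \<open>v = Lower i\<close> by blast
    qed
  next
    case (Upper j)
    then obtain t where t: "{Upper j, t} \<in> Q"
      using matching_partner[OF Q(1), of "Upper j"] v by auto
    show ?thesis
    proof (cases t)
      case (Lower x)
      then have x: "{Lower x, Upper j} \<in> Q" "x < c"
        using t matching_pairD(2)[OF Q(1) t] by (auto simp: insert_commute)
      obtain y where "{Lower y, Upper x} \<in> W" "y < c"
        using W_lower[OF x(2)] by blast
      moreover obtain i where "{Lower y, Upper i} \<in> Q'"
        using V[OF Q' \<open>y < c\<close>] by blast
      ultimately have "{Lower i, Upper j} \<in> splice_pairing Q W Q'"
        using x splice_mem(3) by blast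
      then show ?thesis
        using \<open>v = Upper j\<close> by (auto simp: insert_commute)
    next
      case (Upper i)
      then show ?thesis
        using t splice_mem(1) \<open>v = Upper j\<close> by blast
    qed
  qed
next
  have uQ: "s = t" if "{r, s} \<in> Q" "{r, t} \<in> Q" for r s t
    using matching_unique[OF Q(1) that] .
  have uQ': "s = t" if "{r, s} \<in> Q'" "{r, t} \<in> Q'" for r s t
    using matching_unique[OF Q'(1) that] .
  have uW: "s = t" if "{r, s} \<in> W" "{r, t} \<in> W" for r s t
    using matching_unique[OF W(1) that] .
  have LL: "j = j'" if "{Lower i, Lower j} \<in> splice_pairing Q W Q'" "{Lower i, Lower j'} \<in> splice_pairing Q W Q'" for i j j'
    using that uQ'[of "Upper i" "Upper j" "Upper j'"] by (simp add: splice_mem)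
  have UU: "j = j'" if "{Upper i, Upper j} \<in> splice_pairing Q W Q'" "{Upper i, Upper j'} \<in> splice_pairing Q W Q'" for i j j'
    using that uQ[of "Upper i" "Upper j" "Upper j'"] by (simp add: splice_mem)
  have LU: "j = j'" if l: "{Lower i, Upper j} \<in> splice_pairing Q W Q'" "{Lower i, Upper j'} \<in> splice_pairing Q W Q'" for i j j'
  proof -
    obtain x y where xy: "{Lower y, Upper i} \<in> Q'" "{Lower y, Upper x} \<in> W" "{Lower x, Upper j} \<in> Q"
      using l(1) unfolding splice_mem by blast
    obtain x' y' where xy': "{Lower y', Upper i} \<in> Q'" "{Lower y', Upper x'} \<in> W" "{Lower x', Upper j'} \<in> Q"
      using l(2) unfolding splice_mem by blast
    have "y = y'"
      using uQ'[of "Upper i" "Lower y" "Lower y'"] xy(1) xy'(1) by (simp add: insert_commute)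
    then have "x = x'"
      using uW[OF xy(2)] xy'(2) by blast
    then show ?thesis
      using uQ[OF xy(3)] xy'(3) by blast
  qed
  have UL: "i = i'" if l: "{Lower i, Upper j} \<in> splice_pairing Q W Q'" "{Lower i', Upper j} \<in> splice_pairing Q W Q'" for i i' j
  proof -
    obtain x y where xy: "{Lower y, Upper i} \<in> Q'" "{Lower y, Upper x} \<in> W" "{Lower x, Upper j} \<in> Q"
      using l(1) unfolding splice_mem by blast
    obtain x' y' where xy': "{Lower y', Upper i'} \<in> Q'" "{Lower y', Upper x'} \<in> W" "{Lower x', Upper j} \<in> Q"
      using l(2) unfolding splice_mem by blast
    have "x = x'"
      using uQ[of "Upper j" "Lower x" "Lower x'"] xy(3) xy'(3) by (simp add: insert_commute)
    then have "y = y'"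
      using uW[of "Upper x" "Lower y" "Lower y'"] xy(2) xy'(2) by (simp add: insert_commute)
    then show ?thesis
      using uQ'[OF xy(1)] xy'(1) by blast
  qed
  have LLU: False if l: "{Lower i, Lower j} \<in> splice_pairing Q W Q'" "{Lower i, Upper j'} \<in> splice_pairing Q W Q'" for i j j'
    using l uQ'[of "Upper i" "Upper j" "Lower _"] unfolding splice_mem by (auto simp: insert_commute)
  have UUL: False if l: "{Upper i, Upper j} \<in> splice_pairing Q W Q'" "{Lower j', Upper i} \<in> splice_pairing Q W Q'" for i j j'
    using l uQ[of "Upper i" "Upper j" "Lower _"] unfolding splice_mem by (auto simp: insert_commute)
  fix v w w'
  assume l: "{v, w} \<in> splice_pairing Q W Q'" "{v, w'} \<in> splice_pairing Q W Q'"
  show "w = w'"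
  proof (cases v)
    case v: (Lower i)
    show ?thesis
      using l LL[of i] LU[of i] LLU[of i] unfolding v by (cases w; cases w') auto
  next
    case v: (Upper j)
    show ?thesis
      using l UU[of j] UL[of _ j] UUL[of j] unfolding v
      by (cases w; cases w') (auto simp: insert_commute)
  qed
qed

definition splice_dotted where
  "splice_dotted = (\<lambda>(c :: nat, (Q, n), (W, k), (Q', n')).
     (splice_pairing Q W Q', restrict (spliced_dots Q n k Q' n') (splice_pairing Q W Q')))"

lemma splice_dotted_mem:
  assumes "(Q, n) \<in> cup_part m b c" "(W, k) \<in> perm_part m c" "(Q', n') \<in> cup_part m a c"
  shows "splice_dotted (c, (Q, n), (W, k), (Q', n')) \<in> dotted m a b"
proof -
  have Q: "perfect_matching (points c b) Q" "no_caps Q" "n \<in> Q \<rightarrow>\<^sub>E {..m - 1}"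
    and W: "perfect_matching (points c c) W" "all_vertical W" "k \<in> W \<rightarrow>\<^sub>E {..m - 1}"
    and Q': "perfect_matching (points c a) Q'" "no_caps Q'" "n' \<in> Q' \<rightarrow>\<^sub>E {..m - 1}"
    using assms by (auto simp: cup_part_def perm_part_def dotted_def)
  have "spliced_dots Q n k Q' n' s \<le> m - 1" if s: "s \<in> splice_pairing Q W Q'" for s
  proof -
    consider i j where "s = {Upper i, Upper j}" "{Upper i, Upper j} \<in> Q"
      | i j where "s = {Lower i, Lower j}" "{Upper i, Upper j} \<in> Q'"
      | i j x y where "s = {Lower i, Upper j}" "{Lower y, Upper i} \<in> Q'" "{Lower y, Upper x} \<in> W" "{Lower x, Upper j} \<in> Q"
      using s unfolding splice_pairing_def by blast
    then show ?thesis
    proof cases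
      case (1 i j)
      then show ?thesis
        using Q(3) by (auto simp: spliced_dots_cup PiE_def Pi_def)
    next
      case (2 i j)
      then show ?thesis
        using Q'(3) by (auto simp: spliced_dots_cap PiE_def Pi_def)
    next
      case (3 i j x y)
      then show ?thesis
        using W(3) spliced_dots_vertical[OF Q(1) Q'(1) 3(2,4)] by (auto simp: PiE_def Pi_def)
    qed
  qed
  then show ?thesis
    using splice_matching[OF Q(1,2) W(1,2) Q'(1,2)]
    by (auto simp: splice_dotted_def dotted_def PiE_def Pi_def)
qed

text \<open>The upper points on no cup are the vertical ends. Their number is the number of lower
  points, and by \<open>increasing_rank\<close> they fix the verticals; so the cups determine
  everything.\<close>

lemma increasing_eqI:
  assumes Q: "perfect_matching (points c b) Q" "no_caps Q" "increasing Q"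
    and R: "perfect_matching (points d b) R" "no_caps R" "increasing R"
    and cups: "\<And>i j. {Upper i, Upper j} \<in> Q \<longleftrightarrow> {Upper i, Upper j} \<in> R"
  shows "c = d" "Q = R"
proof -
  have ends: "vertical_ends P = {j. j < b \<and> (\<forall>i. {Upper i, Upper j} \<notin> P)}"
    if P: "perfect_matching (points e b) P" for e P
  proof (intro equalityI subsetI)
    fix j
    assume "j \<in> vertical_ends P"
    then obtain i where i: "{Lower i, Upper j} \<in> P"
      by (auto simp: vertical_ends_def)
    then have "{Upper i', Upper j} \<notin> P" for i'
      using matching_unique[OF P, of "Upper j" "Lower i" "Upper i'"] by (auto simp: insert_commute)
    then show "j \<in> {j. j < b \<and> (\<forall>i. {Upper i, Upper j} \<notin> P)}"
      using matching_pairD(2)[OF P i] by simp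
  next
    fix j
    assume j: "j \<in> {j. j < b \<and> (\<forall>i. {Upper i, Upper j} \<notin> P)}"
    then obtain t where "{Upper j, t} \<in> P"
      using matching_partner[OF P, of "Upper j"] by auto
    then show "j \<in> vertical_ends P"
      using j by (cases t) (auto simp: vertical_ends_def insert_commute)
  qed
  have e: "vertical_ends Q = vertical_ends R"
    unfolding ends[OF Q(1)] ends[OF R(1)] using cups by simp
  show "c = d"
    using increasing_rank(1)[OF Q] increasing_rank(1)[OF R] e by simp
  have verts: "{Lower i, Upper j} \<in> Q \<longleftrightarrow> {Lower i, Upper j} \<in> R" for i j
    unfolding increasing_rank(2)[OF Q] increasing_rank(2)[OF R] e by simp
  have "Q \<subseteq> R"
  proof
    fix s
    assume s: "s \<in> Q"
    then obtain x y where xy: "s = {x, y}"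
      using matching_pairE[OF Q(1)] by blast
    show "s \<in> R"
      using s cups verts Q(2) unfolding xy no_caps_def by (cases x; cases y) (auto simp: insert_commute)
  qed
  then show "Q = R"
    using perfect_matching_subset_eq[OF R(1)] Q(1) \<open>c = d\<close> by auto
qed

text \<open>Cups and caps of the composite are the cups of \<open>Q\<close> and \<open>Q'\<close>,
  which determine these two pairings and the number of middle points. Following verticals recovers
  \<open>W\<close>, and dots are read off strand by strand. So there are at most as many triples as
  dotted pairings.\<close>

lemma splice_dotted_inj:
  "inj_on splice_dotted (SIGMA c:UNIV. cup_part m b c \<times> perm_part m c \<times> cup_part m a c)"
proof (rule inj_onI)
  fix X Y
  assume X: "X \<in> (SIGMA c:UNIV. cup_part m b c \<times> perm_part m c \<times> cup_part m a c)"
    and Y: "Y \<in> (SIGMA c:UNIV. cup_part m b c \<times> perm_part m c \<times> cup_part m a c)"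
    and eq: "splice_dotted X = splice_dotted Y"
  obtain c Q n W k Q' n' where X_eq: "X = (c, (Q, n), (W, k), (Q', n'))"
    by (metis prod.exhaust)
  obtain d R l V h R' l' where Y_eq: "Y = (d, (R, l), (V, h), (R', l'))"
    by (metis prod.exhaust)
  have Q: "perfect_matching (points c b) Q" "no_caps Q" "increasing Q" "n \<in> Q \<rightarrow>\<^sub>E {..m - 1}" "undotted_verticals Q n"
    and W: "perfect_matching (points c c) W" "all_vertical W" "k \<in> W \<rightarrow>\<^sub>E {..m - 1}"
    and Q': "perfect_matching (points c a) Q'" "no_caps Q'" "increasing Q'" "n' \<in> Q' \<rightarrow>\<^sub>E {..m - 1}" "undotted_verticals Q' n'"
    using X by (auto simp: X_eq cup_part_def perm_part_def dotted_def)
  have R: "perfect_matching (points d b) R" "no_caps R" "increasing R" "l \<in> R \<rightarrow>\<^sub>E {..m - 1}" "undotted_verticals R l"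
    and V: "perfect_matching (points d d) V" "all_vertical V" "h \<in> V \<rightarrow>\<^sub>E {..m - 1}"
    and R': "perfect_matching (points d a) R'" "no_caps R'" "increasing R'" "l' \<in> R' \<rightarrow>\<^sub>E {..m - 1}" "undotted_verticals R' l'"
    using Y by (auto simp: Y_eq cup_part_def perm_part_def dotted_def)
  have sp: "splice_pairing Q W Q' = splice_pairing R V R'"
    using eq by (simp add: splice_dotted_def X_eq Y_eq)
  have dots: "spliced_dots Q n k Q' n' s = spliced_dots R l h R' l' s" if "s \<in> splice_pairing Q W Q'" for s
  proof -
    have "restrict (spliced_dots Q n k Q' n') (splice_pairing Q W Q') = restrict (spliced_dots R l h R' l') (splice_pairing R V R')"
      using eq unfolding splice_dotted_def X_eq Y_eq prod.case prod.inject by (rule conjunct2)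
    then have "restrict (spliced_dots Q n k Q' n') (splice_pairing Q W Q') s = restrict (spliced_dots R l h R' l') (splice_pairing R V R') s"
      by (rule fun_cong)
    then show ?thesis
      using that sp by simp
  qed
  have "{Upper i, Upper j} \<in> Q \<longleftrightarrow> {Upper i, Upper j} \<in> R" for i j
    using splice_mem(1)[of i j Q W Q'] splice_mem(1)[of i j R V R'] sp by simp
  note QR = increasing_eqI[OF Q(1-3) R(1-3) this]
  have "{Upper i, Upper j} \<in> Q' \<longleftrightarrow> {Upper i, Upper j} \<in> R'" for i j
    using splice_mem(2)[of i j Q W Q'] splice_mem(2)[of i j R V R'] sp by simp
  note QR' = increasing_eqI[OF Q'(1-3) R'(1-3) this]
  \<comment> \<open>No strand of \<open>W\<close> is lost: both its ends continue along verticals of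
    \<open>Q'\<close> and \<open>Q\<close>, which have no caps.\<close>
  have strand: "\<exists>i j y x. t = {Lower y, Upper x} \<and> {Lower y, Upper i} \<in> Q' \<and> {Lower x, Upper j} \<in> Q \<and>
      {Lower i, Upper j} \<in> splice_pairing Q W Q'" if t: "t \<in> W" for t
  proof -
    obtain y x where yx: "t = {Lower y, Upper x}"
      using W(2) t by (auto simp: all_vertical_def)
    have "y < c" "x < c"
      using matching_pairD[OF W(1), of "Lower y" "Upper x"] t yx by simp_all
    then obtain i j where "{Lower y, Upper i} \<in> Q'" "{Lower x, Upper j} \<in> Q"
      using no_caps_partner[OF Q'(1,2)] no_caps_partner[OF Q(1,2)] by metis
    then show ?thesis
      using yx t splice_mem(3) by blast
  qed
  have "W \<subseteq> V"
  proof
    fix t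
    assume "t \<in> W"
    then obtain i j y x where t: "t = {Lower y, Upper x}" "{Lower y, Upper i} \<in> Q'" "{Lower x, Upper j} \<in> Q"
        "{Lower i, Upper j} \<in> splice_pairing R V R'"
      using strand sp by metis
    then obtain x' y' where xy': "{Lower y', Upper i} \<in> R'" "{Lower y', Upper x'} \<in> V" "{Lower x', Upper j} \<in> R"
      unfolding splice_mem by blast
    have "y' = y"
      using matching_unique[OF Q'(1), of "Upper i" "Lower y" "Lower y'"] t(2) xy'(1) QR'(2)
      by (simp add: insert_commute)
    moreover have "x' = x"
      using matching_unique[OF Q(1), of "Upper j" "Lower x" "Lower x'"] t(3) xy'(3) QR(2)
      by (simp add: insert_commute)
    ultimately show "t \<in> V"
      using xy'(2) t(1) by simp
  qed
  then have WV: "W = V"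
    using perfect_matching_subset_eq[OF V(1)] W(1) QR(1) by auto
  have "n s = l s" if s: "s \<in> Q" for s
  proof -
    obtain x y where xy: "s = {x, y}"
      using matching_pairE[OF Q(1) s] by blast
    consider i j where "s = {Upper i, Upper j}" | i j where "s = {Lower i, Upper j}"
      using s Q(2) unfolding xy no_caps_def by (cases x; cases y) (auto simp: insert_commute)
    then show ?thesis
    proof cases
      case (1 i j)
      then show ?thesis
        using dots[of s] s by (simp add: splice_mem spliced_dots_cup)
    next
      case (2 i j)
      then show ?thesis
        using s Q(5) R(5) QR(2) by (simp add: undotted_verticals_def)
    qed
  qed
  then have nl: "n = l"
    using Q(4) R(4) QR(2) by (intro PiE_ext) auto
  have "n' s = l' s" if s: "s \<in> Q'" for s
  proof -
    obtain x y where xy: "s = {x, y}"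
      using matching_pairE[OF Q'(1) s] by blast
    consider i j where "s = {Upper i, Upper j}" | i j where "s = {Lower i, Upper j}"
      using s Q'(2) unfolding xy no_caps_def by (cases x; cases y) (auto simp: insert_commute)
    then show ?thesis
    proof cases
      case (1 i j)
      then show ?thesis
        using dots[of "{Lower i, Lower j}"] s by (simp add: splice_mem spliced_dots_cap)
    next
      case (2 i j)
      then show ?thesis
        using s Q'(5) R'(5) QR'(2) by (simp add: undotted_verticals_def)
    qed
  qed
  then have nl': "n' = l'"
    using Q'(4) R'(4) QR'(2) by (intro PiE_ext) auto
  have "k t = h t" if t: "t \<in> W" for t
  proof -
    obtain i j y x where t: "t = {Lower y, Upper x}" "{Lower y, Upper i} \<in> Q'" "{Lower x, Upper j} \<in> Q"
        "{Lower i, Upper j} \<in> splice_pairing Q W Q'"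
      using strand[OF t] by blast
    then show ?thesis
      using dots[OF t(4)] spliced_dots_vertical[OF Q(1) Q'(1) t(2,3), of n k n']
        spliced_dots_vertical[OF R(1) R'(1), of y i x j l h l'] QR(2) QR'(2) by simp
  qed
  then have "k = h"
    using W(3) V(3) WV by (intro PiE_ext) auto
  then show "X = Y"
    by (simp add: X_eq Y_eq QR QR' WV nl nl')
qed

text \<open>The \<open>c\<close> verticals have distinct upper ends among \<open>b\<close>
  points.\<close>

lemma cup_part_le:
  assumes "(Q, n) \<in> cup_part m b c"
  shows "c \<le> b"
proof -
  have Q: "perfect_matching (points c b) Q" "no_caps Q" "increasing Q"
    using assms by (auto simp: cup_part_def dotted_def)
  have "vertical_ends Q \<subseteq> {..<b}"
    using matching_pairD(2)[OF Q(1)] by (fastforce simp: vertical_ends_def)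
  then have "card (vertical_ends Q) \<le> b"
    using card_mono[of "{..<b}"] by fastforce
  then show ?thesis
    using increasing_rank(1)[OF Q] by simp
qed

lemma finite_cup_part: "finite (cup_part m b c)"
  by (rule finite_subset[OF _ finite_dotted[of m c b]]) (auto simp: cup_part_def)

lemma finite_perm_part: "finite (perm_part m c)"
  by (rule finite_subset[OF _ finite_dotted[of m c c]]) (auto simp: perm_part_def)

lemma card_parts_le:
  "(\<Sum>c\<le>b. card (cup_part m b c) * (card (perm_part m c) * card (cup_part m a c))) \<le> card (dotted m a b)"
proof -
  let ?T = "SIGMA c:{..b}. cup_part m b c \<times> perm_part m c \<times> cup_part m a c"
  have "card ?T = (\<Sum>c\<le>b. card (cup_part m b c \<times> perm_part m c \<times> cup_part m a c))"
    by (intro card_SigmaI) (auto simp: finite_cup_part finite_perm_part)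
  then have "(\<Sum>c\<le>b. card (cup_part m b c) * (card (perm_part m c) * card (cup_part m a c))) = card ?T"
    by (simp add: card_cartesian_product)
  also have "\<dots> \<le> card (dotted m a b)"
  proof (rule card_inj_on_le)
    show "inj_on splice_dotted ?T"
      by (rule inj_on_subset[OF splice_dotted_inj]) auto
    show "splice_dotted ` ?T \<subseteq> dotted m a b"
      using splice_dotted_mem by auto
  qed (rule finite_dotted)
  finally show ?thesis .
qed

section \<open>The cyclotomic Brauer category\<close>

text \<open>A spanning family with at most \<open>dim\<close> members has exactly \<open>dim\<close>
  distinct ones, so it is injective and its image is a basis.\<close>

lemma (in class_vectorspace) spanning_family_indep:
  assumes T: "finite T" "f ` T \<subseteq> carrier V" "carrier V \<subseteq> span (f ` T)" "card T \<le> dim"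
    and F: "F \<subseteq> T" "(\<Oplus>t\<in>F. l t \<odot> f t) = \<zero>" "t \<in> F"
  shows "l t = 0"
proof (rule ccontr)
  assume l: "l t \<noteq> 0"
  have gen: "span (f ` T) = carrier V"
    using T(3) span_is_subset2[OF T(2)] by blast
  have "dim \<le> card (f ` T)"
    using T(1,2) gen by (intro gen_ge_dim) auto
  moreover have "card (f ` T) \<le> card T"
    using T(1) by (rule card_image_le)
  ultimately have card: "card (f ` T) = card T" "card (f ` T) = dim"
    using T(4) by simp_all
  have inj: "inj_on f T"
    using T(1) card(1) by (rule eq_card_imp_inj_on)
  have fin_dim
    unfolding fin_dim_def using T(1,2) gen by blast
  then have "basis (f ` T)"
    using T(1,2) gen card(2) by (intro dim_gen_is_basis) auto
  then have indpt: "lin_indpt (f ` T)"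
    by (simp add: basis_def)
  have injF: "inj_on f F"
    using inj F(1) by (rule inj_on_subset)
  have carr: "f x \<in> carrier V" if "x \<in> F" for x
    using that T(2) F(1) by auto
  \<comment> \<open>Coefficients of the family become coefficients of its image, by injectivity on
    \<open>F\<close>.\<close>
  define c where "c = l \<circ> the_inv_into F f"
  have c: "c (f x) = l x" if "x \<in> F" for x
    using the_inv_into_f_f[OF injF that] by (simp add: c_def)
  have "lincomb c (f ` F) = (\<Oplus>v\<in>f ` F. c v \<odot> v)"
    by (simp add: lincomb_def)
  also have "\<dots> = (\<Oplus>x\<in>F. c (f x) \<odot> f x)"
    by (rule add.finprod_reindex) (auto simp: scale_closed carr injF)
  also have "\<dots> = (\<Oplus>x\<in>F. l x \<odot> f x)"
    by (rule finsum_cong') (auto simp: scale_closed carr c)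
  finally have "lincomb c (f ` F) = \<zero>"
    using F(2) by simp
  then have "lin_dep (f ` T)"
    using F T(1) l c[OF F(3)]
    by (intro lin_dep_crit[where A = "f ` F" and a = c and v = "f t"]) (auto intro: finite_subset)
  then show False
    using indpt by simp
qed

section \<open>Spanning by induction on the middle object\<close>

context total_category
begin

lemma span_cmp_left:
  assumes "f \<in> hom.span b c B" "B \<subseteq> mor C b c" "g \<in> mor C a b" "X \<subseteq> mor C a c"
    and "\<And>f. f \<in> B \<Longrightarrow> cmp C a b c f g \<in> hom.span a c X"
  shows "cmp C a b c f g \<in> hom.span a c X"
proof -
  have sub: "submodule class_ring (hom.span a c X) (hom_sp C a c)"
    using hom.span_is_submodule[OF assms(4)] .
  have carr: "v \<in> mor C b c" if "v \<in> hom.span b c B" for v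
    using that hom.span_is_subset2[OF assms(2)] by blast
  show ?thesis
    using assms(1,2)
  proof (induction rule: hom.span_induct')
    case zero
    then show ?case
      using sub assms(3) by (simp add: submodule_def)
  next
    case (add v w)
    then show ?case
      using sub assms(3) carr by (simp add: submodule_def cmp_add_left)
  next
    case (scale r v)
    then show ?case
      using sub assms(3) carr by (simp add: submodule_def cmp_smult_left)
  qed (rule assms(5))
qed

lemma span_cmp_right:
  assumes "g \<in> hom.span a b B" "B \<subseteq> mor C a b" "f \<in> mor C b c" "X \<subseteq> mor C a c"
    and "\<And>g. g \<in> B \<Longrightarrow> cmp C a b c f g \<in> hom.span a c X"
  shows "cmp C a b c f g \<in> hom.span a c X"
proof -
  have sub: "submodule class_ring (hom.span a c X) (hom_sp C a c)"
    using hom.span_is_submodule[OF assms(4)] .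
  have carr: "v \<in> mor C a b" if "v \<in> hom.span a b B" for v
    using that hom.span_is_subset2[OF assms(2)] by blast
  show ?thesis
    using assms(1,2)
  proof (induction rule: hom.span_induct')
    case zero
    then show ?case
      using sub assms(3) by (simp add: submodule_def)
  next
    case (add v w)
    then show ?case
      using sub assms(3) carr by (simp add: submodule_def cmp_add_right)
  next
    case (scale r v)
    then show ?case
      using sub assms(3) carr by (simp add: submodule_def cmp_smult_right)
  qed (rule assms(5))
qed

definition composites :: "'j \<Rightarrow> 'j \<Rightarrow> 'j \<Rightarrow> 'm set \<Rightarrow> 'm set \<Rightarrow> 'm set" where
  "composites a c b F G = {cmp C a c b f g | f g. f \<in> F \<and> g \<in> G}"

end

text \<open>Well-founded induction on the middle object \<open>c\<close> of a composite
  \<open>f g\<close>. First \<open>g\<close> is replaced by \<open>x p\<close> with \<open>p\<close>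
  in \<open>Bp c a\<close>, then \<open>f x\<close> by products from \<open>Bm b c\<close> and
  \<open>Bo c\<close>; all corrections pass through smaller objects. Since \<open>x\<close> is
  absorbed into \<open>f\<close>, it may be arbitrary in \<open>upper\<close>.\<close>

lemma (in total_category) products_span_induction:
  fixes lt :: "'j rel"
  assumes wf: "wf lt"
    and closed: "\<And>b c. Bm b c \<subseteq> mor C c b" "\<And>c. Bo c \<subseteq> mor C c c" "\<And>c a. Bp c a \<subseteq> mor C a c"
    and lower: "\<And>b c. mor C c b \<subseteq> hom.span c b
      (composites c c b (Bm b c) (Bo c) \<union> (\<Union>d\<in>{d. (d, c) \<in> lt}. composites c d b (mor C d b) (mor C c d)))"
    and upper: "\<And>a c. mor C a c \<subseteq> hom.span a c
      (composites a c c (mor C c c) (Bp c a) \<union> (\<Union>d\<in>{d. (d, c) \<in> lt}. composites a d c (mor C d c) (mor C a d)))"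
  shows "mor C a b \<subseteq> hom.span a b
    ((\<lambda>(c, f, g, h). cmp C a c b f (cmp C a c c g h)) ` (SIGMA c:UNIV. Bm b c \<times> Bo c \<times> Bp c a))"
    (is "_ \<subseteq> hom.span a b (?T a b)")
proof -
  note cl = closed[THEN subsetD]
  have T: "?T a b \<subseteq> mor C a b" for a b
    by (auto simp: cl intro!: cmp_closed)
  have "cmp C a c b f g \<in> hom.span a b (?T a b)" if "f \<in> mor C c b" "g \<in> mor C a c" for a b c f g
    using wf that
  proof (induction c arbitrary: a b f g rule: wf_induct_rule)
    case (less c)
    \<comment> \<open>The case of a right factor in \<open>Bp c a\<close>, for an arbitrary left
      factor; it will be applied to the composite of \<open>f\<close> and \<open>x\<close>.\<close>
    have low: "cmp C a c b x p \<in> hom.span a b (?T a b)" if x: "x \<in> mor C c b" and p: "p \<in> Bp c a" for x p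
    proof (rule span_cmp_left[OF subsetD[OF lower x] _ _ T])
      fix y
      assume "y \<in> composites c c b (Bm b c) (Bo c) \<union> (\<Union>d\<in>{d. (d, c) \<in> lt}. composites c d b (mor C d b) (mor C c d))"
      then consider f g where "y = cmp C c c b f g" "f \<in> Bm b c" "g \<in> Bo c"
        | d u v where "(d, c) \<in> lt" "y = cmp C c d b u v" "u \<in> mor C d b" "v \<in> mor C c d"
        by (auto simp: composites_def)
      then show "cmp C a c b y p \<in> hom.span a b (?T a b)"
      proof cases
        case 1
        have "cmp C a c b y p = cmp C a c b f (cmp C a c c g p)"
          unfolding 1(1) using 1(2,3) p by (simp add: cmp_assoc cl)
        then have "cmp C a c b y p \<in> ?T a b"
          using 1(2,3) p by force
        then show ?thesis
          using hom.in_own_span[OF T] by blast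
      next
        case 2
        have "cmp C a c b y p = cmp C a d b u (cmp C a c d v p)"
          unfolding 2(2) using 2(3,4) p by (simp add: cmp_assoc cl)
        also have "\<dots> \<in> hom.span a b (?T a b)"
          using less.IH 2 p by (simp add: cl)
        finally show ?thesis .
      qed
    qed (use p in \<open>auto simp: composites_def cl\<close>)
    show ?case
    proof (rule span_cmp_right[OF subsetD[OF upper less.prems(2)] _ less.prems(1) T])
      fix y
      assume "y \<in> composites a c c (mor C c c) (Bp c a) \<union> (\<Union>d\<in>{d. (d, c) \<in> lt}. composites a d c (mor C d c) (mor C a d))"
      then consider x p where "y = cmp C a c c x p" "x \<in> mor C c c" "p \<in> Bp c a"
        | d u v where "(d, c) \<in> lt" "y = cmp C a d c u v" "u \<in> mor C d c" "v \<in> mor C a d"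
        by (auto simp: composites_def)
      then show "cmp C a c b f y \<in> hom.span a b (?T a b)"
      proof cases
        case 1
        then show ?thesis
          using low[of "cmp C c c b f x" p] less.prems(1) by (simp add: cmp_assoc cl)
      next
        case 2
        then show ?thesis
          using less.IH[of d "cmp C d c b f u" b v a] less.prems(1) by (simp add: cmp_assoc)
      qed
    qed (auto simp: composites_def cl)
  qed
  \<comment> \<open>Every morphism is a composite with middle object \<open>b\<close>, its left
    factor being the identity.\<close>
  from this[of "idm C b" b b _ a] show ?thesis
    by auto
qed

lemma arrow_dot_row: "arrow (dot_row ks) (length ks) (length ks)"
proof (induction ks)
  case Nil
  show ?case
    using arrow.intros(5)[of 0] by (simp add: dot_row_def)
next
  case (Cons k ks)
  show ?case
    using arrow.intros(10)[OF arrow_dot_power Cons.IH] by (simp add: dot_row_def)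
qed

lemma dot_row_zeros: "set ks \<subseteq> {0} \<Longrightarrow> (dot_row ks :: 'k::field brterm) \<simeq> One (length ks)"
proof (induction ks)
  case Nil
  show ?case
    by (simp add: dot_row_def abeq_refl)
next
  case (Cons k ks)
  have "(One 1 \<^bold>\<otimes> dot_row ks :: 'k brterm) \<simeq> One 1 \<^bold>\<otimes> One (length ks)"
    using Cons by (intro abeq_tns abeq_refl) auto
  also have "\<dots> \<simeq> One (1 + length ks)"
    by (rule abeq_tns_one)
  finally show ?case
    using Cons.prems by (simp add: dot_row_def)
qed

lemma arrow_diagram_term: "drawing f a b P \<Longrightarrow> arrow (diagram_term a b (f, P, n)) a b"
  using arrow_dot_row[of "map (upper_dots P n) [0..<b]"] arrow_dot_row[of "map (lower_dots P n) [0..<a]"]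
    arrow_drawing[of f a b P]
  by (auto intro: arrow.intros(9))

lemma upper_dots_cup:
  assumes P: "perfect_matching (points a b) P" "{Upper i, Upper j} \<in> P"
  shows "upper_dots P n j = (if i < j then n {Upper i, Upper j} else 0)"
proof -
  have "strand_at P (Upper j) = {Upper i, Upper j}"
    using P by (rule strand_at_eq) simp
  moreover have "i \<noteq> j"
    using matching_pairD(3)[OF P] by simp
  ultimately show ?thesis
    by (auto simp: upper_dots_def)
qed

lemma upper_dots_vertical:
  assumes P: "perfect_matching (points a b) P" "{Lower i, Upper j} \<in> P"
  shows "upper_dots P n j = 0"
proof -
  have "strand_at P (Upper j) = {Lower i, Upper j}"
    using P by (rule strand_at_eq) simp
  then show ?thesis
    by (auto simp: upper_dots_def)
qed

lemma lower_dots_vertical: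
  assumes P: "perfect_matching (points a b) P" "{Lower i, Upper j} \<in> P"
  shows "lower_dots P n i = n {Lower i, Upper j}"
proof -
  have "strand_at P (Lower i) = {Lower i, Upper j}"
    using P by (rule strand_at_eq) simp
  then show ?thesis
    by (auto simp: lower_dots_def)
qed

section \<open>The flip on Hom spaces and the basis given by admissibility\<close>

locale admissible_brauer =
  fixes us :: "'k::field list" and \<omega> :: "nat \<Rightarrow> 'k"
  assumes admissible: "admissible us \<omega>"
begin

abbreviation \<C> where "\<C> \<equiv> CB us \<omega>"
abbreviation m where "m \<equiv> length us"
abbreviation mr where "mr \<equiv> cb_mor us \<omega>"

sublocale total_category \<C>
  by (simp add: total_category_def total_category_axioms_def linear_category_CB)

lemma mor_mrE:
  assumes "X \<in> mor \<C> a b"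
  obtains t where "arrow t a b" "X = mr a b t"
  using assms by (auto simp: mor_CB)

text \<open>Since \<open>flip\<close> preserves the cyclotomic ideal, the choice of representative is irrelevant.\<close>

definition flipm :: "nat \<Rightarrow> nat \<Rightarrow> 'k brterm set set \<Rightarrow> 'k brterm set set" where
  "flipm a b X = mr b a (flip (SOME t. arrow t a b \<and> X = mr a b t))"

lemma flipm_mr:
  assumes "arrow t a b"
  shows "flipm a b (mr a b t) = mr b a (flip t)"
proof -
  let ?s = "SOME s. arrow s a b \<and> mr a b t = mr a b s"
  have "arrow ?s a b \<and> mr a b t = mr a b ?s"
    by (rule someI) (use assms in simp)
  then show ?thesis
    unfolding flipm_def using cb_mor_flip assms by metis
qed

lemma flipm_closed: "X \<in> mor \<C> a b \<Longrightarrow> flipm a b X \<in> mor \<C> b a"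
  by (erule mor_mrE) (simp add: flipm_mr cb_mor_closed arrow_flip)

lemma flipm_flipm: "X \<in> mor \<C> a b \<Longrightarrow> flipm b a (flipm a b X) = X"
  by (erule mor_mrE) (simp add: flipm_mr arrow_flip)

lemma flipm_cmp:
  assumes "f \<in> mor \<C> a b" "g \<in> mor \<C> b c"
  shows "flipm a c (cmp \<C> a b c g f) = cmp \<C> c b a (flipm a b f) (flipm b c g)"
proof -
  obtain s t where "arrow s a b" "f = mr a b s" "arrow t b c" "g = mr b c t"
    using assms by (metis mor_mrE)
  then show ?thesis
    using arrow.intros(9)[of s a b t c] by (simp add: flipm_mr cmp_CB arrow_flip)
qed

lemma flipm_add:
  assumes "f \<in> mor \<C> a b" "g \<in> mor \<C> a b"
  shows "flipm a b (f \<oplus>\<^bsub>hom_sp \<C> a b\<^esub> g) = flipm a b f \<oplus>\<^bsub>hom_sp \<C> b a\<^esub> flipm a b g"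
proof -
  obtain s t where "arrow s a b" "f = mr a b s" "arrow t a b" "g = mr a b t"
    using assms by (metis mor_mrE)
  then show ?thesis
    using arrow.intros(7)[of s a b t] by (simp add: flipm_mr add_CB arrow_flip)
qed

lemma flipm_smult:
  assumes "f \<in> mor \<C> a b"
  shows "flipm a b (r \<odot>\<^bsub>hom_sp \<C> a b\<^esub> f) = r \<odot>\<^bsub>hom_sp \<C> b a\<^esub> flipm a b f"
proof -
  obtain s where "arrow s a b" "f = mr a b s"
    using assms by (metis mor_mrE)
  then show ?thesis
    using arrow.intros(8)[of s a b r] by (simp add: flipm_mr smult_CB arrow_flip)
qed

lemma flipm_span:
  assumes "X \<in> hom.span a b B" "B \<subseteq> mor \<C> a b"
  shows "flipm a b X \<in> hom.span b a (flipm a b ` B)"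
proof -
  have fB: "flipm a b ` B \<subseteq> mor \<C> b a"
    using assms(2) flipm_closed by auto
  have sub: "submodule class_ring (hom.span b a (flipm a b ` B)) (hom_sp \<C> b a)"
    using hom.span_is_submodule[OF fB] .
  have carr: "v \<in> mor \<C> a b" if "v \<in> hom.span a b B" for v
    using that hom.span_is_subset2[OF assms(2)] by blast
  show ?thesis
    using assms
  proof (induction rule: hom.span_induct')
    case zero
    have "flipm a b \<zero>\<^bsub>hom_sp \<C> a b\<^esub> = \<zero>\<^bsub>hom_sp \<C> b a\<^esub>"
      by (simp add: zero_CB flipm_mr arrow.intros(6))
    then show ?case
      using sub by (simp add: submodule_def)
  next
    case (base v)
    then show ?case
      using hom.in_own_span[OF fB] by blast
  next
    case (add v w)
    then show ?case
      using sub carr by (simp add: submodule_def flipm_add)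
  next
    case (scale r v)
    then show ?case
      using sub carr by (simp add: submodule_def flipm_smult)
  qed
qed

text \<open>By admissibility the morphism does not depend on the drawing chosen.\<close>

definition dmor :: "nat \<Rightarrow> nat \<Rightarrow> pairing \<times> (bpoint set \<Rightarrow> nat) \<Rightarrow> 'k brterm set set" where
  "dmor a b = (\<lambda>(P, n). mr a b (diagram_term a b (SOME f. drawing f a b P, P, n)))"

lemma some_drawing:
  "perfect_matching (points a b) P \<Longrightarrow> drawing (SOME f :: 'k brterm. drawing f a b P) a b P"
  by (rule someI_ex[OF perfect_matching_drawable])

lemma dmor_closed: "x \<in> dotted m a b \<Longrightarrow> dmor a b x \<in> mor \<C> a b"
  using cb_mor_closed[OF arrow_diagram_term[OF some_drawing]]
  by (auto simp: dmor_def dotted_def simp del: diagram_term.simps)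

text \<open>The \<open>v\<close> of \<open>admissible\<close> has one value on all diagrams of a
  class; evaluating it at the chosen drawing identifies it with \<open>dmor\<close>.\<close>

lemma dmor_values:
  "\<exists>v. (\<forall>\<beta>\<in>dotted_classes m a b. \<forall>D\<in>\<beta>. v \<beta> = mr a b (diagram_term a b D)) \<and>
     inj_on v (dotted_classes m a b) \<and> vectorspace.basis class_ring (hom_sp \<C> a b) (v ` dotted_classes m a b) \<and>
     (\<forall>x\<in>dotted m a b. v (dotted_class m a b x) = dmor a b x)"
proof -
  obtain v where v: "\<forall>\<beta> \<in> dotted_classes m a b. \<forall>D\<in>\<beta>. v \<beta> = mr a b (diagram_term a b D)"
    "inj_on v (dotted_classes m a b)" "vectorspace.basis class_ring (hom_sp \<C> a b) (v ` dotted_classes m a b)"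
    using admissible[unfolded admissible_def, rule_format, of a b] by (elim exE conjE)
  have "v (dotted_class m a b x) = dmor a b x" if "x \<in> dotted m a b" for x
  proof -
    obtain P n where x: "x = (P, n)"
      by (cases x)
    let ?D = "(SOME f. drawing f a b P, P, n) :: 'k dotted_diagram"
    have D: "?D \<in> dotted_class m a b x"
      using that some_drawing[of a b P] by (simp add: x dotted_def dotted_class_def)
    have "dotted_class m a b x \<in> (dotted_classes m a b :: 'k dotted_diagram set set)"
      unfolding dotted_classes_eq using that by (rule imageI)
    then have "v (dotted_class m a b x) = mr a b (diagram_term a b ?D)"
      using v(1) D by blast
    then show ?thesis
      by (simp add: dmor_def x del: diagram_term.simps)
  qed
  then show ?thesis
    using v by (intro exI[of _ v] conjI ballI) simp_all
qed

text \<open>Injectivity of \<open>v\<close> makes the size of the basis the number of classes, hence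
  of dotted matchings.\<close>

lemma dmor_basis:
  "hom.basis a b (dmor a b ` dotted m a b)" "hom.dim a b = card (dotted m a b)"
proof -
  obtain v where v: "inj_on v (dotted_classes m a b :: 'k dotted_diagram set set)"
    "vectorspace.basis class_ring (hom_sp \<C> a b) (v ` dotted_classes m a b)"
    "\<forall>x\<in>dotted m a b. v (dotted_class m a b x) = dmor a b x"
    using dmor_values[of a b] by (elim exE conjE)
  have "v ` dotted_classes m a b = dmor a b ` dotted m a b"
    unfolding dotted_classes_eq image_image using v(3) by (intro image_cong) simp_all
  then show "hom.basis a b (dmor a b ` dotted m a b)"
    using v(2) by simp
  have "finite (v ` dotted_classes m a b)"
    unfolding dotted_classes_eq using finite_dotted by blast
  then have "hom.dim a b = card (v ` dotted_classes m a b)"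
    using v(2) by (rule hom.dim_basis)
  then show "hom.dim a b = card (dotted m a b)"
    using card_image[OF v(1)] card_dotted_classes by metis
qed

text \<open>This permits a drawing to be replaced by one that factors; it rests on \<open>v\<close>
  having a single value on each class.\<close>

lemma dmor_eq:
  assumes f: "drawing f a b P" and n: "\<And>s. s \<in> P \<Longrightarrow> n s \<le> m - 1"
  shows "mr a b (diagram_term a b (f, P, n)) = dmor a b (P, restrict n P)"
proof -
  obtain v where v: "\<forall>\<beta>\<in>dotted_classes m a b. \<forall>D\<in>\<beta>. v \<beta> = mr a b (diagram_term a b D)"
    "\<forall>x\<in>dotted m a b. v (dotted_class m a b x) = dmor a b x"
    using dmor_values[of a b] by (elim exE conjE)
  have D: "(f, P, n) \<in> dotted_diagrams m a b"
    using f n by (simp add: dotted_diagrams_def)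
  have "dotted_class m a b (P, restrict n P) \<in> (dotted_classes m a b :: 'k dotted_diagram set set)"
    unfolding dotted_classes_eq using dotted_class_mem(1)[OF D] by (rule imageI)
  then show ?thesis
    using v(1)[rule_format, OF _ dotted_class_mem(2)[OF D]] v(2)[rule_format, OF dotted_class_mem(1)[OF D]]
    by simp
qed

section \<open>Cup parts, dotted permutations and cap parts as morphisms\<close>

definition Bm :: "nat \<Rightarrow> nat \<Rightarrow> 'k brterm set set set" where
  "Bm b c = dmor c b ` cup_part m b c"

definition Bo :: "nat \<Rightarrow> 'k brterm set set set" where
  "Bo c = dmor c c ` perm_part m c"

text \<open>Flipping puts the dots of a cap at its right endpoint, so dotted caps are not normally
  ordered here. This does no harm: the argument uses that the products span and how many there
  are.\<close>

definition Bp :: "nat \<Rightarrow> nat \<Rightarrow> 'k brterm set set set" where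
  "Bp c a = flipm c a ` Bm a c"

lemma Bm_closed: "Bm b c \<subseteq> mor \<C> c b"
  by (auto simp: Bm_def cup_part_def dmor_closed)

lemma Bo_closed: "Bo c \<subseteq> mor \<C> c c"
  by (auto simp: Bo_def perm_part_def dmor_closed)

lemma Bp_closed: "Bp c a \<subseteq> mor \<C> a c"
  using flipm_closed[OF subsetD[OF Bm_closed]] unfolding Bp_def by (rule image_subsetI)

lemma Bm_order: "Bm b c \<noteq> {} \<Longrightarrow> c \<le> b"
  using cup_part_le by (fastforce simp: Bm_def)

text \<open>\<open>b\<close> uncrossed verticals occupy all \<open>b\<close> upper points, so the
  pairing is that of the identity; no cups are left to carry dots, and the verticals are
  undotted.\<close>

lemma Bm_diag: "Bm b b = {idm \<C> b}"
proof -
  define I where "I = {{Lower i, Upper i} | i. i < b}"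
  define z where "z = restrict (\<lambda>_. 0 :: nat) I"
  have one_I: "drawing (One b :: 'k brterm) b b I"
    unfolding I_def by (rule drawing.intros(4))
  have I: "perfect_matching (points b b) I"
    using drawing_perfect_matching[OF one_I] .
  have "increasing I" "no_caps I"
    by (auto simp: I_def increasing_def no_caps_def doubleton_eq_iff)
  then have mem: "(I, z) \<in> cup_part m b b"
    using I by (auto simp: cup_part_def dotted_def undotted_verticals_def z_def)
  have "(Q, n) = (I, z)" if "(Q, n) \<in> cup_part m b b" for Q n
  proof -
    have Q: "perfect_matching (points b b) Q" "no_caps Q" "increasing Q" "n \<in> Q \<rightarrow>\<^sub>E {..m - 1}" "undotted_verticals Q n"
      using that by (auto simp: cup_part_def dotted_def)
    have "vertical_ends Q \<subseteq> {..<b}"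
      using matching_pairD(2)[OF Q(1)] by (fastforce simp: vertical_ends_def)
    then have ends: "vertical_ends Q = {..<b}"
      using increasing_rank(1)[OF Q(1-3)] by (intro card_subset_eq) auto
    have "{k. k < b \<and> k < j} = {..<j}" if "j < b" for j
      using that by auto
    then have "I \<subseteq> Q"
      using increasing_rank(2)[OF Q(1-3)] by (auto simp: ends I_def)
    then have "Q = I"
      by (rule perfect_matching_subset_eq[OF Q(1) I])
    moreover have "n s = z s" for s
    proof (cases "s \<in> I")
      case True
      then obtain i where "s = {Lower i, Upper i}"
        by (auto simp: I_def)
      then show ?thesis
        using Q(5) True \<open>Q = I\<close> by (simp add: undotted_verticals_def z_def)
    next
      case False
      then show ?thesis
        using PiE_arb[OF Q(4)] \<open>Q = I\<close> by (simp add: z_def)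
    qed
    ultimately show ?thesis
      by (simp add: fun_eq_iff)
  qed
  then have "cup_part m b b \<subseteq> {(I, z)}"
    by (simp add: subset_iff split_paired_all del: prod.inject)
  then have "cup_part m b b = {(I, z)}"
    using mem by (intro equalityI) simp_all
  moreover have "dmor b b (I, z) = idm \<C> b"
  proof -
    have zero: "set (map (upper_dots I (\<lambda>_. 0)) [0..<b]) \<subseteq> {0}" "set (map (lower_dots I (\<lambda>_. 0)) [0..<b]) \<subseteq> {0}"
      by (auto simp: upper_dots_def lower_dots_def)
    let ?U = "dot_row (map (upper_dots I (\<lambda>_. 0)) [0..<b]) :: 'k brterm"
    let ?L = "dot_row (map (lower_dots I (\<lambda>_. 0)) [0..<b]) :: 'k brterm"
    have types: "brtype ?U = Some (b, b)" "brtype ?L = Some (b, b)"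
      using arrow_dot_row[of "map (upper_dots I (\<lambda>_. 0)) [0..<b]"]
        arrow_dot_row[of "map (lower_dots I (\<lambda>_. 0)) [0..<b]"] by (simp_all only: arrow_iff length_map length_upt diff_zero)
    have one: "?U \<simeq> One b" "?L \<simeq> One b"
      using dot_row_zeros[OF zero(1)] dot_row_zeros[OF zero(2)] by (simp_all only: length_map length_upt diff_zero)
    have "?U \<^bold>\<circ> One b \<^bold>\<circ> ?L \<simeq> One b \<^bold>\<circ> One b \<^bold>\<circ> One b"
      using types by (intro abeq_cmp abeq_refl one) simp_all
    also have "\<dots> \<simeq> One b \<^bold>\<circ> One b"
      by (rule abeq_one_left) simp
    also have "\<dots> \<simeq> One b"
      by (rule abeq_one_left) simp
    finally have "mr b b (?U \<^bold>\<circ> One b \<^bold>\<circ> ?L) = mr b b (One b)"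
      using types by (intro cb_mor_cong abeqD) simp_all
    moreover have "mr b b (diagram_term b b (One b, I, \<lambda>_. 0)) = dmor b b (I, z)"
      unfolding z_def by (rule dmor_eq[OF one_I]) simp
    ultimately show ?thesis
      by (simp add: idm_CB)
  qed
  ultimately show ?thesis
    by (simp add: Bm_def)
qed

lemma Bp_diag: "Bp b b = {idm \<C> b}"
  by (simp add: Bp_def Bm_diag idm_CB flipm_mr arrow.intros(5))

lemma Bp_order: "Bp c a \<noteq> {} \<Longrightarrow> c \<le> a"
  using Bm_order by (simp add: Bp_def)

text \<open>The dots sit on the outer lines, so the drawing inside can be cut where it has only
  \<open>c - 2\<close> points.\<close>

lemma cap_factor:
  assumes x: "(P, n) \<in> dotted m c b" and cap: "\<not> no_caps P"
  shows "dmor c b (P, n) \<in> (\<Union>d\<in>{..<c}. composites c d b (mor \<C> d b) (mor \<C> c d))"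
proof -
  have P: "perfect_matching (points c b) P" and n: "n \<in> P \<rightarrow>\<^sub>E {..m - 1}"
    using x by (auto simp: dotted_def)
  obtain i j where "{Lower i, Lower j} \<in> P"
    using cap by (auto simp: no_caps_def)
  then obtain f w :: "'k brterm" where c: "2 \<le> c" and f: "arrow f (c - 2) b" and w: "arrow w c c"
    and D: "drawing ((f \<^bold>\<otimes> Cap) \<^bold>\<circ> w) c b P"
    using drawing_through_cap[OF P] by metis
  let ?U = "dot_row (map (upper_dots P n) [0..<b]) :: 'k brterm"
  let ?L = "dot_row (map (lower_dots P n) [0..<c]) :: 'k brterm"
  let ?e = "One (c - 2) \<^bold>\<otimes> Cap :: 'k brterm"
  have UL: "arrow ?U b b" "arrow ?L c c"
    using arrow_dot_row[of "map (upper_dots P n) [0..<b]"] arrow_dot_row[of "map (lower_dots P n) [0..<c]"] by simp_all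
  have e: "arrow ?e c (c - 2)"
    using arrow.intros(10)[OF arrow.intros(5)[of "c - 2"] arrow.intros(2)] c by (simp only: le_add_diff_inverse2 add_0_right)
  have types: "brtype f = Some (c - 2, b)" "brtype w = Some (c, c)" "brtype ?U = Some (b, b)" "brtype ?L = Some (c, c)"
    using f w UL by (simp_all add: arrow_iff)
  \<comment> \<open>All of \<open>f\<close> may be placed above the cap; the cut runs between the
    two.\<close>
  have "f \<^bold>\<otimes> Cap \<simeq> (f \<^bold>\<otimes> One 0) \<^bold>\<circ> ?e"
    using types by (intro abeq_slide_right) simp_all
  also have "\<dots> \<simeq> f \<^bold>\<circ> ?e"
    using types by (intro abeq_cmp abeq_unit_right abeq_refl) simp_all
  finally have "?U \<^bold>\<circ> ((f \<^bold>\<otimes> Cap) \<^bold>\<circ> w) \<^bold>\<circ> ?L \<simeq> ?U \<^bold>\<circ> ((f \<^bold>\<circ> ?e) \<^bold>\<circ> w) \<^bold>\<circ> ?L"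
    using types c by (intro abeq_cmp abeq_refl) simp_all
  also have "\<dots> \<simeq> ?U \<^bold>\<circ> (f \<^bold>\<circ> ?e \<^bold>\<circ> w) \<^bold>\<circ> ?L"
    using types c by (intro abeq_cmp abeq_refl abeq_assoc) simp_all
  also have "\<dots> \<simeq> ?U \<^bold>\<circ> f \<^bold>\<circ> (?e \<^bold>\<circ> w) \<^bold>\<circ> ?L"
    using types c by (intro abeq_cmp abeq_refl abeq_assoc) simp_all
  also have "\<dots> \<simeq> (?U \<^bold>\<circ> f) \<^bold>\<circ> (?e \<^bold>\<circ> w) \<^bold>\<circ> ?L"
    using types c by (intro abeq_sym[OF abeq_assoc]) simp_all
  finally have eq: "mr c b (diagram_term c b ((f \<^bold>\<otimes> Cap) \<^bold>\<circ> w, P, n)) = mr c b ((?U \<^bold>\<circ> f) \<^bold>\<circ> (?e \<^bold>\<circ> w) \<^bold>\<circ> ?L)"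
    using types c by (intro cb_mor_cong abeqD) simp_all
  have Uf: "arrow (?U \<^bold>\<circ> f) (c - 2) b" and ewL: "arrow ((?e \<^bold>\<circ> w) \<^bold>\<circ> ?L) c (c - 2)"
    using f w UL e by (auto intro: arrow.intros(9))
  have "mr c b (diagram_term c b ((f \<^bold>\<otimes> Cap) \<^bold>\<circ> w, P, n)) = dmor c b (P, restrict n P)"
    using D n by (intro dmor_eq) auto
  moreover have "restrict n P = n"
    using n by (rule PiE_restrict)
  ultimately have "dmor c b (P, n) = cmp \<C> c (c - 2) b (mr (c - 2) b (?U \<^bold>\<circ> f)) (mr c (c - 2) ((?e \<^bold>\<circ> w) \<^bold>\<circ> ?L))"
    unfolding cmp_CB[OF ewL Uf] using eq by simp
  moreover have "mr (c - 2) b (?U \<^bold>\<circ> f) \<in> mor \<C> (c - 2) b" "mr c (c - 2) ((?e \<^bold>\<circ> w) \<^bold>\<circ> ?L) \<in> mor \<C> c (c - 2)"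
    by (intro cb_mor_closed Uf ewL)+
  ultimately show ?thesis
    using c by (auto simp: composites_def intro!: bexI[of _ "c - 2"])
qed

text \<open>Without caps the upper dots belong to cups and the lower dots to verticals. Cutting
  between \<open>f\<close> and \<open>w\<close> therefore leaves the dots of the cups on a cup part
  and those of the verticals on a permutation, both normally ordered.\<close>

lemma perm_factor:
  assumes x: "(P, n) \<in> dotted m c b" and cap: "no_caps P"
  shows "dmor c b (P, n) \<in> composites c c b (Bm b c) (Bo c)"
proof -
  have P: "perfect_matching (points c b) P" and n: "n \<in> P \<rightarrow>\<^sub>E {..m - 1}"
    using x by (auto simp: dotted_def)
  obtain \<sigma> and f w :: "'k brterm" where \<sigma>: "\<sigma> permutes {..<c}" and inc: "increasing ((`) (map_lower \<sigma>) ` P)"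
    and f: "drawing f c b ((`) (map_lower \<sigma>) ` P)" and w: "drawing w c c (perm_pairing \<sigma> c)"
    and D: "drawing (f \<^bold>\<circ> w) c b P"
    using drawing_through_perm[OF P cap] by metis
  let ?Q = "(`) (map_lower \<sigma>) ` P" and ?W = "perm_pairing \<sigma> c"
  have Q: "perfect_matching (points c b) ?Q" and W: "perfect_matching (points c c) ?W"
    using drawing_perfect_matching[OF f] drawing_perfect_matching[OF w] by simp_all
  \<comment> \<open>The cups keep their dots in the upper part; the dots of a vertical pass to the
    strand of the permutation with the same lower end.\<close>
  define nQ where "nQ s = (if \<exists>i j. s = {Upper i, Upper j} then n s else 0)" for s
  define nW where "nW s = lower_dots P n (THE i. Lower i \<in> s)" for s :: "bpoint set"
  have Q_pair: "\<exists>s t. x = map_lower \<sigma> s \<and> y = map_lower \<sigma> t \<and> {s, t} \<in> P" if "{x, y} \<in> ?Q" for x y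
    using that matching_image_pair_iff[OF P map_lower_inj[OF permutes_inj[OF \<sigma>]]] by blast
  have Q_cup: "{Upper i, Upper j} \<in> P" if "{Upper i, Upper j} \<in> ?Q" for i j
  proof -
    have "\<exists>s t. Upper i = map_lower \<sigma> s \<and> Upper j = map_lower \<sigma> t \<and> {s, t} \<in> P"
      using Q_pair that by simp
    then obtain s t where "Upper i = map_lower \<sigma> s" "Upper j = map_lower \<sigma> t" "{s, t} \<in> P"
      by (elim exE conjE)
    then show ?thesis
      by (cases s; cases t) auto
  qed
  have Q_caps: "no_caps ?Q"
    unfolding no_caps_def
  proof (intro allI notI)
    fix i j
    assume "{Lower i, Lower j} \<in> ?Q"
    then obtain s t where "Lower i = map_lower \<sigma> s" "Lower j = map_lower \<sigma> t" "{s, t} \<in> P"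
      using Q_pair by blast
    then show False
      using cap by (cases s; cases t) (auto simp: no_caps_def)
  qed
  have n_le: "n s \<le> m - 1" if "s \<in> P" for s
    using n that by auto
  have lower_le: "lower_dots P n i \<le> m - 1" if "i < c" for i
  proof -
    obtain j where "{Lower i, Upper j} \<in> P"
      using no_caps_partner[OF P cap \<open>i < c\<close>] by metis
    then show ?thesis
      using lower_dots_vertical[OF P] n_le by simp
  qed
  have nQ_le: "nQ s \<le> m - 1" if "s \<in> ?Q" for s
  proof (cases "\<exists>i j. s = {Upper i, Upper j}")
    case True
    then obtain i j where s: "s = {Upper i, Upper j}"
      by blast
    have "n s \<le> m - 1"
      unfolding s using Q_cup that[unfolded s] n_le by simp
    then show ?thesis
      by (simp add: nQ_def)
  qed (simp add: nQ_def)
  have nW_eq: "nW {Lower i, Upper j} = lower_dots P n i" for i j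
    by (simp add: nW_def)
  have nW_le: "nW s \<le> m - 1" if "s \<in> ?W" for s
    using that lower_le by (auto simp: perm_pairing_def nW_eq)
  have undotted: "undotted_verticals ?Q (restrict nQ ?Q)"
    by (auto simp: undotted_verticals_def nQ_def doubleton_eq_iff)
  have partQ: "(?Q, restrict nQ ?Q) \<in> cup_part m b c"
    using Q Q_caps inc undotted nQ_le by (auto simp: cup_part_def dotted_def)
  have partW: "(?W, restrict nW ?W) \<in> perm_part m c"
    using W nW_le by (auto simp: perm_part_def dotted_def all_vertical_def perm_pairing_def)
  have upper: "map (upper_dots ?Q nQ) [0..<b] = map (upper_dots P n) [0..<b]"
  proof (rule map_cong)
    fix j
    assume "j \<in> set [0..<b]"
    then obtain y where y: "{Upper j, y} \<in> P"
      using matching_partner[OF P, of "Upper j"] by auto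
    show "upper_dots ?Q nQ j = upper_dots P n j"
    proof (cases y)
      case (Lower i)
      then have P': "{Lower i, Upper j} \<in> P"
        using y by (simp add: insert_commute)
      then have "{Lower (\<sigma> i), Upper j} \<in> ?Q"
        using mem_map_lower[of "Lower i" "Upper j" P \<sigma>] by simp
      then show ?thesis
        using upper_dots_vertical[OF Q] upper_dots_vertical[OF P P'] by simp
    next
      case (Upper i)
      then have P': "{Upper i, Upper j} \<in> P"
        using y by (simp add: insert_commute)
      then have "{Upper i, Upper j} \<in> ?Q"
        using mem_map_lower[of "Upper i" "Upper j" P \<sigma>] by simp
      then show ?thesis
        using upper_dots_cup[OF Q] upper_dots_cup[OF P P'] by (auto simp: nQ_def)
    qed
  qed simp
  have lower: "map (lower_dots ?W nW) [0..<c] = map (lower_dots P n) [0..<c]"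
  proof (rule map_cong)
    fix i
    assume "i \<in> set [0..<c]"
    then have "{Lower i, Upper (\<sigma> i)} \<in> ?W"
      by (auto simp: perm_pairing_def)
    then show "lower_dots ?W nW i = lower_dots P n i"
      using lower_dots_vertical[OF W] by (simp add: nW_eq)
  qed simp
  \<comment> \<open>No dots are drawn along the cut: the lower ends of the upper part belong to
    undotted verticals, and the strands of the permutation carry their dots at the bottom. The two
    rows of dots between \<open>f\<close> and \<open>w\<close> are therefore identities.\<close>
  have zeroQ: "set (map (lower_dots ?Q nQ) [0..<c]) \<subseteq> {0}"
  proof -
    have "lower_dots ?Q nQ i = 0" if "i < c" for i
    proof -
      obtain j where "{Lower i, Upper j} \<in> ?Q"
        using no_caps_partner[OF Q Q_caps \<open>i < c\<close>] by metis
      then show ?thesis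
        using lower_dots_vertical[OF Q] by (auto simp: nQ_def doubleton_eq_iff)
    qed
    then show ?thesis
      by auto
  qed
  have zeroW: "set (map (upper_dots ?W nW) [0..<c]) \<subseteq> {0}"
  proof -
    have "upper_dots ?W nW j = 0" if "j < c" for j
    proof -
      have "{Lower (Hilbert_Choice.inv \<sigma> j), Upper j} \<in> ?W"
        using permutes_inverses(1)[OF \<sigma>, of j] permutes_in_image[OF permutes_inv[OF \<sigma>], of j] that
        by (auto simp: perm_pairing_def intro!: exI[of _ "Hilbert_Choice.inv \<sigma> j"])
      then show ?thesis
        by (rule upper_dots_vertical[OF W])
    qed
    then show ?thesis
      by auto
  qed
  let ?U = "dot_row (map (upper_dots P n) [0..<b]) :: 'k brterm"
  let ?L = "dot_row (map (lower_dots P n) [0..<c]) :: 'k brterm"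
  let ?ZQ = "dot_row (map (lower_dots ?Q nQ) [0..<c]) :: 'k brterm"
  let ?ZW = "dot_row (map (upper_dots ?W nW) [0..<c]) :: 'k brterm"
  have types: "brtype f = Some (c, b)" "brtype w = Some (c, c)" "brtype ?U = Some (b, b)" "brtype ?L = Some (c, c)"
    using arrow_drawing[OF f] arrow_drawing[OF w] arrow_dot_row[of "map (upper_dots P n) [0..<b]"]
      arrow_dot_row[of "map (lower_dots P n) [0..<c]"] by (simp_all add: arrow_iff)
  have Z: "?ZQ \<simeq> One c" "?ZW \<simeq> One c" "brtype ?ZQ = Some (c, c)" "brtype ?ZW = Some (c, c)"
    using dot_row_zeros[OF zeroQ] dot_row_zeros[OF zeroW] arrow_dot_row[of "map (lower_dots ?Q nQ) [0..<c]"]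
      arrow_dot_row[of "map (upper_dots ?W nW) [0..<c]"] by (simp_all add: arrow_iff)
  have "?U \<^bold>\<circ> f \<^bold>\<circ> ?ZQ \<simeq> ?U \<^bold>\<circ> f \<^bold>\<circ> One c"
    using types Z by (intro abeq_cmp abeq_refl) simp_all
  also have "\<dots> \<simeq> ?U \<^bold>\<circ> f"
    using types by (intro abeq_cmp abeq_refl abeq_one_right) simp_all
  finally have 1: "?U \<^bold>\<circ> f \<^bold>\<circ> ?ZQ \<simeq> ?U \<^bold>\<circ> f" .
  have "?ZW \<^bold>\<circ> w \<^bold>\<circ> ?L \<simeq> One c \<^bold>\<circ> w \<^bold>\<circ> ?L"
    using types Z by (intro abeq_cmp abeq_refl) simp_all
  also have "\<dots> \<simeq> w \<^bold>\<circ> ?L"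
    using types by (intro abeq_one_left) simp_all
  finally have 2: "?ZW \<^bold>\<circ> w \<^bold>\<circ> ?L \<simeq> w \<^bold>\<circ> ?L" .
  have "?U \<^bold>\<circ> (f \<^bold>\<circ> w) \<^bold>\<circ> ?L \<simeq> ?U \<^bold>\<circ> f \<^bold>\<circ> w \<^bold>\<circ> ?L"
    using types by (intro abeq_cmp abeq_refl abeq_assoc) simp_all
  also have "\<dots> \<simeq> (?U \<^bold>\<circ> f) \<^bold>\<circ> w \<^bold>\<circ> ?L"
    using types by (intro abeq_sym[OF abeq_assoc]) simp_all
  also have "\<dots> \<simeq> (?U \<^bold>\<circ> f \<^bold>\<circ> ?ZQ) \<^bold>\<circ> (?ZW \<^bold>\<circ> w \<^bold>\<circ> ?L)"
    using types Z by (intro abeq_cmp abeq_sym[OF 1] abeq_sym[OF 2]) simp_all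
  finally have eq: "mr c b (?U \<^bold>\<circ> (f \<^bold>\<circ> w) \<^bold>\<circ> ?L) = mr c b ((?U \<^bold>\<circ> f \<^bold>\<circ> ?ZQ) \<^bold>\<circ> (?ZW \<^bold>\<circ> w \<^bold>\<circ> ?L))"
    using types Z by (intro cb_mor_cong abeqD) simp_all
  have arr: "arrow (?U \<^bold>\<circ> f \<^bold>\<circ> ?ZQ) c b" "arrow (?ZW \<^bold>\<circ> w \<^bold>\<circ> ?L) c c"
    using types Z by (simp_all add: arrow_iff)
  have "dmor c b (P, n) = mr c b (diagram_term c b (f \<^bold>\<circ> w, P, n))"
    using dmor_eq[OF D n_le] PiE_restrict[OF n] by simp
  also have "\<dots> = cmp \<C> c c b (mr c b (?U \<^bold>\<circ> f \<^bold>\<circ> ?ZQ)) (mr c c (?ZW \<^bold>\<circ> w \<^bold>\<circ> ?L))"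
    unfolding cmp_CB[OF arr(2,1)] using eq by simp
  also have "mr c b (?U \<^bold>\<circ> f \<^bold>\<circ> ?ZQ) = dmor c b (?Q, restrict nQ ?Q)"
    using dmor_eq[OF f, where n = nQ, OF nQ_le] by (simp add: upper)
  also have "mr c c (?ZW \<^bold>\<circ> w \<^bold>\<circ> ?L) = dmor c c (?W, restrict nW ?W)"
    using dmor_eq[OF w, where n = nW, OF nW_le] by (simp add: lower)
  finally show ?thesis
    unfolding composites_def Bm_def Bo_def using imageI[OF partQ, of "dmor c b"] imageI[OF partW, of "dmor c c"]
    by blast
qed

lemma mor_factor_lower:
  "mor \<C> c b \<subseteq> hom.span c b
    (composites c c b (Bm b c) (Bo c) \<union> (\<Union>d\<in>{..<c}. composites c d b (mor \<C> d b) (mor \<C> c d)))"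
proof -
  have "mor \<C> c b = hom.span c b (dmor c b ` dotted m c b)"
    using dmor_basis(1) by (simp add: hom.basis_def)
  also have "\<dots> \<subseteq> hom.span c b
    (composites c c b (Bm b c) (Bo c) \<union> (\<Union>d\<in>{..<c}. composites c d b (mor \<C> d b) (mor \<C> c d)))"
  proof (intro hom.span_is_monotone image_subsetI)
    fix x
    assume "x \<in> dotted m c b"
    then show "dmor c b x \<in> composites c c b (Bm b c) (Bo c) \<union> (\<Union>d\<in>{..<c}. composites c d b (mor \<C> d b) (mor \<C> c d))"
      using cap_factor[of "fst x" "snd x" c b] perm_factor[of "fst x" "snd x" c b] by (cases "no_caps (fst x)") simp_all
  qed
  finally show ?thesis .
qed

text \<open>\<open>mor_factor_lower\<close> for the flipped morphism, flipped back. A flipped dotted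
  permutation carries its dots at the top and is kept only as some endomorphism of \<open>c\<close>,
  which is as much as \<open>products_span_induction\<close> asks for.\<close>

lemma mor_factor_upper:
  "mor \<C> a c \<subseteq> hom.span a c
    (composites a c c (mor \<C> c c) (Bp c a) \<union> (\<Union>d\<in>{..<c}. composites a d c (mor \<C> d c) (mor \<C> a d)))"
proof
  let ?X = "composites c c a (Bm a c) (Bo c) \<union> (\<Union>d\<in>{..<c}. composites c d a (mor \<C> d a) (mor \<C> c d))"
  let ?Y = "composites a c c (mor \<C> c c) (Bp c a) \<union> (\<Union>d\<in>{..<c}. composites a d c (mor \<C> d c) (mor \<C> a d))"
  fix f
  assume f: "f \<in> mor \<C> a c"
  have "flipm a c f \<in> hom.span c a ?X"
    using mor_factor_lower flipm_closed[OF f] by (rule subsetD)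
  then have "flipm c a (flipm a c f) \<in> hom.span a c (flipm c a ` ?X)"
    by (rule flipm_span) (auto simp: composites_def Bm_closed[THEN subsetD] Bo_closed[THEN subsetD])
  moreover have "flipm c a x \<in> ?Y" if x: "x \<in> ?X" for x
  proof -
    consider g h where "x = cmp \<C> c c a g h" "g \<in> Bm a c" "h \<in> Bo c"
      | d g h where "d < c" "x = cmp \<C> c d a g h" "g \<in> mor \<C> d a" "h \<in> mor \<C> c d"
      using x unfolding composites_def by blast
    then show ?thesis
    proof cases
      case 1
      have "flipm c a x = cmp \<C> a c c (flipm c c h) (flipm c a g)"
        unfolding 1(1) using 1(2,3) Bm_closed[of a c] Bo_closed[of c] by (intro flipm_cmp) auto
      moreover have "flipm c c h \<in> mor \<C> c c" "flipm c a g \<in> Bp c a"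
        using 1(2,3) Bo_closed[of c] by (auto simp: Bp_def intro!: flipm_closed)
      ultimately show ?thesis
        by (auto simp: composites_def)
    next
      case 2
      have "flipm c a x = cmp \<C> a d c (flipm c d h) (flipm d a g)"
        unfolding 2(2) using 2(3,4) by (rule flipm_cmp[rotated])
      moreover have "flipm c d h \<in> mor \<C> d c" "flipm d a g \<in> mor \<C> a d"
        using 2(3,4) by (simp_all add: flipm_closed)
      ultimately show ?thesis
        using 2(1) by (auto simp: composites_def)
    qed
  qed
  then have "flipm c a ` ?X \<subseteq> ?Y"
    by (rule image_subsetI)
  then have "hom.span a c (flipm c a ` ?X) \<subseteq> hom.span a c ?Y"
    by (rule hom.span_is_monotone)
  ultimately show "f \<in> hom.span a c ?Y"
    using flipm_flipm[OF f] by auto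
qed

abbreviation triples where
  "triples b a \<equiv> SIGMA c:UNIV. Bm b c \<times> Bo c \<times> Bp c a"

abbreviation triple_product where
  "triple_product b a \<equiv> \<lambda>(c, f, g, h). cmp \<C> a c b f (cmp \<C> a c c g h)"

lemma triples_span: "mor \<C> a b \<subseteq> hom.span a b (triple_product b a ` triples b a)"
proof (rule products_span_induction[OF wf_less_than Bm_closed Bo_closed Bp_closed])
  have "{d. (d, c) \<in> less_than} = {..<c}" for c
    by auto
  then show "mor \<C> c b \<subseteq> hom.span c b (composites c c b (Bm b c) (Bo c) \<union>
      (\<Union>d\<in>{d. (d, c) \<in> less_than}. composites c d b (mor \<C> d b) (mor \<C> c d)))"
    and "mor \<C> a c \<subseteq> hom.span a c (composites a c c (mor \<C> c c) (Bp c a) \<union>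
      (\<Union>d\<in>{d. (d, c) \<in> less_than}. composites a d c (mor \<C> d c) (mor \<C> a d)))" for a b c
    using mor_factor_lower[of c b] mor_factor_upper[of a c] by simp_all
qed

text \<open>The three families are images of sets of dotted pairings, so their sizes are bounded
  above by \<open>card_parts_le\<close>; that no triples coincide will follow from spanning.\<close>

lemma triples_small: "finite (triples b a)" "card (triples b a) \<le> hom.dim a b"
proof -
  have fin: "finite (Bm b c)" "finite (Bo c)" "finite (Bp c a)" for a b c
    by (simp_all add: Bm_def Bo_def Bp_def finite_cup_part finite_perm_part)
  have "c \<le> b" if "f \<in> Bm b c" for c f
    using that Bm_order by blast
  then have eq: "triples b a = (SIGMA c:{..b}. Bm b c \<times> Bo c \<times> Bp c a)"
    by auto
  show "finite (triples b a)"
    unfolding eq using fin by simp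
  have "card (triples b a) = (\<Sum>c\<le>b. card (Bm b c \<times> Bo c \<times> Bp c a))"
    unfolding eq using fin by (intro card_SigmaI) auto
  also have "\<dots> \<le> (\<Sum>c\<le>b. card (cup_part m b c) * (card (perm_part m c) * card (cup_part m a c)))"
  proof (rule sum_mono)
    fix c
    have Bm_card: "card (Bm b c) \<le> card (cup_part m b c)" for b
      unfolding Bm_def using finite_cup_part by (rule card_image_le)
    have "card (Bp c a) \<le> card (Bm a c)"
      unfolding Bp_def using fin(1) by (rule card_image_le)
    moreover have "card (Bo c) \<le> card (perm_part m c)"
      unfolding Bo_def using finite_perm_part by (rule card_image_le)
    ultimately show "card (Bm b c \<times> Bo c \<times> Bp c a) \<le> card (cup_part m b c) * (card (perm_part m c) * card (cup_part m a c))"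
      unfolding card_cartesian_product using Bm_card order_trans by (intro mult_le_mono) blast+
  qed
  also have "\<dots> \<le> card (dotted m a b)"
    by (rule card_parts_le)
  finally show "card (triples b a) \<le> hom.dim a b"
    by (simp add: dmor_basis(2))
qed

lemma triangular: "triangular_data \<C> Bm Bo Bp"
proof (intro triangular_data.intro triangular_data_axioms.intro)
  show "total_category \<C>" ..
  show "finite {b :: nat. b \<le> a}" for a
    by simp
  show "Bm b c \<subseteq> mor \<C> c b" "Bo c \<subseteq> mor \<C> c c" "Bp c b \<subseteq> mor \<C> b c" for b c
    by (rule Bm_closed Bo_closed Bp_closed)+
  show "Bm b c \<noteq> {} \<Longrightarrow> c \<le> b" "Bp c b \<noteq> {} \<Longrightarrow> c \<le> b" for b c
    using Bm_order Bp_order by blast+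
  show "Bm b b = {idm \<C> b}" "Bp b b = {idm \<C> b}" for b
    by (rule Bm_diag Bp_diag)+
  show "vectorspace.fin_dim class_ring (hom_sp \<C> a b)" for a b
  proof -
    have "dmor a b ` dotted m a b \<subseteq> mor \<C> a b" "hom.span a b (dmor a b ` dotted m a b) = mor \<C> a b"
      using dmor_basis(1)[of a b] by (simp_all add: hom.basis_def)
    then show ?thesis
      unfolding hom.fin_dim_def using finite_imageI[OF finite_dotted[of m a b]] by metis
  qed
  show "mor \<C> a b \<subseteq> hom.span a b (triple_product b a ` triples b a)" for a b
    by (rule triples_span)
  \<comment> \<open>Independence comes from the count alone: the products span, and there are at
    most as many triples as the dimension.\<close>
  show "l t = 0" if "finite F" "F \<subseteq> triples b a"
    "(\<Oplus>\<^bsub>hom_sp \<C> a b\<^esub> t\<in>F. l t \<odot>\<^bsub>hom_sp \<C> a b\<^esub> triple_product b a t) = \<zero>\<^bsub>hom_sp \<C> a b\<^esub>" "t \<in> F"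
    for F a b l t
  proof -
    have closed: "triple_product b a ` triples b a \<subseteq> mor \<C> a b"
      by (auto intro!: cmp_closed simp: Bm_closed[THEN subsetD] Bo_closed[THEN subsetD] Bp_closed[THEN subsetD])
    show ?thesis
      by (rule hom.spanning_family_indep[OF triples_small(1) closed triples_span triples_small(2) that(2-4)])
  qed
qed

end

theorem proposition6p3:
  fixes m :: nat and u :: "'k::alg_closed_field list" and \<omega> :: "nat \<Rightarrow> 'k"
  assumes "CHAR('k) \<noteq> 2"
    and "m \<ge> 1"
    and "length u = m"
    and "admissible u \<omega>"
  shows "upper_finite_weakly_triangular_category (CB u \<omega>)"
proof -
  interpret admissible_brauer u \<omega>
    using assms(4) by (rule admissible_brauer.intro)
  show ?thesis
    by (rule triangular_data.upper_finite_weakly_triangular[OF triangular])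
qed

end
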